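(* Let $N\in\mathbb N$ and let $V$ satisfy the Standing Assumption of the context with this $N$, some $\nu_\pm\in\mathbb R$ and (where $V$ is unbounded) some $\varepsilon_1>0$. Set $n:=N-1$. For all sufficiently large $\lambda>0$ let $\delta_\pm,\Delta_\pm,\mathcal J_\pm$, the cut-off $\xi$, the function $g$ (built with the index $n$ and the functions $\{\psi_k'\}_{k\in[[-1,n-1]]}$) and $f=\xi g$ be as in the context. Then $$\frac{\|(H_V-\lambda)f\|}{\|f\|}=\kappa(\lambda)+\sigma^{(n)}(\lambda),$$ where $\kappa=\kappa_-+\kappa_+$ and $\sigma^{(n)}=\sigma^{(n)}_-+\sigma^{(n)}_+$ satisfy the following, as $\lambda\to+\infty$ (for each choice of the sign $\pm$, with some $c>0$): (i) if $V$ is unbounded at $\pm\infty$, then $\kappa_\pm(\lambda)=\mathcal O\big(\exp(-c\,\delta_\pm^{\nu_\pm+1+\varepsilon_1})\big)$ and $$\sigma^{(n)}_\pm(\lambda)=\begin{cases}\mathcal O\Big(\lambda^{-\frac{n+1}{2}}\sup_{x\in\mathcal J_\pm}|V(x)|\langle x\rangle^{(n+1)\nu_\pm}\Big), & \nu_\pm<0,\\[1mm] \mathcal O\Big(\delta_\pm^{(n+1)\nu_\pm}\lambda^{\frac{1-n}{2}}\Big), & \nu_\pm\ge 0;\end{cases}$$ (ii) if $V$ is bounded at $\pm\infty$, then $\kappa_\pm(\lambda)=\mathcal O\big(\exp(-c\,\lambda^{\varepsilon_2/2})\big)$ and $$\sigma^{(n)}_\pm(\lambda)=\begin{cases}\mathcal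 O\big(\lambda^{-\frac{n+1}{2}}\big), & \nu_\pm<0,\\[1mm] \mathcal O\big(\lambda^{-\frac{n+1}{2}(1-(1+\varepsilon_2)\nu_\pm)}\big), & \nu_\pm\ge0.\end{cases}$$
   Context: Notation: $\mathbb N=\{1,2,\dots\}$, $\mathbb N_0=\mathbb N\cup\{0\}$, $\mathbb R_+=(0,\infty)$, $\mathbb R_-=(-\infty,0)$, $\langle x\rangle=(1+x^2)^{1/2}$, $[[m,n]]=[m,n]\cap\mathbb Z$, $\|\cdot\|$ is the norm of $L^2(\mathbb R)$. $A\lesssim B$ means $A\le CB$ with $C>0$ independent of $\lambda$ and $x$. All complex square roots and powers are principal branches. Statements with $\pm$ are meant separately for the sign $+$ and the sign $-$. Operator: for $V:\mathbb R\to\mathbb C$ in $L^2_{\rm loc}(\mathbb R)$, $H_Vf=-f''+Vf$ with domain $\{f\in L^2(\mathbb R): -f''+Vf\in L^2(\mathbb R)\}$. Standing Assumption (with parameter $N\in\mathbb N$): $V:\mathbb R\to\mathbb C$ belongs to $W^{N,\infty}_{\rm loc}(\mathbb R)$ and (a) $\limsup_{x\to-\infty}\operatorname{Im}V(x)<0$ and $\liminf_{x\to+\infty}\operatorname{Im}V(x)>0$; (b) there are $\nu_\pm\in\mathbb R$ such that for all $m\in[[1,N]]$, $|\operatorname{Im}V^{(m)}(x)|=\mathcal O(|\operatorname{Im}V(x)|\langle x\rangle^{m\nu_\pm})$ and $|V^{(m)}(x)|=\mathcal O(|V(x)|\langle x\rangle^{m\nu_\pm})$ as $x\to\pm\infty$;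 (c) if $V$ is unbounded at $\pm\infty$, then there is $\varepsilon_1>0$ with $\langle x\rangle^{4(\nu_\pm+\varepsilon_1)+2}\big(\langle x\rangle^{4\nu_\pm+2}+|\operatorname{Re}V(x)|\big)=\mathcal O(|\operatorname{Im}V(x)|^2)$ as $x\to\pm\infty$; if $V$ is bounded at $\pm\infty$, then $\nu_\pm<1$. Cut-off parameters: if $V$ is unbounded at $\pm\infty$, $\delta_\pm:=\inf\{\delta\ge0:\ |\operatorname{Im}V(\pm\delta)|^2\langle\delta\rangle^{-4\nu_\pm-2\varepsilon_1-2}=\lambda\}$ and $\Delta_\pm:=\frac14\delta_\pm^{-\nu_\pm}$; if $V$ is bounded at $\pm\infty$, $\delta_\pm:=\lambda^{(1+\varepsilon_2)/2}$ with a fixed $0<\varepsilon_2<1-\nu_\pm$ and $\Delta_\pm:=\frac14\delta_\pm$. (For large $\lambda$ these are finite.) $\mathcal J:=(-\delta_-,\delta_+)$, $\mathcal J_\pm:=\{x\in\mathbb R_\pm:|x|<\delta_\pm\}$. The cut-off $\xi\in C_0^\infty(\mathbb R)$ satisfies $0\le\xi\le1$, $\xi=1$ on $(-\delta_-+\Delta_-,\delta_+-\Delta_+)$, $\xi=0$ outside $\mathcal J$, and $\|\xi^{(j)}\|_{L^\infty(\mathbb R_\pm)}\lesssim\Delta_\pm^{-j}$ for $j=1,2$. Pseudomode with index $n\in\mathbb N_0$: for $\lambda>0$ so large that $\lambda-V(x)\in\mathbb C\setminus(-\infty,0]$ for all $x$, define $\psi_{-1}':=i\lambda^{-1/2}(\lambda-V)^{1/2}$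 and, recursively for $k\in[[-1,n-2]]$, $\psi_{k+1}':=\frac1{2\psi_{-1}'}\Big(\psi_k''-\sum_{\alpha+\beta=k,\ \alpha,\beta\ne-1}\psi_\alpha'\psi_\beta'\Big)$ (with $\psi_\alpha=0$ for $\alpha\ge n$ or $\alpha\le-2$), with $\psi_k(0)=0$ for $k\in[[-1,n-1]]$. Set $g(x):=\exp\big(-\sum_{k=-1}^{n-1}\lambda^{-k/2}\psi_k(x)\big)$ and $f:=\xi g$. *)

theory Defs
  imports "HOL-Analysis.Analysis" "HOL-Library.Landau_Symbols"
begin

text \<open>The two ends of the real line; every statement about an end is made separately
  for each of them.\<close>

datatype side = Minus | Plus

fun sg :: "side \<Rightarrow> real" where
  "sg Minus = -1"
| "sg Plus = 1"

fun at_end :: "side \<Rightarrow> real filter" where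
  "at_end Minus = at_bot"
| "at_end Plus = at_top"

definition half_line :: "side \<Rightarrow> real set" where
  "half_line s = {x. 0 < sg s * x}"

definition japanese :: "real \<Rightarrow> real" where
  "japanese x = sqrt (1 + x\<^sup>2)"


section \<open>Test functions, local Sobolev spaces, square-integrable functions\<close>

definition test_fun :: "(real \<Rightarrow> real) \<Rightarrow> bool" where
  "test_fun \<phi> \<longleftrightarrow>
     (\<forall>k x. (deriv ^^ k) \<phi> field_differentiable at x) \<and> compact (closure {x. \<phi> x \<noteq> 0})"

definition Linf_loc :: "(real \<Rightarrow> complex) \<Rightarrow> bool" where
  "Linf_loc W \<longleftrightarrow> W \<in> borel_measurable lebesgue \<and>
     (\<forall>K. compact K \<longrightarrow> (\<exists>C. AE x in lebesgue. x \<in> K \<longrightarrow> norm (W x) \<le> C))"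

definition is_weak_deriv :: "nat \<Rightarrow> (real \<Rightarrow> complex) \<Rightarrow> (real \<Rightarrow> complex) \<Rightarrow> bool" where
  "is_weak_deriv m V W \<longleftrightarrow> (\<forall>\<phi>. test_fun \<phi> \<longrightarrow>
     (LINT x|lebesgue. (deriv ^^ m) \<phi> x *\<^sub>R V x) = (-1) ^ m * (LINT x|lebesgue. \<phi> x *\<^sub>R W x))"

definition W_Ninf_loc :: "nat \<Rightarrow> (real \<Rightarrow> complex) \<Rightarrow> bool" where
  "W_Ninf_loc N V \<longleftrightarrow> Linf_loc V \<and> (\<forall>m\<in>{1..N}. \<exists>W. Linf_loc W \<and> is_weak_deriv m V W)"

text \<open>A weak derivative is determined only up to null sets; \<open>wderiv\<close> picks a representative,
  and below it is only used in almost-everywhere statements.\<close>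

definition wderiv :: "nat \<Rightarrow> (real \<Rightarrow> complex) \<Rightarrow> real \<Rightarrow> complex" where
  "wderiv m V = (SOME W. Linf_loc W \<and> is_weak_deriv m V W)"

definition L2_fun :: "(real \<Rightarrow> complex) \<Rightarrow> bool" where
  "L2_fun f \<longleftrightarrow> f \<in> borel_measurable lebesgue \<and> integrable lebesgue (\<lambda>x. (norm (f x))\<^sup>2)"

definition norm_L2 :: "(real \<Rightarrow> complex) \<Rightarrow> real" where
  "norm_L2 f = sqrt (LINT x|lebesgue. (norm (f x))\<^sup>2)"


section \<open>The Schroedinger operator on its maximal domain\<close>

text \<open>\<open>H_graph V f h\<close>: both \<open>f\<close> and \<open>h\<close> are square-integrable and
  \<open>- f'' + V f = h\<close> in the sense of distributions.\<close>

definition H_graph :: "(real \<Rightarrow> complex) \<Rightarrow> (real \<Rightarrow> complex) \<Rightarrow> (real \<Rightarrow> complex) \<Rightarrow> bool" where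
  "H_graph V f h \<longleftrightarrow> L2_fun f \<and> L2_fun h \<and>
     (\<forall>\<phi>. test_fun \<phi> \<longrightarrow>
        (LINT x|lebesgue. \<phi> x *\<^sub>R (V x * f x) - (deriv ^^ 2) \<phi> x *\<^sub>R f x)
          = (LINT x|lebesgue. \<phi> x *\<^sub>R h x))"

definition H_dom :: "(real \<Rightarrow> complex) \<Rightarrow> (real \<Rightarrow> complex) set" where
  "H_dom V = {f. \<exists>h. H_graph V f h}"

text \<open>The value is unique up to null sets, so its \<open>L\<^sup>2\<close>-norm does not depend on the choice.\<close>

definition H_op :: "(real \<Rightarrow> complex) \<Rightarrow> (real \<Rightarrow> complex) \<Rightarrow> real \<Rightarrow> complex" where
  "H_op V f = (SOME h. H_graph V f h)"


section \<open>The assumption on the potential\<close>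

definition bounded_at :: "side \<Rightarrow> (real \<Rightarrow> complex) \<Rightarrow> bool" where
  "bounded_at s V \<longleftrightarrow> bounded (V ` half_line s)"

text \<open>An element of \<open>W\<^sup>N\<^sup>,\<^sup>\<infinity>\<close> (locally), with \<open>N \<ge> 1\<close>, is an almost-everywhere class with a unique
  continuous representative; pointwise values of \<open>V\<close> refer to it, whence the continuity below.
  The parameters \<open>\<nu> s\<close> and \<open>\<epsilon>1 s\<close> belong to the end \<open>s\<close>; the latter is used only if
  \<open>V\<close> is unbounded there.\<close>

definition standing_assumption ::
  "nat \<Rightarrow> (real \<Rightarrow> complex) \<Rightarrow> (side \<Rightarrow> real) \<Rightarrow> (side \<Rightarrow> real) \<Rightarrow> bool" where
  "standing_assumption N V \<nu> \<epsilon>1 \<longleftrightarrow>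
     continuous_on UNIV V \<and> W_Ninf_loc N V \<and>
     Limsup at_bot (\<lambda>x. ereal (Im (V x))) < 0 \<and>
     Liminf at_top (\<lambda>x. ereal (Im (V x))) > 0 \<and>
     (\<forall>s. \<forall>m\<in>{1..N}.
        (\<exists>C X. AE x in lebesgue. X \<le> sg s * x \<longrightarrow>
           \<bar>Im (wderiv m V x)\<bar> \<le> C * (\<bar>Im (V x)\<bar> * japanese x powr (m * \<nu> s))) \<and>
        (\<exists>C X. AE x in lebesgue. X \<le> sg s * x \<longrightarrow>
           norm (wderiv m V x) \<le> C * (norm (V x) * japanese x powr (m * \<nu> s)))) \<and>
     (\<forall>s. \<not> bounded_at s V \<longrightarrow>
        0 < \<epsilon>1 s \<and>
        (\<lambda>x. japanese x powr (4 * (\<nu> s + \<epsilon>1 s) + 2) *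
              (japanese x powr (4 * \<nu> s + 2) + \<bar>Re (V x)\<bar>))
          \<in> O[at_end s](\<lambda>x. \<bar>Im (V x)\<bar>\<^sup>2)) \<and>
     (\<forall>s. bounded_at s V \<longrightarrow> \<nu> s < 1)"


section \<open>Cut-off\<close>

text \<open>From here on, \<open>\<nu>\<close>, \<open>\<epsilon>1\<close>, \<open>\<epsilon>2\<close> denote families over the two ends and \<open>l\<close> is the
  spectral parameter \<open>\<lambda>\<close>.\<close>

definition cut_delta ::
  "(real \<Rightarrow> complex) \<Rightarrow> (side \<Rightarrow> real) \<Rightarrow> (side \<Rightarrow> real) \<Rightarrow> (side \<Rightarrow> real) \<Rightarrow> side \<Rightarrow> real \<Rightarrow> real" where
  "cut_delta V \<nu> \<epsilon>1 \<epsilon>2 s l =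
     (if bounded_at s V then l powr ((1 + \<epsilon>2 s) / 2)
      else Inf {d. 0 \<le> d \<and>
             \<bar>Im (V (sg s * d))\<bar>\<^sup>2 * japanese d powr (- 4 * \<nu> s - 2 * \<epsilon>1 s - 2) = l})"

definition cut_Delta ::
  "(real \<Rightarrow> complex) \<Rightarrow> (side \<Rightarrow> real) \<Rightarrow> (side \<Rightarrow> real) \<Rightarrow> (side \<Rightarrow> real) \<Rightarrow> side \<Rightarrow> real \<Rightarrow> real" where
  "cut_Delta V \<nu> \<epsilon>1 \<epsilon>2 s l =
     (if bounded_at s V then cut_delta V \<nu> \<epsilon>1 \<epsilon>2 s l / 4
      else cut_delta V \<nu> \<epsilon>1 \<epsilon>2 s l powr (- \<nu> s) / 4)"

definition J_side ::
  "(real \<Rightarrow> complex) \<Rightarrow> (side \<Rightarrow> real) \<Rightarrow> (side \<Rightarrow> real) \<Rightarrow> (side \<Rightarrow> real) \<Rightarrow> side \<Rightarrow> real \<Rightarrow> real set" where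
  "J_side V \<nu> \<epsilon>1 \<epsilon>2 s l = {x \<in> half_line s. \<bar>x\<bar> < cut_delta V \<nu> \<epsilon>1 \<epsilon>2 s l}"

text \<open>A family \<open>\<xi> l\<close> of cut-offs, for all large \<open>l\<close>, whose derivative bounds hold with a
  constant independent of \<open>l\<close>.\<close>

definition cutoff_family ::
  "(real \<Rightarrow> complex) \<Rightarrow> (side \<Rightarrow> real) \<Rightarrow> (side \<Rightarrow> real) \<Rightarrow> (side \<Rightarrow> real) \<Rightarrow> (real \<Rightarrow> real \<Rightarrow> real) \<Rightarrow> bool" where
  "cutoff_family V \<nu> \<epsilon>1 \<epsilon>2 \<xi> \<longleftrightarrow>
     (\<exists>C>0. \<forall>\<^sub>F l in at_top.
        (let \<delta> = (\<lambda>s. cut_delta V \<nu> \<epsilon>1 \<epsilon>2 s l); \<Delta> = (\<lambda>s. cut_Delta V \<nu> \<epsilon>1 \<epsilon>2 s l) in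
           test_fun (\<xi> l) \<and>
           (\<forall>x. 0 \<le> \<xi> l x \<and> \<xi> l x \<le> 1) \<and>
           (\<forall>x\<in>{- \<delta> Minus + \<Delta> Minus <..< \<delta> Plus - \<Delta> Plus}. \<xi> l x = 1) \<and>
           (\<forall>x. x \<notin> {- \<delta> Minus <..< \<delta> Plus} \<longrightarrow> \<xi> l x = 0) \<and>
           (\<forall>s. \<forall>j\<in>{1,2}. AE x in lebesgue. x \<in> half_line s \<longrightarrow>
              \<bar>(deriv ^^ j) (\<xi> l) x\<bar> \<le> C * \<Delta> s powr (- real j))))"


section \<open>Pseudomodes\<close>

text \<open>Indices are shifted by one: \<open>dpsi V l j\<close> is the function \<open>\<psi>\<^sub>k'\<close> with \<open>k = j - 1\<close>.
  In the recursion for \<open>\<psi>\<^sub>k\<^sub>+\<^sub>1'\<close>, the sum over \<open>\<alpha> + \<beta> = k\<close>, \<open>\<alpha>, \<beta> \<noteq> -1\<close>, has nonzero terms only for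
  \<open>0 \<le> \<alpha>, \<beta> \<le> k\<close> (the functions with index at most \<open>-2\<close> vanish), hence it is the sum over
  \<open>\<alpha> < j\<close> with \<open>\<beta> = j - 1 - \<alpha>\<close>. The functions with indices \<open>-1, \<dots>, n - 1\<close> do not depend on the
  truncation index \<open>n\<close>, and up to \<open>n = N - 1\<close> the recursion differentiates only functions that
  are continuously differentiable.\<close>

fun dpsi :: "(real \<Rightarrow> complex) \<Rightarrow> real \<Rightarrow> nat \<Rightarrow> real \<Rightarrow> complex" where
  "dpsi V l 0 x = \<i> * complex_of_real (l powr (- 1 / 2)) * csqrt (complex_of_real l - V x)"
| "dpsi V l (Suc j) x =
     1 / (2 * dpsi V l 0 x) *
       (vector_derivative (\<lambda>y. dpsi V l j y) (at x)
         - (\<Sum>\<alpha><j. dpsi V l (Suc \<alpha>) x * dpsi V l (j - \<alpha>) x))"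

definition psi :: "(real \<Rightarrow> complex) \<Rightarrow> real \<Rightarrow> nat \<Rightarrow> real \<Rightarrow> complex" where
  "psi V l j x = (LBINT t=ereal 0..ereal x. dpsi V l j t)"

text \<open>With \<open>k = j - 1\<close>, the weight \<open>\<lambda>\<^sup>-\<^sup>k\<^sup>/\<^sup>2\<close> is \<open>l powr (- (real j - 1) / 2)\<close>, and
  \<open>k\<close> running through \<open>-1, \<dots>, n - 1\<close> means \<open>j \<le> n\<close>.\<close>

definition g_mode :: "(real \<Rightarrow> complex) \<Rightarrow> nat \<Rightarrow> real \<Rightarrow> real \<Rightarrow> complex" where
  "g_mode V n l x =
     exp (- (\<Sum>j\<le>n. complex_of_real (l powr (- (real j - 1) / 2)) * psi V l j x))"

definition pseudomode ::
  "(real \<Rightarrow> complex) \<Rightarrow> nat \<Rightarrow> (real \<Rightarrow> real \<Rightarrow> real) \<Rightarrow> real \<Rightarrow> real \<Rightarrow> complex" where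
  "pseudomode V n \<xi> l x = complex_of_real (\<xi> l x) * g_mode V n l x"

end

theory Submission
  imports Defs
begin

text \<open>The pseudomode is a WKB solution. Write \<open>P\<close> for the sum of the \<open>\<lambda>\<^sup>-\<^sup>k\<^sup>/\<^sup>2 \<psi>\<^sub>k\<close>, so that \<open>g = exp (- P)\<close> and
\<open>- g'' + (V - \<lambda>) g = (P'' - P'\<^sup>2 + V - \<lambda>) g\<close>. Sorted by powers of \<open>\<lambda>\<^sup>-\<^sup>1\<^sup>/\<^sup>2\<close>, the leading term of the bracket
vanishes because \<open>\<psi>\<^sub>-\<^sub>1'\<close> solves the eikonal equation, and each later \<open>\<psi>\<^sub>k'\<close> is defined so as to cancel the
next term (\<open>remainder_identity\<close>). There remain the derivative of the last \<open>\<psi>'\<close> and the products of total order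
beyond the truncation. A symbol calculus bounds them: every derivative of \<open>V\<close> costs a factor
\<open>w = \<langle>x\<rangle>\<^sup>\<nu>\<close>, every \<open>\<psi>\<^sub>k'\<close> with \<open>k \<ge> 0\<close> is at most of size \<open>(\<bar>V\<bar> + 1) w\<^sup>k\<^sup>+\<^sup>1 / \<lambda>\<close> (\<open>dpsi_sym\<close>), and on the support
of the cut-off \<open>\<bar>V\<bar> + 1\<close> is at most of order \<open>\<lambda>\<close> and \<open>w\<close> at most of order \<open>\<lambda>\<^sup>1\<^sup>/\<^sup>2\<close>. Hence the remainder is
at most of order \<open>\<lambda>\<^sup>-\<^sup>(\<^sup>n\<^sup>+\<^sup>1\<^sup>)\<^sup>/\<^sup>2 (\<bar>V\<bar> + 1) w\<^sup>n\<^sup>+\<^sup>1\<close> (\<open>rem_bound\<close>); this produces \<open>\<sigma>\<close>.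

The cut-off adds terms with \<open>\<xi>'\<close> and \<open>\<xi>''\<close>, which live next to the two cut-off points, and there \<open>g\<close> is
exponentially small (\<open>g_decay\<close>): the real part of \<open>P'\<close> is close to \<open>Im V / (2 Re (\<lambda> - V)\<^sup>1\<^sup>/\<^sup>2)\<close>, so far out it
has the sign of \<open>x\<close>, and over a window of length \<open>\<Delta>\<close> in front of the support of \<open>\<xi>'\<close> the real part of \<open>P\<close>
grows by a multiple of \<open>\<Delta> \<bar>Im V\<bar> / \<lambda>\<^sup>1\<^sup>/\<^sup>2\<close>, which is a multiple of the exponent claimed for \<open>\<kappa>\<close>. All
quantities of polynomial size are absorbed by giving up half of that exponent.

All that the estimate has to know about one end of the line is collected in \<open>end_geometry\<close>. At a bounded end
this is elementary (\<open>bounded_end_geometry\<close>). At an unbounded end it comes from Gronwall's inequality for \<open>V\<close>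
and \<open>Im V\<close> (\<open>unbounded_end_geometry\<close>), which forces \<open>\<nu> \<ge> -1\<close>, makes \<open>Im V\<close> comparable with its
value at \<open>\<delta>\<close> on the window, and bounds \<open>\<lambda>\<close> by the exponential of a lower power of \<open>\<delta>\<close> than the one in \<open>\<kappa>\<close>.

Since \<open>V\<close> is only a local Sobolev function, the lemma of du Bois-Reymond first turns its weak derivatives into
classical ones: those of order below \<open>N\<close> are locally Lipschitz, and the last one exists off a null set
(\<open>W_Ninf_loc_tower\<close>). Consequently the derivative of the pseudomode is still Lipschitz, and integrating by parts
twice identifies \<open>(H\<^sub>V - \<lambda>) f\<close> (\<open>pseudomode_H_graph\<close>). In the end the quotient of norms is at most a constant times
the sum of the four claimed rates, and it is divided among \<open>\<kappa>\<^sub>\<plusminus>\<close> and \<open>\<sigma>\<^sub>\<plusminus>\<close> in proportion to them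
(\<open>split_quotient\<close>).\<close>

section \<open>Smooth functions and test functions\<close>

definition smooth_fun :: "(real \<Rightarrow> real) \<Rightarrow> bool" where
  "smooth_fun f \<longleftrightarrow> (\<forall>k x. (deriv ^^ k) f field_differentiable at x)"

text \<open>Smoothness is always proved by exhibiting a family of functions, containing the given one, in
which every member has its derivative again in the family.\<close>

lemma smooth_funI:
  assumes "f \<in> S"
    and "\<And>f. f \<in> S \<Longrightarrow> \<exists>f'\<in>S. \<forall>x. (f has_field_derivative f' x) (at x)"
  shows "smooth_fun f"
proof -
  have "(deriv ^^ k) f \<in> S" for k
  proof (induction k)
    case 0 then show ?case using assms(1) by simp
  next
    case (Suc k)
    then obtain f' where f': "f' \<in> S" "\<forall>x. ((deriv ^^ k) f has_field_derivative f' x) (at x)"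
      using assms(2) by blast
    then have "deriv ((deriv ^^ k) f) = f'" by (auto simp: DERIV_imp_deriv)
    then show ?case using f' by simp
  qed
  then show ?thesis unfolding smooth_fun_def field_differentiable_def using assms(2) by metis
qed

lemma smooth_fun_DERIV: "smooth_fun f \<Longrightarrow> (f has_field_derivative deriv f x) (at x)"
  unfolding smooth_fun_def by (metis DERIV_deriv_iff_field_differentiable funpow_0)

lemma smooth_fun_deriv: "smooth_fun f \<Longrightarrow> smooth_fun (deriv f)"
  unfolding smooth_fun_def by (metis comp_apply funpow_Suc_right)

lemma smooth_fun_antideriv:
  assumes "\<And>x. (F has_field_derivative f x) (at x)" "smooth_fun f"
  shows "smooth_fun F"
proof (rule smooth_funI[of F "insert F (Collect smooth_fun)"])
  fix h assume "h \<in> insert F (Collect smooth_fun)"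
  then show "\<exists>f'\<in>insert F (Collect smooth_fun). \<forall>x. (h has_field_derivative f' x) (at x)"
    using assms smooth_fun_DERIV smooth_fun_deriv by (metis insert_iff mem_Collect_eq)
qed simp

text \<open>The derivative of a product is a sum of products, so smoothness of products needs a family closed
under both operations.\<close>

inductive_set smooth_alg :: "(real \<Rightarrow> real) set" where
  base: "smooth_fun f \<Longrightarrow> f \<in> smooth_alg"
| plus: "f \<in> smooth_alg \<Longrightarrow> g \<in> smooth_alg \<Longrightarrow> (\<lambda>x. f x + g x) \<in> smooth_alg"
| times: "f \<in> smooth_alg \<Longrightarrow> g \<in> smooth_alg \<Longrightarrow> (\<lambda>x. f x * g x) \<in> smooth_alg"

lemma smooth_alg_smooth:
  assumes "f \<in> smooth_alg" shows "smooth_fun f"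
proof (rule smooth_funI[OF assms])
  fix f assume "f \<in> smooth_alg"
  then show "\<exists>f'\<in>smooth_alg. \<forall>x. (f has_field_derivative f' x) (at x)"
  proof induction
    case (base f)
    then show ?case using smooth_fun_DERIV smooth_fun_deriv smooth_alg.base by blast
  next
    case (plus f g)
    then obtain f' g' where "f'\<in>smooth_alg" "g'\<in>smooth_alg"
      "\<forall>x. (f has_field_derivative f' x) (at x)" "\<forall>x. (g has_field_derivative g' x) (at x)" by blast
    then show ?case by (intro bexI[of _ "\<lambda>x. f' x + g' x"]) (auto intro: DERIV_add smooth_alg.intros)
  next
    case (times f g)
    then obtain f' g' where *: "f'\<in>smooth_alg" "g'\<in>smooth_alg"
      "\<forall>x. (f has_field_derivative f' x) (at x)" "\<forall>x. (g has_field_derivative g' x) (at x)" by blast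
    show ?case
    proof (intro bexI[of _ "\<lambda>x. f' x * g x + g' x * f x"] allI)
      show "((\<lambda>x. f x * g x) has_field_derivative f' x * g x + g' x * f x) (at x)" for x
        using * by (intro DERIV_mult) auto
      show "(\<lambda>x. f' x * g x + g' x * f x) \<in> smooth_alg"
        using * times.hyps by (intro smooth_alg.intros(2,3))
    qed
  qed
qed

lemma smooth_fun_add: "smooth_fun f \<Longrightarrow> smooth_fun g \<Longrightarrow> smooth_fun (\<lambda>x. f x + g x)"
  and smooth_fun_mult: "smooth_fun f \<Longrightarrow> smooth_fun g \<Longrightarrow> smooth_fun (\<lambda>x. f x * g x)"
  using smooth_alg_smooth smooth_alg.intros by metis+

lemma smooth_fun_const: "smooth_fun (\<lambda>x. c)"
  by (rule smooth_funI[of _ "range (\<lambda>c x. c)"]) (auto intro!: derivative_eq_intros)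

lemma smooth_fun_cmult: "smooth_fun f \<Longrightarrow> smooth_fun (\<lambda>x. c * f x)"
  by (intro smooth_fun_mult smooth_fun_const)

lemma smooth_fun_affine:
  assumes "smooth_fun f" shows "smooth_fun (\<lambda>x. f (a * x + b))"
proof (rule smooth_funI[of _ "{(\<lambda>x. c * f (a * x + b)) |f c. smooth_fun f}"])
  show "(\<lambda>x. f (a * x + b)) \<in> {(\<lambda>x. c * f (a * x + b)) |f c. smooth_fun f}"
    using assms by (auto intro!: exI[of _ f] exI[of _ 1])
next
  fix h assume "h \<in> {(\<lambda>x. c * f (a * x + b)) |f c. smooth_fun f}"
  then obtain f c where h: "h = (\<lambda>x. c * f (a * x + b))" "smooth_fun f" by auto
  show "\<exists>f'\<in>{(\<lambda>x. c * f (a * x + b)) |f c. smooth_fun f}. \<forall>x. (h has_field_derivative f' x) (at x)"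
  proof (intro bexI allI)
    fix x
    have "((\<lambda>x. f (a * x + b)) has_field_derivative deriv f (a * x + b) * a) (at x)"
      by (rule DERIV_chain2[OF smooth_fun_DERIV[OF h(2)]]) (auto intro!: derivative_eq_intros)
    from DERIV_cmult[OF this, of c]
    show "(h has_field_derivative (c * a) * deriv f (a * x + b)) (at x)"
      by (simp add: h mult_ac)
    show "(\<lambda>x. (c * a) * deriv f (a * x + b)) \<in> {(\<lambda>x. c * f (a * x + b)) |f c. smooth_fun f}"
      using h smooth_fun_deriv by blast
  qed
qed

definition flat_exp :: "real \<Rightarrow> real" where
  "flat_exp x = (if 0 < x then exp (- 1 / x) else 0)"

lemma poly_exp_decay:
  fixes p :: "real poly"
  shows "((\<lambda>x. poly p (1 / x) * exp (- 1 / x)) \<longlongrightarrow> 0) (at_right 0)"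
proof -
  have "((\<lambda>y. poly p y * exp (- y)) \<longlongrightarrow> 0) at_top" for p :: "real poly"
  proof -
    have "((\<lambda>y. \<Sum>i\<le>degree p. coeff p i * (y ^ i / exp y)) \<longlongrightarrow> (\<Sum>i\<le>degree p. coeff p i * 0)) at_top"
      by (intro tendsto_sum tendsto_mult tendsto_const tendsto_power_div_exp_0)
    then show ?thesis by (simp add: poly_altdef sum_distrib_right exp_minus divide_inverse mult.assoc)
  qed
  from filterlim_compose[OF this filterlim_inverse_at_top_right, of p]
  show ?thesis by (simp add: field_simps inverse_eq_divide)
qed

text \<open>The family used here consists of the functions \<open>p (1 / x) exp (- 1 / x)\<close>, extended by zero, with
\<open>p\<close> a polynomial; exponential decay beats every \<open>p\<close> at the origin.\<close>

lemma smooth_flat_exp: "smooth_fun flat_exp"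
proof -
  define S where "S = range (\<lambda>(p::real poly) x. if 0 < x then poly p (1 / x) * exp (- 1 / x) else 0)"
  show ?thesis
  proof (rule smooth_funI[of _ S])
    show "flat_exp \<in> S" unfolding S_def flat_exp_def by (rule range_eqI[of _ _ "[:1:]"]) (auto simp: fun_eq_iff)
  next
    fix f assume "f \<in> S"
    then obtain p where f: "f = (\<lambda>x. if 0 < x then poly p (1 / x) * exp (- 1 / x) else 0)"
      unfolding S_def by auto
    (* With y = 1 / x: the derivative of p(y) exp(-y) with respect to x is y^2 (p(y) - p'(y))
       exp(-y). *)
    define q where "q = [:0, 0, 1:] * (p - pderiv p)"
    define f' where "f' = (\<lambda>x::real. if 0 < x then poly q (1 / x) * exp (- 1 / x) else 0)"
    have "(f has_field_derivative f' x) (at x)" for x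
    proof -
      consider "x > 0" | "x < 0" | "x = 0" by linarith
      then show ?thesis
      proof cases
        case 1
        have "((\<lambda>x. poly p (1 / x) * exp (- 1 / x)) has_field_derivative f' x) (at x)"
          using 1 unfolding f'_def q_def
          by (auto intro!: derivative_eq_intros DERIV_chain2[OF poly_DERIV] simp: power2_eq_square divide_simps)
             (simp add: algebra_simps)
        then show ?thesis
          by (rule has_field_derivative_transform_within_open[where S="{0<..}"]) (use 1 in \<open>auto simp: f\<close>)
      next
        case 2
        have "((\<lambda>x. 0) has_field_derivative f' x) (at x)" using 2 by (auto simp: f'_def)
        then show ?thesis
          by (rule has_field_derivative_transform_within_open[where S="{..<0}"]) (use 2 in \<open>auto simp: f\<close>)
      next
        case 3
        have r: "((\<lambda>h. f h / h) \<longlongrightarrow> 0) (at_right 0)"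
        proof (rule Lim_transform_eventually[OF poly_exp_decay[of "[:0, 1:] * p"]])
          show "\<forall>\<^sub>F x in at_right 0. poly ([:0, 1:] * p) (1 / x) * exp (- 1 / x) = f x / x"
            unfolding eventually_at_right_field by (auto simp: f intro!: exI[of _ 1])
        qed
        have l: "((\<lambda>h. f h / h) \<longlongrightarrow> 0) (at_left 0)"
        proof (rule Lim_transform_eventually[OF tendsto_const])
          show "\<forall>\<^sub>F x in at_left 0. 0 = f x / x"
            unfolding eventually_at_left_field by (auto simp: f intro!: exI[of _ "-1"])
        qed
        from l r have "((\<lambda>h. f h / h) \<longlongrightarrow> 0) (at 0)" by (simp add: filterlim_at_split)
        moreover have "f (0 + h) - f 0 = f h" for h by (simp add: f)
        ultimately show ?thesis using 3 by (simp add: DERIV_def f'_def)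
      qed
    qed
    then show "\<exists>f'\<in>S. \<forall>x. (f has_field_derivative f' x) (at x)"
      by (intro bexI[of _ f']) (auto simp: S_def f'_def)
  qed
qed

text \<open>The factor \<open>Suc k\<close> steepens the two flanks, so that the bumps tend to the indicator function of
the interval; they replace mollifiers below.\<close>

definition bump :: "real \<Rightarrow> real \<Rightarrow> nat \<Rightarrow> real \<Rightarrow> real" where
  "bump a b k x = flat_exp (real (Suc k) * (x - a)) * flat_exp (real (Suc k) * (b - x))"

lemma flat_exp_bounds: "0 \<le> flat_exp x" "flat_exp x \<le> 1"
  by (auto simp: flat_exp_def)

lemma bump_bounds: "0 \<le> bump a b k x" "bump a b k x \<le> 1"
  unfolding bump_def using flat_exp_bounds by (auto intro!: mult_nonneg_nonneg mult_le_one)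

lemma bump_outside: "x \<notin> {a<..<b} \<Longrightarrow> bump a b k x = 0"
  by (auto simp: bump_def flat_exp_def zero_less_mult_iff)

lemma smooth_bump: "smooth_fun (bump a b k)"
proof -
  have "smooth_fun (\<lambda>x. flat_exp (real (Suc k) * x + (- real (Suc k) * a)) * flat_exp (- real (Suc k) * x + real (Suc k) * b))"
    by (intro smooth_fun_mult smooth_fun_affine smooth_flat_exp)
  then show ?thesis by (rule back_subst[of smooth_fun]) (auto simp: bump_def fun_eq_iff algebra_simps)
qed

lemma flat_exp_tendsto: assumes "x > 0" shows "(\<lambda>k. flat_exp (real (Suc k) * x)) \<longlonglongrightarrow> 1"
proof -
  have "(\<lambda>k. exp (- (1 / x) * inverse (real (Suc k)))) \<longlonglongrightarrow> exp (- (1 / x) * 0)"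
    by (intro tendsto_intros LIMSEQ_inverse_real_of_nat)
  then show ?thesis using assms by (simp add: flat_exp_def field_simps del: of_nat_Suc)
qed

lemma bump_tendsto: "(\<lambda>k. bump a b k x) \<longlonglongrightarrow> indicat_real {a<..<b} x"
proof (cases "x \<in> {a<..<b}")
  case True
  then have "(\<lambda>k. bump a b k x) \<longlonglongrightarrow> 1 * 1"
    unfolding bump_def by (intro tendsto_mult flat_exp_tendsto) auto
  then show ?thesis using True by simp
qed (simp add: bump_outside)

lemma test_fun_smooth: "test_fun f \<longleftrightarrow> smooth_fun f \<and> compact (closure {x. f x \<noteq> 0})"
  by (simp add: test_fun_def smooth_fun_def)

lemma compact_closure_support:
  assumes "\<And>x. f x \<noteq> (0::real) \<Longrightarrow> x \<in> {a..b}"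
  shows "compact (closure {x::real. f x \<noteq> 0})"
proof -
  have "{x. f x \<noteq> 0} \<subseteq> {a..b}" using assms by auto
  then have "bounded {x. f x \<noteq> 0}" using bounded_closed_interval bounded_subset by blast
  then show ?thesis by (simp add: compact_closure)
qed

lemma test_fun_bump: "test_fun (bump a b k)"
  unfolding test_fun_smooth
proof
  show "compact (closure {x. bump a b k x \<noteq> 0})"
    using bump_outside[of _ a b k] by (intro compact_closure_support[of _ a b]) (metis atLeastAtMost_iff greaterThanLessThan_iff less_imp_le)
qed (rule smooth_bump)

lemma test_fun_support:
  assumes "test_fun f" obtains r where "r > 0" "\<And>x. x \<notin> {-r..r} \<Longrightarrow> f x = 0"
proof -
  from assms have "bounded {x. f x \<noteq> 0}"
    unfolding test_fun_def by (meson bounded_subset closure_subset compact_imp_bounded)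
  then obtain r where "r > 0" "\<forall>x\<in>{x. f x \<noteq> 0}. norm x \<le> r" using bounded_pos by blast
  then show ?thesis by (intro that[of r]) (auto simp: abs_le_iff minus_le_iff)
qed

lemma test_fun_deriv: assumes "test_fun f" shows "test_fun (deriv f)"
proof -
  obtain r where r: "r > 0" "\<And>x. x \<notin> {-r..r} \<Longrightarrow> f x = 0" using test_fun_support[OF assms] by blast
  have "deriv f x = 0" if "x \<notin> {-r..r}" for x
  proof -
    have "((\<lambda>x. 0) has_field_derivative 0) (at x)" by simp
    then have "(f has_field_derivative 0) (at x)"
      by (rule has_field_derivative_transform_within_open[where S="- {-r..r}"])
         (use that r in \<open>auto simp del: atLeastAtMost_iff\<close>)
    then show ?thesis by (rule DERIV_imp_deriv)
  qed
  then have "compact (closure {x. deriv f x \<noteq> 0})"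
    by (intro compact_closure_support[of _ "-r" r]) metis
  then show ?thesis using assms smooth_fun_deriv unfolding test_fun_smooth by blast
qed

section \<open>Primitives of functions defined almost everywhere\<close>

text \<open>The fundamental theorem of calculus is taken as the definition: this makes sense for \<open>W\<close> given up to
null sets, and \<open>F\<close> need not be differentiable at every point.\<close>

definition primitive :: "(real \<Rightarrow> 'a::euclidean_space) \<Rightarrow> (real \<Rightarrow> 'a) \<Rightarrow> bool" where
  "primitive F W \<longleftrightarrow> (\<forall>a b. a \<le> b \<longrightarrow> (W has_integral F b - F a) {a..b})"

lemma primitiveD: "primitive F W \<Longrightarrow> a \<le> b \<Longrightarrow> (W has_integral F b - F a) {a..b}"
  by (simp add: primitive_def)

lemma primitive_integrable: "primitive F W \<Longrightarrow> W integrable_on {a..b}"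
  by (cases "a \<le> b") (auto simp: primitive_def integrable_on_def)

lemma AE_lebesgue_negligible:
  "(AE x in lebesgue. P x) \<longleftrightarrow> (\<exists>Z. negligible Z \<and> (\<forall>x. x \<notin> Z \<longrightarrow> P x))"
  unfolding eventually_ae_filter_negligible by blast

lemma primitive_cong_AE:
  assumes "primitive F W" "AE x in lebesgue. W x = W' x"
  shows "primitive F W'"
proof -
  obtain Z where Z: "negligible Z" "\<And>x. x \<notin> Z \<Longrightarrow> W x = W' x"
    using assms(2) unfolding AE_lebesgue_negligible by blast
  show ?thesis unfolding primitive_def
  proof (intro allI impI)
    fix a b :: real assume "a \<le> b"
    show "(W' has_integral F b - F a) {a..b}"
      by (rule has_integral_spike[OF Z(1) _ primitiveD[OF assms(1) \<open>a \<le> b\<close>]]) (use Z(2) in auto)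
  qed
qed

lemma primitive_exists:
  assumes "\<And>a b. W integrable_on {a..b}"
  shows "\<exists>F. primitive F W"
proof -
  define F where "F x = (if 0 \<le> x then integral {0..x} W else - integral {x..0} W)" for x
  have "(W has_integral F b - F a) {a..b}" if "a \<le> b" for a b
  proof -
    have "integral {a..b} W = F b - F a"
    proof (cases "0 \<le> a")
      case True
      then show ?thesis using that Henstock_Kurzweil_Integration.integral_combine[of 0 a b W] assms
        by (simp add: F_def algebra_simps)
    next
      case a: False
      show ?thesis
      proof (cases "0 \<le> b")
        case True
        then show ?thesis using a Henstock_Kurzweil_Integration.integral_combine[of a 0 b W] assms
          by (simp add: F_def algebra_simps)
      next
        case False
        then show ?thesis using a that Henstock_Kurzweil_Integration.integral_combine[of a b 0 W] assms
          by (simp add: F_def algebra_simps)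
      qed
    qed
    then show ?thesis using assms by (metis integrable_integral)
  qed
  then show ?thesis unfolding primitive_def by blast
qed

lemma primitive_diff:
  "primitive F W \<Longrightarrow> primitive G U \<Longrightarrow> primitive (\<lambda>x. F x - G x) (\<lambda>x. W x - U x)"
  unfolding primitive_def
proof (intro allI impI)
  fix a b :: real
  assume *: "\<forall>a b. a \<le> b \<longrightarrow> (W has_integral F b - F a) {a..b}"
    "\<forall>a b. a \<le> b \<longrightarrow> (U has_integral G b - G a) {a..b}" "a \<le> b"
  then have "((\<lambda>x. W x - U x) has_integral (F b - F a) - (G b - G a)) {a..b}"
    by (intro has_integral_diff) auto
  then show "((\<lambda>x. W x - U x) has_integral F b - G b - (F a - G a)) {a..b}"
    by (simp add: algebra_simps)
qed

lemma primitive_add_const: "primitive F W \<Longrightarrow> primitive (\<lambda>x. F x + c) W"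
  by (simp add: primitive_def)

lemma primitive_deriv_at:
  assumes F: "primitive F W" and W: "continuous_on {a..b} W" and x: "x \<in> {a<..<b}"
  shows "(F has_vector_derivative W x) (at x)"
proof -
  have "((\<lambda>u. integral {a..u} W) has_vector_derivative W x) (at x within {a..b})"
    using x by (intro integral_has_vector_derivative W) auto
  then have "((\<lambda>u. integral {a..u} W) has_vector_derivative W x) (at x)"
    using x by (simp add: at_within_Icc_at)
  then have "((\<lambda>u. integral {a..u} W + F a) has_vector_derivative W x) (at x)"
    by (rule has_vector_derivative_add_const[THEN iffD2])
  then show ?thesis
  proof (rule has_vector_derivative_transform_within_open[where S="{a<..<b}"])
    fix y assume "y \<in> {a<..<b}"
    then show "integral {a..y} W + F a = F y"
      using primitiveD[OF F, of a y] by (simp add: integral_unique)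
  qed (use x in auto)
qed

lemma primitive_deriv:
  assumes "primitive F W" "continuous_on UNIV W"
  shows "(F has_vector_derivative W x) (at x)"
  by (rule primitive_deriv_at[OF assms(1), of "x-1" "x+1"])
     (use assms(2) continuous_on_subset in auto)

text \<open>The averages of \<open>W\<close> over \<open>[x, x + h]\<close> with \<open>h > 0\<close> converge to \<open>W x\<close> for almost all \<open>x\<close>. Applied to
\<open>W\<close> and to its reflection, this gives the right and the left derivative of \<open>F\<close>.\<close>

lemma primitive_AE_deriv:
  fixes F W :: "real \<Rightarrow> 'a::euclidean_space"
  assumes F: "primitive F W"
  shows "AE x in lebesgue. (F has_vector_derivative W x) (at x)"
proof -
  have one_sided: "\<exists>N. negligible N \<and> (\<forall>x e. x \<notin> N \<longrightarrow> 0 < e \<longrightarrow>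
      (\<exists>d>0. \<forall>h. 0 < h \<and> h < d \<longrightarrow> norm (G (x + h) - G x - h *\<^sub>R U x) \<le> e * h))"
    if G: "primitive G U" for G U :: "real \<Rightarrow> 'a"
  proof -
    obtain N where N: "negligible N"
       "\<And>x e. \<lbrakk>x \<notin> N; 0 < e\<rbrakk> \<Longrightarrow> \<exists>d>0. \<forall>h. 0 < h \<and> h < d \<longrightarrow>
            norm(integral (cbox x (x + h *\<^sub>R One)) U /\<^sub>R h ^ DIM(real) - U x) < e"
      using integrable_ccontinuous_explicit[of U] primitive_integrable[OF G]
      by (metis box_real(2))
    show ?thesis
    proof (intro exI[of _ N] conjI allI impI)
      fix x e :: real assume "x \<notin> N" "0 < e"
      then obtain d where d: "d > 0" "\<And>h. 0 < h \<and> h < d \<Longrightarrow>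
            norm(integral (cbox x (x + h *\<^sub>R One)) U /\<^sub>R h ^ DIM(real) - U x) < e"
        using N(2) by blast
      have "norm (G (x + h) - G x - h *\<^sub>R U x) \<le> e * h" if "0 < h \<and> h < d" for h
      proof -
        have "integral {x..x+h} U = G (x + h) - G x"
          using primitiveD[OF G, of x "x+h"] that by (simp add: integral_unique)
        then have *: "norm ((G (x + h) - G x) /\<^sub>R h - U x) < e"
          using d(2)[OF that] by simp
        have "G (x + h) - G x - h *\<^sub>R U x = h *\<^sub>R ((G (x + h) - G x) /\<^sub>R h - U x)"
          using that by (simp add: scaleR_diff_right)
        then have "norm (G (x + h) - G x - h *\<^sub>R U x) = h * norm ((G (x + h) - G x) /\<^sub>R h - U x)"
          using that by simp
        then show ?thesis using * that by (simp add: mult.commute mult_left_mono)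
      qed
      then show "\<exists>d>0. \<forall>h. 0 < h \<and> h < d \<longrightarrow> norm (G (x + h) - G x - h *\<^sub>R U x) \<le> e * h"
        using d(1) by blast
    qed (rule N(1))
  qed
  have R: "primitive (\<lambda>x. - F (- x)) (\<lambda>x. W (- x))"
    unfolding primitive_def
  proof (intro allI impI)
    fix a b :: real assume "a \<le> b"
    then have "(W has_integral F (- a) - F (- b)) {- b..- a}"
      using primitiveD[OF F, of "-b" "-a"] by simp
    then show "((\<lambda>x. W (- x)) has_integral - F (- b) - - F (- a)) {a..b}"
      using has_integral_reflect_real[of W "F (- a) - F (- b)" "-a" "-b"] by simp
  qed
  obtain N1 where N1: "negligible N1" "\<And>x e. x \<notin> N1 \<Longrightarrow> 0 < e \<Longrightarrow>
      (\<exists>d>0. \<forall>h. 0 < h \<and> h < d \<longrightarrow> norm (F (x + h) - F x - h *\<^sub>R W x) \<le> e * h)"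
    using one_sided[OF F] by blast
  obtain N2 where N2: "negligible N2" "\<And>x e. x \<notin> N2 \<Longrightarrow> 0 < e \<Longrightarrow>
      (\<exists>d>0. \<forall>h. 0 < h \<and> h < d \<longrightarrow> norm (- F (- (x + h)) - - F (- x) - h *\<^sub>R W (- x)) \<le> e * h)"
    using one_sided[OF R] by blast
  have "negligible (uminus ` N2)"
    using N2(1) by (intro negligible_differentiable_image_negligible) (auto intro!: derivative_intros)
  then have "negligible (N1 \<union> uminus ` N2)" using N1(1) by simp
  moreover have "(F has_vector_derivative W x) (at x)" if x: "x \<notin> N1 \<union> uminus ` N2" for x
    unfolding has_vector_derivative_def has_derivative_at_alt
  proof (intro conjI allI impI)
    show "bounded_linear (\<lambda>h. h *\<^sub>R W x)" by (rule bounded_linear_scaleR_left)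
  next
    fix e :: real assume "e > 0"
    obtain d1 where d1: "d1 > 0" "\<And>h. 0 < h \<and> h < d1 \<Longrightarrow> norm (F (x + h) - F x - h *\<^sub>R W x) \<le> e * h"
      using N1(2)[of x e] x \<open>e > 0\<close> by blast
    have "- x \<notin> N2" using x by force
    then obtain d2 where d2: "d2 > 0"
      "\<And>h. 0 < h \<and> h < d2 \<Longrightarrow> norm (- F (- (- x + h)) - - F (- (- x)) - h *\<^sub>R W (- (- x))) \<le> e * h"
      using N2(2)[of "-x" e] \<open>e > 0\<close> by blast
    show "\<exists>d>0. \<forall>y. norm (y - x) < d \<longrightarrow> norm (F y - F x - (y - x) *\<^sub>R W x) \<le> e * norm (y - x)"
    proof (intro exI[of _ "min d1 d2"] conjI allI impI)
      fix y assume y: "norm (y - x) < min d1 d2"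
      consider "y > x" | "y = x" | "y < x" by linarith
      then show "norm (F y - F x - (y - x) *\<^sub>R W x) \<le> e * norm (y - x)"
      proof cases
        case 1 then show ?thesis using d1(2)[of "y - x"] y by auto
      next
        case 3
        have "norm (- F (- (- x + (x - y))) - - F (- (- x)) - (x - y) *\<^sub>R W (- (- x))) \<le> e * (x - y)"
          using 3 y by (intro d2(2)) auto
        moreover have "- F (- (- x + (x - y))) - - F (- (- x)) - (x - y) *\<^sub>R W (- (- x)) = - (F y - F x - (x - y) *\<^sub>R (- W x))"
          by (simp add: algebra_simps)
        moreover have "(x - y) *\<^sub>R (- W x) = (y - x) *\<^sub>R W x" by (simp add: algebra_simps)
        ultimately have "norm (F y - F x - (y - x) *\<^sub>R W x) \<le> e * (x - y)"
          by (metis norm_minus_cancel)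
        then show ?thesis using 3 by simp
      qed simp
    qed (use d1 d2 in auto)
  qed
  ultimately show ?thesis unfolding AE_lebesgue_negligible by blast
qed

lemma difference_quotient_tendsto:
  fixes F :: "real \<Rightarrow> 'a::real_normed_vector"
  assumes "(F has_vector_derivative D) (at x)"
  shows "(\<lambda>k. real (Suc k) *\<^sub>R (F (x + inverse (real (Suc k))) - F x)) \<longlonglongrightarrow> D"
proof (rule LIMSEQ_I)
  fix e :: real assume "e > 0"
  then obtain d where d: "d > 0" "\<And>y. norm (y - x) < d \<Longrightarrow> norm (F y - F x - (y - x) *\<^sub>R D) \<le> e / 2 * norm (y - x)"
    using assms unfolding has_vector_derivative_def has_derivative_at_alt by (meson half_gt_zero)
  obtain N where N: "inverse (real (Suc N)) < d" using reals_Archimedean[OF d(1)] by blast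
  show "\<exists>no. \<forall>n\<ge>no. norm (real (Suc n) *\<^sub>R (F (x + inverse (real (Suc n))) - F x) - D) < e"
  proof (intro exI[of _ N] allI impI)
    fix n assume "N \<le> n"
    let ?h = "inverse (real (Suc n))"
    have "?h \<le> inverse (real (Suc N))" using \<open>N \<le> n\<close> by (intro le_imp_inverse_le) auto
    then have "?h < d" using N by (rule le_less_trans)
    moreover have "?h > 0" by simp
    ultimately have h: "?h < d" "?h > 0" by blast+
    have "real (Suc n) *\<^sub>R (F (x + ?h) - F x) - D = real (Suc n) *\<^sub>R (F (x + ?h) - F x - ?h *\<^sub>R D)"
      by (simp add: scaleR_diff_right)
    then have "norm (real (Suc n) *\<^sub>R (F (x + ?h) - F x) - D) = real (Suc n) * norm (F (x + ?h) - F x - ?h *\<^sub>R D)"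
      by (metis abs_of_nat norm_scaleR)
    also have "\<dots> \<le> real (Suc n) * (e / 2 * ?h)"
      using d(2)[of "x + ?h"] h by (intro mult_left_mono) auto
    also have "\<dots> = e / 2" by simp
    finally show "norm (real (Suc n) *\<^sub>R (F (x + ?h) - F x) - D) < e" using \<open>e > 0\<close> by simp
  qed
qed

text \<open>Measurability of the derivative, as an almost everywhere limit of difference quotients.\<close>

lemma borel_measurable_AE_deriv:
  fixes F :: "real \<Rightarrow> 'a::euclidean_space"
  assumes "continuous_on UNIV F" "AE x in lebesgue. (F has_vector_derivative F' x) (at x)"
  shows "F' \<in> borel_measurable lebesgue"
proof -
  define G where "G k x = real (Suc k) *\<^sub>R (F (x + inverse (real (Suc k))) - F x)" for k x
  have "continuous_on UNIV (G k)" for k unfolding G_def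
    by (intro continuous_intros continuous_on_compose2[OF assms(1)]) (use assms(1) in auto)
  then have [measurable]: "G k \<in> borel_measurable borel" for k
    by (rule borel_measurable_continuous_onI)
  have "(\<lambda>x. lim (\<lambda>k. G k x)) \<in> borel_measurable borel"
    by (rule borel_measurable_lim_metric) measurable
  then have "(\<lambda>x. lim (\<lambda>k. G k x)) \<in> borel_measurable lebesgue"
    by (intro measurable_completion) simp
  moreover have "AE x in lebesgue. lim (\<lambda>k. G k x) = F' x"
    using assms(2) by eventually_elim (unfold G_def, rule limI, rule difference_quotient_tendsto)
  ultimately show ?thesis by (rule borel_measurable_AE)
qed

definition loc_lip :: "(real \<Rightarrow> 'a::real_normed_vector) \<Rightarrow> bool" where
  "loc_lip F \<longleftrightarrow> (\<forall>a b. \<exists>L. L-lipschitz_on {a..b} F)"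

lemma loc_lip_continuous: assumes "loc_lip F" shows "continuous_on A F"
proof -
  have "isCont F x" for x
  proof -
    obtain L where "L-lipschitz_on {x-1..x+1} F" using assms unfolding loc_lip_def by blast
    then have "continuous_on {x-1..x+1} F" by (rule lipschitz_on_continuous_on)
    then show ?thesis by (auto intro: continuous_on_interior)
  qed
  then show ?thesis using continuous_at_imp_continuous_on by blast
qed

text \<open>The difference quotients of \<open>F\<close> are bounded by the Lipschitz constant, so dominated convergence
applies to their integrals, which are difference quotients of a primitive of \<open>F\<close>.\<close>

lemma lipschitz_FTC_global:
  fixes F :: "real \<Rightarrow> 'a::euclidean_space"
  assumes F: "L-lipschitz_on UNIV F"
    and d: "AE x in lebesgue. (F has_vector_derivative F' x) (at x)"
    and ab: "a \<le> b"
  shows "(F' has_integral F b - F a) {a..b}"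
proof -
  have contF: "continuous_on A F" for A
    by (rule continuous_on_subset[OF lipschitz_on_continuous_on[OF F]]) simp
  then obtain \<Phi> where "primitive \<Phi> F"
    using primitive_exists[of F] integrable_continuous_interval by blast
  then have \<Phi>: "(\<Phi> has_vector_derivative F x) (at x)" for x
    by (rule primitive_deriv) (rule contF)
  obtain Z where Z: "negligible Z" "\<And>x. x \<notin> Z \<Longrightarrow> (F has_vector_derivative F' x) (at x)"
    using d unfolding AE_lebesgue_negligible by blast
  define q where "q k = inverse (real (Suc k))" for k
  define f where "f k x = real (Suc k) *\<^sub>R (F (x + q k) - F x)" for k x
  define g where "g x = (if x \<in> Z then 0 else F' x)" for x
  define fz where "fz k x = (if x \<in> Z then 0 else f k x)" for k x
  have "(g has_integral F b - F a) {a..b}"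
  proof (rule has_integral_dominated_convergence)
    fix k
    have shift: "((\<lambda>x. \<Phi> (x + q k)) has_vector_derivative F (x + q k)) (at x)" for x
    proof -
      have "((\<lambda>x. x + q k) has_vector_derivative 1) (at x)" by (auto intro!: derivative_eq_intros)
      from vector_diff_chain_at[OF this \<Phi>] show ?thesis by (simp add: o_def)
    qed
    have "((\<lambda>x. F (x + q k)) has_integral \<Phi> (b + q k) - \<Phi> (a + q k)) {a..b}"
      by (rule fundamental_theorem_of_calculus[OF ab]) (rule has_vector_derivative_at_within[OF shift])
    moreover have "(F has_integral \<Phi> b - \<Phi> a) {a..b}"
      by (rule fundamental_theorem_of_calculus[OF ab]) (rule has_vector_derivative_at_within[OF \<Phi>])
    ultimately have "(f k has_integral real (Suc k) *\<^sub>R ((\<Phi> (b + q k) - \<Phi> (a + q k)) - (\<Phi> b - \<Phi> a))) {a..b}"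
      unfolding f_def by (intro has_integral_cmul has_integral_diff)
    then show "(fz k has_integral real (Suc k) *\<^sub>R ((\<Phi> (b + q k) - \<Phi> (a + q k)) - (\<Phi> b - \<Phi> a))) {a..b}"
      by (rule has_integral_spike[OF Z(1), rotated]) (auto simp: fz_def)
  next
    show "(\<lambda>x. L) integrable_on {a..b}" by (rule integrable_const_ivl)
  next
    fix k show "\<forall>x\<in>{a..b}. norm (fz k x) \<le> L"
    proof
      fix x
      have "norm (F (x + q k) - F x) \<le> L * q k"
        using lipschitz_onD[OF F, of "x + q k" x] by (simp add: dist_norm q_def)
      then have "real (Suc k) * norm (F (x + q k) - F x) \<le> real (Suc k) * (L * q k)"
        by (rule mult_left_mono) simp
      also have "\<dots> = L" by (simp add: q_def)
      finally have "norm (f k x) \<le> L" by (simp add: f_def)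
      then show "norm (fz k x) \<le> L" using lipschitz_on_nonneg[OF F] by (simp add: fz_def)
    qed
  next
    show "\<forall>x\<in>{a..b}. (\<lambda>k. fz k x) \<longlonglongrightarrow> g x"
      unfolding fz_def g_def f_def q_def using difference_quotient_tendsto[OF Z(2)] by auto
  next
    have "(\<lambda>k. real (Suc k) *\<^sub>R (\<Phi> (b + q k) - \<Phi> b) - real (Suc k) *\<^sub>R (\<Phi> (a + q k) - \<Phi> a)) \<longlonglongrightarrow> F b - F a"
      unfolding q_def by (intro tendsto_diff difference_quotient_tendsto \<Phi>)
    then show "(\<lambda>k. real (Suc k) *\<^sub>R ((\<Phi> (b + q k) - \<Phi> (a + q k)) - (\<Phi> b - \<Phi> a))) \<longlonglongrightarrow> F b - F a"
      by (rule back_subst[of "\<lambda>u. u \<longlonglongrightarrow> F b - F a"]) (simp only: scaleR_diff_right, simp add: fun_eq_iff)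
  qed
  then show ?thesis by (rule has_integral_spike[OF Z(1), rotated]) (auto simp: g_def)
qed

text \<open>Extending \<open>F\<close> by constants on both sides of the interval reduces this to the global case.\<close>

lemma lipschitz_FTC:
  fixes F :: "real \<Rightarrow> 'a::euclidean_space"
  assumes F: "L-lipschitz_on {a..b} F"
    and d: "AE x in lebesgue. x \<in> {a<..<b} \<longrightarrow> (F has_vector_derivative F' x) (at x)"
    and ab: "a \<le> b"
  shows "(F' has_integral F b - F a) {a..b}"
proof -
  (* The projection onto [a, b]; F composed with c is the constant extension of F. *)
  define c where "c x = max a (min b x)" for x
  define G where "G x = F (c x)" for x
  define G' where "G' x = (if x \<in> {a<..<b} then F' x else 0)" for x
  have "L-lipschitz_on UNIV G"
  proof (rule lipschitz_onI)
    fix x y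
    have "dist (F (c x)) (F (c y)) \<le> L * dist (c x) (c y)"
      by (rule lipschitz_onD[OF F]) (use ab in \<open>auto simp: c_def\<close>)
    also have "\<dots> \<le> L * dist x y"
      using lipschitz_on_nonneg[OF F] by (intro mult_left_mono) (auto simp: c_def dist_real_def)
    finally show "dist (G x) (G y) \<le> L * dist x y" by (simp add: G_def)
  qed (rule lipschitz_on_nonneg[OF F])
  moreover have "AE x in lebesgue. (G has_vector_derivative G' x) (at x)"
  proof -
    obtain Z where Z: "negligible Z" "\<And>x. x \<notin> Z \<Longrightarrow> x \<in> {a<..<b} \<Longrightarrow> (F has_vector_derivative F' x) (at x)"
      using d unfolding AE_lebesgue_negligible by blast
    have "negligible (insert a (insert b Z))" using Z(1) by simp
    moreover have "(G has_vector_derivative G' x) (at x)" if "x \<notin> insert a (insert b Z)" for x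
    proof -
      have "x \<noteq> a" "x \<noteq> b" using that by auto
      then consider "x < a" | "a < x \<and> x < b" | "x > b" by linarith
      then show ?thesis
      proof cases
        case 1
        have "((\<lambda>x. F a) has_vector_derivative G' x) (at x)" using 1 by (auto simp: G'_def)
        then show ?thesis
          by (rule has_vector_derivative_transform_within_open[where S="{..<a}"])
             (use 1 ab in \<open>auto simp: G_def c_def\<close>)
      next
        case 2
        have "(F has_vector_derivative G' x) (at x)" using 2 that Z(2) by (auto simp: G'_def)
        then show ?thesis
          by (rule has_vector_derivative_transform_within_open[where S="{a<..<b}"])
             (use 2 ab in \<open>auto simp: G_def c_def\<close>)
      next
        case 3
        have "((\<lambda>x. F b) has_vector_derivative G' x) (at x)" using 3 by (auto simp: G'_def)
        then show ?thesis
          by (rule has_vector_derivative_transform_within_open[where S="{b<..}"])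
             (use 3 ab in \<open>auto simp: G_def c_def\<close>)
      qed
    qed
    ultimately show ?thesis unfolding AE_lebesgue_negligible by blast
  qed
  ultimately have "(G' has_integral G b - G a) {a..b}" using ab by (rule lipschitz_FTC_global)
  then have "(G' has_integral F b - F a) {a..b}" using ab by (simp add: G_def c_def)
  then show ?thesis
    by (rule has_integral_spike[rotated 2, where S="{a,b}"]) (auto simp: G'_def)
qed

lemma Linf_loc_interval:
  assumes "Linf_loc W" obtains C where "C \<ge> 0" "AE x in lebesgue. x \<in> {a..b} \<longrightarrow> norm (W x) \<le> C"
proof -
  obtain C where C: "AE x in lebesgue. x \<in> {a..b} \<longrightarrow> norm (W x) \<le> C"
    using assms unfolding Linf_loc_def by (meson compact_Icc)
  have "AE x in lebesgue. x \<in> {a..b} \<longrightarrow> norm (W x) \<le> max C 0"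
    using C by eventually_elim auto
  then show ?thesis by (intro that[of "max C 0"]) auto
qed

lemma Linf_loc_measurable: "Linf_loc W \<Longrightarrow> W \<in> borel_measurable lebesgue"
  by (simp add: Linf_loc_def)

lemma bounded_set_integrable:
  fixes W :: "real \<Rightarrow> 'a::{banach, second_countable_topology}"
  assumes "W \<in> borel_measurable lebesgue" "AE x in lebesgue. x \<in> {a..b} \<longrightarrow> norm (W x) \<le> C"
  shows "W absolutely_integrable_on {a..b}"
  unfolding set_integrable_def
proof (rule Bochner_Integration.integrable_bound)
  show "integrable lebesgue (\<lambda>x. indicat_real {a..b} x *\<^sub>R C)"
    using integrable_const_ivl[of C a b] absolutely_integrable_on_const[of "{a..b}" C]
    by (simp add: set_integrable_def)
  show "(\<lambda>x. indicat_real {a..b} x *\<^sub>R W x) \<in> borel_measurable lebesgue"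
    using assms(1) by (intro borel_measurable_scaleR borel_measurable_indicator) auto
  show "AE x in lebesgue. norm (indicat_real {a..b} x *\<^sub>R W x) \<le> norm (indicat_real {a..b} x *\<^sub>R C)"
    using assms(2) by eventually_elim (auto simp: indicator_def)
qed

lemma Linf_loc_abs_integrable: 
  assumes "Linf_loc W" shows "W absolutely_integrable_on {a..b}"
proof -
  obtain C where "AE x in lebesgue. x \<in> {a..b} \<longrightarrow> norm (W x) \<le> C"
    using Linf_loc_interval[OF assms, of a b] by blast
  then show ?thesis by (rule bounded_set_integrable[OF Linf_loc_measurable[OF assms]])
qed

lemma continuous_measurable_lebesgue:
  fixes F :: "real \<Rightarrow> 'a::euclidean_space"
  shows "continuous_on UNIV F \<Longrightarrow> F \<in> borel_measurable lebesgue"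
  by (intro measurable_completion) (simp add: borel_measurable_continuous_onI)

lemma continuous_bounded_interval:
  fixes F :: "real \<Rightarrow> 'a::real_normed_vector"
  assumes "continuous_on {a..b} F" obtains C where "C \<ge> 0" "\<And>x. x \<in> {a..b} \<Longrightarrow> norm (F x) \<le> C"
proof -
  have "bounded (F ` {a..b})" using assms by (intro compact_imp_bounded compact_continuous_image) auto
  then show ?thesis using that unfolding bounded_pos by (metis image_eqI less_imp_le)
qed

lemma continuous_Linf_loc:
  assumes "continuous_on UNIV F" shows "Linf_loc F"
  unfolding Linf_loc_def
proof (intro conjI allI impI continuous_measurable_lebesgue assms)
  fix K :: "real set" assume "compact K"
  then have "bounded (F ` K)"
    using assms by (intro compact_imp_bounded compact_continuous_image) (auto intro: continuous_on_subset)
  then show "\<exists>C. AE x in lebesgue. x \<in> K \<longrightarrow> norm (F x) \<le> C"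
    unfolding bounded_iff by (auto intro!: AE_I2)
qed

lemma Linf_loc_diff:
  assumes "Linf_loc F" "Linf_loc G" shows "Linf_loc (\<lambda>x. F x - G x)"
  unfolding Linf_loc_def
proof (intro conjI allI impI)
  have [measurable]: "F \<in> borel_measurable lebesgue" "G \<in> borel_measurable lebesgue"
    using assms Linf_loc_measurable by auto
  show "(\<lambda>x. F x - G x) \<in> borel_measurable lebesgue" by measurable
  fix K :: "real set" assume "compact K"
  then obtain C D where CD: "AE x in lebesgue. x \<in> K \<longrightarrow> norm (F x) \<le> C" "AE x in lebesgue. x \<in> K \<longrightarrow> norm (G x) \<le> D"
    using assms unfolding Linf_loc_def by blast
  have "AE x in lebesgue. x \<in> K \<longrightarrow> norm (F x - G x) \<le> C + D"
    using CD by eventually_elim (meson add_mono norm_triangle_ineq4 order_trans)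
  then show "\<exists>C. AE x in lebesgue. x \<in> K \<longrightarrow> norm (F x - G x) \<le> C" by blast
qed

text \<open>The integral of a function bounded by \<open>C\<close> almost everywhere on \<open>[x, y]\<close> is at most \<open>C (y - x)\<close>.\<close>

lemma primitive_loc_lip:
  assumes F: "primitive F W" and W: "Linf_loc W"
  shows "loc_lip F"
  unfolding loc_lip_def
proof (intro allI)
  fix a b
  obtain C where C: "C \<ge> 0" "AE x in lebesgue. x \<in> {a..b} \<longrightarrow> norm (W x) \<le> C"
    using Linf_loc_interval[OF W] by blast
  then obtain Z where Z: "negligible Z" "\<And>x. x \<notin> Z \<Longrightarrow> x \<in> {a..b} \<Longrightarrow> norm (W x) \<le> C"
    unfolding AE_lebesgue_negligible by blast
  have *: "norm (F y - F x) \<le> C * (y - x)" if "a \<le> x" "x \<le> y" "y \<le> b" for x y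
  proof -
    have "((\<lambda>t. if t \<in> Z then 0 else W t) has_integral F y - F x) {x..y}"
      by (rule has_integral_spike[OF Z(1) _ primitiveD[OF F that(2)]]) auto
    then have "norm (F y - F x) \<le> C * measure lborel (cbox x y)"
      using has_integral_bound[OF C(1), of "\<lambda>t. if t \<in> Z then 0 else W t" "F y - F x" x y] Z(2) that C(1)
      by (auto simp: box_real)
    then show ?thesis using that by simp
  qed
  have "dist (F x) (F y) \<le> C * dist x y" if "x \<in> {a..b}" "y \<in> {a..b}" for x y
    using *[of x y] *[of y x] that by (cases "x \<le> y") (auto simp: dist_norm norm_minus_commute)
  then show "\<exists>L. L-lipschitz_on {a..b} F" using C(1) unfolding lipschitz_on_def by blast
qed

section \<open>Weak derivatives and the lemma of du Bois-Reymond\<close>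

lemma bump_integral_tendsto:
  fixes W :: "real \<Rightarrow> complex"
  assumes W: "W absolutely_integrable_on {a..b}"
  shows "(\<lambda>k. LINT x|lebesgue. bump a b k x *\<^sub>R W x) \<longlonglongrightarrow> integral {a..b} W"
proof -
  have bm: "bump a b k \<in> borel_measurable lebesgue" for k
  proof -
    have "continuous_on UNIV (bump a b k)"
      using smooth_fun_DERIV[OF smooth_bump, of a b k] DERIV_isCont continuous_at_imp_continuous_on by blast
    then show ?thesis by (rule continuous_measurable_lebesgue)
  qed
  have eq: "bump a b k x *\<^sub>R W x = bump a b k x *\<^sub>R (indicat_real {a..b} x *\<^sub>R W x)" for k x
    using bump_outside[of x a b k] by (cases "x \<in> {a..b}") auto
  have m: "(\<lambda>x. indicat_real {a..b} x *\<^sub>R W x) \<in> borel_measurable lebesgue"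
    using W unfolding set_integrable_def by (rule borel_measurable_integrable)
  have m1: "(\<lambda>x. indicat_real {a<..<b} x *\<^sub>R (indicat_real {a..b} x *\<^sub>R W x)) \<in> borel_measurable lebesgue"
    by (rule borel_measurable_scaleR[OF borel_measurable_indicator m]) simp
  have m2: "(\<lambda>x. bump a b k x *\<^sub>R (indicat_real {a..b} x *\<^sub>R W x)) \<in> borel_measurable lebesgue" for k
    by (rule borel_measurable_scaleR[OF bm m])
  have "(\<lambda>k. LINT x|lebesgue. bump a b k x *\<^sub>R (indicat_real {a..b} x *\<^sub>R W x)) \<longlonglongrightarrow>
      (LINT x|lebesgue. indicat_real {a<..<b} x *\<^sub>R (indicat_real {a..b} x *\<^sub>R W x))"
  proof (rule integral_dominated_convergence)
    show "integrable lebesgue (\<lambda>x. norm (indicat_real {a..b} x *\<^sub>R W x))"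
      using W unfolding set_integrable_def by (rule integrable_norm)
    show "AE x in lebesgue. (\<lambda>k. bump a b k x *\<^sub>R indicat_real {a..b} x *\<^sub>R W x) \<longlonglongrightarrow>
        indicat_real {a<..<b} x *\<^sub>R indicat_real {a..b} x *\<^sub>R W x"
      by (intro AE_I2 tendsto_scaleR bump_tendsto tendsto_const)
    show "AE x in lebesgue. norm (bump a b k x *\<^sub>R indicat_real {a..b} x *\<^sub>R W x) \<le> norm (indicat_real {a..b} x *\<^sub>R W x)" for k
    proof (rule AE_I2)
      fix x
      show "norm (bump a b k x *\<^sub>R indicat_real {a..b} x *\<^sub>R W x) \<le> norm (indicat_real {a..b} x *\<^sub>R W x)"
        using mult_right_mono[OF bump_bounds(2)[of a b k x], of "norm (indicat_real {a..b} x *\<^sub>R W x)"]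
          bump_bounds(1)[of a b k x] by (simp only: norm_scaleR abs_of_nonneg) simp
    qed
  qed (rule m1, rule m2)
  also have "(LINT x|lebesgue. indicat_real {a<..<b} x *\<^sub>R (indicat_real {a..b} x *\<^sub>R W x)) = (LINT x|lebesgue. indicat_real {a..b} x *\<^sub>R W x)"
  proof (rule integral_cong_AE)
    show "AE x in lebesgue. indicat_real {a<..<b} x *\<^sub>R indicat_real {a..b} x *\<^sub>R W x = indicat_real {a..b} x *\<^sub>R W x"
      unfolding AE_lebesgue_negligible by (rule exI[of _ "{a,b}"]) (auto simp: indicator_def)
  qed (rule m1, rule m)
  also have "\<dots> = integral {a..b} W"
    using set_lebesgue_integral_eq_integral(2)[OF W] by (simp add: set_lebesgue_integral_def)
  finally show ?thesis by (simp only: eq[symmetric])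
qed

text \<open>Testing with bumps shows that the integral over every interval vanishes; then zero is a primitive
of \<open>W\<close>, and \<open>W\<close> is almost everywhere its derivative.\<close>

lemma fundamental_lemma_variations:
  fixes W :: "real \<Rightarrow> complex"
  assumes W: "\<And>a b. W absolutely_integrable_on {a..b}"
    and 0: "\<And>\<phi>. test_fun \<phi> \<Longrightarrow> (LINT x|lebesgue. \<phi> x *\<^sub>R W x) = 0"
  shows "AE x in lebesgue. W x = 0"
proof -
  have "integral {a..b} W = 0" for a b
    using bump_integral_tendsto[OF W, of a b] 0[OF test_fun_bump] by (simp add: LIMSEQ_const_iff)
  then have "primitive (\<lambda>x. 0) W"
    using W set_lebesgue_integral_eq_integral(1) unfolding primitive_def by (metis diff_zero integrable_integral)
  then have "AE x in lebesgue. ((\<lambda>x. 0) has_vector_derivative W x) (at x)" by (rule primitive_AE_deriv)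
  then show ?thesis
    by eventually_elim (metis has_vector_derivative_const vector_derivative_unique_at)
qed

lemma test_fun_isCont: "test_fun \<phi> \<Longrightarrow> continuous_on A \<phi>"
  unfolding test_fun_smooth using smooth_fun_DERIV DERIV_isCont continuous_at_imp_continuous_on by blast

lemma test_fun_has_deriv: "test_fun \<phi> \<Longrightarrow> (\<phi> has_field_derivative deriv \<phi> x) (at x)"
  unfolding test_fun_smooth using smooth_fun_DERIV by blast

lemma integral_support:
  fixes h :: "real \<Rightarrow> complex"
  assumes "\<And>x. x \<notin> {a..b} \<Longrightarrow> h x = 0" "h absolutely_integrable_on {a..b}"
  shows "integrable lebesgue h" "(LINT x|lebesgue. h x) = integral {a..b} h"
proof -
  have *: "(\<lambda>x. indicat_real {a..b} x *\<^sub>R h x) = h" using assms(1) by (auto simp: indicator_def fun_eq_iff)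
  show "integrable lebesgue h" using assms(2) unfolding set_integrable_def * .
  show "(LINT x|lebesgue. h x) = integral {a..b} h"
    using set_lebesgue_integral_eq_integral(2)[OF assms(2)] unfolding set_lebesgue_integral_def * .
qed

lemma loc_lip_smooth:
  fixes f :: "real \<Rightarrow> 'a::euclidean_space"
  assumes "\<And>x. (f has_vector_derivative f' x) (at x)" "continuous_on UNIV f'"
  shows "loc_lip f"
  unfolding loc_lip_def
proof (intro allI)
  fix a b
  obtain C where C: "C \<ge> 0" "\<And>x. x \<in> {a..b} \<Longrightarrow> norm (f' x) \<le> C"
    using continuous_bounded_interval assms(2) continuous_on_subset by (metis subset_UNIV)
  have "C-lipschitz_on {a..b} f"
  proof (rule bounded_derivative_imp_lipschitz)
    show "(f has_derivative (\<lambda>h. h *\<^sub>R f' x)) (at x within {a..b})" for x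
      using assms(1)[of x] unfolding has_vector_derivative_def by (rule has_derivative_at_withinI)
    show "onorm (\<lambda>h. h *\<^sub>R f' x) \<le> C" if "x \<in> {a..b}" for x
    proof (rule onorm_le)
      fix h show "norm (h *\<^sub>R f' x) \<le> C * norm h"
        using mult_right_mono[OF C(2)[OF that], of "\<bar>h\<bar>"] by (simp add: mult.commute)
    qed
  qed (use C in auto)
  then show "\<exists>L. L-lipschitz_on {a..b} f" by blast
qed

lemma loc_lip_mult:
  fixes f g :: "real \<Rightarrow> 'a::real_normed_algebra"
  assumes f: "loc_lip f" and g: "loc_lip g" shows "loc_lip (\<lambda>x. f x * g x)"
  unfolding loc_lip_def
proof (intro allI)
  fix a b
  obtain L M where LM: "L-lipschitz_on {a..b} f" "M-lipschitz_on {a..b} g"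
    using f g unfolding loc_lip_def by blast
  obtain C D where CD: "C \<ge> 0" "\<And>x. x \<in> {a..b} \<Longrightarrow> norm (f x) \<le> C" "D \<ge> 0" "\<And>x. x \<in> {a..b} \<Longrightarrow> norm (g x) \<le> D"
    using continuous_bounded_interval loc_lip_continuous f g by metis
  have "(C * M + L * D)-lipschitz_on {a..b} (\<lambda>x. f x * g x)"
  proof (rule lipschitz_onI)
    fix x y assume xy: "x \<in> {a..b}" "y \<in> {a..b}"
    have "f x * g x - f y * g y = f x * (g x - g y) + (f x - f y) * g y" by (simp add: algebra_simps)
    then have "norm (f x * g x - f y * g y) \<le> norm (f x) * norm (g x - g y) + norm (f x - f y) * norm (g y)"
      by (metis add_mono norm_mult_ineq norm_triangle_le)
    also have "\<dots> \<le> C * (M * dist x y) + (L * dist x y) * D"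
      using lipschitz_onD[OF LM(1) xy] lipschitz_onD[OF LM(2) xy] CD xy lipschitz_on_nonneg[OF LM(1)]
      by (intro add_mono mult_mono) (auto simp: dist_norm)
    finally show "dist (f x * g x) (f y * g y) \<le> (C * M + L * D) * dist x y"
      by (simp add: dist_norm algebra_simps)
  qed (use CD lipschitz_on_nonneg[OF LM(1)] lipschitz_on_nonneg[OF LM(2)] in auto)
  then show "\<exists>L. L-lipschitz_on {a..b} (\<lambda>x. f x * g x)" by blast
qed

lemma loc_lip_add:
  fixes f g :: "real \<Rightarrow> 'a::real_normed_vector"
  assumes "loc_lip f" "loc_lip g" shows "loc_lip (\<lambda>x. f x + g x)"
  using assms unfolding loc_lip_def by (metis lipschitz_on_add)

lemma loc_lip_minus:
  fixes f :: "real \<Rightarrow> 'a::real_normed_vector"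
  assumes "loc_lip f" shows "loc_lip (\<lambda>x. - f x)"
  using assms unfolding loc_lip_def by simp

lemma loc_lip_const: "loc_lip (\<lambda>x. c)"
  unfolding loc_lip_def using lipschitz_on_constant by blast

lemma loc_lip_FTC:
  fixes F :: "real \<Rightarrow> 'a::euclidean_space"
  assumes F: "loc_lip F" and d: "AE x in lebesgue. (F has_vector_derivative F' x) (at x)"
  shows "primitive F F'"
  unfolding primitive_def
proof (intro allI impI)
  fix a b :: real assume "a \<le> b"
  obtain L where "L-lipschitz_on {a..b} F" using F unfolding loc_lip_def by blast
  then show "(F' has_integral F b - F a) {a..b}"
    by (rule lipschitz_FTC[OF _ _ \<open>a \<le> b\<close>]) (use d in eventually_elim, auto)
qed

text \<open>Where it exists, the derivative of a Lipschitz function is bounded by the Lipschitz constant, as a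
limit of difference quotients; the interval is enlarged by one to contain the quotient's second point.\<close>

lemma loc_lip_deriv_Linf:
  fixes F :: "real \<Rightarrow> complex"
  assumes F: "loc_lip F" and d: "AE x in lebesgue. (F has_vector_derivative F' x) (at x)"
  shows "Linf_loc F'"
  unfolding Linf_loc_def
proof (intro conjI allI impI)
  show "F' \<in> borel_measurable lebesgue"
    using loc_lip_continuous[OF F] d by (rule borel_measurable_AE_deriv)
  fix K :: "real set" assume "compact K"
  then obtain r where r: "\<And>x. x \<in> K \<Longrightarrow> \<bar>x\<bar> \<le> r" using compact_imp_bounded bounded_iff by (metis real_norm_def)
  obtain L where L: "L-lipschitz_on {-r..r+1} F" using F unfolding loc_lip_def by blast
  have "AE x in lebesgue. x \<in> K \<longrightarrow> norm (F' x) \<le> L"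
    using d
  proof eventually_elim
    fix x assume dx: "(F has_vector_derivative F' x) (at x)"
    show "x \<in> K \<longrightarrow> norm (F' x) \<le> L"
    proof
      assume "x \<in> K"
      then have x: "- r \<le> x" "x \<le> r" using r[of x] by linarith+
      show "norm (F' x) \<le> L"
      proof (rule LIMSEQ_le_const2[OF tendsto_norm[OF difference_quotient_tendsto[OF dx]]], intro exI allI impI)
        fix k :: nat
        let ?h = "inverse (real (Suc k))"
        have h: "0 < ?h" "?h \<le> 1" by (auto simp: inverse_le_1_iff)
        have "norm (F (x + ?h) - F x) \<le> L * ?h"
        proof -
          have "x + ?h \<in> {-r..r+1}" "x \<in> {-r..r+1}" using x h unfolding atLeastAtMost_iff by linarith+
          from lipschitz_onD[OF L this] show ?thesis by (simp add: dist_norm)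
        qed
        then have "real (Suc k) * norm (F (x + ?h) - F x) \<le> real (Suc k) * (L * ?h)"
          by (rule mult_left_mono) simp
        also have "\<dots> = L" by simp
        finally show "norm (real (Suc k) *\<^sub>R (F (x + ?h) - F x)) \<le> L" by simp
      qed
    qed
  qed
  then show "\<exists>C. AE x in lebesgue. x \<in> K \<longrightarrow> norm (F' x) \<le> C" by blast
qed

lemma test_fun_times_abs_integrable:
  assumes "test_fun \<phi>" "W absolutely_integrable_on {a..b}"
  shows "(\<lambda>x. \<phi> x *\<^sub>R (W x :: complex)) absolutely_integrable_on {a..b}"
proof -
  obtain C where C: "C \<ge> 0" "\<And>x. x \<in> {a..b} \<Longrightarrow> norm (\<phi> x) \<le> C"
    using continuous_bounded_interval[OF test_fun_isCont[OF assms(1)]] by metis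
  have m: "\<phi> \<in> borel_measurable lebesgue"
    by (rule continuous_measurable_lebesgue[OF test_fun_isCont[OF assms(1)]])
  have w: "(\<lambda>x. indicat_real {a..b} x *\<^sub>R W x) \<in> borel_measurable lebesgue"
    using assms(2) unfolding set_integrable_def by (rule borel_measurable_integrable)
  show ?thesis unfolding set_integrable_def
  proof (rule Bochner_Integration.integrable_bound)
    show "integrable lebesgue (\<lambda>x. C *\<^sub>R (indicat_real {a..b} x *\<^sub>R W x))"
      using assms(2) unfolding set_integrable_def by (rule integrable_scaleR_right)
    have "(\<lambda>x. \<phi> x *\<^sub>R (indicat_real {a..b} x *\<^sub>R W x)) \<in> borel_measurable lebesgue"
      using m w by (rule borel_measurable_scaleR)
    then show "(\<lambda>x. indicat_real {a..b} x *\<^sub>R \<phi> x *\<^sub>R W x) \<in> borel_measurable lebesgue"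
      by (simp add: mult.commute)
    show "AE x in lebesgue. norm (indicat_real {a..b} x *\<^sub>R \<phi> x *\<^sub>R W x)
        \<le> norm (C *\<^sub>R (indicat_real {a..b} x *\<^sub>R W x))"
      using C by (intro AE_I2) (auto simp: indicator_def intro!: mult_right_mono)
  qed
qed

lemma test_fun_integrable:
  assumes "test_fun \<phi>" "\<And>a b. W absolutely_integrable_on {a..b}"
  shows "integrable lebesgue (\<lambda>x. \<phi> x *\<^sub>R (W x :: complex))"
proof -
  obtain r where r: "r > 0" "\<And>x. x \<notin> {-r..r} \<Longrightarrow> \<phi> x = 0" using test_fun_support[OF assms(1)] by blast
  show ?thesis
    using r by (intro integral_support(1)[of "-r" r] test_fun_times_abs_integrable assms) auto
qed

text \<open>The product of a test function with a locally Lipschitz function is Lipschitz, so the fundamental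
theorem of calculus holds for it and its total integral is zero.\<close>

lemma test_fun_ibp:
  fixes G :: "real \<Rightarrow> complex"
  assumes \<phi>: "test_fun \<phi>" and G: "loc_lip G" and d: "AE x in lebesgue. (G has_vector_derivative W x) (at x)"
  shows "(LINT x|lebesgue. deriv \<phi> x *\<^sub>R G x) = - (LINT x|lebesgue. \<phi> x *\<^sub>R W x)"
proof -
  obtain r where r: "r > 0" "\<And>x. x \<notin> {-r..r} \<Longrightarrow> \<phi> x = 0" using test_fun_support[OF \<phi>] by blast
  have W: "Linf_loc W" using G d by (rule loc_lip_deriv_Linf)
  have i1: "integrable lebesgue (\<lambda>x. deriv \<phi> x *\<^sub>R G x)"
    by (intro test_fun_integrable test_fun_deriv \<phi> Linf_loc_abs_integrable continuous_Linf_loc loc_lip_continuous G)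
  have i2: "integrable lebesgue (\<lambda>x. \<phi> x *\<^sub>R W x)"
    by (intro test_fun_integrable \<phi> Linf_loc_abs_integrable W)
  have "loc_lip \<phi>"
    using test_fun_has_deriv[OF \<phi>] test_fun_isCont[OF test_fun_deriv[OF \<phi>]]
    by (intro loc_lip_smooth[of _ "deriv \<phi>"]) (auto simp: has_real_derivative_iff_has_vector_derivative)
  then have "loc_lip (\<lambda>x. complex_of_real (\<phi> x))"
    unfolding loc_lip_def lipschitz_on_def by (simp add: dist_norm flip: of_real_diff)
  then have K: "loc_lip (\<lambda>x. complex_of_real (\<phi> x) * G x)" using G by (rule loc_lip_mult)
  have "AE x in lebesgue. ((\<lambda>x. complex_of_real (\<phi> x) * G x) has_vector_derivative
      (deriv \<phi> x *\<^sub>R G x + \<phi> x *\<^sub>R W x)) (at x)"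
    using d
  proof eventually_elim
    fix x assume dx: "(G has_vector_derivative W x) (at x)"
    have "((\<lambda>x. \<phi> x *\<^sub>R G x) has_vector_derivative (\<phi> x *\<^sub>R W x + deriv \<phi> x *\<^sub>R G x)) (at x)"
      by (rule has_vector_derivative_scaleR[OF test_fun_has_deriv[OF \<phi>] dx])
    then show "((\<lambda>x. complex_of_real (\<phi> x) * G x) has_vector_derivative
      (deriv \<phi> x *\<^sub>R G x + \<phi> x *\<^sub>R W x)) (at x)"
      by (simp add: scaleR_conv_of_real add.commute)
  qed
  then have P: "primitive (\<lambda>x. complex_of_real (\<phi> x) * G x) (\<lambda>x. deriv \<phi> x *\<^sub>R G x + \<phi> x *\<^sub>R W x)"
    by (rule loc_lip_FTC[OF K])
  define R where "R = r + 1"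
  have z: "\<phi> R = 0" "\<phi> (- R) = 0" using r by (auto simp: R_def)
  have dz: "deriv \<phi> x = 0" if "x \<notin> {-R..R}" for x
  proof -
    have "((\<lambda>x. 0) has_field_derivative 0) (at x)" by simp
    then have "(\<phi> has_field_derivative 0) (at x)"
      by (rule has_field_derivative_transform_within_open[where S="- {-R..R}"])
         (use that r in \<open>auto simp: R_def\<close>)
    then show ?thesis by (rule DERIV_imp_deriv)
  qed
  have "((\<lambda>x. deriv \<phi> x *\<^sub>R G x + \<phi> x *\<^sub>R W x) has_integral 0) {-R..R}"
    using primitiveD[OF P, of "-R" R] r z by (simp add: R_def)
  moreover have "(LINT x|lebesgue. deriv \<phi> x *\<^sub>R G x + \<phi> x *\<^sub>R W x) =
      integral {-R..R} (\<lambda>x. deriv \<phi> x *\<^sub>R G x + \<phi> x *\<^sub>R W x)"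
  proof (rule integral_support(2))
    show "deriv \<phi> x *\<^sub>R G x + \<phi> x *\<^sub>R W x = 0" if "x \<notin> {-R..R}" for x
      using dz[OF that] r(2)[of x] that by (auto simp: R_def)
    show "(\<lambda>x. deriv \<phi> x *\<^sub>R G x + \<phi> x *\<^sub>R W x) absolutely_integrable_on {-R..R}"
      by (intro set_integral_add(1) test_fun_times_abs_integrable test_fun_deriv \<phi> 
          Linf_loc_abs_integrable W continuous_Linf_loc loc_lip_continuous G)
  qed
  ultimately have "(LINT x|lebesgue. deriv \<phi> x *\<^sub>R G x + \<phi> x *\<^sub>R W x) = 0"
    by (simp add: integral_unique)
  then show ?thesis using i1 i2 by (simp add: eq_neg_iff_add_eq_0)
qed

text \<open>Two translates of the same bump have the same integral, so the primitive of their difference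
vanishes on both sides and is itself a test function.\<close>

lemma test_fun_bump_difference:
  obtains \<phi> where "test_fun \<phi>" "deriv \<phi> = (\<lambda>x. bump a (a + h) k x - bump b (b + h) k x)"
proof -
  define \<rho> where "\<rho> = bump 0 h k"
  have cont: "continuous_on UNIV \<rho>" unfolding \<rho>_def by (rule test_fun_isCont[OF test_fun_bump])
  then obtain E where E: "primitive E \<rho>"
    using primitive_exists[of \<rho>, OF integrable_continuous_interval[OF continuous_on_subset[OF cont subset_UNIV]]]
    by blast
  have dE: "(E has_field_derivative \<rho> x) (at x)" for x
    using primitive_deriv[OF E cont] by (simp add: has_real_derivative_iff_has_vector_derivative)
  have zero: "\<rho> x = 0" if "x \<notin> {0<..<h}" for x using that bump_outside by (simp add: \<rho>_def)
  have const_left: "E x = E 0" if "x \<le> 0" for x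
  proof -
    have "(\<rho> has_integral 0) {x..0}" by (rule has_integral_is_0) (auto intro: zero)
    from has_integral_unique[OF primitiveD[OF E that] this] show ?thesis by simp
  qed
  have const_right: "E x = E h" if "h \<le> x" for x
  proof -
    have "(\<rho> has_integral 0) {h..x}" by (rule has_integral_is_0) (auto intro: zero)
    from has_integral_unique[OF primitiveD[OF E that] this] show ?thesis by simp
  qed
  define \<phi> where "\<phi> x = E (x - a) - E (x - b)" for x
  have shift: "\<rho> (x - c) = bump c (c + h) k x" for x c
    by (simp add: \<rho>_def bump_def algebra_simps)
  have d: "(\<phi> has_field_derivative (bump a (a + h) k x - bump b (b + h) k x)) (at x)" for x
  proof -
    have "((\<lambda>x. E (x - c)) has_field_derivative \<rho> (x - c) * 1) (at x)" for c
      by (rule DERIV_chain2[OF dE]) (auto intro!: derivative_eq_intros)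
    then show ?thesis unfolding \<phi>_def by (simp add: shift DERIV_diff)
  qed
  have "smooth_fun (\<lambda>x. bump a (a + h) k x + (- 1) * bump b (b + h) k x)"
    by (intro smooth_fun_add smooth_fun_cmult smooth_bump)
  then have "smooth_fun \<phi>" by (intro smooth_fun_antideriv[OF d]) simp
  moreover have "compact (closure {x. \<phi> x \<noteq> 0})"
  proof (rule compact_closure_support[of _ "min a b" "max a b + \<bar>h\<bar>"], rule ccontr)
    fix x assume x: "\<phi> x \<noteq> 0" "x \<notin> {min a b..max a b + \<bar>h\<bar>}"
    then consider "x < min a b" | "x > max a b + \<bar>h\<bar>" by fastforce
    then show False
    proof cases
      case 1 then have "x - a \<le> 0" "x - b \<le> 0" by auto
      then show ?thesis using const_left[of "x-a"] const_left[of "x-b"] x by (simp add: \<phi>_def)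
    next
      case 2 then have "h \<le> x - a" "h \<le> x - b" by linarith+
      then show ?thesis using const_right[of "x-a"] const_right[of "x-b"] x by (simp add: \<phi>_def)
    qed
  qed
  moreover have "deriv \<phi> = (\<lambda>x. bump a (a + h) k x - bump b (b + h) k x)"
    by (rule ext) (rule DERIV_imp_deriv[OF d])
  ultimately show ?thesis using that[of \<phi>] unfolding test_fun_smooth by blast
qed

text \<open>Tested against the derivatives just constructed, \<open>K\<close> turns out to have the same integral over all
intervals of the same length. Increments of its primitive are therefore translation invariant, and comparing the
derivatives of the primitive at two points where they exist gives the same value of \<open>K\<close>.\<close>

lemma weak_derivative_zero_const:
  fixes K :: "real \<Rightarrow> complex"
  assumes K: "Linf_loc K" and 0: "\<And>\<phi>. test_fun \<phi> \<Longrightarrow> (LINT x|lebesgue. deriv \<phi> x *\<^sub>R K x) = 0"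
  shows "\<exists>c. AE x in lebesgue. K x = c"
proof -
  have abs: "K absolutely_integrable_on {a..b}" for a b using K by (rule Linf_loc_abs_integrable)
  have eq: "integral {a..a+h} K = integral {b..b+h} K" for a b h
  proof -
    have "(LINT x|lebesgue. bump a (a + h) k x *\<^sub>R K x) = (LINT x|lebesgue. bump b (b + h) k x *\<^sub>R K x)" for k
    proof -
      obtain \<phi> where \<phi>: "test_fun \<phi>" "deriv \<phi> = (\<lambda>x. bump a (a + h) k x - bump b (b + h) k x)"
        by (rule test_fun_bump_difference)
      have "(LINT x|lebesgue. bump a (a + h) k x *\<^sub>R K x - bump b (b + h) k x *\<^sub>R K x) = 0"
        using 0[OF \<phi>(1)] by (simp add: \<phi>(2) scaleR_diff_left)
      then show ?thesis using test_fun_integrable[OF test_fun_bump abs] by simp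
    qed
    then show ?thesis
      using bump_integral_tendsto[OF abs, of a "a+h"] bump_integral_tendsto[OF abs, of b "b+h"] LIMSEQ_unique by auto
  qed
  obtain P where P: "primitive P K"
    using primitive_exists[of K] abs set_lebesgue_integral_eq_integral(1) by blast
  have shift: "P y - P a = P (y + (b - a)) - P b" for a b y
  proof -
    have up: "P (a + h) - P a = P (b + h) - P b" if "h \<ge> 0" for a b h
      using primitiveD[OF P, of a "a+h"] primitiveD[OF P, of b "b+h"] eq[of a h b] that
      by (simp add: integral_unique)
    show ?thesis
    proof (cases "y \<ge> a")
      case True then show ?thesis using up[of "y - a" a b] by (simp add: algebra_simps)
    next
      case False then show ?thesis using up[of "a - y" y "y + (b - a)"] by (simp add: algebra_simps)
    qed
  qed
  obtain Z where Z: "negligible Z" "\<And>x. x \<notin> Z \<Longrightarrow> (P has_vector_derivative K x) (at x)"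
    using primitive_AE_deriv[OF P] unfolding AE_lebesgue_negligible by blast
  obtain a where a: "a \<notin> Z" using Z(1) non_negligible_UNIV by (metis UNIV_eq_I)
  have "K b = K a" if b: "b \<notin> Z" for b
  proof -
    have "((\<lambda>y. P (y + (a - b)) - (P a - P b)) has_vector_derivative K a) (at b)"
    proof -
      have 1: "((\<lambda>y. y + (a - b)) has_vector_derivative 1) (at b)" by (auto intro!: derivative_eq_intros)
      have "(P has_vector_derivative K a) (at (b + (a - b)))" using Z(2)[OF a] by simp
      from vector_diff_chain_at[OF 1 this]
      have "((\<lambda>y. P (y + (a - b))) has_vector_derivative K a) (at b)" by (simp add: o_def)
      then show ?thesis by (auto intro!: derivative_eq_intros)
    qed
    moreover have "P (y + (a - b)) - (P a - P b) = P y" for y using shift[of y b a] by (simp add: algebra_simps)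
    ultimately have "(P has_vector_derivative K a) (at b)" by simp
    then show ?thesis using Z(2)[OF b] vector_derivative_unique_at by blast
  qed
  then show ?thesis unfolding AE_lebesgue_negligible using Z(1) by blast
qed

text \<open>A primitive of \<open>W\<close> differs from \<open>U\<close> by a function with vanishing weak derivative.\<close>

lemma du_Bois_Reymond:
  assumes U: "Linf_loc U" and W: "Linf_loc W"
    and weak: "\<And>\<phi>. test_fun \<phi> \<Longrightarrow> (LINT x|lebesgue. deriv \<phi> x *\<^sub>R U x) = - (LINT x|lebesgue. \<phi> x *\<^sub>R W x)"
  shows "\<exists>F. primitive F W \<and> (AE x in lebesgue. U x = F x)"
proof -
  obtain G where G: "primitive G W"
    using primitive_exists[of W] Linf_loc_abs_integrable[OF W] set_lebesgue_integral_eq_integral(1) by blast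
  have Gl: "loc_lip G" using G W by (rule primitive_loc_lip)
  have GL: "Linf_loc G" by (intro continuous_Linf_loc loc_lip_continuous Gl)
  have "\<exists>c. AE x in lebesgue. U x - G x = c"
  proof (rule weak_derivative_zero_const[OF Linf_loc_diff[OF U GL]])
    fix \<phi> assume \<phi>: "test_fun \<phi>"
    have "(LINT x|lebesgue. deriv \<phi> x *\<^sub>R G x) = (LINT x|lebesgue. deriv \<phi> x *\<^sub>R U x)"
      using weak[OF \<phi>] test_fun_ibp[OF \<phi> Gl primitive_AE_deriv[OF G]] by simp
    then show "(LINT x|lebesgue. deriv \<phi> x *\<^sub>R (U x - G x)) = 0"
      using test_fun_integrable[OF test_fun_deriv[OF \<phi>] Linf_loc_abs_integrable[OF U]]
        test_fun_integrable[OF test_fun_deriv[OF \<phi>] Linf_loc_abs_integrable[OF GL]]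
      by (simp add: scaleR_diff_right)
  qed
  then obtain c where "AE x in lebesgue. U x - G x = c" by blast
  then have "AE x in lebesgue. U x = G x + c" by eventually_elim (simp add: algebra_simps)
  then show ?thesis using primitive_add_const[OF G] by blast
qed

lemma AE_eq_continuous:
  fixes F G :: "real \<Rightarrow> complex"
  assumes "continuous_on UNIV F" "continuous_on UNIV G" "AE x in lebesgue. F x = G x"
  shows "F = G"
proof (rule ext, rule ccontr)
  fix x assume "F x \<noteq> G x"
  have "open {x. F x \<noteq> G x}" using assms(1,2) by (intro open_Collect_neq)
  then obtain e where e: "e > 0" "ball x e \<subseteq> {x. F x \<noteq> G x}" using \<open>F x \<noteq> G x\<close> by (auto simp: open_contains_ball)
  obtain Z where Z: "negligible Z" "\<And>x. x \<notin> Z \<Longrightarrow> F x = G x" using assms(3) unfolding AE_lebesgue_negligible by blast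
  have "ball x e \<subseteq> Z" using e(2) Z(2) by blast
  then have "negligible (ball x e)" using Z(1) negligible_subset by blast
  then show False using e(1) open_not_negligible[of "ball x e"] by simp
qed

text \<open>Derivatives of test functions are test functions, so the weak derivative of order \<open>m + 1\<close> is the
weak derivative of the one of order \<open>m\<close>, and the lemma of du Bois-Reymond supplies a Lipschitz representative for
every order below \<open>N\<close>. For order \<open>0\<close> this representative is \<open>V\<close> itself by continuity.\<close>

lemma W_Ninf_loc_tower:
  assumes V: "W_Ninf_loc N V" "continuous_on UNIV V" and N: "1 \<le> N"
  obtains Vd where "Vd 0 = V" "\<And>m. m < N \<Longrightarrow> primitive (Vd m) (Vd (Suc m))"
    "\<And>m. m < N \<Longrightarrow> loc_lip (Vd m)" "Linf_loc (Vd N)"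
    "\<And>m. m \<in> {1..N} \<Longrightarrow> AE x in lebesgue. Vd m x = wderiv m V x"
proof -
  define W where "W m = (if m = 0 then V else wderiv m V)" for m
  have Wm: "Linf_loc (wderiv m V) \<and> is_weak_deriv m V (wderiv m V)" if "m \<in> {1..N}" for m
  proof -
    obtain U where "Linf_loc U \<and> is_weak_deriv m V U" using V(1) \<open>m \<in> {1..N}\<close> unfolding W_Ninf_loc_def by blast
    then show ?thesis unfolding wderiv_def by (rule someI[of "\<lambda>W. Linf_loc W \<and> is_weak_deriv m V W"])
  qed
  have WL: "Linf_loc (W m)" if "m \<le> N" for m
    using Wm[of m] V(1) that unfolding W_def W_Ninf_loc_def by auto
  have Ww: "is_weak_deriv m V (W m)" if "m \<le> N" for m
    using Wm[of m] that by (cases "m = 0") (auto simp: W_def is_weak_deriv_def)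
  have "\<exists>F. primitive F (W (Suc m)) \<and> (AE x in lebesgue. W m x = F x)" if m: "m < N" for m
  proof (rule du_Bois_Reymond)
    fix \<phi> assume \<phi>: "test_fun \<phi>"
    have a: "(LINT x|lebesgue. (deriv ^^ m) (deriv \<phi>) x *\<^sub>R V x) = (-1) ^ m * (LINT x|lebesgue. deriv \<phi> x *\<^sub>R W m x)"
      using Ww[of m] m test_fun_deriv[OF \<phi>] unfolding is_weak_deriv_def by auto
    have b: "(LINT x|lebesgue. (deriv ^^ Suc m) \<phi> x *\<^sub>R V x) = (-1) ^ Suc m * (LINT x|lebesgue. \<phi> x *\<^sub>R W (Suc m) x)"
      using Ww[of "Suc m"] m \<phi> unfolding is_weak_deriv_def by auto
    have "(deriv ^^ Suc m) \<phi> = (deriv ^^ m) (deriv \<phi>)" by (simp add: funpow_swap1)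
    then have "(-1) ^ m * (LINT x|lebesgue. deriv \<phi> x *\<^sub>R W m x) = (-1) ^ m * (- (LINT x|lebesgue. \<phi> x *\<^sub>R W (Suc m) x))"
      using a b by simp
    then show "(LINT x|lebesgue. deriv \<phi> x *\<^sub>R W m x) = - (LINT x|lebesgue. \<phi> x *\<^sub>R W (Suc m) x)"
      by (subst (asm) mult_cancel_left) simp
  qed (use WL m in auto)
  then have "\<exists>F. \<forall>m. m < N \<longrightarrow> primitive (F m) (W (Suc m)) \<and> (AE x in lebesgue. W m x = F m x)"
    by (intro choice) blast
  then obtain F where F: "\<And>m. m < N \<Longrightarrow> primitive (F m) (W (Suc m))"
    "\<And>m. m < N \<Longrightarrow> AE x in lebesgue. W m x = F m x" by blast
  define Vd where "Vd m = (if m < N then F m else W m)" for m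
  have ll: "loc_lip (Vd m)" if "m < N" for m
    using primitive_loc_lip[OF F(1)[OF that] WL[of "Suc m"]] that by (simp add: Vd_def)
  have ae: "AE x in lebesgue. W m x = Vd m x" if "m \<le> N" for m
    using F(2)[of m] that by (cases "m < N") (auto simp: Vd_def)
  show ?thesis
  proof (rule that[of Vd])
    have "V = Vd 0"
      using ae[of 0] N by (intro AE_eq_continuous[OF V(2) loc_lip_continuous[OF ll]]) (auto simp: W_def)
    then show "Vd 0 = V" by simp
    show "primitive (Vd m) (Vd (Suc m))" if "m < N" for m
      using primitive_cong_AE[OF F(1)[OF that] ae[of "Suc m"]] that by (simp add: Vd_def)
    show "loc_lip (Vd m)" if "m < N" for m by (rule ll[OF that])
    show "Linf_loc (Vd N)" using WL[of N] by (simp add: Vd_def)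
    show "AE x in lebesgue. Vd m x = wderiv m V x" if "m \<in> {1..N}" for m
      using ae[of m] that by (auto simp: W_def)
  qed
qed

lemma L2_abs_integrable:
  assumes "L2_fun h" shows "h absolutely_integrable_on {a..b}"
  unfolding set_integrable_def
proof (rule Bochner_Integration.integrable_bound)
  have m: "h \<in> borel_measurable lebesgue" and i: "integrable lebesgue (\<lambda>x. (norm (h x))\<^sup>2)"
    using assms by (auto simp: L2_fun_def)
  have "integrable lebesgue (indicat_real {a..b})"
    using absolutely_integrable_on_const[of "{a..b}" "1::real"] by (simp add: set_integrable_def)
  then show "integrable lebesgue (\<lambda>x. indicat_real {a..b} x + (norm (h x))\<^sup>2)"
    using i by (rule Bochner_Integration.integrable_add)
  show "(\<lambda>x. indicat_real {a..b} x *\<^sub>R h x) \<in> borel_measurable lebesgue"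
    using m by (intro borel_measurable_scaleR borel_measurable_indicator) auto
  have "norm (h x) \<le> 1 + (norm (h x))\<^sup>2" for x
  proof (cases "norm (h x) \<le> 1")
    case False
    then show ?thesis using mult_left_mono[of 1 "norm (h x)" "norm (h x)"] by (simp add: power2_eq_square)
  qed (simp add: add_increasing2)
  then show "AE x in lebesgue. norm (indicat_real {a..b} x *\<^sub>R h x) \<le> norm (indicat_real {a..b} x + (norm (h x))\<^sup>2)"
    by (intro AE_I2) (auto simp: indicator_def)
qed

text \<open>The difference of two values annihilates all test functions.\<close>

lemma H_graph_unique:
  assumes "H_graph V f h1" "H_graph V f h2"
  shows "AE x in lebesgue. h1 x = h2 x"
proof -
  have a: "h1 absolutely_integrable_on {a..b}" "h2 absolutely_integrable_on {a..b}" for a b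
    using assms by (auto simp: H_graph_def L2_abs_integrable)
  have "AE x in lebesgue. h1 x - h2 x = 0"
  proof (rule fundamental_lemma_variations)
    show "(\<lambda>x. h1 x - h2 x) absolutely_integrable_on {a..b}" for a b using a by (intro set_integral_diff(1))
    fix \<phi> assume \<phi>: "test_fun \<phi>"
    then have "(LINT x|lebesgue. \<phi> x *\<^sub>R h1 x) = (LINT x|lebesgue. \<phi> x *\<^sub>R h2 x)"
      using assms unfolding H_graph_def by metis
    then show "(LINT x|lebesgue. \<phi> x *\<^sub>R (h1 x - h2 x)) = 0"
      using test_fun_integrable[OF \<phi> a(1)] test_fun_integrable[OF \<phi> a(2)] by (simp add: scaleR_diff_right)
  qed
  then show ?thesis by simp
qed

section \<open>Gronwall inequality, reciprocals and square roots\<close>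

lemma primitive_mono_AE:
  fixes F :: "real \<Rightarrow> real"
  assumes F: "primitive F F'" and "a \<le> b" "AE x in lebesgue. x \<in> {a..b} \<longrightarrow> 0 \<le> F' x"
  shows "F a \<le> F b"
proof -
  obtain Z where Z: "negligible Z" "\<And>x. x \<notin> Z \<Longrightarrow> x \<in> {a..b} \<Longrightarrow> 0 \<le> F' x"
    using assms(3) unfolding AE_lebesgue_negligible by blast
  have "((\<lambda>x. if x \<in> Z then 0 else F' x) has_integral F b - F a) {a..b}"
    by (rule has_integral_spike[OF Z(1) _ primitiveD[OF F assms(2)]]) auto
  then have "0 \<le> F b - F a" by (rule has_integral_nonneg) (use Z(2) in auto)
  then show ?thesis by simp
qed

lemma primitive_const: "primitive (\<lambda>x. c) (\<lambda>x. 0)"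
  by (simp add: primitive_def)

lemma loc_lip_bounded_linear:
  assumes "bounded_linear h" "loc_lip f" shows "loc_lip (\<lambda>x. h (f x))"
  unfolding loc_lip_def
proof (intro allI)
  fix a b
  obtain L where L: "L-lipschitz_on {a..b} f" using assms(2) unfolding loc_lip_def by blast
  obtain B where B: "B > 0" "\<And>x. norm (h x) \<le> norm x * B" using bounded_linear.pos_bounded[OF assms(1)] by blast
  have "(B * L)-lipschitz_on {a..b} (\<lambda>x. h (f x))"
  proof (rule lipschitz_onI)
    fix x y assume xy: "x \<in> {a..b}" "y \<in> {a..b}"
    have "dist (h (f x)) (h (f y)) = norm (h (f x - f y))"
      by (simp add: dist_norm linear_diff[OF bounded_linear.linear[OF assms(1)]])
    also have "\<dots> \<le> dist (f x) (f y) * B" using B(2) by (simp add: dist_norm)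
    also have "\<dots> \<le> (L * dist x y) * B" using lipschitz_onD[OF L xy] B(1) by (intro mult_right_mono) auto
    finally show "dist (h (f x)) (h (f y)) \<le> B * L * dist x y" by (simp add: mult_ac)
  qed (use B(1) lipschitz_on_nonneg[OF L] in auto)
  then show "\<exists>L. L-lipschitz_on {a..b} (\<lambda>x. h (f x))" by blast
qed

lemma loc_lip_norm_square:
  fixes u :: "real \<Rightarrow> complex"
  assumes "loc_lip u" shows "loc_lip (\<lambda>x. (norm (u x))\<^sup>2)"
proof -
  have "loc_lip (\<lambda>x. Re (u x) * Re (u x) + Im (u x) * Im (u x))"
    by (intro loc_lip_add loc_lip_mult loc_lip_bounded_linear[OF bounded_linear_Re assms]
        loc_lip_bounded_linear[OF bounded_linear_Im assms])
  moreover have "(norm (u x))\<^sup>2 = Re (u x) * Re (u x) + Im (u x) * Im (u x)" for x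
    using cmod_power2[of "u x"] by (simp add: power2_eq_square)
  ultimately show ?thesis by simp
qed

text \<open>The functions \<open>\<bar>u\<bar>\<^sup>2 exp (\<plusminus> 2 k)\<close> are monotone, one in each direction. The square of
the norm is used because the norm itself is not differentiable at zeros of \<open>u\<close>.\<close>

lemma Gronwall_AE:
  fixes u :: "real \<Rightarrow> complex"
  assumes u: "loc_lip u" "AE x in lebesgue. (u has_vector_derivative u' x) (at x)"
    and k: "\<And>x. (k has_real_derivative k' x) (at x)" "continuous_on UNIV k'"
    and le: "AE x in lebesgue. x \<in> {a..b} \<longrightarrow> norm (u' x) \<le> k' x * norm (u x)"
    and ab: "a \<le> b"
  shows "norm (u b) \<le> norm (u a) * exp (k b - k a)" "norm (u a) \<le> norm (u b) * exp (k b - k a)"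
proof -
  define F where "F \<sigma> x = (norm (u x))\<^sup>2 * exp (\<sigma> * k x)" for \<sigma> x :: real
  define F' where "F' \<sigma> x = (norm (u x))\<^sup>2 * (exp (\<sigma> * k x) * (\<sigma> * k' x)) + (2 * (u x \<bullet> u' x)) * exp (\<sigma> * k x)" for \<sigma> x
  have kc: "continuous_on UNIV k"
    using k(1) DERIV_isCont continuous_at_imp_continuous_on by blast
  have de: "((\<lambda>x. exp (\<sigma> * k x)) has_real_derivative exp (\<sigma> * k x) * (\<sigma> * k' x)) (at x)" for \<sigma> x
    by (auto intro!: derivative_eq_intros k(1))
  have ll: "loc_lip (F \<sigma>)" for \<sigma>
  proof -
    have "loc_lip (\<lambda>x. exp (\<sigma> * k x))"
      by (rule loc_lip_smooth[where f'="\<lambda>x. exp (\<sigma> * k x) * (\<sigma> * k' x)"])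
         (use de in \<open>auto simp: has_real_derivative_iff_has_vector_derivative intro!: continuous_intros kc k(2)\<close>)
    then show ?thesis unfolding F_def by (intro loc_lip_mult loc_lip_norm_square u(1))
  qed
  have "AE x in lebesgue. (F \<sigma> has_vector_derivative F' \<sigma> x) (at x)" for \<sigma>
    using u(2)
  proof eventually_elim
    fix x assume d: "(u has_vector_derivative u' x) (at x)"
    have "((\<lambda>x. u x \<bullet> u x) has_vector_derivative (u x \<bullet> u' x + u' x \<bullet> u x)) (at x)"
      by (rule bounded_bilinear.has_vector_derivative[OF bounded_bilinear_inner d d])
    then have "((\<lambda>x. (norm (u x))\<^sup>2) has_vector_derivative (2 * (u x \<bullet> u' x))) (at x)"
      by (simp add: power2_norm_eq_inner inner_commute)
    then have "((\<lambda>x. (norm (u x))\<^sup>2 * exp (\<sigma> * k x)) has_vector_derivative F' \<sigma> x) (at x)"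
      unfolding F'_def
      by (intro has_vector_derivative_mult) (use de in \<open>auto simp: has_real_derivative_iff_has_vector_derivative\<close>)
    then show "(F \<sigma> has_vector_derivative F' \<sigma> x) (at x)" unfolding F_def .
  qed
  then have prim: "primitive (F \<sigma>) (F' \<sigma>)" for \<sigma> using loc_lip_FTC[OF ll] by blast
  have cs: "\<bar>u x \<bullet> u' x\<bar> \<le> k' x * (norm (u x))\<^sup>2" if "norm (u' x) \<le> k' x * norm (u x)" for x
  proof -
    have "\<bar>u x \<bullet> u' x\<bar> \<le> norm (u x) * norm (u' x)" by (rule Cauchy_Schwarz_ineq2)
    also have "\<dots> \<le> norm (u x) * (k' x * norm (u x))" using that by (intro mult_left_mono) auto
    finally show ?thesis by (simp add: power2_eq_square mult_ac)
  qed
  have F'eq: "F' \<sigma> x = exp (\<sigma> * k x) * (\<sigma> * (k' x * (norm (u x))\<^sup>2) + 2 * (u x \<bullet> u' x))" for \<sigma> x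
    by (simp add: F'_def algebra_simps)
  have "F 2 a \<le> F 2 b"
  proof (rule primitive_mono_AE[OF prim ab])
    show "AE x in lebesgue. x \<in> {a..b} \<longrightarrow> 0 \<le> F' 2 x"
      using le
    proof eventually_elim
      fix x assume "x \<in> {a..b} \<longrightarrow> norm (u' x) \<le> k' x * norm (u x)"
      then show "x \<in> {a..b} \<longrightarrow> 0 \<le> F' 2 x" unfolding F'eq using cs[of x] by (auto simp: abs_le_iff)
    qed
  qed
  then have "(norm (u a))\<^sup>2 * exp (2 * k a) \<le> (norm (u b))\<^sup>2 * exp (2 * k b)" by (simp add: F_def)
  then have "(norm (u a) * exp (k a))\<^sup>2 \<le> (norm (u b) * exp (k b))\<^sup>2"
    by (simp add: power_mult_distrib flip: exp_of_nat_mult)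
  then have "norm (u a) * exp (k a) \<le> norm (u b) * exp (k b)" by (rule power2_le_imp_le) simp
  then show "norm (u a) \<le> norm (u b) * exp (k b - k a)" by (simp add: exp_diff field_simps)
  have "- F (-2) a \<le> - F (-2) b"
  proof (rule primitive_mono_AE[OF _ ab])
    show "primitive (\<lambda>x. - F (-2) x) (\<lambda>x. - F' (-2) x)"
      using primitive_diff[OF primitive_const prim[of "-2"], of 0] by simp
    show "AE x in lebesgue. x \<in> {a..b} \<longrightarrow> 0 \<le> - F' (-2) x"
      using le
    proof eventually_elim
      fix x assume "x \<in> {a..b} \<longrightarrow> norm (u' x) \<le> k' x * norm (u x)"
      then show "x \<in> {a..b} \<longrightarrow> 0 \<le> - F' (-2) x" unfolding F'eq using cs[of x]
        by (auto simp: abs_le_iff mult_le_0_iff)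
    qed
  qed
  then have "(norm (u b))\<^sup>2 * exp (- (2 * k b)) \<le> (norm (u a))\<^sup>2 * exp (- (2 * k a))" by (simp add: F_def)
  then have "(norm (u b) * exp (- k b))\<^sup>2 \<le> (norm (u a) * exp (- k a))\<^sup>2"
    by (simp add: power_mult_distrib flip: exp_of_nat_mult)
  then have "norm (u b) * exp (- k b) \<le> norm (u a) * exp (- k a)" by (rule power2_le_imp_le) simp
  then show "norm (u b) \<le> norm (u a) * exp (k b - k a)" by (simp add: exp_diff exp_minus field_simps)
qed

lemma loc_lip_inverse:
  fixes f :: "real \<Rightarrow> complex"
  assumes f: "loc_lip f" and nz: "\<And>x. f x \<noteq> 0" shows "loc_lip (\<lambda>x. inverse (f x))"
  unfolding loc_lip_def
proof (intro allI)
  fix a b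
  obtain L where L: "L-lipschitz_on {a..b} f" using f unfolding loc_lip_def by blast
  have "continuous_on {a..b} (\<lambda>x. inverse (f x))" using nz by (intro continuous_intros loc_lip_continuous f) auto
  then obtain C where C: "C \<ge> 0" "\<And>x. x \<in> {a..b} \<Longrightarrow> norm (inverse (f x)) \<le> C" using continuous_bounded_interval by metis
  have "(C * L * C)-lipschitz_on {a..b} (\<lambda>x. inverse (f x))"
  proof (rule lipschitz_onI)
    fix x y assume xy: "x \<in> {a..b}" "y \<in> {a..b}"
    have "inverse (f x) - inverse (f y) = inverse (f x) * (f y - f x) * inverse (f y)"
      using nz[of x] nz[of y] by (simp add: field_simps)
    then have "norm (inverse (f x) - inverse (f y)) = norm (inverse (f x)) * norm (f y - f x) * norm (inverse (f y))"
      by (simp add: norm_mult)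
    also have "\<dots> \<le> C * (L * dist x y) * C"
      using C xy lipschitz_onD[OF L xy] lipschitz_on_nonneg[OF L]
      by (intro mult_mono) (auto simp: dist_norm norm_minus_commute)
    finally show "dist (inverse (f x)) (inverse (f y)) \<le> C * L * C * dist x y" by (simp add: dist_norm mult_ac)
  qed (use C lipschitz_on_nonneg[OF L] in auto)
  then show "\<exists>L. L-lipschitz_on {a..b} (\<lambda>x. inverse (f x))" by blast
qed

lemma Re_csqrt_pos: assumes "z \<notin> \<real>\<^sub>\<le>\<^sub>0" shows "0 < Re (csqrt z)"
proof (rule ccontr)
  assume "\<not> 0 < Re (csqrt z)"
  then have "Re (csqrt z) = 0" using Re_csqrt[of z] by linarith
  then have "csqrt z = \<i> * complex_of_real (Im (csqrt z))" by (simp add: complex_eq_iff)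
  then have "z = (\<i> * complex_of_real (Im (csqrt z)))\<^sup>2" using power2_csqrt[of z] by metis
  also have "\<dots> = complex_of_real (- (Im (csqrt z))\<^sup>2)" by (simp add: power_mult_distrib)
  finally obtain r :: real where "z = complex_of_real (- r\<^sup>2)" by blast
  then have "z \<in> \<real>\<^sub>\<le>\<^sub>0" unfolding nonpos_Reals_def using zero_le_power2[of r] by (intro CollectI exI[of _ "- r\<^sup>2"]) auto
  then show False using assms by simp
qed

text \<open>The difference of two square roots, times their sum, is the difference of the arguments; both roots
have positive real part, so the sum cannot be smaller than the real part of either.\<close>

lemma loc_lip_csqrt:
  fixes f :: "real \<Rightarrow> complex"
  assumes f: "loc_lip f" and nz: "\<And>x. f x \<notin> \<real>\<^sub>\<le>\<^sub>0" shows "loc_lip (\<lambda>x. csqrt (f x))"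
  unfolding loc_lip_def
proof (intro allI)
  fix a b
  obtain L where L: "L-lipschitz_on {a..b} f" using f unfolding loc_lip_def by blast
  have pos: "0 < Re (csqrt (f x))" for x using Re_csqrt_pos[OF nz] .
  have "continuous_on {a..b} (\<lambda>x. inverse (Re (csqrt (f x))))"
  proof (intro continuous_intros)
    show "continuous_on {a..b} (\<lambda>x. csqrt (f x))"
      using nz by (intro continuous_on_compose2[OF continuous_on_csqrt] loc_lip_continuous f) auto
    show "\<forall>x\<in>{a..b}. Re (csqrt (f x)) \<noteq> 0" using pos less_imp_neq by metis
  qed
  then obtain C where C: "C \<ge> 0" "\<And>x. x \<in> {a..b} \<Longrightarrow> norm (inverse (Re (csqrt (f x)))) \<le> C"
    using continuous_bounded_interval by metis
  have "(L * C)-lipschitz_on {a..b} (\<lambda>x. csqrt (f x))"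
  proof (rule lipschitz_onI)
    fix x y assume xy: "x \<in> {a..b}" "y \<in> {a..b}"
    have ne: "Re (csqrt (f x)) \<le> norm (csqrt (f x) + csqrt (f y))"
      using pos[of y] complex_Re_le_cmod[of "csqrt (f x) + csqrt (f y)"] plus_complex.sel(1)[of "csqrt (f x)" "csqrt (f y)"]
      by linarith
    have "(csqrt (f x) - csqrt (f y)) * (csqrt (f x) + csqrt (f y)) = f x - f y"
      by (simp add: algebra_simps flip: power2_eq_square)
    then have "norm (csqrt (f x) - csqrt (f y)) * norm (csqrt (f x) + csqrt (f y)) = norm (f x - f y)"
      by (metis norm_mult)
    then have "norm (csqrt (f x) - csqrt (f y)) * Re (csqrt (f x)) \<le> norm (f x - f y)"
      using mult_left_mono[OF ne, of "norm (csqrt (f x) - csqrt (f y))"] by simp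
    then have "norm (csqrt (f x) - csqrt (f y)) \<le> norm (f x - f y) * inverse (Re (csqrt (f x)))"
      using pos[of x] by (simp add: field_simps)
    also have "\<dots> \<le> (L * dist x y) * C"
      using C(2)[OF xy(1)] pos[of x] lipschitz_onD[OF L xy] lipschitz_on_nonneg[OF L]
      by (intro mult_mono) (auto simp: dist_norm)
    finally show "dist (csqrt (f x)) (csqrt (f y)) \<le> L * C * dist x y" by (simp add: dist_norm mult_ac)
  qed (use C lipschitz_on_nonneg[OF L] in auto)
  then show "\<exists>L. L-lipschitz_on {a..b} (\<lambda>x. csqrt (f x))" by blast
qed

section \<open>A calculus of symbols\<close>

text \<open>The region \<open>J l\<close> is where estimates are required, uniformly in the spectral parameter \<open>l \<ge> l0\<close>; the
weight \<open>w\<close> is the price of one derivative; \<open>Z\<close> is a null set off which the highest derivatives exist.\<close>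

locale symbol_calculus =
  fixes Z :: "real set" and J :: "real \<Rightarrow> real set" and w :: "real \<Rightarrow> real" and l0 :: real
  assumes w_nonneg: "0 \<le> w x"
begin

text \<open>\<open>sym M B F\<close>: the function \<open>F\<close> has \<open>M\<close> derivatives and the \<open>j\<close>-th one is \<open>O(B w\<^sup>j)\<close> on \<open>J\<close>. Those of order
below \<open>M\<close> are locally Lipschitz and exist everywhere; the last one exists and is bounded off \<open>Z\<close>, as
\<open>V\<close> has one derivative more than is continuous. Differentiability is required on the whole line, bounds only on
\<open>J\<close>, because the phase is defined by integration from the origin and the regularity statements are global.\<close>

primrec sym :: "nat \<Rightarrow> (real \<Rightarrow> real \<Rightarrow> real) \<Rightarrow> (real \<Rightarrow> real \<Rightarrow> complex) \<Rightarrow> bool" where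
  "sym 0 B F \<longleftrightarrow> (\<exists>C\<ge>0. \<forall>l\<ge>l0. \<forall>x\<in>J l - Z. norm (F l x) \<le> C * B l x)"
| "sym (Suc M) B F \<longleftrightarrow>
     (\<exists>C\<ge>0. \<forall>l\<ge>l0. \<forall>x\<in>J l. norm (F l x) \<le> C * B l x) \<and>
     (\<forall>l\<ge>l0. loc_lip (F l)) \<and>
     (\<exists>F'. (\<forall>l\<ge>l0. \<forall>x. (M = 0 \<longrightarrow> x \<notin> Z) \<longrightarrow> (F l has_vector_derivative F' l x) (at x)) \<and>
           sym M (\<lambda>l x. B l x * w x) F')"

lemma sym_SucI:
  assumes "0 \<le> C" "\<And>l x. l \<ge> l0 \<Longrightarrow> x \<in> J l \<Longrightarrow> norm (F l x) \<le> C * B l x"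
    and "\<And>l. l \<ge> l0 \<Longrightarrow> loc_lip (F l)"
    and "\<And>l x. l \<ge> l0 \<Longrightarrow> (M = 0 \<longrightarrow> x \<notin> Z) \<Longrightarrow> (F l has_vector_derivative F' l x) (at x)"
    and "sym M (\<lambda>l x. B l x * w x) F'"
  shows "sym (Suc M) B F"
  unfolding sym.simps using assms by blast

lemma sym_SucE:
  assumes "sym (Suc M) B F"
  obtains C F' where "0 \<le> C" "\<And>l x. l \<ge> l0 \<Longrightarrow> x \<in> J l \<Longrightarrow> norm (F l x) \<le> C * B l x"
    "\<And>l. l \<ge> l0 \<Longrightarrow> loc_lip (F l)"
    "\<And>l x. l \<ge> l0 \<Longrightarrow> (M = 0 \<longrightarrow> x \<notin> Z) \<Longrightarrow> (F l has_vector_derivative F' l x) (at x)"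
    "sym M (\<lambda>l x. B l x * w x) F'"
  using assms unfolding sym.simps by blast

lemma sym_bound:
  assumes "sym M B F"
  obtains C where "0 \<le> C" "\<And>l x. l \<ge> l0 \<Longrightarrow> x \<in> J l \<Longrightarrow> (M = 0 \<longrightarrow> x \<notin> Z) \<Longrightarrow> norm (F l x) \<le> C * B l x"
  using assms by (cases M) auto

declare sym.simps(2) [simp del]

lemma sym_Suc_D: "sym (Suc M) B F \<Longrightarrow> sym M B F"
proof (induction M arbitrary: B F)
  case 0
  then show ?case by (auto simp: sym.simps(2))
next
  case (Suc M)
  obtain C F' where F: "0 \<le> C" "\<And>l x. l \<ge> l0 \<Longrightarrow> x \<in> J l \<Longrightarrow> norm (F l x) \<le> C * B l x"
    "\<And>l. l \<ge> l0 \<Longrightarrow> loc_lip (F l)"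
    "\<And>l x. l \<ge> l0 \<Longrightarrow> (Suc M = 0 \<longrightarrow> x \<notin> Z) \<Longrightarrow> (F l has_vector_derivative F' l x) (at x)"
    "sym (Suc M) (\<lambda>l x. B l x * w x) F'"
    by (rule sym_SucE[OF Suc.prems]) blast
  show ?case by (rule sym_SucI[OF F(1-3) F(4) Suc.IH[OF F(5)]]) simp_all
qed

lemma sym_le: "sym M B F \<Longrightarrow> M' \<le> M \<Longrightarrow> sym M' B F"
proof (induction M)
  case (Suc M) then show ?case using sym_Suc_D by (metis le_Suc_eq)
qed simp

lemma sym_mono:
  assumes "sym M B F" "0 \<le> K" "\<And>l x. l \<ge> l0 \<Longrightarrow> x \<in> J l \<Longrightarrow> B l x \<le> K * B' l x"
  shows "sym M B' F"
  using assms
proof (induction M arbitrary: B B' F)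
  case 0
  then obtain C where C: "C \<ge> 0" "\<And>l x. l \<ge> l0 \<Longrightarrow> x \<in> J l - Z \<Longrightarrow> norm (F l x) \<le> C * B l x" by auto
  have "norm (F l x) \<le> (C * K) * B' l x" if "l \<ge> l0" "x \<in> J l - Z" for l x
    using C(2)[OF that] mult_left_mono[OF 0(3)[of l x] C(1)] that by (simp add: mult.assoc)
  then show ?case using C(1) 0(2) by (auto intro!: exI[of _ "C * K"])
next
  case (Suc M)
  obtain C F' where F: "0 \<le> C" "\<And>l x. l \<ge> l0 \<Longrightarrow> x \<in> J l \<Longrightarrow> norm (F l x) \<le> C * B l x"
    "\<And>l. l \<ge> l0 \<Longrightarrow> loc_lip (F l)"
    "\<And>l x. l \<ge> l0 \<Longrightarrow> (M = 0 \<longrightarrow> x \<notin> Z) \<Longrightarrow> (F l has_vector_derivative F' l x) (at x)"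
    "sym M (\<lambda>l x. B l x * w x) F'"
    by (rule sym_SucE[OF Suc.prems(1)]) blast
  show ?case
  proof (rule sym_SucI[OF _ _ F(3,4)])
    show "0 \<le> C * K" using F(1) Suc.prems(2) by simp
    show "norm (F l x) \<le> (C * K) * B' l x" if "l \<ge> l0" "x \<in> J l" for l x
      using F(2)[OF that] mult_left_mono[OF Suc.prems(3)[OF that] F(1)] by (simp add: mult.assoc)
    show "sym M (\<lambda>l x. B' l x * w x) F'"
    proof (rule Suc.IH[OF F(5) Suc.prems(2)])
      show "B l x * w x \<le> K * (B' l x * w x)" if "l \<ge> l0" "x \<in> J l" for l x
        using mult_right_mono[OF Suc.prems(3)[OF that] w_nonneg[of x]] by (simp add: mult.assoc)
    qed
  qed
qed

lemma sym_add:
  assumes "sym M B F" "sym M B G" shows "sym M B (\<lambda>l x. F l x + G l x)"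
  using assms
proof (induction M arbitrary: B F G)
  case 0
  then obtain C D where CD: "C \<ge> 0" "\<And>l x. l \<ge> l0 \<Longrightarrow> x \<in> J l - Z \<Longrightarrow> norm (F l x) \<le> C * B l x"
    "D \<ge> 0" "\<And>l x. l \<ge> l0 \<Longrightarrow> x \<in> J l - Z \<Longrightarrow> norm (G l x) \<le> D * B l x" by auto
  have "norm (F l x + G l x) \<le> (C + D) * B l x" if "l \<ge> l0" "x \<in> J l - Z" for l x
    using norm_triangle_le[OF add_mono[OF CD(2)[OF that] CD(4)[OF that]]] by (simp add: distrib_right)
  then show ?case using CD(1,3) by (auto intro!: exI[of _ "C + D"])
next
  case (Suc M)
  obtain C F' where F: "0 \<le> C" "\<And>l x. l \<ge> l0 \<Longrightarrow> x \<in> J l \<Longrightarrow> norm (F l x) \<le> C * B l x"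
    "\<And>l. l \<ge> l0 \<Longrightarrow> loc_lip (F l)"
    "\<And>l x. l \<ge> l0 \<Longrightarrow> (M = 0 \<longrightarrow> x \<notin> Z) \<Longrightarrow> (F l has_vector_derivative F' l x) (at x)"
    "sym M (\<lambda>l x. B l x * w x) F'"
    by (rule sym_SucE[OF Suc.prems(1)]) blast
  obtain D G' where G: "0 \<le> D" "\<And>l x. l \<ge> l0 \<Longrightarrow> x \<in> J l \<Longrightarrow> norm (G l x) \<le> D * B l x"
    "\<And>l. l \<ge> l0 \<Longrightarrow> loc_lip (G l)"
    "\<And>l x. l \<ge> l0 \<Longrightarrow> (M = 0 \<longrightarrow> x \<notin> Z) \<Longrightarrow> (G l has_vector_derivative G' l x) (at x)"
    "sym M (\<lambda>l x. B l x * w x) G'"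
    by (rule sym_SucE[OF Suc.prems(2)]) blast
  show ?case
  proof (rule sym_SucI[where C="C + D" and F'="\<lambda>l x. F' l x + G' l x"])
    show "norm (F l x + G l x) \<le> (C + D) * B l x" if "l \<ge> l0" "x \<in> J l" for l x
      using norm_triangle_le[OF add_mono[OF F(2)[OF that] G(2)[OF that]]] by (simp add: distrib_right)
    show "loc_lip (\<lambda>x. F l x + G l x)" if "l \<ge> l0" for l by (rule loc_lip_add[OF F(3)[OF that] G(3)[OF that]])
    show "((\<lambda>x. F l x + G l x) has_vector_derivative F' l x + G' l x) (at x)" if "l \<ge> l0" "M = 0 \<longrightarrow> x \<notin> Z" for l x
      by (rule has_vector_derivative_add[OF F(4)[OF that] G(4)[OF that]])
    show "sym M (\<lambda>l x. B l x * w x) (\<lambda>l x. F' l x + G' l x)" by (rule Suc.IH[OF F(5) G(5)])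
  qed (use F(1) G(1) in auto)
qed

text \<open>Leibniz rule: a derivative falls on one of the two factors, and contributes one \<open>w\<close> in either case.\<close>

lemma sym_mult:
  assumes "sym M B1 F" "sym M B2 G" shows "sym M (\<lambda>l x. B1 l x * B2 l x) (\<lambda>l x. F l x * G l x)"
  using assms
proof (induction M arbitrary: B1 B2 F G)
  case 0
  then obtain C D where CD: "C \<ge> 0" "\<And>l x. l \<ge> l0 \<Longrightarrow> x \<in> J l - Z \<Longrightarrow> norm (F l x) \<le> C * B1 l x"
    "D \<ge> 0" "\<And>l x. l \<ge> l0 \<Longrightarrow> x \<in> J l - Z \<Longrightarrow> norm (G l x) \<le> D * B2 l x" by auto
  have "norm (F l x * G l x) \<le> (C * D) * (B1 l x * B2 l x)" if "l \<ge> l0" "x \<in> J l - Z" for l x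
    using mult_mono'[OF CD(2)[OF that] CD(4)[OF that]] by (simp add: norm_mult mult_ac)
  then show ?case using CD(1,3) by (auto intro!: exI[of _ "C * D"])
next
  case (Suc M)
  obtain C F' where F: "0 \<le> C" "\<And>l x. l \<ge> l0 \<Longrightarrow> x \<in> J l \<Longrightarrow> norm (F l x) \<le> C * B1 l x"
    "\<And>l. l \<ge> l0 \<Longrightarrow> loc_lip (F l)"
    "\<And>l x. l \<ge> l0 \<Longrightarrow> (M = 0 \<longrightarrow> x \<notin> Z) \<Longrightarrow> (F l has_vector_derivative F' l x) (at x)"
    "sym M (\<lambda>l x. B1 l x * w x) F'"
    by (rule sym_SucE[OF Suc.prems(1)]) blast
  obtain D G' where G: "0 \<le> D" "\<And>l x. l \<ge> l0 \<Longrightarrow> x \<in> J l \<Longrightarrow> norm (G l x) \<le> D * B2 l x"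
    "\<And>l. l \<ge> l0 \<Longrightarrow> loc_lip (G l)"
    "\<And>l x. l \<ge> l0 \<Longrightarrow> (M = 0 \<longrightarrow> x \<notin> Z) \<Longrightarrow> (G l has_vector_derivative G' l x) (at x)"
    "sym M (\<lambda>l x. B2 l x * w x) G'"
    by (rule sym_SucE[OF Suc.prems(2)]) blast
  show ?case
  proof (rule sym_SucI[where C="C * D" and F'="\<lambda>l x. F l x * G' l x + F' l x * G l x"])
    show "norm (F l x * G l x) \<le> (C * D) * (B1 l x * B2 l x)" if "l \<ge> l0" "x \<in> J l" for l x
      using mult_mono'[OF F(2)[OF that] G(2)[OF that]] by (simp add: norm_mult mult_ac)
    show "loc_lip (\<lambda>x. F l x * G l x)" if "l \<ge> l0" for l by (rule loc_lip_mult[OF F(3)[OF that] G(3)[OF that]])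
    show "((\<lambda>x. F l x * G l x) has_vector_derivative F l x * G' l x + F' l x * G l x) (at x)"
      if "l \<ge> l0" "M = 0 \<longrightarrow> x \<notin> Z" for l x
      by (rule has_vector_derivative_mult[OF F(4)[OF that] G(4)[OF that]])
    have "sym M (\<lambda>l x. B1 l x * (B2 l x * w x)) (\<lambda>l x. F l x * G' l x)"
      by (rule Suc.IH[OF sym_Suc_D[OF Suc.prems(1)] G(5)])
    moreover have "sym M (\<lambda>l x. (B1 l x * w x) * B2 l x) (\<lambda>l x. F' l x * G l x)"
      by (rule Suc.IH[OF F(5) sym_Suc_D[OF Suc.prems(2)]])
    ultimately show "sym M (\<lambda>l x. B1 l x * B2 l x * w x) (\<lambda>l x. F l x * G' l x + F' l x * G l x)"
      by (intro sym_add) (simp_all add: mult_ac)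
  qed (use F(1) G(1) in auto)
qed

lemma sym_zero: "sym M B (\<lambda>l x. 0)"
proof (induction M arbitrary: B)
  case 0 then show ?case by (auto intro!: exI[of _ 0])
next
  case (Suc M) show ?case
    by (rule sym_SucI[where C=0 and F'="\<lambda>l x. 0", OF _ _ _ _ Suc]) (auto intro: loc_lip_const)
qed

lemma sym_const:
  assumes "0 \<le> C" "\<And>l x. l \<ge> l0 \<Longrightarrow> x \<in> J l \<Longrightarrow> norm (c l) \<le> C * B l x"
  shows "sym M B (\<lambda>l x. c l)"
proof (cases M)
  case 0 then show ?thesis using assms by (auto intro!: exI[of _ C])
next
  case (Suc k) show ?thesis unfolding Suc
    by (rule sym_SucI[where C=C and F'="\<lambda>l x. 0", OF _ _ _ _ sym_zero]) (use assms in \<open>auto intro: loc_lip_const\<close>)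
qed

lemma sym_cmult:
  assumes "sym M B F" shows "sym M (\<lambda>l x. norm (c l) * B l x) (\<lambda>l x. c l * F l x)"
  by (rule sym_mult[OF sym_const[where C=1] assms]) auto

lemma sym_uminus: "sym M B F \<Longrightarrow> sym M B (\<lambda>l x. - F l x)"
  using sym_cmult[of M B F "\<lambda>l. -1"] by simp

lemma sym_diff: "sym M B F \<Longrightarrow> sym M B G \<Longrightarrow> sym M B (\<lambda>l x. F l x - G l x)"
  using sym_add[OF _ sym_uminus, of M B F G] by simp

lemma sym_sum:
  assumes "\<And>i. i \<in> I \<Longrightarrow> sym M B (F i)" shows "sym M B (\<lambda>l x. \<Sum>i\<in>I. F i l x)"
  using assms by (induction I rule: infinite_finite_induct) (auto intro: sym_zero sym_add)

lemma sym_cong: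
  assumes "sym M B F" "\<And>l x. l \<ge> l0 \<Longrightarrow> F l x = G l x"
  shows "sym M B G"
proof (cases M)
  case 0
  then show ?thesis using assms by auto
next
  case (Suc k)
  obtain C F' where F: "0 \<le> C" "\<And>l x. l \<ge> l0 \<Longrightarrow> x \<in> J l \<Longrightarrow> norm (F l x) \<le> C * B l x"
    "\<And>l. l \<ge> l0 \<Longrightarrow> loc_lip (F l)"
    "\<And>l x. l \<ge> l0 \<Longrightarrow> (k = 0 \<longrightarrow> x \<notin> Z) \<Longrightarrow> (F l has_vector_derivative F' l x) (at x)"
    "sym k (\<lambda>l x. B l x * w x) F'"
    by (rule sym_SucE[OF assms(1)[unfolded Suc]]) blast
  have eq: "F l = G l" if "l \<ge> l0" for l using assms(2)[OF that] by auto
  show ?thesis unfolding Suc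
    by (rule sym_SucI[OF F(1) _ _ _ F(5)]) (use F eq in auto)
qed

end

section \<open>The WKB recursion\<close>

text \<open>The function \<open>U\<close> stands for \<open>\<bar>V\<bar> + 1\<close>. The derivatives \<open>Vd m\<close> of \<open>V\<close> are of size \<open>U w\<^sup>m\<close>, whereas
on \<open>J l\<close> the spectral parameter dominates: \<open>U\<close> is \<open>O(l)\<close>, the real part of \<open>l - V\<close> is at least \<open>l / 2\<close>, and
\<open>w\<close> is at most of the order of the square root of \<open>l\<close>.\<close>

locale wkb = symbol_calculus Z J w l0
  for Z :: "real set" and J :: "real \<Rightarrow> real set" and w :: "real \<Rightarrow> real" and l0 :: real +
  fixes V :: "real \<Rightarrow> complex" and Vd :: "nat \<Rightarrow> real \<Rightarrow> complex" and U :: "real \<Rightarrow> real"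
    and N n :: nat and CV CU Cw :: real
  assumes N: "N = Suc n" and Vd0: "Vd 0 = V" and neg_Z: "negligible Z"
    and Vd_lip: "\<And>m. m < N \<Longrightarrow> loc_lip (Vd m)"
    and Vd_deriv: "\<And>m x. m < N \<Longrightarrow> (Suc m = N \<longrightarrow> x \<notin> Z) \<Longrightarrow> (Vd m has_vector_derivative Vd (Suc m) x) (at x)"
    and Vd_bound: "0 \<le> CV" "\<And>m x. 1 \<le> m \<Longrightarrow> m \<le> N \<Longrightarrow> (m = N \<longrightarrow> x \<notin> Z) \<Longrightarrow> norm (Vd m x) \<le> CV * (U x * w x ^ m)"
    and V_le_U: "\<And>x. norm (V x) \<le> U x"
    and l0: "1 \<le> l0"
    and slit: "\<And>l x. l \<ge> l0 \<Longrightarrow> complex_of_real l - V x \<notin> \<real>\<^sub>\<le>\<^sub>0"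
    and U_le: "0 \<le> CU" "\<And>l x. l \<ge> l0 \<Longrightarrow> x \<in> J l \<Longrightarrow> U x \<le> CU * l"
    and ReV: "\<And>l x. l \<ge> l0 \<Longrightarrow> x \<in> J l \<Longrightarrow> Re (V x) \<le> l / 2"
    and w_le: "0 \<le> Cw" "\<And>l x. l \<ge> l0 \<Longrightarrow> x \<in> J l \<Longrightarrow> w x \<le> Cw * sqrt l"
begin

lemma U_nonneg: "0 \<le> U x"
  using V_le_U[of x] norm_ge_zero order_trans by blast

lemma l_pos: "l \<ge> l0 \<Longrightarrow> 0 < l"
  using l0 by simp

text \<open>Derivatives of the square root are polynomials in its reciprocal and in the derivatives of \<open>V\<close>; this
makes the reciprocal the convenient basic symbol.\<close>

definition R :: "real \<Rightarrow> real \<Rightarrow> complex" where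
  "R l x = inverse (csqrt (complex_of_real l - V x))"

lemma csqrt_nz: "l \<ge> l0 \<Longrightarrow> csqrt (complex_of_real l - V x) \<noteq> 0"
  using slit[of l x] by (auto simp: nonpos_Reals_def)

lemma V_deriv: "(1 = N \<longrightarrow> x \<notin> Z) \<Longrightarrow> (V has_vector_derivative Vd 1 x) (at x)"
  using Vd_deriv[of 0 x] N Vd0 by auto

lemma V_lip: "loc_lip V"
  using Vd_lip[of 0] N Vd0 by auto

lemma q_lip: "loc_lip (\<lambda>x. complex_of_real l - V x)"
  using loc_lip_add[OF loc_lip_const loc_lip_minus[OF V_lip], of "complex_of_real l"] by simp

lemma csqrt_deriv:
  assumes "l \<ge> l0" "1 = N \<longrightarrow> x \<notin> Z"
  shows "((\<lambda>x. csqrt (complex_of_real l - V x)) has_vector_derivative - (Vd 1 x * R l x / 2)) (at x)"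
proof -
  have 1: "((\<lambda>x. complex_of_real l - V x) has_vector_derivative - Vd 1 x) (at x)"
    using V_deriv[OF assms(2)] by (auto intro!: derivative_eq_intros)
  have 2: "(csqrt has_field_derivative inverse (2 * csqrt (complex_of_real l - V x))) (at (complex_of_real l - V x))"
    by (rule has_field_derivative_csqrt[OF slit[OF assms(1)]])
  show ?thesis
    using field_vector_diff_chain_at[OF 1 2] by (simp add: o_def R_def field_simps)
qed

lemma R_deriv:
  assumes "l \<ge> l0" "1 = N \<longrightarrow> x \<notin> Z"
  shows "(R l has_vector_derivative (1 / 2) * (Vd 1 x * (R l x * (R l x * R l x)))) (at x)"
proof -
  let ?s = "csqrt (complex_of_real l - V x)"
  have 2: "(inverse has_field_derivative - (inverse ?s ^ Suc (Suc 0))) (at ?s)"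
    by (rule DERIV_inverse[OF csqrt_nz[OF assms(1)]])
  show ?thesis
    using field_vector_diff_chain_at[OF csqrt_deriv[OF assms] 2]
    by (simp add: o_def R_def[abs_def] mult_ac)
qed

lemma q_lower: "l \<ge> l0 \<Longrightarrow> x \<in> J l \<Longrightarrow> l / 2 \<le> norm (complex_of_real l - V x)"
  using ReV[of l x] complex_Re_le_cmod[of "complex_of_real l - V x"] by simp

lemma R_bound: assumes "l \<ge> l0" "x \<in> J l" shows "norm (R l x) \<le> sqrt 2 * (1 / sqrt l)"
proof -
  have "sqrt (l / 2) \<le> sqrt (norm (complex_of_real l - V x))" using q_lower[OF assms] by simp
  moreover have "0 < sqrt (l / 2)" using l_pos[OF assms(1)] by simp
  ultimately have "norm (R l x) \<le> inverse (sqrt (l / 2))"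
    unfolding R_def norm_inverse norm_csqrt by (rule le_imp_inverse_le)
  then show ?thesis by (simp add: real_sqrt_divide)
qed

lemma sym_Vd: "k < N \<Longrightarrow> sym k (\<lambda>l x. U x * w x ^ (N - k)) (\<lambda>l. Vd (N - k))"
proof (induction k)
  case 0
  show ?case using Vd_bound(2)[of N] Vd_bound(1) N by (auto intro!: exI[of _ CV])
next
  case (Suc k)
  have e: "N - k = Suc (N - Suc k)" using Suc.prems by simp
  show ?case
  proof (rule sym_SucI[OF Vd_bound(1), where F'="\<lambda>l. Vd (N - k)"])
    show "norm (Vd (N - Suc k) x) \<le> CV * (U x * w x ^ (N - Suc k))" for l x
      using Suc.prems by (intro Vd_bound) auto
    show "loc_lip (Vd (N - Suc k))" using Suc.prems by (intro Vd_lip) auto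
    show "(Vd (N - Suc k) has_vector_derivative Vd (N - k) x) (at x)" if "k = 0 \<longrightarrow> x \<notin> Z" for x
      unfolding e using Suc.prems that by (intro Vd_deriv) auto
    show "sym k (\<lambda>l x. U x * w x ^ (N - Suc k) * w x) (\<lambda>l. Vd (N - k))"
      using Suc unfolding e by (simp add: mult_ac)
  qed
qed

lemma sym_V': "sym n (\<lambda>l x. U x * w x) (\<lambda>l. Vd 1)"
  using sym_Vd[of n] N by simp

text \<open>The derivative of \<open>R\<close> is \<open>V' R\<^sup>3 / 2\<close>, of size \<open>U w l\<^sup>-\<^sup>3\<^sup>/\<^sup>2\<close>; the factor \<open>U / l\<close> is bounded on
\<open>J\<close>, and induction on the number of derivatives closes.\<close>

lemma sym_R: "M \<le> N \<Longrightarrow> sym M (\<lambda>l x. 1 / sqrt l) R"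
proof (induction M)
  case 0
  show ?case using R_bound by (auto intro!: exI[of _ "sqrt 2"])
next
  case (Suc M)
  show ?case
  proof (rule sym_SucI[of "sqrt 2"])
    show "loc_lip (R l)" if "l \<ge> l0" for l
      unfolding R_def[abs_def] using csqrt_nz slit that by (intro loc_lip_inverse loc_lip_csqrt q_lip) auto
    show "(R l has_vector_derivative (1 / 2) * (Vd 1 x * (R l x * (R l x * R l x)))) (at x)"
      if "l \<ge> l0" "M = 0 \<longrightarrow> x \<notin> Z" for l x
      using that Suc.prems N by (intro R_deriv) auto
    have IH: "sym M (\<lambda>l x. 1 / sqrt l) R" using Suc by simp
    have V': "sym M (\<lambda>l x. U x * w x) (\<lambda>l. Vd 1)" using sym_le[OF sym_V', of M] Suc.prems N by simp
    have "sym M (\<lambda>l x. norm (1 / 2 :: complex) * (U x * w x * (1 / sqrt l * (1 / sqrt l * (1 / sqrt l)))))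
       (\<lambda>l x. (1 / 2) * (Vd 1 x * (R l x * (R l x * R l x))))"
      by (intro sym_cmult sym_mult IH V')
    then show "sym M (\<lambda>l x. 1 / sqrt l * w x) (\<lambda>l x. (1 / 2) * (Vd 1 x * (R l x * (R l x * R l x))))"
    proof (rule sym_mono[where K="CU"])
      fix l x assume lx: "l \<ge> l0" "x \<in> J l"
      have s: "sqrt l * sqrt l = l" "0 < sqrt l" using l_pos[OF lx(1)] by auto
      have norm_half: "norm (1 / 2 :: complex) = 1 / 2" by (simp add: norm_divide)
      have "U x * w x * (1 / l) * (1 / sqrt l) \<le> (CU * l) * w x * (1 / l) * (1 / sqrt l)"
        using U_le(2)[OF lx] s l_pos[OF lx(1)] w_nonneg by (intro mult_right_mono) auto
      also have "\<dots> = CU * (1 / sqrt l * w x)" using l_pos[OF lx(1)] by simp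
      finally have a: "U x * w x * (1 / l) * (1 / sqrt l) \<le> CU * (1 / sqrt l * w x)" .
      have "U x * w x * (1 / sqrt l * (1 / sqrt l * (1 / sqrt l))) = U x * w x * (1 / l) * (1 / sqrt l)"
        using s by (simp add: divide_simps)
      moreover have "0 \<le> U x * w x * (1 / sqrt l * (1 / sqrt l * (1 / sqrt l)))"
        using s U_nonneg w_nonneg by simp
      ultimately show "norm (1 / 2 :: complex) * (U x * w x * (1 / sqrt l * (1 / sqrt l * (1 / sqrt l)))) \<le> CU * (1 / sqrt l * w x)"
        unfolding norm_half using a by linarith
    qed (rule U_le(1))
  qed (use R_bound in auto)
qed

end

text \<open>The recursion for \<open>dpsi\<close> contains a derivative of \<open>dpsi\<close> itself, so it is only unfolded at chosen
instances.\<close>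

declare dpsi.simps [simp del] csqrt.sel [simp del]

context wkb begin

lemma powr_neg_half: "l \<ge> l0 \<Longrightarrow> l powr (- 1 / 2) = 1 / sqrt l"
  using l_pos[of l] by (simp add: powr_minus_divide powr_half_sqrt)

lemma dpsi_0: "l \<ge> l0 \<Longrightarrow> dpsi V l 0 x = (\<i> * complex_of_real (1 / sqrt l)) * csqrt (complex_of_real l - V x)"
  by (simp only: dpsi.simps powr_neg_half)

lemma csqrt_bound:
  assumes "l \<ge> l0" "x \<in> J l"
  shows "norm (csqrt (complex_of_real l - V x)) \<le> sqrt (1 + CU) * sqrt l"
proof -
  have "norm (complex_of_real l - V x) \<le> l + U x"
    using norm_triangle_ineq4[of "complex_of_real l" "V x"] V_le_U[of x] l_pos[OF assms(1)] by simp
  also have "\<dots> \<le> (1 + CU) * l" using U_le(2)[OF assms] by (simp add: algebra_simps)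
  finally show ?thesis by (simp add: real_sqrt_mult[symmetric])
qed

text \<open>The derivative of \<open>\<psi>\<^sub>-\<^sub>1'\<close>.\<close>

definition D0 :: "real \<Rightarrow> real \<Rightarrow> complex" where
  "D0 l x = (\<i> * complex_of_real (1 / sqrt l)) * (- (1/2) * (Vd 1 x * R l x))"

lemma dpsi_0_deriv:
  assumes "l \<ge> l0" "n = 0 \<longrightarrow> x \<notin> Z"
  shows "(dpsi V l 0 has_vector_derivative D0 l x) (at x)"
proof -
  have "((\<lambda>x. (\<i> * complex_of_real (1 / sqrt l)) * csqrt (complex_of_real l - V x)) has_vector_derivative
      (\<i> * complex_of_real (1 / sqrt l)) * - (Vd 1 x * R l x / 2)) (at x)"
    by (rule has_vector_derivative_mult_right[OF csqrt_deriv]) (use assms N in auto)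
  moreover have "dpsi V l 0 = (\<lambda>x. (\<i> * complex_of_real (1 / sqrt l)) * csqrt (complex_of_real l - V x))"
    using dpsi_0[OF assms(1)] by auto
  ultimately show ?thesis unfolding D0_def by simp
qed

lemma sym_D0: "sym n (\<lambda>l x. U x * w x / l) D0"
proof -
  have "sym n (\<lambda>l x. norm (\<i> * complex_of_real (1 / sqrt l)) * (norm (- (1/2) :: complex) * (U x * w x * (1 / sqrt l)))) D0"
    unfolding D0_def[abs_def]
    by (intro sym_cmult sym_mult sym_V' sym_R) (use N in auto)
  then show ?thesis
  proof (rule sym_mono[where K=1])
    fix l x assume lx: "l \<ge> l0" "x \<in> J l"
    have l: "0 < l" "0 < sqrt l" "sqrt l * sqrt l = l" using l_pos[OF lx(1)] by auto
    have a: "norm (\<i> * complex_of_real (1 / sqrt l)) = 1 / sqrt l" using l by (simp add: norm_mult norm_divide)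
    have b: "norm (- (1/2) :: complex) = 1 / 2" by (simp add: norm_divide)
    have "(1 / sqrt l) * (1 / 2 * (U x * w x * (1 / sqrt l))) = 1/2 * (U x * w x / l)"
      using l by (simp add: divide_simps)
    also have "\<dots> \<le> 1 * (U x * w x / l)" using U_nonneg w_nonneg l by (intro mult_right_mono) auto
    finally show "norm (\<i> * complex_of_real (1 / sqrt l)) * (norm (- (1/2) :: complex) * (U x * w x * (1 / sqrt l))) \<le> 1 * (U x * w x / l)"
      unfolding a b .
  qed simp
qed

lemma sym_dpsi_0: "sym N (\<lambda>l x. 1) (\<lambda>l. dpsi V l 0)"
  unfolding N
proof (rule sym_SucI[where C="sqrt (1 + CU)" and F'=D0])
  show "norm (dpsi V l 0 x) \<le> sqrt (1 + CU) * 1" if "l \<ge> l0" "x \<in> J l" for l x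
  proof -
    have "0 < sqrt l" using l_pos[OF that(1)] by simp
    then show ?thesis using csqrt_bound[OF that] unfolding dpsi_0[OF that(1)]
      by (simp add: norm_mult norm_divide field_simps)
  qed
  show "loc_lip (dpsi V l 0)" if "l \<ge> l0" for l
  proof -
    have "loc_lip (\<lambda>x. (\<i> * complex_of_real (1 / sqrt l)) * csqrt (complex_of_real l - V x))"
      using slit[OF that] by (intro loc_lip_mult loc_lip_const loc_lip_csqrt q_lip) auto
    then show ?thesis using dpsi_0[OF that] by presburger
  qed
  show "(dpsi V l 0 has_vector_derivative D0 l x) (at x)" if "l \<ge> l0" "n = 0 \<longrightarrow> x \<notin> Z" for l x
    using that by (rule dpsi_0_deriv)
  show "sym n (\<lambda>l x. 1 * w x) D0"
  proof (rule sym_mono[OF sym_D0 U_le(1)])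
    fix l x assume lx: "l \<ge> l0" "x \<in> J l"
    have "U x * w x \<le> CU * l * w x" using U_le(2)[OF lx] w_nonneg by (intro mult_right_mono) auto
    then show "U x * w x / l \<le> CU * (1 * w x)" using l_pos[OF lx(1)] by (simp add: field_simps)
  qed
qed (use U_le(1) in auto)

lemma sym_inv_dpsi_0: "sym N (\<lambda>l x. 1) (\<lambda>l x. 1 / (2 * dpsi V l 0 x))"
proof (rule sym_cong)
  have "sym N (\<lambda>l x. norm (- \<i> / 2 * complex_of_real (sqrt l)) * (1 / sqrt l)) (\<lambda>l x. (- \<i> / 2 * complex_of_real (sqrt l)) * R l x)"
    by (intro sym_cmult sym_R order_refl)
  then show "sym N (\<lambda>l x. 1) (\<lambda>l x. (- \<i> / 2 * complex_of_real (sqrt l)) * R l x)"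
  proof (rule sym_mono[where K=1])
    fix l x assume lx: "l \<ge> l0"
    then show "norm (- \<i> / 2 * complex_of_real (sqrt l)) * (1 / sqrt l) \<le> 1 * 1"
      using l_pos[OF lx] by (simp add: norm_mult norm_divide)
  qed simp
  fix l x assume l: "l \<ge> l0"
  have "complex_of_real (sqrt l) \<noteq> 0" using l_pos[OF l] by simp
  then show "- \<i> / 2 * complex_of_real (sqrt l) * R l x = 1 / (2 * dpsi V l 0 x)"
    unfolding dpsi_0[OF l] R_def using csqrt_nz[OF l, of x] by (simp add: field_simps)
qed

definition Dpsi :: "nat \<Rightarrow> real \<Rightarrow> real \<Rightarrow> complex" where
  "Dpsi j l x = vector_derivative (\<lambda>y. dpsi V l j y) (at x)"

text \<open>The weight of \<open>\<psi>\<^sub>k'\<close>, \<open>k = j - 1\<close>. All of them except the leading one arise by differentiating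
\<open>l - V\<close>, which removes the constant \<open>l\<close> and leaves \<open>U / l\<close>.\<close>

definition B :: "nat \<Rightarrow> real \<Rightarrow> real \<Rightarrow> real" where
  "B j l x = (if j = 0 then 1 else U x * w x ^ j / l)"

text \<open>Passing to the next index costs one derivative, hence one factor \<open>w\<close> and one order of
differentiability. In a product of two earlier functions the powers of \<open>w\<close> add up correctly, and of the two
factors \<open>U / l\<close> one is bounded on \<open>J\<close>. The derivative appears separately in the statement because for \<open>j = 0\<close> it
is smaller, by the factor \<open>U / l\<close>, than the symbol estimate for the function itself would give.\<close>

lemma dpsi_sym:
  "j \<le> n \<Longrightarrow> sym (N - j) (B j) (\<lambda>l. dpsi V l j) \<and>
     (\<exists>D. (\<forall>l\<ge>l0. \<forall>x. (j = n \<longrightarrow> x \<notin> Z) \<longrightarrow> (dpsi V l j has_vector_derivative D l x) (at x)) \<and>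
          sym (n - j) (\<lambda>l x. U x * w x ^ Suc j / l) D)"
proof (induction j rule: less_induct)
  case (less j)
  show ?case
  proof (cases j)
    case 0
    have "sym N (B 0) (\<lambda>l. dpsi V l 0)" using sym_dpsi_0 by (simp add: B_def[abs_def])
    moreover have "\<forall>l\<ge>l0. \<forall>x. (0 = n \<longrightarrow> x \<notin> Z) \<longrightarrow> (dpsi V l 0 has_vector_derivative D0 l x) (at x)"
      using dpsi_0_deriv by auto
    ultimately show ?thesis using sym_D0 unfolding 0 by (auto intro!: exI[of _ D0])
  next
    case (Suc k)
    have kn: "k < n" using less.prems Suc by simp
    obtain D where D: "\<And>l x. l \<ge> l0 \<Longrightarrow> (dpsi V l k has_vector_derivative D l x) (at x)"
      "sym (n - k) (\<lambda>l x. U x * w x ^ Suc k / l) D"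
    proof -
      have "\<exists>D. (\<forall>l\<ge>l0. \<forall>x. (k = n \<longrightarrow> x \<notin> Z) \<longrightarrow> (dpsi V l k has_vector_derivative D l x) (at x)) \<and>
          sym (n - k) (\<lambda>l x. U x * w x ^ Suc k / l) D"
        by (rule less.IH[THEN conjunct2]) (use kn Suc in auto)
      moreover have "k \<noteq> n" using kn by simp
      ultimately show thesis using that by blast
    qed
    have IH: "sym (n - k) (B i) (\<lambda>l. dpsi V l i)" if "i \<le> k" for i
    proof (rule sym_le)
      show "sym (N - i) (B i) (\<lambda>l. dpsi V l i)"
        by (rule less.IH[THEN conjunct1]) (use that kn Suc in auto)
      show "n - k \<le> N - i" using that N by simp
    qed
    have prod: "sym (n - k) (\<lambda>l x. U x * w x ^ Suc k / l) (\<lambda>l x. dpsi V l (Suc \<alpha>) x * dpsi V l (k - \<alpha>) x)"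
      if "\<alpha> \<in> {..<k}" for \<alpha>
    proof (rule sym_mono[OF sym_mult[OF IH IH] U_le(1)])
      fix l x assume lx: "l \<ge> l0" "x \<in> J l"
      have l: "0 < l" using l_pos[OF lx(1)] .
      have "B (Suc \<alpha>) l x * B (k - \<alpha>) l x = (U x / l) * (U x * (w x ^ Suc \<alpha> * w x ^ (k - \<alpha>)) / l)"
        using that by (simp add: B_def)
      also have "w x ^ Suc \<alpha> * w x ^ (k - \<alpha>) = w x ^ Suc k"
        using that by (simp flip: power_add)
      also have "(U x / l) * (U x * w x ^ Suc k / l) \<le> CU * (U x * w x ^ Suc k / l)"
        using U_le(2)[OF lx] l U_nonneg w_nonneg by (intro mult_right_mono) (auto simp: divide_le_eq)
      finally show "B (Suc \<alpha>) l x * B (k - \<alpha>) l x \<le> CU * (U x * w x ^ Suc k / l)" .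
    qed (use that in auto)
    have main: "sym (n - k) (B j) (\<lambda>l. dpsi V l j)"
    proof (rule sym_cong)
      have "sym (n - k) (\<lambda>l x. 1 * (U x * w x ^ Suc k / l))
         (\<lambda>l x. 1 / (2 * dpsi V l 0 x) * (D l x - (\<Sum>\<alpha><k. dpsi V l (Suc \<alpha>) x * dpsi V l (k - \<alpha>) x)))"
        by (intro sym_mult sym_diff D(2) sym_sum prod sym_le[OF sym_inv_dpsi_0]) (use N in auto)
      then show "sym (n - k) (B j) (\<lambda>l x. 1 / (2 * dpsi V l 0 x) * (D l x - (\<Sum>\<alpha><k. dpsi V l (Suc \<alpha>) x * dpsi V l (k - \<alpha>) x)))"
        by (simp add: B_def[abs_def] Suc)
      fix l x assume "l \<ge> l0"
      then have "vector_derivative (\<lambda>y. dpsi V l k y) (at x) = D l x"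
        by (intro vector_derivative_at D(1))
      then show "1 / (2 * dpsi V l 0 x) * (D l x - (\<Sum>\<alpha><k. dpsi V l (Suc \<alpha>) x * dpsi V l (k - \<alpha>) x)) = dpsi V l j x"
        unfolding Suc dpsi.simps(2)[of V l k x] by simp
    qed
    have e: "n - k = Suc (n - j)" "N - j = n - k" using kn Suc N by auto
    obtain C F' where F: "0 \<le> C" "\<And>l x. l \<ge> l0 \<Longrightarrow> x \<in> J l \<Longrightarrow> norm (dpsi V l j x) \<le> C * B j l x"
      "\<And>l. l \<ge> l0 \<Longrightarrow> loc_lip (dpsi V l j)"
      "\<And>l x. l \<ge> l0 \<Longrightarrow> (n - j = 0 \<longrightarrow> x \<notin> Z) \<Longrightarrow> (dpsi V l j has_vector_derivative F' l x) (at x)"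
      "sym (n - j) (\<lambda>l x. B j l x * w x) F'"
      by (rule sym_SucE[OF main[unfolded e(1)]]) blast
    have "(\<lambda>l x. B j l x * w x) = (\<lambda>l x. U x * w x ^ Suc j / l)"
      using Suc by (auto simp: B_def fun_eq_iff mult_ac)
    then have "sym (n - j) (\<lambda>l x. U x * w x ^ Suc j / l) F'" using F(5) by simp
    moreover have "\<forall>l\<ge>l0. \<forall>x. (j = n \<longrightarrow> x \<notin> Z) \<longrightarrow> (dpsi V l j has_vector_derivative F' l x) (at x)"
      by (intro allI impI F(4)) (use less.prems in auto)
    ultimately show ?thesis using main unfolding e(2) by blast
  qed
qed

lemma dpsi_deriv:
  assumes "l \<ge> l0" "j \<le> n" "j = n \<longrightarrow> x \<notin> Z"
  shows "(dpsi V l j has_vector_derivative Dpsi j l x) (at x)"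
proof -
  obtain D where "\<forall>l\<ge>l0. \<forall>x. (j = n \<longrightarrow> x \<notin> Z) \<longrightarrow> (dpsi V l j has_vector_derivative D l x) (at x)"
    using dpsi_sym[OF assms(2)] by blast
  then have d: "(dpsi V l j has_vector_derivative D l x) (at x)" using assms by blast
  then have "Dpsi j l x = D l x" unfolding Dpsi_def by (rule vector_derivative_at)
  then show ?thesis using d by simp
qed

lemma dpsi_lip: assumes "l \<ge> l0" "j \<le> n" shows "loc_lip (dpsi V l j)"
proof -
  have "N - j = Suc (n - j)" using assms N by simp
  then have "sym (Suc (n - j)) (B j) (\<lambda>l. dpsi V l j)" using dpsi_sym[OF assms(2)] by simp
  then show ?thesis using assms(1) by (simp add: sym.simps(2))
qed

lemma Dpsi_bound:
  obtains C where "C \<ge> 0" "\<And>l x. l \<ge> l0 \<Longrightarrow> x \<in> J l \<Longrightarrow> x \<notin> Z \<Longrightarrow> norm (Dpsi n l x) \<le> C * (U x * w x ^ N / l)"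
proof -
  obtain D where D: "\<forall>l\<ge>l0. \<forall>x. (n = n \<longrightarrow> x \<notin> Z) \<longrightarrow> (dpsi V l n has_vector_derivative D l x) (at x)"
    "sym (n - n) (\<lambda>l x. U x * w x ^ Suc n / l) D" using dpsi_sym[of n] by auto
  have eq: "Dpsi n l x = D l x" if "l \<ge> l0" "x \<notin> Z" for l x
    using D(1) that unfolding Dpsi_def by (intro vector_derivative_at) auto
  obtain C where "C \<ge> 0" "\<And>l x. l \<ge> l0 \<Longrightarrow> x \<in> J l - Z \<Longrightarrow> norm (D l x) \<le> C * (U x * w x ^ Suc n / l)"
    using D(2) by auto
  then show ?thesis using eq that[of C] N by auto
qed

lemma dpsi_bound:
  obtains C where "C \<ge> 0"
    "\<And>l x j. l \<ge> l0 \<Longrightarrow> x \<in> J l \<Longrightarrow> 1 \<le> j \<Longrightarrow> j \<le> n \<Longrightarrow> norm (dpsi V l j x) \<le> C * (U x * w x ^ j / l)"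
proof -
  have "\<exists>C\<ge>0. 1 \<le> j \<longrightarrow> j \<le> n \<longrightarrow> (\<forall>l\<ge>l0. \<forall>x\<in>J l. norm (dpsi V l j x) \<le> C * (U x * w x ^ j / l))" for j
  proof (cases "1 \<le> j \<and> j \<le> n")
    case True
    then have "N - j \<noteq> 0" using N by simp
    moreover have "sym (N - j) (B j) (\<lambda>l. dpsi V l j)" using dpsi_sym[of j] True by simp
    ultimately obtain C where "0 \<le> C" "\<And>l x. l \<ge> l0 \<Longrightarrow> x \<in> J l \<Longrightarrow> norm (dpsi V l j x) \<le> C * B j l x"
      using sym_bound by metis
    then show ?thesis using True by (auto simp: B_def)
  qed (auto intro!: exI[of _ 0])
  then obtain c where c: "\<And>j. 0 \<le> c j" "\<And>j l x. 1 \<le> j \<Longrightarrow> j \<le> n \<Longrightarrow> l \<ge> l0 \<Longrightarrow> x \<in> J l \<Longrightarrow> norm (dpsi V l j x) \<le> c j * (U x * w x ^ j / l)"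
    by metis
  show ?thesis
  proof (rule that[of "\<Sum>j\<le>n. c j"])
    show "0 \<le> (\<Sum>j\<le>n. c j)" using c(1) by (intro sum_nonneg) auto
    fix l x j assume *: "l \<ge> l0" "x \<in> J l" "1 \<le> j" "j \<le> n"
    have "c j \<le> (\<Sum>j\<le>n. c j)" using c(1) *(4) by (intro member_le_sum) auto
    then have "c j * (U x * w x ^ j / l) \<le> (\<Sum>j\<le>n. c j) * (U x * w x ^ j / l)"
      using l_pos[OF *(1)] U_nonneg w_nonneg by (intro mult_right_mono) auto
    then show "norm (dpsi V l j x) \<le> (\<Sum>j\<le>n. c j) * (U x * w x ^ j / l)" using c(2)[OF *(3,4,1,2)] by simp
  qed
qed

text \<open>The power \<open>\<lambda>\<^sup>-\<^sup>k\<^sup>/\<^sup>2\<close> with \<open>k = j - 1\<close>; similarly, all indices \<open>j\<close> below are shifted by one.\<close>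

definition coef :: "real \<Rightarrow> nat \<Rightarrow> real" where
  "coef l j = l powr (- (real j - 1) / 2)"

text \<open>The first and, in \<open>Pdd\<close>, the second derivative of the phase \<open>P\<close>, which is obtained from them by
integration.\<close>

definition Pd :: "real \<Rightarrow> real \<Rightarrow> complex" where
  "Pd l x = (\<Sum>j\<le>n. complex_of_real (coef l j) * dpsi V l j x)"

definition Pdd :: "real \<Rightarrow> real \<Rightarrow> complex" where
  "Pdd l x = (\<Sum>j\<le>n. complex_of_real (coef l j) * Dpsi j l x)"

text \<open>The products in \<open>P'\<^sup>2\<close> that are of too high order to be cancelled by the recursion.\<close>

definition tail_pairs :: "(nat \<times> nat) set" where
  "tail_pairs = {(i, j). i \<le> n \<and> j \<le> n \<and> n < i + j}"

definition rem :: "real \<Rightarrow> real \<Rightarrow> complex" where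
  "rem l x = complex_of_real (coef l n) * Dpsi n l x -
     (\<Sum>(i, j)\<in>tail_pairs. (complex_of_real (coef l i) * dpsi V l i x) * (complex_of_real (coef l j) * dpsi V l j x))"

lemma finite_tail_pairs: "finite tail_pairs"
  by (rule finite_subset[of _ "{..n} \<times> {..n}"]) (auto simp: tail_pairs_def)

lemma Pd_lip: "l \<ge> l0 \<Longrightarrow> loc_lip (Pd l)"
proof -
  assume l: "l \<ge> l0"
  have "loc_lip (\<lambda>x. \<Sum>j\<in>I. complex_of_real (coef l j) * dpsi V l j x)" if "finite I" "I \<subseteq> {..n}" for I
    using that
    by (induction I rule: finite_induct) (auto intro!: loc_lip_const loc_lip_add loc_lip_mult dpsi_lip l)
  then show ?thesis unfolding Pd_def[abs_def] by auto
qed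

lemma Pd_deriv: "l \<ge> l0 \<Longrightarrow> x \<notin> Z \<Longrightarrow> (Pd l has_vector_derivative Pdd l x) (at x)"
  unfolding Pd_def[abs_def] Pdd_def
  by (intro has_vector_derivative_sum has_vector_derivative_mult_right dpsi_deriv) auto

lemma coef_mult: assumes "i \<le> m" "l \<ge> l0" shows "coef l i * coef l (m - i) = l powr (1 - real m / 2)"
proof -
  have "coef l i * coef l (m - i) = l powr (- (real i - 1) / 2 + - (real (m - i) - 1) / 2)"
    by (simp add: coef_def powr_add)
  also have "- (real i - 1) / 2 + - (real (m - i) - 1) / 2 = 1 - real m / 2"
    using assms(1) by (simp add: of_nat_diff field_simps)
  finally show ?thesis .
qed

lemma dpsi_0_nz: "l \<ge> l0 \<Longrightarrow> dpsi V l 0 x \<noteq> 0"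
  unfolding dpsi_0 using csqrt_nz[of l x] l_pos[of l] by simp

lemma eikonal: assumes "l \<ge> l0"
  shows "(complex_of_real (coef l 0) * dpsi V l 0 x)\<^sup>2 = V x - complex_of_real l"
proof -
  have "coef l 0 = sqrt l" using l_pos[OF assms] by (simp add: coef_def powr_half_sqrt)
  then have "complex_of_real (coef l 0) * dpsi V l 0 x = \<i> * csqrt (complex_of_real l - V x)"
    unfolding dpsi_0[OF assms] using l_pos[OF assms] by simp
  then show ?thesis by (simp add: power_mult_distrib)
qed

text \<open>The recursion read backwards: in it, the two terms with an index \<open>0\<close> have been isolated as
\<open>2 \<psi>\<^sub>-\<^sub>1' \<psi>\<^sub>k\<^sub>+\<^sub>1'\<close>.\<close>

lemma transport:
  assumes "l \<ge> l0" "k < n"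
  shows "complex_of_real (coef l k) * Dpsi k l x =
    (\<Sum>i\<le>Suc k. (complex_of_real (coef l i) * dpsi V l i x) * (complex_of_real (coef l (Suc k - i)) * dpsi V l (Suc k - i) x))"
proof -
  have "2 * dpsi V l 0 x * dpsi V l (Suc k) x = Dpsi k l x - (\<Sum>\<alpha><k. dpsi V l (Suc \<alpha>) x * dpsi V l (k - \<alpha>) x)"
    unfolding dpsi.simps(2)[of V l k x] Dpsi_def[symmetric] using dpsi_0_nz[OF assms(1), of x] by (simp)
  then have "Dpsi k l x = 2 * dpsi V l 0 x * dpsi V l (Suc k) x + (\<Sum>\<alpha><k. dpsi V l (Suc \<alpha>) x * dpsi V l (k - \<alpha>) x)"
    by (simp)
  also have "\<dots> = (\<Sum>i\<le>Suc k. dpsi V l i x * dpsi V l (Suc k - i) x)"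
  proof -
    have "(\<Sum>i\<le>Suc k. dpsi V l i x * dpsi V l (Suc k - i) x) =
        dpsi V l 0 x * dpsi V l (Suc k) x + (\<Sum>i\<le>k. dpsi V l (Suc i) x * dpsi V l (k - i) x)"
      by (subst sum.atMost_Suc_shift) (simp)
    also have "(\<Sum>i\<le>k. dpsi V l (Suc i) x * dpsi V l (k - i) x) =
        (\<Sum>i<k. dpsi V l (Suc i) x * dpsi V l (k - i) x) + dpsi V l (Suc k) x * dpsi V l 0 x"
      by (simp add: lessThan_Suc_atMost[symmetric])
    finally show ?thesis by (simp add: algebra_simps)
  qed
  finally have "complex_of_real (coef l k) * Dpsi k l x = (\<Sum>i\<le>Suc k. complex_of_real (coef l k) * (dpsi V l i x * dpsi V l (Suc k - i) x))"
    by (simp only: sum_distrib_left)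
  also have "\<dots> = (\<Sum>i\<le>Suc k. (complex_of_real (coef l i) * dpsi V l i x) * (complex_of_real (coef l (Suc k - i)) * dpsi V l (Suc k - i) x))"
  proof (rule sum.cong[OF refl])
    fix i assume "i \<in> {..Suc k}"
    then have "coef l i * coef l (Suc k - i) = l powr (1 - real (Suc k) / 2)" using assms by (intro coef_mult) auto
    also have "\<dots> = coef l k" by (simp add: coef_def field_simps)
    finally have "complex_of_real (coef l k) = complex_of_real (coef l i) * complex_of_real (coef l (Suc k - i))"
      by (simp flip: of_real_mult)
    then show "complex_of_real (coef l k) * (dpsi V l i x * dpsi V l (Suc k - i) x) =
        (complex_of_real (coef l i) * dpsi V l i x) * (complex_of_real (coef l (Suc k - i)) * dpsi V l (Suc k - i) x)"
      by (simp only: mult_ac)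
  qed
  finally show ?thesis .
qed

text \<open>Group the double sum for \<open>P'\<^sup>2\<close> by the sum of the two indices. Sum \<open>0\<close> is the eikonal equation, sums
\<open>1, \<dots>, n\<close> cancel the second derivatives of index \<open>0, \<dots>, n - 1\<close> by the transport equations, and larger sums
remain.\<close>

lemma remainder_identity:
  assumes l: "l \<ge> l0"
  shows "Pdd l x - (Pd l x)\<^sup>2 + (V x - complex_of_real l) = rem l x"
proof -
  define a where "a i = complex_of_real (coef l i) * dpsi V l i x" for i
  have "(Pd l x)\<^sup>2 = (\<Sum>i\<le>n. \<Sum>j\<le>n. a i * a j)"
    by (simp add: Pd_def a_def power2_eq_square sum_product)
  also have "\<dots> = (\<Sum>(i,j)\<in>{..n} \<times> {..n}. a i * a j)" by (rule sum.cartesian_product)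
  also have "{..n} \<times> {..n} = {(i,j). i + j \<le> n} \<union> tail_pairs" by (auto simp: tail_pairs_def)
  also have "(\<Sum>(i,j)\<in>{(i,j). i + j \<le> n} \<union> tail_pairs. a i * a j) =
      (\<Sum>(i,j)\<in>{(i,j). i + j \<le> n}. a i * a j) + (\<Sum>(i,j)\<in>tail_pairs. a i * a j)"
  proof (rule sum.union_disjoint)
    show "finite {(i::nat,j). i + j \<le> n}" by (rule finite_subset[of _ "{..n} \<times> {..n}"]) auto
  qed (use finite_tail_pairs in \<open>auto simp: tail_pairs_def\<close>)
  also have "(\<Sum>(i,j)\<in>{(i,j). i + j \<le> n}. a i * a j) = (\<Sum>k\<le>n. \<Sum>i\<le>k. a i * a (k - i))"
    by (rule sum.triangle_reindex_eq)
  also have "\<dots> = a 0 * a 0 + (\<Sum>k<n. \<Sum>i\<le>Suc k. a i * a (Suc k - i))"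
    by (subst sum.atMost_shift) simp
  also have "(\<Sum>k<n. \<Sum>i\<le>Suc k. a i * a (Suc k - i)) = (\<Sum>k<n. complex_of_real (coef l k) * Dpsi k l x)"
    unfolding a_def by (intro sum.cong refl transport[OF l, symmetric]) auto
  finally have "(Pd l x)\<^sup>2 = a 0 * a 0 + (\<Sum>k<n. complex_of_real (coef l k) * Dpsi k l x) + (\<Sum>(i,j)\<in>tail_pairs. a i * a j)" .
  moreover have "a 0 * a 0 = V x - complex_of_real l"
    using eikonal[OF l, of x] unfolding a_def power2_eq_square .
  moreover have "Pdd l x = (\<Sum>k<n. complex_of_real (coef l k) * Dpsi k l x) + complex_of_real (coef l n) * Dpsi n l x"
    unfolding Pdd_def by (simp add: lessThan_Suc_atMost[symmetric])
  moreover have "rem l x = complex_of_real (coef l n) * Dpsi n l x - (\<Sum>(i,j)\<in>tail_pairs. a i * a j)"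
    unfolding rem_def a_def by (simp only:)
  ultimately show ?thesis by simp
qed

lemma coef_sqrt: assumes "l \<ge> l0" shows "coef l (Suc k) * sqrt l ^ k = 1"
proof -
  have l: "0 < l" using l_pos[OF assms] .
  have "sqrt l ^ k = l powr (real k / 2)"
    using l by (simp add: powr_half_sqrt[symmetric] powr_realpow[symmetric] powr_powr)
  then show ?thesis using l by (simp add: coef_def flip: powr_add)
qed

lemma coef_pos: "l \<ge> l0 \<Longrightarrow> 0 < coef l j"
  using l_pos[of l] by (simp add: coef_def)

text \<open>Each further term of the expansion has one more factor \<open>w l\<^sup>-\<^sup>1\<^sup>/\<^sup>2\<close>, which is bounded on \<open>J\<close>. So all
corrections to the leading term of \<open>P'\<close> obey the bound of the first one.\<close>

lemma term_bound:
  assumes lx: "l \<ge> l0" "x \<in> J l" and C: "0 \<le> C"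
    and d: "norm (dpsi V l (Suc k) x) \<le> C * (U x * w x ^ Suc k / l)"
  shows "norm (complex_of_real (coef l (Suc k)) * dpsi V l (Suc k) x) \<le> C * Cw ^ k * (U x * w x / l)"
proof -
  have l: "0 < l" using l_pos[OF lx(1)] .
  have "norm (complex_of_real (coef l (Suc k)) * dpsi V l (Suc k) x) = coef l (Suc k) * norm (dpsi V l (Suc k) x)"
    using coef_pos[OF lx(1), of "Suc k"] by (simp add: norm_mult)
  also have "\<dots> \<le> coef l (Suc k) * (C * (U x * w x ^ Suc k / l))"
    using d coef_pos[OF lx(1), of "Suc k"] by (intro mult_left_mono) auto
  also have "\<dots> = (coef l (Suc k) * w x ^ k) * (C * (U x * w x / l))" by (simp add: mult_ac)
  also have "\<dots> \<le> (coef l (Suc k) * (Cw * sqrt l) ^ k) * (C * (U x * w x / l))"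
    using w_le(2)[OF lx] w_nonneg[of x] coef_pos[OF lx(1), of "Suc k"] C U_nonneg[of x] l
    by (intro mult_right_mono mult_left_mono power_mono) auto
  also have "coef l (Suc k) * (Cw * sqrt l) ^ k = Cw ^ k * (coef l (Suc k) * sqrt l ^ k)"
    by (simp add: power_mult_distrib)
  also have "\<dots> = Cw ^ k" using coef_sqrt[OF lx(1)] by simp
  finally show ?thesis by (simp add: mult_ac)
qed

lemma Pd_near:
  obtains C where "C \<ge> 0" "\<And>l x. l \<ge> l0 \<Longrightarrow> x \<in> J l \<Longrightarrow>
      norm (Pd l x - \<i> * csqrt (complex_of_real l - V x)) \<le> C * (U x * w x / l)"
proof -
  obtain C where C: "C \<ge> 0"
    "\<And>l x j. l \<ge> l0 \<Longrightarrow> x \<in> J l \<Longrightarrow> 1 \<le> j \<Longrightarrow> j \<le> n \<Longrightarrow> norm (dpsi V l j x) \<le> C * (U x * w x ^ j / l)"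
    using dpsi_bound by blast
  define K where "K = (\<Sum>k<n. C * Cw ^ k)"
  have "norm (Pd l x - \<i> * csqrt (complex_of_real l - V x)) \<le> K * (U x * w x / l)" if lx: "l \<ge> l0" "x \<in> J l" for l x
  proof -
    have l: "0 < l" using l_pos[OF lx(1)] .
    have "complex_of_real (coef l 0) * dpsi V l 0 x = \<i> * csqrt (complex_of_real l - V x)"
      unfolding dpsi_0[OF lx(1)] using l by (simp add: coef_def powr_half_sqrt)
    moreover have "Pd l x = complex_of_real (coef l 0) * dpsi V l 0 x + (\<Sum>k<n. complex_of_real (coef l (Suc k)) * dpsi V l (Suc k) x)"
      unfolding Pd_def by (rule sum.atMost_shift)
    ultimately have "Pd l x - \<i> * csqrt (complex_of_real l - V x) = (\<Sum>k<n. complex_of_real (coef l (Suc k)) * dpsi V l (Suc k) x)"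
      by simp
    also have "norm \<dots> \<le> (\<Sum>k<n. C * Cw ^ k * (U x * w x / l))"
      by (intro sum_norm_le term_bound lx C) auto
    finally show ?thesis unfolding K_def sum_distrib_right .
  qed
  moreover have "0 \<le> K" unfolding K_def using C w_le(1) by (intro sum_nonneg) auto
  ultimately show ?thesis using that by blast
qed

lemma Pd_bound:
  obtains C where "C \<ge> 0" "\<And>l x. l \<ge> l0 \<Longrightarrow> x \<in> J l \<Longrightarrow> norm (Pd l x) \<le> C * sqrt l"
proof -
  obtain C where C: "C \<ge> 0" "\<And>l x. l \<ge> l0 \<Longrightarrow> x \<in> J l \<Longrightarrow>
      norm (Pd l x - \<i> * csqrt (complex_of_real l - V x)) \<le> C * (U x * w x / l)"
    using Pd_near by blast
  show ?thesis
  proof (rule that[of "C * (CU * Cw) + sqrt (1 + CU)"])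
    fix l x assume lx: "l \<ge> l0" "x \<in> J l"
    have l: "0 < l" using l_pos[OF lx(1)] .
    have "U x / l \<le> CU" using U_le(2)[OF lx] l by (simp add: divide_le_eq)
    then have "(U x / l) * w x \<le> CU * (Cw * sqrt l)"
      using w_le(2)[OF lx] w_nonneg[of x] U_le(1) by (intro mult_mono) auto
    then have "C * (U x * w x / l) \<le> C * (CU * (Cw * sqrt l))"
      using C(1) by (intro mult_left_mono) auto
    then have "norm (Pd l x - \<i> * csqrt (complex_of_real l - V x)) \<le> C * (CU * (Cw * sqrt l))"
      using C(2)[OF lx] by linarith
    moreover have "norm (\<i> * csqrt (complex_of_real l - V x)) \<le> sqrt (1 + CU) * sqrt l"
      unfolding norm_mult norm_ii mult_1 by (rule csqrt_bound[OF lx])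
    ultimately have "norm ((Pd l x - \<i> * csqrt (complex_of_real l - V x)) + \<i> * csqrt (complex_of_real l - V x)) \<le>
        C * (CU * (Cw * sqrt l)) + sqrt (1 + CU) * sqrt l" by (rule norm_triangle_le[OF add_mono])
    then show "norm (Pd l x) \<le> (C * (CU * Cw) + sqrt (1 + CU)) * sqrt l" by (simp add: algebra_simps)
  qed (use C(1) U_le(1) w_le(1) in auto)
qed

section \<open>The remainder, and the pseudomode in the domain of the operator\<close>

text \<open>A pair of indices with sum \<open>N + m\<close> carries \<open>m\<close> superfluous factors \<open>w\<close>, each of order \<open>l\<^sup>1\<^sup>/\<^sup>2\<close>
at most, but also \<open>m\<close> additional factors \<open>l\<^sup>-\<^sup>1\<^sup>/\<^sup>2\<close>; and one of its two factors \<open>U / l\<close> is bounded. So all terms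
are of the size of the term with the last derivative.\<close>

lemma rem_bound:
  obtains C where "C \<ge> 0" "\<And>l x. l \<ge> l0 \<Longrightarrow> x \<in> J l \<Longrightarrow> x \<notin> Z \<Longrightarrow>
      norm (rem l x) \<le> C * (l powr (- (real n + 1) / 2) * (U x * w x ^ N))"
proof -
  obtain C1 where C1: "C1 \<ge> 0" "\<And>l x. l \<ge> l0 \<Longrightarrow> x \<in> J l \<Longrightarrow> x \<notin> Z \<Longrightarrow> norm (Dpsi n l x) \<le> C1 * (U x * w x ^ N / l)"
    using Dpsi_bound by blast
  obtain C where C: "C \<ge> 0"
    "\<And>l x j. l \<ge> l0 \<Longrightarrow> x \<in> J l \<Longrightarrow> 1 \<le> j \<Longrightarrow> j \<le> n \<Longrightarrow> norm (dpsi V l j x) \<le> C * (U x * w x ^ j / l)"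
    using dpsi_bound by blast
  define K where "K = (\<Sum>(i, j)\<in>tail_pairs. C * C * CU * Cw ^ (i + j - N))"
  have K0: "0 \<le> K" unfolding K_def using C(1) U_le(1) w_le(1) by (intro sum_nonneg) auto
  show ?thesis
  proof (rule that[of "C1 + K"])
    fix l x assume lx: "l \<ge> l0" "x \<in> J l" and xZ: "x \<notin> Z"
    have l: "0 < l" "1 \<le> l" using l_pos[OF lx(1)] lx(1) l0 by auto
    let ?T = "l powr (- (real n + 1) / 2) * (U x * w x ^ N)"
    have T0: "0 \<le> U x * w x ^ N" using U_nonneg w_nonneg by simp
    have cl: "coef l n / l = l powr (- (real n + 1) / 2)"
    proof -
      have "coef l n / l = l powr (- (real n - 1) / 2) / l powr 1" using l by (simp add: coef_def)
      also have "\<dots> = l powr (- (real n - 1) / 2 - 1)" by (simp only: powr_diff)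
      also have "- (real n - 1) / 2 - 1 = - (real n + 1) / 2" by (simp add: field_simps)
      finally show ?thesis .
    qed
    have "norm (complex_of_real (coef l n) * Dpsi n l x) \<le> coef l n * (C1 * (U x * w x ^ N / l))"
      using coef_pos[OF lx(1), of n] mult_left_mono[OF C1(2)[OF lx xZ], of "coef l n"] by (simp add: norm_mult)
    also have "\<dots> = C1 * ((coef l n / l) * (U x * w x ^ N))" by simp
    finally have A: "norm (complex_of_real (coef l n) * Dpsi n l x) \<le> C1 * ?T" unfolding cl .
    have Bd: "norm (case p of (i, j) \<Rightarrow> (complex_of_real (coef l i) * dpsi V l i x) * (complex_of_real (coef l j) * dpsi V l j x))
        \<le> (case p of (i, j) \<Rightarrow> C * C * CU * Cw ^ (i + j - N)) * ?T" if "p \<in> tail_pairs" for p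
    proof -
      obtain i j where ij: "p = (i, j)" by (cases p)
      have "i \<le> n \<and> j \<le> n \<and> n < i + j" using that unfolding tail_pairs_def ij by simp
      then have p: "p = (i, j)" "1 \<le> i" "i \<le> n" "1 \<le> j" "j \<le> n" "N \<le> i + j"
        using ij N by auto
      define m where "m = i + j - N"
      have m: "i + j = m + N" using p(6) by (simp add: m_def)
      have "norm ((complex_of_real (coef l i) * dpsi V l i x) * (complex_of_real (coef l j) * dpsi V l j x))
         = (coef l i * coef l j) * (norm (dpsi V l i x) * norm (dpsi V l j x))"
        using coef_pos[OF lx(1), of i] coef_pos[OF lx(1), of j] by (simp add: norm_mult)
      also have "\<dots> \<le> (coef l i * coef l j) * ((C * (U x * w x ^ i / l)) * (C * (U x * w x ^ j / l)))"
        using coef_pos[OF lx(1), of i] coef_pos[OF lx(1), of j] C(2)[OF lx p(2,3)] C(2)[OF lx p(4,5)]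
        by (intro mult_left_mono mult_mono') auto
      also have "\<dots> = (coef l i * coef l j / l) * (C * C) * (U x / l) * (U x * w x ^ (i + j))"
        by (simp add: power_add)
      also have "\<dots> = (coef l i * coef l j / l) * (C * C) * (U x / l) * (w x ^ m * (U x * w x ^ N))"
        unfolding m by (simp add: power_add mult_ac)
      also have "\<dots> \<le> (coef l i * coef l j / l) * (C * C) * CU * ((Cw * sqrt l) ^ m * (U x * w x ^ N))"
        using coef_pos[OF lx(1), of i] coef_pos[OF lx(1), of j] l C(1) U_le(1) U_le(2)[OF lx] w_nonneg[of x] w_le(2)[OF lx] T0 U_nonneg[of x]
        by (intro mult_mono mult_left_mono mult_right_mono power_mono mult_nonneg_nonneg) (auto simp: divide_le_eq)
      also have "\<dots> = C * C * CU * Cw ^ m * ((coef l i * coef l j / l * sqrt l ^ m) * (U x * w x ^ N))"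
        by (simp add: power_mult_distrib mult_ac)
      also have "coef l i * coef l j / l * sqrt l ^ m = l powr (- (real n + 1) / 2)"
      proof -
        have "sqrt l ^ m = l powr (real m / 2)"
          using l by (simp add: powr_half_sqrt[symmetric] powr_realpow[symmetric] powr_powr)
        then have "coef l i * coef l j / l * sqrt l ^ m
            = l powr (- (real i - 1) / 2) * l powr (- (real j - 1) / 2) / l powr 1 * l powr (real m / 2)"
          using l by (simp add: coef_def)
        also have "\<dots> = l powr (- (real i - 1) / 2 + - (real j - 1) / 2 - 1 + real m / 2)"
          by (simp only: powr_add powr_diff)
        also have "- (real i - 1) / 2 + - (real j - 1) / 2 - 1 + real m / 2 = - (real n + 1) / 2"
          using m N by (simp add: field_simps)
        finally show ?thesis .
      qed
      finally show ?thesis unfolding p(1) by (simp add: m_def)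
    qed
    have "norm (rem l x) \<le> C1 * ?T + (\<Sum>p\<in>tail_pairs. (case p of (i, j) \<Rightarrow> C * C * CU * Cw ^ (i + j - N)) * ?T)"
      unfolding rem_def by (rule order_trans[OF norm_triangle_ineq4 add_mono[OF A sum_norm_le[OF Bd]]])
    also have "\<dots> = (C1 + K) * ?T" unfolding K_def sum_distrib_right[symmetric] by (simp add: distrib_right)
    finally show "norm (rem l x) \<le> (C1 + K) * ?T" .
  qed (use C1(1) K0 in auto)
qed

definition P :: "real \<Rightarrow> real \<Rightarrow> complex" where
  "P l x = (\<Sum>j\<le>n. complex_of_real (coef l j) * psi V l j x)"

lemma psi_deriv: assumes "l \<ge> l0" "j \<le> n"
  shows "(psi V l j has_vector_derivative dpsi V l j x) (at x)"
proof -
  let ?r = "\<bar>x\<bar> + 1"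
  have c: "continuous_on {-?r..?r} (dpsi V l j)" by (rule loc_lip_continuous[OF dpsi_lip[OF assms]])
  have "((\<lambda>u. LBINT y=ereal 0..ereal u. dpsi V l j y) has_vector_derivative dpsi V l j x) (at x within {-?r..?r})"
    by (rule interval_integral_FTC2) (use c in auto)
  moreover have "at x within {-?r..?r} = at x" by (rule at_within_interior) (auto simp: interior_atLeastAtMost_real)
  ultimately show ?thesis by (simp add: psi_def[abs_def])
qed

lemma P_deriv: "l \<ge> l0 \<Longrightarrow> (P l has_vector_derivative Pd l x) (at x)"
  unfolding P_def[abs_def] Pd_def
  by (intro has_vector_derivative_sum has_vector_derivative_mult_right psi_deriv) auto

lemma P_0: "P l 0 = 0"
  by (simp add: P_def psi_def zero_ereal_def[symmetric])

lemma g_mode_P: "g_mode V n l x = exp (- P l x)"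
  by (simp only: g_mode_def P_def coef_def)

lemma g_deriv: assumes "l \<ge> l0" shows "(g_mode V n l has_vector_derivative - (Pd l x * g_mode V n l x)) (at x)"
proof -
  have "((\<lambda>x. - P l x) has_vector_derivative - Pd l x) (at x)"
    by (intro has_vector_derivative_minus P_deriv assms)
  from field_vector_diff_chain_at[OF this DERIV_exp]
  show ?thesis by (simp add: o_def g_mode_P[abs_def])
qed

lemma g_lip: assumes "l \<ge> l0" shows "loc_lip (g_mode V n l)"
proof (rule loc_lip_smooth[OF g_deriv[OF assms]])
  have "continuous_on UNIV (g_mode V n l)"
    using has_vector_derivative_continuous[OF g_deriv[OF assms]] continuous_at_imp_continuous_on by blast
  then show "continuous_on UNIV (\<lambda>x. - (Pd l x * g_mode V n l x))"
    by (intro continuous_intros loc_lip_continuous[OF Pd_lip[OF assms]])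
qed

text \<open>The derivative of \<open>\<eta> g\<close>.\<close>

definition f1 :: "(real \<Rightarrow> real) \<Rightarrow> real \<Rightarrow> real \<Rightarrow> complex" where
  "f1 \<eta> l x = (complex_of_real (deriv \<eta> x) + complex_of_real (\<eta> x) * - Pd l x) * g_mode V n l x"

text \<open>The commutator of \<open>- d\<^sup>2/dx\<^sup>2\<close> with multiplication by \<open>\<eta>\<close>, applied to \<open>g\<close>.\<close>

definition cut_error :: "(real \<Rightarrow> real) \<Rightarrow> real \<Rightarrow> real \<Rightarrow> complex" where
  "cut_error \<eta> l x = (2 * complex_of_real (deriv \<eta> x) * Pd l x - complex_of_real (deriv (deriv \<eta>) x)) * g_mode V n l x"

definition defect :: "(real \<Rightarrow> real) \<Rightarrow> real \<Rightarrow> real \<Rightarrow> complex" where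
  "defect \<eta> l x = cut_error \<eta> l x + rem l x * (complex_of_real (\<eta> x) * g_mode V n l x)"

lemma test_fun_vector_deriv:
  assumes "test_fun \<eta>" shows "((\<lambda>x. complex_of_real (\<eta> x)) has_vector_derivative complex_of_real (deriv \<eta> x)) (at x)"
  using test_fun_has_deriv[OF assms]
  by (auto intro: has_vector_derivative_of_real simp: has_real_derivative_iff_has_vector_derivative)

lemma test_fun_lip: assumes "test_fun \<eta>" shows "loc_lip (\<lambda>x. complex_of_real (\<eta> x))"
  by (rule loc_lip_smooth[OF test_fun_vector_deriv[OF assms]])
     (intro continuous_intros test_fun_isCont test_fun_deriv assms)

lemma f_deriv:
  assumes l: "l \<ge> l0" and \<eta>: "test_fun \<eta>"
  shows "((\<lambda>x. complex_of_real (\<eta> x) * g_mode V n l x) has_vector_derivative f1 \<eta> l x) (at x)"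
  using has_vector_derivative_mult[OF test_fun_vector_deriv[OF \<eta>] g_deriv[OF l], of x]
  by (simp add: f1_def algebra_simps)

lemma f1_lip: assumes l: "l \<ge> l0" and \<eta>: "test_fun \<eta>" shows "loc_lip (f1 \<eta> l)"
  unfolding f1_def[abs_def]
  by (intro loc_lip_mult loc_lip_add loc_lip_minus test_fun_lip test_fun_deriv Pd_lip g_lip \<eta> l)

lemma f1_deriv:
  assumes l: "l \<ge> l0" and \<eta>: "test_fun \<eta>" and x: "x \<notin> Z"
  shows "(f1 \<eta> l has_vector_derivative
    (V x - complex_of_real l) * (complex_of_real (\<eta> x) * g_mode V n l x) - defect \<eta> l x) (at x)"
proof -
  let ?c = "complex_of_real" let ?g = "g_mode V n l x"
  have "(f1 \<eta> l has_vector_derivative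
     (?c (deriv \<eta> x) + ?c (\<eta> x) * - Pd l x) * - (Pd l x * ?g) +
     (?c (deriv (deriv \<eta>) x) + (?c (\<eta> x) * - Pdd l x + ?c (deriv \<eta> x) * - Pd l x)) * ?g) (at x)"
    unfolding f1_def[abs_def]
    by (intro has_vector_derivative_mult has_vector_derivative_add has_vector_derivative_minus
         test_fun_vector_deriv test_fun_deriv Pd_deriv g_deriv \<eta> l x)
  moreover have "(?c (deriv \<eta> x) + ?c (\<eta> x) * - Pd l x) * - (Pd l x * ?g) +
     (?c (deriv (deriv \<eta>) x) + (?c (\<eta> x) * - Pdd l x + ?c (deriv \<eta> x) * - Pd l x)) * ?g
     = (V x - ?c l) * (?c (\<eta> x) * ?g) - defect \<eta> l x"
    unfolding defect_def cut_error_def remainder_identity[OF l, symmetric] by (simp add: algebra_simps power2_eq_square)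
  ultimately show ?thesis by simp
qed

lemma Linf_loc_L2:
  assumes h: "Linf_loc h" and 0: "\<And>x. x \<notin> {-r..r} \<Longrightarrow> h x = 0"
  shows "L2_fun h"
  unfolding L2_fun_def
proof
  show m: "h \<in> borel_measurable lebesgue" using h by (rule Linf_loc_measurable)
  obtain C where C: "C \<ge> 0" "AE x in lebesgue. x \<in> {-r..r} \<longrightarrow> norm (h x) \<le> C" using Linf_loc_interval[OF h] by blast
  show "integrable lebesgue (\<lambda>x. (norm (h x))\<^sup>2)"
  proof (rule Bochner_Integration.integrable_bound)
    show "integrable lebesgue (\<lambda>x. indicat_real {-r..r} x *\<^sub>R C\<^sup>2)"
      using absolutely_integrable_on_const[of "{-r..r}" "C\<^sup>2"] by (simp add: set_integrable_def)
    show "(\<lambda>x. (norm (h x))\<^sup>2) \<in> borel_measurable lebesgue"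
      by (intro borel_measurable_power measurable_compose[OF m borel_measurable_norm])
    show "AE x in lebesgue. norm ((norm (h x))\<^sup>2) \<le> norm (indicat_real {-r..r} x *\<^sub>R C\<^sup>2)"
      using C(2)
    proof eventually_elim
      fix x assume "x \<in> {-r..r} \<longrightarrow> norm (h x) \<le> C"
      then show "norm ((norm (h x))\<^sup>2) \<le> norm (indicat_real {-r..r} x *\<^sub>R C\<^sup>2)"
        using 0[of x] by (cases "x \<in> {-r..r}") (auto intro: power_mono)
    qed
  qed
qed

text \<open>The first derivative of the pseudomode is Lipschitz, and the second one exists off \<open>Z\<close>. Two integrations
by parts therefore move both derivatives from the test function to the pseudomode.\<close>

lemma pseudomode_H_graph:
  assumes l: "l \<ge> l0" and \<eta>: "test_fun \<eta>"
  defines "f \<equiv> \<lambda>x. complex_of_real (\<eta> x) * g_mode V n l x"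
  shows "H_graph V f (\<lambda>x. complex_of_real l * f x + defect \<eta> l x)"
proof -
  let ?h = "\<lambda>x. complex_of_real l * f x + defect \<eta> l x"
  (* The second derivative of f, off Z. *)
  define f2 where "f2 x = (V x - complex_of_real l) * f x - defect \<eta> l x" for x
  have d1: "(f has_vector_derivative f1 \<eta> l x) (at x)" for x unfolding f_def by (rule f_deriv[OF l \<eta>])
  have flip: "loc_lip f"
    unfolding f_def by (intro loc_lip_mult test_fun_lip \<eta> g_lip l)
  have d2: "AE x in lebesgue. (f1 \<eta> l has_vector_derivative f2 x) (at x)"
    unfolding AE_lebesgue_negligible f2_def f_def using neg_Z f1_deriv[OF l \<eta>] by blast
  have f2L: "Linf_loc f2" by (rule loc_lip_deriv_Linf[OF f1_lip[OF l \<eta>] d2])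
  have VfL: "Linf_loc (\<lambda>x. V x * f x)"
    by (intro continuous_Linf_loc loc_lip_continuous loc_lip_mult V_lip flip)
  have h_eq: "?h = (\<lambda>x. V x * f x - f2 x)" by (auto simp: f2_def algebra_simps)
  have hL: "Linf_loc ?h" unfolding h_eq by (rule Linf_loc_diff[OF VfL f2L])
  obtain r0 r1 r2 where r: "\<And>x. x \<notin> {-r0..r0} \<Longrightarrow> \<eta> x = 0" "\<And>x. x \<notin> {-r1..r1} \<Longrightarrow> deriv \<eta> x = 0"
      "\<And>x. x \<notin> {-r2..r2} \<Longrightarrow> deriv (deriv \<eta>) x = 0"
    using test_fun_support[OF \<eta>] test_fun_support[OF test_fun_deriv[OF \<eta>]]
      test_fun_support[OF test_fun_deriv[OF test_fun_deriv[OF \<eta>]]] by metis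
  define r where "r = max r0 (max r1 r2)"
  have supp: "\<eta> x = 0" "deriv \<eta> x = 0" "deriv (deriv \<eta>) x = 0" if "x \<notin> {-r..r}" for x
    using that by (auto simp: r_def intro!: r)
  have L2f: "L2_fun f"
    by (rule Linf_loc_L2[of _ r]) (use supp in \<open>auto simp: f_def intro!: continuous_Linf_loc loc_lip_continuous flip[unfolded f_def]\<close>)
  have L2h: "L2_fun ?h"
    by (rule Linf_loc_L2[OF hL, of r]) (use supp in \<open>auto simp: f_def defect_def cut_error_def\<close>)
  have "(LINT x|lebesgue. \<phi> x *\<^sub>R (V x * f x) - (deriv ^^ 2) \<phi> x *\<^sub>R f x) = (LINT x|lebesgue. \<phi> x *\<^sub>R ?h x)"
    if \<phi>: "test_fun \<phi>" for \<phi>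
  proof -
    have \<phi>': "test_fun (deriv \<phi>)" "test_fun (deriv (deriv \<phi>))" using \<phi> test_fun_deriv by auto
    have i1: "integrable lebesgue (\<lambda>x. \<phi> x *\<^sub>R (V x * f x))"
      by (intro test_fun_integrable \<phi> Linf_loc_abs_integrable VfL)
    have i2: "integrable lebesgue (\<lambda>x. deriv (deriv \<phi>) x *\<^sub>R f x)"
      by (intro test_fun_integrable \<phi>' Linf_loc_abs_integrable continuous_Linf_loc loc_lip_continuous flip)
    have i3: "integrable lebesgue (\<lambda>x. \<phi> x *\<^sub>R f2 x)"
      by (intro test_fun_integrable \<phi> Linf_loc_abs_integrable f2L)
    have "(LINT x|lebesgue. deriv (deriv \<phi>) x *\<^sub>R f x) = - (LINT x|lebesgue. deriv \<phi> x *\<^sub>R f1 \<eta> l x)"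
      by (rule test_fun_ibp[OF \<phi>'(1) flip]) (use d1 in auto)
    also have "(LINT x|lebesgue. deriv \<phi> x *\<^sub>R f1 \<eta> l x) = - (LINT x|lebesgue. \<phi> x *\<^sub>R f2 x)"
      by (rule test_fun_ibp[OF \<phi> f1_lip[OF l \<eta>] d2])
    finally have "(LINT x|lebesgue. deriv (deriv \<phi>) x *\<^sub>R f x) = (LINT x|lebesgue. \<phi> x *\<^sub>R f2 x)" by simp
    moreover have "\<phi> x *\<^sub>R ?h x = \<phi> x *\<^sub>R (V x * f x) - \<phi> x *\<^sub>R f2 x" for x
      using fun_cong[OF h_eq, of x] by (simp add: scaleR_diff_right)
    ultimately show ?thesis using i1 i2 i3 by (simp add: numeral_2_eq_2)
  qed
  then show ?thesis unfolding H_graph_def using L2f L2h by blast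
qed

end

section \<open>Decay of the pseudomode and the norm of the defect\<close>

lemma sg_square [simp]: "sg s * (sg s * x) = x"
  by (cases s) auto

lemma abs_sg [simp]: "\<bar>sg s * x\<bar> = \<bar>x\<bar>"
  by (cases s) auto

lemma deriv_ge_imp_growth:
  fixes p :: "real \<Rightarrow> real"
  assumes "\<And>t. t \<in> {a..b} \<Longrightarrow> (p has_real_derivative p' t) (at t)" "\<And>t. t \<in> {a..b} \<Longrightarrow> m \<le> p' t" "a \<le> b"
  shows "m * (b - a) \<le> p b - p a"
proof (cases "a = b")
  case False
  then have "a < b" using assms(3) by simp
  then obtain z where z: "a < z" "z < b" "p b - p a = (b - a) * p' z" using MVT2[of a b p p'] assms(1) by auto
  then show ?thesis using assms(2)[of z] \<open>a < b\<close> by (simp add: mult.commute mult_left_mono)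
qed simp

lemma norm_L2_square: "(norm_L2 f)\<^sup>2 = (LINT x|lebesgue. (norm (f x))\<^sup>2)"
  by (simp add: norm_L2_def integral_nonneg_AE)

lemma norm_L2_nonneg: "0 \<le> norm_L2 f"
  by (simp add: norm_L2_def integral_nonneg_AE)

context wkb begin

text \<open>With \<open>q\<close> the square root of \<open>l - V\<close>, the identity \<open>2 Re q Im q = - Im V\<close> gives the leading part \<open>i q\<close> of
\<open>P'\<close> the real part \<open>Im V / (2 Re q)\<close>. Far out the corrections are less than half of it by the assumption \<open>small\<close>;
on the bounded part that is left, everything is bounded uniformly in \<open>l\<close>.\<close>

lemma Re_Pd_growth:
  assumes Jside: "\<And>l t. l \<ge> l0 \<Longrightarrow> 0 \<le> t \<Longrightarrow> t < \<delta> l \<Longrightarrow> sg s * t \<in> J l"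
    and sign: "\<And>t. X \<le> t \<Longrightarrow> 0 < sg s * Im (V (sg s * t))"
    and Uw: "\<And>r. \<exists>K. \<forall>x. \<bar>x\<bar> \<le> r \<longrightarrow> U x * w x \<le> K"
    and small: "\<And>\<eta>. 0 < \<eta> \<Longrightarrow> \<exists>X'. \<forall>\<^sub>F l in at_top. \<forall>t. X' \<le> t \<and> t < \<delta> l \<longrightarrow>
        U (sg s * t) * w (sg s * t) \<le> \<eta> * (sqrt l * \<bar>Im (V (sg s * t))\<bar>)"
  obtains X1 c1 C1 where "1 \<le> X1" "0 < c1" "0 \<le> C1"
    "\<forall>\<^sub>F l in at_top. \<forall>t. X1 \<le> t \<and> t < \<delta> l \<longrightarrow> c1 * (\<bar>Im (V (sg s * t))\<bar> / sqrt l) \<le> sg s * Re (Pd l (sg s * t))"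
    "\<forall>l\<ge>l0. \<forall>t. 0 \<le> t \<and> t \<le> X1 \<and> t < \<delta> l \<longrightarrow> \<bar>Re (Pd l (sg s * t))\<bar> \<le> C1"
proof -
  obtain C where C: "C \<ge> 0" "\<And>l x. l \<ge> l0 \<Longrightarrow> x \<in> J l \<Longrightarrow>
      norm (Pd l x - \<i> * csqrt (complex_of_real l - V x)) \<le> C * (U x * w x / l)"
    using Pd_near by blast
  define q where "q l x = csqrt (complex_of_real l - V x)" for l x
  have Re_q_pos: "0 < Re (q l x)" if "l \<ge> l0" for l x unfolding q_def using Re_csqrt_pos[OF slit[OF that]] .
  have ImRe: "2 * Re (q l x) * Im (q l x) = - Im (V x)" for l x
  proof -
    have "Im ((q l x)\<^sup>2) = - Im (V x)" by (simp add: q_def)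
    then show ?thesis by (simp add: power2_eq_square mult_ac)
  qed
  have main: "Re (\<i> * q l x) = Im (V x) / (2 * Re (q l x))" if "l \<ge> l0" for l x
    using ImRe[of l x] Re_q_pos[OF that, of x] by (simp add: field_simps)
  have err: "\<bar>Re (Pd l x) - Im (V x) / (2 * Re (q l x))\<bar> \<le> C * (U x * w x / l)" if "l \<ge> l0" "x \<in> J l" for l x
  proof -
    have "\<bar>Re (Pd l x - \<i> * q l x)\<bar> \<le> C * (U x * w x / l)"
      using order_trans[OF abs_Re_le_cmod C(2)[OF that]] unfolding q_def .
    moreover have "Re (Pd l x - \<i> * q l x) = Re (Pd l x) - Im (V x) / (2 * Re (q l x))"
      using main[OF that(1), of x] by (simp only: minus_complex.sel)
    ultimately show ?thesis by simp
  qed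
  have Re_q_upper: "Re (q l x) \<le> sqrt (1 + CU) * sqrt l" if "l \<ge> l0" "x \<in> J l" for l x
    using order_trans[OF complex_Re_le_cmod csqrt_bound[OF that]] unfolding q_def .
  have Re_q_lower: "1 / 2 \<le> Re (q l x)" if "l \<ge> l0" "x \<in> J l" for l x
  proof -
    have "1 \<le> l" using that(1) l0 by simp
    have "(1 / 2)\<^sup>2 \<le> l / 2" using \<open>1 \<le> l\<close> by (simp add: power2_eq_square)
    also have "l / 2 \<le> Re (complex_of_real l - V x)" using ReV[OF that] by simp
    also have "\<dots> = Re ((q l x)\<^sup>2)" by (simp add: q_def)
    also have "\<dots> \<le> (Re (q l x))\<^sup>2" by (simp add: power2_eq_square)
    finally have "(1 / 2)\<^sup>2 \<le> (Re (q l x))\<^sup>2" .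
    then show ?thesis by (rule power2_le_imp_le) (rule less_imp_le[OF Re_q_pos[OF that(1)]])
  qed
  (* Since Re q is at most sqrt (1 + CU) sqrt l, the leading part is at least c times |Im V| / sqrt
     l. The smallness parameter below makes C times the correction at most half of that. *)
  define c where "c = 1 / (2 * sqrt (1 + CU))"
  have sq_pos: "0 < sqrt (1 + CU)" using U_le(1) by simp
  then have cpos: "0 < c" by (simp add: c_def)
  have \<eta>pos: "0 < c / (2 * (C + 1))" using cpos C(1) by simp
  obtain X' where X': "\<forall>\<^sub>F l in at_top. \<forall>t. X' \<le> t \<and> t < \<delta> l \<longrightarrow>
        U (sg s * t) * w (sg s * t) \<le> (c / (2 * (C + 1))) * (sqrt l * \<bar>Im (V (sg s * t))\<bar>)"
    using small[OF \<eta>pos] by blast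
  define X1 where "X1 = max 1 (max X X')"
  obtain K where K: "\<And>x. \<bar>x\<bar> \<le> X1 \<Longrightarrow> U x * w x \<le> K" using Uw by blast
  obtain KV where KV: "KV \<ge> 0" "\<And>x. x \<in> {-X1..X1} \<Longrightarrow> norm (V x) \<le> KV"
    using continuous_bounded_interval[OF loc_lip_continuous[OF V_lip]] by metis
  show ?thesis
  proof (rule that[of X1 "c / 2" "KV + C * \<bar>K\<bar>"])
    show "\<forall>\<^sub>F l in at_top. \<forall>t. X1 \<le> t \<and> t < \<delta> l \<longrightarrow> c / 2 * (\<bar>Im (V (sg s * t))\<bar> / sqrt l) \<le> sg s * Re (Pd l (sg s * t))"
      using X' eventually_ge_at_top[of l0]
    proof eventually_elim
      fix l assume H: "\<forall>t. X' \<le> t \<and> t < \<delta> l \<longrightarrow>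
        U (sg s * t) * w (sg s * t) \<le> (c / (2 * (C + 1))) * (sqrt l * \<bar>Im (V (sg s * t))\<bar>)" and l: "l \<ge> l0"
      show "\<forall>t. X1 \<le> t \<and> t < \<delta> l \<longrightarrow> c / 2 * (\<bar>Im (V (sg s * t))\<bar> / sqrt l) \<le> sg s * Re (Pd l (sg s * t))"
      proof (intro allI impI)
        fix t assume t: "X1 \<le> t \<and> t < \<delta> l"
        let ?x = "sg s * t" let ?I = "\<bar>Im (V ?x)\<bar>"
        have t0: "0 \<le> t" "X \<le> t" "X' \<le> t" using t by (auto simp: X1_def)
        have xJ: "?x \<in> J l" using Jside l t t0 by auto
        have lp: "0 < l" "0 < sqrt l" using l_pos[OF l] by auto
        have sI: "sg s * Im (V ?x) = ?I"
          using sign[OF t0(2)] by (cases s) auto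
        have "c / sqrt l = 1 / (2 * (sqrt (1 + CU) * sqrt l))" by (simp add: c_def)
        also have "\<dots> \<le> 1 / (2 * Re (q l ?x))"
          using Re_q_upper[OF l xJ] Re_q_pos[OF l, of ?x] lp sq_pos by (intro divide_left_mono) auto
        finally have "?I * (c / sqrt l) \<le> ?I * (1 / (2 * Re (q l ?x)))" by (rule mult_left_mono) simp
        then have a: "c * (?I / sqrt l) \<le> sg s * (Im (V ?x) / (2 * Re (q l ?x)))"
          unfolding sI[symmetric] by (simp add: mult_ac)
        have "U ?x * w ?x / l \<le> (c / (2 * (C + 1))) * (sqrt l * ?I) / l"
          using H t t0 lp by (intro divide_right_mono) auto
        also have "\<dots> = (c / (2 * (C + 1))) * (?I * (sqrt l / l))" by simp
        also have "sqrt l / l = 1 / sqrt l" using lp by (simp add: field_simps)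
        finally have "C * (U ?x * w ?x / l) \<le> C * ((c / (2 * (C + 1))) * (?I * (1 / sqrt l)))"
          using C(1) by (rule mult_left_mono)
        also have "\<dots> = (C / (C + 1)) * (c / 2 * (?I / sqrt l))" by simp
        also have "\<dots> \<le> 1 * (c / 2 * (?I / sqrt l))"
          using C(1) cpos lp by (intro mult_right_mono) auto
        finally have b: "C * (U ?x * w ?x / l) \<le> c / 2 * (?I / sqrt l)" by simp
        have "\<bar>sg s * (Re (Pd l ?x) - Im (V ?x) / (2 * Re (q l ?x)))\<bar> \<le> C * (U ?x * w ?x / l)"
          using err[OF l xJ] by simp
        then have "sg s * Re (Pd l ?x) \<ge> sg s * (Im (V ?x) / (2 * Re (q l ?x))) - C * (U ?x * w ?x / l)"
          unfolding right_diff_distrib by linarith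
        moreover have "m / 2 \<le> r" if "a - e \<le> r" "m \<le> a" "e \<le> m / 2" for a e r m :: real
          using that by linarith
        moreover have half: "c / 2 * (?I / sqrt l) = c * (?I / sqrt l) / 2" by simp
        ultimately show "c / 2 * (?I / sqrt l) \<le> sg s * Re (Pd l ?x)" using a b unfolding half by blast
      qed
    qed
    show "\<forall>l\<ge>l0. \<forall>t. 0 \<le> t \<and> t \<le> X1 \<and> t < \<delta> l \<longrightarrow> \<bar>Re (Pd l (sg s * t))\<bar> \<le> KV + C * \<bar>K\<bar>"
    proof (intro allI impI)
      fix l t assume l: "l \<ge> l0" and t: "0 \<le> t \<and> t \<le> X1 \<and> t < \<delta> l"
      let ?x = "sg s * t"
      have xJ: "?x \<in> J l" using Jside l t by auto
      have lp: "1 \<le> l" using l l0 by simp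
      have x1: "\<bar>?x\<bar> \<le> X1" using t by simp
      then have "?x \<in> {-X1..X1}" unfolding atLeastAtMost_iff by linarith
      then have "norm (V ?x) \<le> KV" by (rule KV(2))
      then have iv: "\<bar>Im (V ?x)\<bar> \<le> KV" using abs_Im_le_cmod order_trans by blast
      have "\<bar>Im (V ?x) / (2 * Re (q l ?x))\<bar> = \<bar>Im (V ?x)\<bar> / (2 * Re (q l ?x))"
        using Re_q_pos[OF l, of ?x] by simp
      also have "\<dots> \<le> \<bar>Im (V ?x)\<bar> / 1" using Re_q_lower[OF l xJ] by (intro divide_left_mono) auto
      finally have a: "\<bar>Im (V ?x) / (2 * Re (q l ?x))\<bar> \<le> KV" using iv by simp
      have "0 \<le> U ?x * w ?x" using U_nonneg w_nonneg by simp
      then have "U ?x * w ?x / l \<le> U ?x * w ?x / 1" using lp by (intro divide_left_mono) auto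
      then have "U ?x * w ?x / l \<le> \<bar>K\<bar>" using K[OF x1] by simp
      then have "C * (U ?x * w ?x / l) \<le> C * \<bar>K\<bar>" using C(1) by (rule mult_left_mono)
      then show "\<bar>Re (Pd l ?x)\<bar> \<le> KV + C * \<bar>K\<bar>" using err[OF l xJ] a by linarith
    qed
  qed (use C(1) KV(1) cpos in \<open>auto simp: X1_def\<close>)
qed

lemma phase_deriv:
  assumes "l \<ge> l0"
  shows "((\<lambda>t. Re (P l (sg s * t))) has_real_derivative sg s * Re (Pd l (sg s * t))) (at t)"
proof -
  have 1: "((\<lambda>t. sg s * t) has_vector_derivative sg s) (at t)" by (auto intro!: derivative_eq_intros)
  have "((\<lambda>t. P l (sg s * t)) has_vector_derivative sg s *\<^sub>R Pd l (sg s * t)) (at t)"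
    using vector_diff_chain_at[OF 1 P_deriv[OF assms]] by (simp add: o_def)
  then have "((\<lambda>t. Re (P l (sg s * t))) has_vector_derivative Re (sg s *\<^sub>R Pd l (sg s * t))) (at t)"
    by (rule bounded_linear.has_vector_derivative[OF bounded_linear_Re])
  then show ?thesis by (simp add: has_real_derivative_iff_has_vector_derivative)
qed

lemma norm_g: "norm (g_mode V n l x) = exp (- Re (P l x))"
  by (simp add: g_mode_P norm_exp_eq_Re)

text \<open>The real part of the phase starts at \<open>0\<close>, loses at most a constant on \<open>[0, X1]\<close>, then is
nondecreasing up to \<open>\<delta>\<close>, and gains a multiple of \<open>E\<close> while crossing \<open>[\<delta> - 2 \<Delta>, \<delta> - \<Delta>]\<close>. The lower
bound near the origin is what keeps the norm of the pseudomode away from zero.\<close>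

lemma g_decay:
  assumes Jside: "\<And>l t. l \<ge> l0 \<Longrightarrow> 0 \<le> t \<Longrightarrow> t < \<delta> l \<Longrightarrow> sg s * t \<in> J l"
    and sign: "\<And>t. X \<le> t \<Longrightarrow> 0 < sg s * Im (V (sg s * t))"
    and Uw: "\<And>r. \<exists>K. \<forall>x. \<bar>x\<bar> \<le> r \<longrightarrow> U x * w x \<le> K"
    and small: "\<And>\<eta>. 0 < \<eta> \<Longrightarrow> \<exists>X'. \<forall>\<^sub>F l in at_top. \<forall>t. X' \<le> t \<and> t < \<delta> l \<longrightarrow>
        U (sg s * t) * w (sg s * t) \<le> \<eta> * (sqrt l * \<bar>Im (V (sg s * t))\<bar>)"
    and \<delta>: "filterlim \<delta> at_top at_top"
    and \<Delta>: "\<forall>\<^sub>F l in at_top. 0 < \<Delta> l \<and> \<Delta> l \<le> \<delta> l / 4"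
    and c: "0 < c" "\<forall>\<^sub>F l in at_top. \<forall>t\<in>{\<delta> l - 2 * \<Delta> l..\<delta> l - \<Delta> l}. c * (sqrt l * E l) \<le> \<Delta> l * \<bar>Im (V (sg s * t))\<bar>"
  obtains c2 C2 where "0 < c2" "0 < C2"
    "\<forall>\<^sub>F l in at_top. \<forall>t. \<delta> l - \<Delta> l \<le> t \<and> t < \<delta> l \<longrightarrow> norm (g_mode V n l (sg s * t)) \<le> C2 * exp (- (c2 * E l))"
    "\<forall>\<^sub>F l in at_top. \<forall>t. 0 \<le> t \<and> t \<le> 1 \<longrightarrow> C2 \<ge> 1 \<and> norm (g_mode V n l (sg s * t)) \<ge> 1 / C2"
proof -
  obtain X1 c1 C1 where X1: "1 \<le> X1" "0 < c1" "0 \<le> C1"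
    "\<forall>\<^sub>F l in at_top. \<forall>t. X1 \<le> t \<and> t < \<delta> l \<longrightarrow> c1 * (\<bar>Im (V (sg s * t))\<bar> / sqrt l) \<le> sg s * Re (Pd l (sg s * t))"
    "\<forall>l\<ge>l0. \<forall>t. 0 \<le> t \<and> t \<le> X1 \<and> t < \<delta> l \<longrightarrow> \<bar>Re (Pd l (sg s * t))\<bar> \<le> C1"
    using Re_Pd_growth[OF Jside sign Uw small] by blast
  have big: "\<forall>\<^sub>F l in at_top. 2 * X1 < \<delta> l" using \<delta> by (simp add: filterlim_at_top_dense)
  define p where "p l t = Re (P l (sg s * t))" for l t
  have p0: "p l 0 = 0" for l by (simp add: p_def P_0)
  have dp: "(p l has_real_derivative sg s * Re (Pd l (sg s * t))) (at t)" if "l \<ge> l0" for l t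
    unfolding p_def using phase_deriv[OF that] .
  have inner: "\<bar>p l t\<bar> \<le> C1 * t" if l: "l \<ge> l0" "2 * X1 < \<delta> l" and t: "0 \<le> t" "t \<le> X1" for l t
  proof -
    have b: "- C1 \<le> sg s * Re (Pd l (sg s * \<tau>))" "- C1 \<le> - (sg s * Re (Pd l (sg s * \<tau>)))"
      if "\<tau> \<in> {0..t}" for \<tau>
    proof -
      have "\<bar>Re (Pd l (sg s * \<tau>))\<bar> \<le> C1" using X1(1,5) l t that by auto
      then have "\<bar>sg s * Re (Pd l (sg s * \<tau>))\<bar> \<le> C1" unfolding abs_sg .
      then show "- C1 \<le> sg s * Re (Pd l (sg s * \<tau>))" "- C1 \<le> - (sg s * Re (Pd l (sg s * \<tau>)))"
        by linarith+
    qed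
    have "- C1 * (t - 0) \<le> p l t - p l 0"
      by (rule deriv_ge_imp_growth[OF dp[OF l(1)]]) (use b(1) t in blast, use t in simp)
    moreover have "- C1 * (t - 0) \<le> - p l t - - p l 0"
      by (rule deriv_ge_imp_growth[OF DERIV_minus[OF dp[OF l(1)]]]) (use b(2) t in blast, use t in simp)
    ultimately show ?thesis using p0 by simp
  qed
  define C2 where "C2 = exp (C1 * X1)"
  have C2: "1 \<le> C2" using X1 by (simp add: C2_def)
  show ?thesis
  proof (rule that[of "c1 * c" C2])
    show "\<forall>\<^sub>F l in at_top. \<forall>t. 0 \<le> t \<and> t \<le> 1 \<longrightarrow> C2 \<ge> 1 \<and> norm (g_mode V n l (sg s * t)) \<ge> 1 / C2"
      using big eventually_ge_at_top[of l0]
    proof eventually_elim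
      fix l assume l: "2 * X1 < \<delta> l" "l \<ge> l0"
      show "\<forall>t. 0 \<le> t \<and> t \<le> 1 \<longrightarrow> C2 \<ge> 1 \<and> norm (g_mode V n l (sg s * t)) \<ge> 1 / C2"
      proof (intro allI impI conjI C2)
        fix t :: real assume t: "0 \<le> t \<and> t \<le> 1"
        then have "\<bar>p l t\<bar> \<le> C1 * t" using inner[OF l(2,1)] X1(1) by auto
        also have "\<dots> \<le> C1 * X1" using t X1 by (intro mult_left_mono) auto
        finally have "exp (- (C1 * X1)) \<le> exp (- p l t)" by simp
        then show "1 / C2 \<le> norm (g_mode V n l (sg s * t))" by (simp add: norm_g p_def C2_def exp_minus inverse_eq_divide)
      qed
    qed
    show "\<forall>\<^sub>F l in at_top. \<forall>t. \<delta> l - \<Delta> l \<le> t \<and> t < \<delta> l \<longrightarrow> norm (g_mode V n l (sg s * t)) \<le> C2 * exp (- (c1 * c * E l))"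
      using big eventually_ge_at_top[of l0] \<Delta> c(2) X1(4)
    proof eventually_elim
      fix l assume l: "2 * X1 < \<delta> l" "l \<ge> l0" and D: "0 < \<Delta> l \<and> \<Delta> l \<le> \<delta> l / 4"
        and lower: "\<forall>t\<in>{\<delta> l - 2 * \<Delta> l..\<delta> l - \<Delta> l}. c * (sqrt l * E l) \<le> \<Delta> l * \<bar>Im (V (sg s * t))\<bar>"
        and growth: "\<forall>t. X1 \<le> t \<and> t < \<delta> l \<longrightarrow> c1 * (\<bar>Im (V (sg s * t))\<bar> / sqrt l) \<le> sg s * Re (Pd l (sg s * t))"
      have lp: "0 < sqrt l" using l_pos[OF l(2)] by simp
      have a: "X1 \<le> \<delta> l - 2 * \<Delta> l" using l(1) D by simp
      show "\<forall>t. \<delta> l - \<Delta> l \<le> t \<and> t < \<delta> l \<longrightarrow> norm (g_mode V n l (sg s * t)) \<le> C2 * exp (- (c1 * c * E l))"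
      proof (intro allI impI)
        fix t assume t: "\<delta> l - \<Delta> l \<le> t \<and> t < \<delta> l"
        have nonneg: "0 \<le> sg s * Re (Pd l (sg s * \<tau>))" if "X1 \<le> \<tau>" "\<tau> < \<delta> l" for \<tau>
        proof -
          have "0 \<le> c1 * (\<bar>Im (V (sg s * \<tau>))\<bar> / sqrt l)" using X1(2) lp by simp
          then show ?thesis using growth that by (meson order_trans)
        qed
        have 1: "- (C1 * X1) \<le> p l X1" using inner[OF l(2,1), of X1] X1(1) by auto
        have 2: "0 * (\<delta> l - 2 * \<Delta> l - X1) \<le> p l (\<delta> l - 2 * \<Delta> l) - p l X1"
          by (rule deriv_ge_imp_growth[OF dp[OF l(2)]]) (use nonneg a D in auto)
        have 3: "(c1 * c * E l / \<Delta> l) * ((\<delta> l - \<Delta> l) - (\<delta> l - 2 * \<Delta> l)) \<le> p l (\<delta> l - \<Delta> l) - p l (\<delta> l - 2 * \<Delta> l)"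
        proof (rule deriv_ge_imp_growth[OF dp[OF l(2)]])
          fix \<tau> assume \<tau>: "\<tau> \<in> {\<delta> l - 2 * \<Delta> l..\<delta> l - \<Delta> l}"
          have "c * (sqrt l * E l) \<le> \<Delta> l * \<bar>Im (V (sg s * \<tau>))\<bar>" using lower \<tau> by blast
          then have "c * E l / \<Delta> l \<le> \<bar>Im (V (sg s * \<tau>))\<bar> / sqrt l" using lp D by (simp add: field_simps)
          then have "c1 * (c * E l / \<Delta> l) \<le> c1 * (\<bar>Im (V (sg s * \<tau>))\<bar> / sqrt l)"
            using X1(2) by (intro mult_left_mono) auto
          also have "\<dots> \<le> sg s * Re (Pd l (sg s * \<tau>))" using growth \<tau> a D by auto
          finally show "c1 * c * E l / \<Delta> l \<le> sg s * Re (Pd l (sg s * \<tau>))" by simp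
        qed (use D in auto)
        have 4: "0 * (t - (\<delta> l - \<Delta> l)) \<le> p l t - p l (\<delta> l - \<Delta> l)"
          by (rule deriv_ge_imp_growth[OF dp[OF l(2)]]) (use nonneg a D t in auto)
        have "(c1 * c * E l / \<Delta> l) * ((\<delta> l - \<Delta> l) - (\<delta> l - 2 * \<Delta> l)) = c1 * c * E l" using D by simp
        then have "c1 * c * E l - C1 * X1 \<le> p l t" using 1 2 3 4 by simp
        then have "exp (- p l t) \<le> exp (C1 * X1 + - (c1 * c * E l))" by simp
        then show "norm (g_mode V n l (sg s * t)) \<le> C2 * exp (- (c1 * c * E l))"
          unfolding C2_def exp_add[symmetric] by (simp add: norm_g p_def)
      qed
    qed
  qed (use X1(2) c(1) C2 in auto)
qed

text \<open>Pointwise, \<open>\<bar>a + b\<bar>\<^sup>2 \<le> 2 \<bar>a\<bar>\<^sup>2 + 2 \<bar>b\<bar>\<^sup>2\<close> with \<open>a\<close> the cut-off error and \<open>b\<close> the remainder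
part; then integrate. The half-lines are treated separately as each has its own cut-off scale, and the origin, which
belongs to neither, is a null set.\<close>

lemma norm_defect_bound:
  assumes l: "l \<ge> l0" and \<eta>: "test_fun \<eta>"
    and \<delta>: "\<And>s. 0 \<le> \<delta> s" and K: "\<And>s. 0 \<le> K s" and S: "0 \<le> S"
    and cut: "\<And>s. AE x in lebesgue. 0 < sg s * x \<longrightarrow> norm (cut_error \<eta> l x) \<le> (if sg s * x \<le> \<delta> s then K s else 0)"
    and rem: "AE x in lebesgue. \<eta> x \<noteq> 0 \<longrightarrow> norm (rem l x) \<le> S"
  defines "f \<equiv> \<lambda>x. complex_of_real (\<eta> x) * g_mode V n l x"
  shows "norm_L2 (defect \<eta> l) \<le> 2 * (K Minus * sqrt (\<delta> Minus) + K Plus * sqrt (\<delta> Plus)) + 2 * S * norm_L2 f"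
proof -
  have L2f: "L2_fun f" using pseudomode_H_graph[OF l \<eta>] unfolding H_graph_def f_def by blast
  define H where "H x = 2 * (K Minus)\<^sup>2 * indicat_real {- \<delta> Minus..0} x + 2 * (K Plus)\<^sup>2 * indicat_real {0..\<delta> Plus} x
      + 2 * S\<^sup>2 * (norm (f x))\<^sup>2" for x
  have iI: "integrable lebesgue (indicat_real {a..b})" for a b :: real
    using absolutely_integrable_on_const[of "{a..b}" "1::real"] by (simp add: set_integrable_def)
  have vI: "(LINT x|lebesgue. indicat_real {a..b} x) = b - a" if "a \<le> b" for a b :: real
    using that by simp
  have fI: "integrable lebesgue (\<lambda>x. (norm (f x))\<^sup>2)" using L2f by (simp add: L2_fun_def)
  have HI: "integrable lebesgue H" unfolding H_def
    by (intro Bochner_Integration.integrable_add integrable_mult_right iI fI)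
  have Hv: "(LINT x|lebesgue. H x) = 2 * (K Minus)\<^sup>2 * \<delta> Minus + 2 * (K Plus)\<^sup>2 * \<delta> Plus + 2 * S\<^sup>2 * (norm_L2 f)\<^sup>2"
    unfolding H_def norm_L2_square using iI fI \<delta> by simp
  have "(LINT x|lebesgue. (norm (defect \<eta> l x))\<^sup>2) \<le> (LINT x|lebesgue. H x)"
  proof (rule integral_mono_AE')
    show "integrable lebesgue H" by (rule HI)
    have n0: "AE x in lebesgue. x \<noteq> (0::real)"
      unfolding AE_lebesgue_negligible by (rule exI[of _ "{0}"]) auto
    show "AE x in lebesgue. (norm (defect \<eta> l x))\<^sup>2 \<le> H x"
      using cut[of Minus] cut[of Plus] rem n0
    proof eventually_elim
      fix x :: real
      assume cM: "0 < sg Minus * x \<longrightarrow> norm (cut_error \<eta> l x) \<le> (if sg Minus * x \<le> \<delta> Minus then K Minus else 0)"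
        and cP: "0 < sg Plus * x \<longrightarrow> norm (cut_error \<eta> l x) \<le> (if sg Plus * x \<le> \<delta> Plus then K Plus else 0)"
        and r: "\<eta> x \<noteq> 0 \<longrightarrow> norm (rem l x) \<le> S" and x: "x \<noteq> 0"
      let ?a = "norm (cut_error \<eta> l x)" let ?b = "S * norm (f x)"
      have b: "norm (rem l x * f x) \<le> ?b"
        using r by (cases "\<eta> x = 0") (auto simp: norm_mult f_def intro!: mult_right_mono)
      have "norm (defect \<eta> l x) \<le> ?a + ?b"
        unfolding defect_def f_def[symmetric] using b norm_triangle_ineq[of "cut_error \<eta> l x" "rem l x * f x"]
        by (simp add: f_def)
      then have "(norm (defect \<eta> l x))\<^sup>2 \<le> (?a + ?b)\<^sup>2" by (intro power_mono) auto
      also have "\<dots> \<le> 2 * ?a\<^sup>2 + 2 * ?b\<^sup>2" using sum_squares_bound[of ?a ?b] by (simp add: power2_sum)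
      finally have 1: "(norm (defect \<eta> l x))\<^sup>2 \<le> 2 * ?a\<^sup>2 + 2 * ?b\<^sup>2" .
      have 2: "?a\<^sup>2 \<le> (K Minus)\<^sup>2 * indicat_real {- \<delta> Minus..0} x + (K Plus)\<^sup>2 * indicat_real {0..\<delta> Plus} x"
      proof (cases "0 < x")
        case True
        then have "?a \<le> (if x \<le> \<delta> Plus then K Plus else 0)" using cP by simp
        then have "?a\<^sup>2 \<le> (if x \<le> \<delta> Plus then K Plus else 0)\<^sup>2" by (intro power_mono) auto
        also have "\<dots> = (K Plus)\<^sup>2 * indicat_real {0..\<delta> Plus} x" using True by (auto simp: indicator_def)
        finally show ?thesis by (simp add: add_increasing)
      next
        case False
        then have "x < 0" using x by simp
        then have "?a \<le> (if - x \<le> \<delta> Minus then K Minus else 0)" using cM by simp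
        then have "?a\<^sup>2 \<le> (if - x \<le> \<delta> Minus then K Minus else 0)\<^sup>2" by (intro power_mono) auto
        also have "\<dots> = (K Minus)\<^sup>2 * indicat_real {- \<delta> Minus..0} x" using \<open>x < 0\<close> by (auto simp: indicator_def)
        finally show ?thesis by (simp add: add_increasing2)
      qed
      show "(norm (defect \<eta> l x))\<^sup>2 \<le> H x" using 1 2 unfolding H_def by (simp add: power_mult_distrib)
    qed
    show "AE x in lebesgue. 0 \<le> H x"
      unfolding H_def by (intro AE_I2 add_nonneg_nonneg) auto
  qed
  then have "(norm_L2 (defect \<eta> l))\<^sup>2 \<le> 2 * (K Minus)\<^sup>2 * \<delta> Minus + 2 * (K Plus)\<^sup>2 * \<delta> Plus + 2 * S\<^sup>2 * (norm_L2 f)\<^sup>2"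
    unfolding norm_L2_square Hv[unfolded norm_L2_square] .
  also have "\<dots> = 2 * (K Minus * sqrt (\<delta> Minus))\<^sup>2 + 2 * (K Plus * sqrt (\<delta> Plus))\<^sup>2 + 2 * (S * norm_L2 f)\<^sup>2"
    using \<delta> by (simp add: power_mult_distrib)
  also have "\<dots> \<le> (2 * (K Minus * sqrt (\<delta> Minus) + K Plus * sqrt (\<delta> Plus)) + 2 * S * norm_L2 f)\<^sup>2"
  proof -
    have "2 * a\<^sup>2 + 2 * b\<^sup>2 + 2 * c\<^sup>2 \<le> (2 * (a + b) + 2 * c)\<^sup>2" if "0 \<le> a" "0 \<le> b" "0 \<le> c" for a b c :: real
    proof -
      have "(2 * (a + b) + 2 * c)\<^sup>2 = 4 * a\<^sup>2 + 4 * b\<^sup>2 + 4 * c\<^sup>2 + 8 * (a * b) + 8 * (a * c) + 8 * (b * c)"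
        by (simp add: power2_eq_square algebra_simps)
      moreover have "0 \<le> a * b" "0 \<le> a * c" "0 \<le> b * c" "0 \<le> a\<^sup>2" "0 \<le> b\<^sup>2" "0 \<le> c\<^sup>2" using that by auto
      ultimately show ?thesis by linarith
    qed
    from this[of "K Minus * sqrt (\<delta> Minus)" "K Plus * sqrt (\<delta> Plus)" "S * norm_L2 f"]
    show ?thesis using \<delta> K S norm_L2_nonneg by (simp add: mult.assoc)
  qed
  finally show ?thesis
    by (rule power2_le_imp_le)
       (intro add_nonneg_nonneg mult_nonneg_nonneg real_sqrt_ge_zero \<delta> K S norm_L2_nonneg, simp_all)
qed

end

section \<open>Powers, exponentials and the Japanese bracket\<close>

lemma filterlim_powr_at_top: assumes "0 < a" shows "filterlim (\<lambda>x::real. x powr a) at_top at_top"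
  unfolding filterlim_at_top
proof
  fix M :: real
  show "\<forall>\<^sub>F x in at_top. M \<le> x powr a"
    using eventually_ge_at_top[of "max 1 (\<bar>M\<bar> powr (1 / a))"]
  proof eventually_elim
    fix x :: real assume x: "max 1 (\<bar>M\<bar> powr (1 / a)) \<le> x"
    have "M \<le> \<bar>M\<bar> powr 1" by simp
    also have "\<dots> = (\<bar>M\<bar> powr (1 / a)) powr a" using assms by (simp only: powr_powr) simp
    also have "\<dots> \<le> x powr a" using x assms by (intro powr_mono2) auto
    finally show "M \<le> x powr a" .
  qed
qed

lemma powr_dominates:
  fixes p r M \<eta> :: real
  assumes "0 < r" "0 < \<eta>"
  shows "\<forall>\<^sub>F d in at_top. M * d powr p \<le> \<eta> * d powr (p + r)"
proof -
  have "\<forall>\<^sub>F d in at_top. M / \<eta> \<le> d powr r"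
    using filterlim_powr_at_top[OF assms(1)] by (simp add: filterlim_at_top)
  then show ?thesis
  proof eventually_elim
    fix d :: real assume "M / \<eta> \<le> d powr r"
    then have "M \<le> \<eta> * d powr r" using assms(2) by (simp add: field_simps)
    then have "M * d powr p \<le> (\<eta> * d powr r) * d powr p" by (rule mult_right_mono) simp
    then show "M * d powr p \<le> \<eta> * d powr (p + r)" by (simp add: powr_add mult_ac)
  qed
qed

lemma linear_le_exp_powr:
  fixes a \<eta> :: real
  assumes "0 < a" "0 < \<eta>"
  shows "\<forall>\<^sub>F x in at_top. x \<le> exp (\<eta> * x powr a)"
proof -
  have "\<forall>\<^sub>F x in at_top. 1 / (a / 2) * x powr (a / 2) \<le> \<eta> * x powr (a / 2 + a / 2)"
    using assms by (intro powr_dominates) auto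
  then show ?thesis
    using eventually_ge_at_top[of 1]
  proof eventually_elim
  fix x :: real assume h: "1 / (a / 2) * x powr (a / 2) \<le> \<eta> * x powr (a / 2 + a / 2)" and x: "1 \<le> x"
  have "ln x \<le> x powr (a / 2) / (a / 2)" using x assms by (intro ln_powr_bound) auto
  also have "\<dots> \<le> \<eta> * x powr a" using h by (simp add: mult.commute)
  finally have "exp (ln x) \<le> exp (\<eta> * x powr a)" by simp
  then show "x \<le> exp (\<eta> * x powr a)" using x by simp
  qed
qed

lemma japanese_ge_1: "1 \<le> japanese x"
  by (simp add: japanese_def)

lemma japanese_pos: "0 < japanese x"
  using japanese_ge_1[of x] by linarith

lemma japanese_sg [simp]: "japanese (sg s * x) = japanese x"
  by (cases s) (auto simp: japanese_def)

lemma japanese_ge_abs: "\<bar>x\<bar> \<le> japanese x"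
  unfolding japanese_def by (rule real_le_rsqrt) simp

lemma japanese_le: "japanese x \<le> 1 + \<bar>x\<bar>"
  unfolding japanese_def by (rule real_le_lsqrt) (auto simp: power2_sum)

lemma japanese_le_2: "1 \<le> x \<Longrightarrow> japanese x \<le> 2 * x"
  using japanese_le[of x] by simp

lemma japanese_mono: "0 \<le> x \<Longrightarrow> x \<le> y \<Longrightarrow> japanese x \<le> japanese y"
  unfolding japanese_def by (simp add: power_mono)

lemma continuous_japanese: "continuous_on A japanese"
  unfolding japanese_def by (intro continuous_intros)

lemma continuous_japanese_powr: "continuous_on A (\<lambda>x. japanese x powr \<mu>)"
  by (intro continuous_on_powr continuous_japanese continuous_on_const) (simp add: less_imp_neq[OF japanese_pos, symmetric])

lemma powr_ratio_bound:
  fixes y d \<mu> :: real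
  assumes "0 < d" "d / 2 \<le> y" "y \<le> 2 * d"
  shows "y powr \<mu> \<le> 2 powr \<bar>\<mu>\<bar> * d powr \<mu>" "d powr \<mu> \<le> 2 powr \<bar>\<mu>\<bar> * y powr \<mu>"
proof -
  have gen: "a powr \<mu> \<le> 2 powr \<bar>\<mu>\<bar> * b powr \<mu>" if ab: "0 < a" "0 < b" "a \<le> 2 * b" "b \<le> 2 * a" for a b :: real
  proof (cases "0 \<le> \<mu>")
    case True
    then have "a powr \<mu> \<le> (2 * b) powr \<mu>" using ab by (intro powr_mono2) auto
    then show ?thesis using True ab by (simp add: powr_mult)
  next
    case False
    then have "a powr \<mu> \<le> (b / 2) powr \<mu>" using ab by (intro powr_mono2') auto
    also have "\<dots> = 2 powr \<bar>\<mu>\<bar> * b powr \<mu>" using False ab by (simp add: powr_divide powr_minus field_simps)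
    finally show ?thesis .
  qed
  show "y powr \<mu> \<le> 2 powr \<bar>\<mu>\<bar> * d powr \<mu>" "d powr \<mu> \<le> 2 powr \<bar>\<mu>\<bar> * y powr \<mu>"
    using assms by (auto intro!: gen)
qed

lemma japanese_powr_bounds:
  fixes x \<mu> :: real
  assumes "1 \<le> x"
  shows "japanese x powr \<mu> \<le> 2 powr \<bar>\<mu>\<bar> * x powr \<mu>" "x powr \<mu> \<le> 2 powr \<bar>\<mu>\<bar> * japanese x powr \<mu>"
  using powr_ratio_bound[of x "japanese x" \<mu>] assms japanese_le_2[of x] japanese_ge_abs[of x] by auto

lemma japanese_powr_le_max:
  assumes "0 \<le> t" "t \<le> d" "1 \<le> d"
  shows "japanese t powr \<mu> \<le> 2 powr \<bar>\<mu>\<bar> * d powr (max \<mu> 0)"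
proof (cases "0 \<le> \<mu>")
  case True
  have "japanese t \<le> 2 * d" using japanese_mono[OF assms(1,2)] japanese_le_2[OF assms(3)] by linarith
  then have "japanese t powr \<mu> \<le> (2 * d) powr \<mu>" using True japanese_pos[of t] by (intro powr_mono2) auto
  then show ?thesis using True assms by (simp add: powr_mult)
next
  case False
  have "japanese t powr \<mu> \<le> japanese t powr 0" using False japanese_ge_1[of t] by (intro powr_mono) auto
  also have "\<dots> = 1" using japanese_pos[of t] by simp
  also have "\<dots> \<le> 2 powr \<bar>\<mu>\<bar> * d powr (max \<mu> 0)" using False assms(3) by (simp add: ge_one_powr_ge_zero)
  finally show ?thesis .
qed

section \<open>Geometry of a bounded end\<close>

text \<open>Everything the estimate uses about one end, parametrised by \<open>t \<ge> 0\<close>. Clauses three to six serve, in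
this order: the symbol calculus on \<open>J\<close>; the smallness of the corrections to the leading part of the phase; the
growth of the phase over the window in front of the support of \<open>\<xi>'\<close>, measured by the exponent \<open>E\<close>; and the
absorption of all polynomial factors.\<close>

definition end_geometry ::
  "(real \<Rightarrow> complex) \<Rightarrow> real \<Rightarrow> (real \<Rightarrow> real) \<Rightarrow> (real \<Rightarrow> real) \<Rightarrow> (real \<Rightarrow> real) \<Rightarrow> bool" where
  "end_geometry v \<nu> \<delta> \<Delta> E \<longleftrightarrow>
     filterlim \<delta> at_top at_top \<and>
     (\<forall>\<^sub>F l in at_top. 0 < \<Delta> l \<and> \<Delta> l \<le> \<delta> l / 4) \<and>
     (\<exists>C\<ge>0. \<forall>\<^sub>F l in at_top. \<forall>t. 0 \<le> t \<and> t < \<delta> l \<longrightarrow>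
        norm (v t) + 1 \<le> C * l \<and> Re (v t) \<le> l / 2 \<and> japanese t powr \<nu> \<le> C * sqrt l) \<and>
     (\<forall>\<eta>>0. \<exists>X. \<forall>\<^sub>F l in at_top. \<forall>t. X \<le> t \<and> t < \<delta> l \<longrightarrow>
        (norm (v t) + 1) * japanese t powr \<nu> \<le> \<eta> * (sqrt l * \<bar>Im (v t)\<bar>)) \<and>
     (\<exists>c>0. \<forall>\<^sub>F l in at_top. \<forall>t\<in>{\<delta> l - 2 * \<Delta> l..\<delta> l - \<Delta> l}. c * (sqrt l * E l) \<le> \<Delta> l * \<bar>Im (v t)\<bar>) \<and>
     (\<forall>\<eta>>0. \<forall>\<^sub>F l in at_top. l \<le> exp (\<eta> * E l) \<and> 1 / \<Delta> l \<le> exp (\<eta> * E l) \<and> \<delta> l \<le> exp (\<eta> * E l))"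

text \<open>At a bounded end only the weight can grow. Up to \<open>\<delta>\<close> it is \<open>O(l\<^sup>\<theta>)\<close> with \<open>\<theta> < 1/2\<close>, and this is where
\<open>\<epsilon> < 1 - \<nu>\<close> enters.\<close>

lemma bounded_end_geometry:
  fixes v :: "real \<Rightarrow> complex" and \<nu> \<epsilon> :: real
  assumes bdd: "\<And>t. 0 \<le> t \<Longrightarrow> norm (v t) \<le> M"
    and c0: "0 < c0" "\<And>t. X \<le> t \<Longrightarrow> c0 \<le> \<bar>Im (v t)\<bar>"
    and \<epsilon>: "0 < \<epsilon>" "\<epsilon> < 1 - \<nu>"
  defines "\<delta> \<equiv> \<lambda>l. l powr ((1 + \<epsilon>) / 2)"
  shows "end_geometry v \<nu> \<delta> (\<lambda>l. \<delta> l / 4) (\<lambda>l. l powr (\<epsilon> / 2))"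
proof -
  have M: "0 \<le> M" using bdd[of 0] norm_ge_zero[of "v 0"] by linarith
  define \<theta> where "\<theta> = (1 + \<epsilon>) / 2 * max \<nu> 0"
  have \<theta>: "0 \<le> \<theta>" "\<theta> < 1 / 2"
  proof -
    show "0 \<le> \<theta>" using \<epsilon> by (simp add: \<theta>_def)
    show "\<theta> < 1 / 2"
    proof (cases "0 < \<nu>")
      case True
      (* Here (2 - nu) nu = 1 - (1 - nu)^2. *)
      have "(1 + \<epsilon>) * \<nu> < (2 - \<nu>) * \<nu>" using True \<epsilon> by (intro mult_strict_right_mono) auto
      also have "\<dots> \<le> 1" using zero_le_power2[of "1 - \<nu>"] by (simp add: power2_eq_square algebra_simps)
      finally show ?thesis using True by (simp add: \<theta>_def)
    qed (simp add: \<theta>_def)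
  qed
  have \<delta>1: "1 \<le> \<delta> l" if "1 \<le> l" for l
    using that \<epsilon> unfolding \<delta>_def by (intro ge_one_powr_ge_zero) auto
  have w: "japanese t powr \<nu> \<le> 2 powr \<bar>\<nu>\<bar> * l powr \<theta>" if "1 \<le> l" "0 \<le> t" "t < \<delta> l" for l t
  proof -
    have "japanese t powr \<nu> \<le> 2 powr \<bar>\<nu>\<bar> * \<delta> l powr (max \<nu> 0)"
      using that \<delta>1[OF that(1)] by (intro japanese_powr_le_max) auto
    then show ?thesis by (simp add: \<delta>_def powr_powr \<theta>_def)
  qed
  have lim: "filterlim \<delta> at_top at_top"
    unfolding \<delta>_def using \<epsilon> by (intro filterlim_powr_at_top) auto
  show ?thesis
    unfolding end_geometry_def
  proof (intro conjI)
    show "filterlim \<delta> at_top at_top" by (rule lim)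
    show "\<forall>\<^sub>F l in at_top. 0 < \<delta> l / 4 \<and> \<delta> l / 4 \<le> \<delta> l / 4"
      using eventually_ge_at_top[of 1]
    proof eventually_elim
      fix l :: real assume "1 \<le> l"
      then show "0 < \<delta> l / 4 \<and> \<delta> l / 4 \<le> \<delta> l / 4" using \<delta>1[of l] by simp
    qed
    show "\<exists>C\<ge>0. \<forall>\<^sub>F l in at_top. \<forall>t. 0 \<le> t \<and> t < \<delta> l \<longrightarrow>
        norm (v t) + 1 \<le> C * l \<and> Re (v t) \<le> l / 2 \<and> japanese t powr \<nu> \<le> C * sqrt l"
    proof (intro exI conjI)
      let ?C = "M + 1 + 2 powr \<bar>\<nu>\<bar>"
      show "0 \<le> ?C" using M by simp
      show "\<forall>\<^sub>F l in at_top. \<forall>t. 0 \<le> t \<and> t < \<delta> l \<longrightarrow>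
        norm (v t) + 1 \<le> ?C * l \<and> Re (v t) \<le> l / 2 \<and> japanese t powr \<nu> \<le> ?C * sqrt l"
        using eventually_ge_at_top[of 1] eventually_ge_at_top[of "2 * M"]
      proof eventually_elim
        fix l :: real assume l: "1 \<le> l" "2 * M \<le> l"
        show "\<forall>t. 0 \<le> t \<and> t < \<delta> l \<longrightarrow>
        norm (v t) + 1 \<le> ?C * l \<and> Re (v t) \<le> l / 2 \<and> japanese t powr \<nu> \<le> ?C * sqrt l"
        proof (intro allI impI conjI)
          fix t assume t: "0 \<le> t \<and> t < \<delta> l"
          have "norm (v t) + 1 \<le> ?C * 1" using bdd[of t] t by (simp add: add_increasing2)
          also have "\<dots> \<le> ?C * l" using l M by (intro mult_left_mono) auto
          finally show "norm (v t) + 1 \<le> ?C * l" .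
          show "Re (v t) \<le> l / 2" using bdd[of t] t l complex_Re_le_cmod[of "v t"] by linarith
          have "l powr \<theta> \<le> l powr (1 / 2)" using l \<theta> by (intro powr_mono) auto
          also have "\<dots> = sqrt l" using l by (simp add: powr_half_sqrt)
          finally have "2 powr \<bar>\<nu>\<bar> * l powr \<theta> \<le> 2 powr \<bar>\<nu>\<bar> * sqrt l" by simp
          also have "\<dots> \<le> ?C * sqrt l" using M l by (intro mult_right_mono) auto
          finally show "japanese t powr \<nu> \<le> ?C * sqrt l" using w[of l t] l t by simp
        qed
      qed
    qed
    show "\<forall>\<eta>>0. \<exists>X. \<forall>\<^sub>F l in at_top. \<forall>t. X \<le> t \<and> t < \<delta> l \<longrightarrow>
        (norm (v t) + 1) * japanese t powr \<nu> \<le> \<eta> * (sqrt l * \<bar>Im (v t)\<bar>)"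
    proof (intro allI impI exI[of _ "max 0 X"])
      fix \<eta> :: real assume \<eta>: "0 < \<eta>"
      have "\<forall>\<^sub>F l in at_top. ((M + 1) * 2 powr \<bar>\<nu>\<bar>) * l powr \<theta> \<le> (\<eta> * c0) * l powr (\<theta> + (1 / 2 - \<theta>))"
        using \<theta> \<eta> c0 by (intro powr_dominates) auto
      then show "\<forall>\<^sub>F l in at_top. \<forall>t. max 0 X \<le> t \<and> t < \<delta> l \<longrightarrow>
        (norm (v t) + 1) * japanese t powr \<nu> \<le> \<eta> * (sqrt l * \<bar>Im (v t)\<bar>)"
        using eventually_ge_at_top[of 1]
      proof eventually_elim
        fix l :: real assume h: "((M + 1) * 2 powr \<bar>\<nu>\<bar>) * l powr \<theta> \<le> (\<eta> * c0) * l powr (\<theta> + (1 / 2 - \<theta>))" and l: "1 \<le> l"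
        show "\<forall>t. max 0 X \<le> t \<and> t < \<delta> l \<longrightarrow>
          (norm (v t) + 1) * japanese t powr \<nu> \<le> \<eta> * (sqrt l * \<bar>Im (v t)\<bar>)"
        proof (intro allI impI)
          fix t assume t: "max 0 X \<le> t \<and> t < \<delta> l"
          have "(norm (v t) + 1) * japanese t powr \<nu> \<le> (M + 1) * (2 powr \<bar>\<nu>\<bar> * l powr \<theta>)"
            using bdd[of t] w[of l t] t l M by (intro mult_mono) auto
          also have "\<dots> \<le> \<eta> * c0 * sqrt l" using h l by (simp add: powr_half_sqrt mult.assoc)
          also have "\<dots> = (\<eta> * sqrt l) * c0" by simp
          also have "\<dots> \<le> (\<eta> * sqrt l) * \<bar>Im (v t)\<bar>" using c0(2)[of t] t \<eta> l by (intro mult_left_mono) auto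
          finally show "(norm (v t) + 1) * japanese t powr \<nu> \<le> \<eta> * (sqrt l * \<bar>Im (v t)\<bar>)" by (simp add: mult.assoc)
        qed
      qed
    qed
    show "\<exists>c>0. \<forall>\<^sub>F l in at_top. \<forall>t\<in>{\<delta> l - 2 * (\<delta> l / 4)..\<delta> l - \<delta> l / 4}.
        c * (sqrt l * l powr (\<epsilon> / 2)) \<le> \<delta> l / 4 * \<bar>Im (v t)\<bar>"
    proof (intro exI[of _ "c0 / 4"] conjI)
      have "\<forall>\<^sub>F l in at_top. 2 * X \<le> \<delta> l" using lim by (simp add: filterlim_at_top)
      then show "\<forall>\<^sub>F l in at_top. \<forall>t\<in>{\<delta> l - 2 * (\<delta> l / 4)..\<delta> l - \<delta> l / 4}.
        c0 / 4 * (sqrt l * l powr (\<epsilon> / 2)) \<le> \<delta> l / 4 * \<bar>Im (v t)\<bar>"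
        using eventually_ge_at_top[of 1]
      proof eventually_elim
        fix l :: real assume X: "2 * X \<le> \<delta> l" and l: "1 \<le> l"
        have e: "sqrt l * l powr (\<epsilon> / 2) = \<delta> l"
          using l by (simp add: powr_half_sqrt[symmetric] \<delta>_def add_divide_distrib flip: powr_add)
        show "\<forall>t\<in>{\<delta> l - 2 * (\<delta> l / 4)..\<delta> l - \<delta> l / 4}.
            c0 / 4 * (sqrt l * l powr (\<epsilon> / 2)) \<le> \<delta> l / 4 * \<bar>Im (v t)\<bar>"
        proof
          fix t assume "t \<in> {\<delta> l - 2 * (\<delta> l / 4)..\<delta> l - \<delta> l / 4}"
          then have "c0 \<le> \<bar>Im (v t)\<bar>" using X by (intro c0(2)) auto
          then have "\<delta> l / 4 * c0 \<le> \<delta> l / 4 * \<bar>Im (v t)\<bar>" using \<delta>1[OF l] by (intro mult_left_mono) auto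
          then show "c0 / 4 * (sqrt l * l powr (\<epsilon> / 2)) \<le> \<delta> l / 4 * \<bar>Im (v t)\<bar>" unfolding e by (simp add: mult.commute)
        qed
      qed
    qed (use c0 in simp)
    show "\<forall>\<eta>>0. \<forall>\<^sub>F l in at_top. l \<le> exp (\<eta> * l powr (\<epsilon> / 2)) \<and>
        1 / (\<delta> l / 4) \<le> exp (\<eta> * l powr (\<epsilon> / 2)) \<and> \<delta> l \<le> exp (\<eta> * l powr (\<epsilon> / 2))"
    proof (intro allI impI)
      fix \<eta> :: real assume \<eta>: "0 < \<eta>"
      have e1: "\<forall>\<^sub>F l in at_top. l \<le> exp (\<eta> * l powr (\<epsilon> / 2))"
        using \<eta> \<epsilon> by (intro linear_le_exp_powr) auto
      have e2: "\<forall>\<^sub>F x in at_top. x \<le> exp (\<eta> * x powr (\<epsilon> / (1 + \<epsilon>)))"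
        using \<eta> \<epsilon> by (intro linear_le_exp_powr) auto
      have e3: "\<forall>\<^sub>F l in at_top. \<delta> l \<le> exp (\<eta> * \<delta> l powr (\<epsilon> / (1 + \<epsilon>)))"
        by (rule eventually_compose_filterlim[OF e2 lim])
      have e4: "\<forall>\<^sub>F l in at_top. 4 \<le> \<delta> l" using lim by (simp add: filterlim_at_top)
      show "\<forall>\<^sub>F l in at_top. l \<le> exp (\<eta> * l powr (\<epsilon> / 2)) \<and>
        1 / (\<delta> l / 4) \<le> exp (\<eta> * l powr (\<epsilon> / 2)) \<and> \<delta> l \<le> exp (\<eta> * l powr (\<epsilon> / 2))"
        using e1 e3 e4
      proof eventually_elim
        fix l assume 1: "l \<le> exp (\<eta> * l powr (\<epsilon> / 2))" and 3: "\<delta> l \<le> exp (\<eta> * \<delta> l powr (\<epsilon> / (1 + \<epsilon>)))" and 4: "4 \<le> \<delta> l"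
        have "(1 + \<epsilon>) / 2 * (\<epsilon> / (1 + \<epsilon>)) = \<epsilon> / 2" using \<epsilon> by (simp add: field_simps)
        then have "\<delta> l powr (\<epsilon> / (1 + \<epsilon>)) = l powr (\<epsilon> / 2)" by (simp only: \<delta>_def powr_powr)
        then have 5: "\<delta> l \<le> exp (\<eta> * l powr (\<epsilon> / 2))" using 3 by simp
        have "1 / (\<delta> l / 4) \<le> 1" using 4 by simp
        also have "\<dots> \<le> exp (\<eta> * l powr (\<epsilon> / 2))" using \<eta> by simp
        finally show "l \<le> exp (\<eta> * l powr (\<epsilon> / 2)) \<and>
          1 / (\<delta> l / 4) \<le> exp (\<eta> * l powr (\<epsilon> / 2)) \<and> \<delta> l \<le> exp (\<eta> * l powr (\<epsilon> / 2))" using 1 5 by blast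
      qed
    qed
  qed
qed

section \<open>Geometry of an unbounded end\<close>

text \<open>The potential near one end, reflected if necessary, with the hypotheses on it valid for all \<open>t \<ge> X\<close>
with explicit constants.\<close>

locale unbounded_end =
  fixes v v' :: "real \<Rightarrow> complex" and \<nu> \<epsilon> C0 Cd c0 X :: real
  assumes v_lip: "loc_lip v" and v_deriv: "AE t in lebesgue. (v has_vector_derivative v' t) (at t)"
    and X: "1 \<le> X" and c0: "0 < c0" "\<And>t. X \<le> t \<Longrightarrow> c0 \<le> \<bar>Im (v t)\<bar>"
    and Cd: "0 \<le> Cd" "AE t in lebesgue. X \<le> t \<longrightarrow> \<bar>Im (v' t)\<bar> \<le> Cd * (\<bar>Im (v t)\<bar> * japanese t powr \<nu>)"
      "AE t in lebesgue. X \<le> t \<longrightarrow> norm (v' t) \<le> Cd * (norm (v t) * japanese t powr \<nu>)"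
    and C0: "0 < C0" "\<And>t. X \<le> t \<Longrightarrow>
      japanese t powr (4 * (\<nu> + \<epsilon>) + 2) * (japanese t powr (4 * \<nu> + 2) + \<bar>Re (v t)\<bar>) \<le> C0 * \<bar>Im (v t)\<bar>\<^sup>2"
    and \<epsilon>: "0 < \<epsilon>"
    and unb: "\<not> bounded (v ` {0<..})"
begin

abbreviation a :: "real \<Rightarrow> real" where "a t \<equiv> \<bar>Im (v t)\<bar>"

text \<open>The function whose first level point for the value \<open>l\<close> is the cut-off point.\<close>

definition Q :: "real \<Rightarrow> real" where
  "Q t = (a t)\<^sup>2 * japanese t powr (- 4 * \<nu> - 2 * \<epsilon> - 2)"

definition \<delta> :: "real \<Rightarrow> real" where
  "\<delta> l = Inf {d. 0 \<le> d \<and> Q d = l}"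

definition \<Delta> :: "real \<Rightarrow> real" where
  "\<Delta> l = \<delta> l powr (- \<nu>) / 4"

definition E :: "real \<Rightarrow> real" where
  "E l = \<delta> l powr (\<nu> + 1 + \<epsilon>)"

lemma continuous_v: "continuous_on A v"
  by (rule loc_lip_continuous[OF v_lip])

lemma continuous_Q: "continuous_on A Q"
proof -
  have "continuous_on A (\<lambda>t. \<bar>Im (v t)\<bar>\<^sup>2 * japanese t powr (- 4 * \<nu> - 2 * \<epsilon> - 2))"
    by (intro continuous_on_mult continuous_on_power continuous_on_rabs continuous_on_Im continuous_v continuous_japanese_powr)
  then show ?thesis unfolding Q_def[abs_def] .
qed

lemma bounded_if_tail:
  assumes "\<And>t. Y \<le> t \<Longrightarrow> norm (v t) \<le> M" shows False
proof -
  obtain C where C: "\<And>t. t \<in> {0..Y} \<Longrightarrow> norm (v t) \<le> C" using continuous_bounded_interval[OF continuous_v] by metis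
  have "norm (v t) \<le> max C M" if "t \<in> {0<..}" for t
  proof (cases "t \<le> Y")
    case True then show ?thesis using C[of t] that by auto
  next
    case False then show ?thesis using assms[of t] by auto
  qed
  then have "bounded (v ` {0<..})" unfolding bounded_iff by blast
  then show False using unb by blast
qed

text \<open>Here \<open>k\<close> is a primitive of the logarithmic growth rate \<open>Cd \<langle>t\<rangle>\<^sup>\<nu>\<close> that the assumptions allow.\<close>

lemma gronwall_end:
  obtains k where "\<And>t. (k has_real_derivative Cd * japanese t powr \<nu>) (at t)"
    "\<And>s t. X \<le> s \<Longrightarrow> s \<le> t \<Longrightarrow> a t \<le> a s * exp (k t - k s)"
    "\<And>s t. X \<le> s \<Longrightarrow> s \<le> t \<Longrightarrow> a s \<le> a t * exp (k t - k s)"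
    "\<And>s t. X \<le> s \<Longrightarrow> s \<le> t \<Longrightarrow> norm (v t) \<le> norm (v s) * exp (k t - k s)"
proof -
  define k' where "k' t = Cd * japanese t powr \<nu>" for t
  have k'c: "continuous_on A k'" for A
    unfolding k'_def by (intro continuous_on_mult continuous_on_const continuous_japanese_powr)
  obtain k where "primitive k k'" using primitive_exists[of k'] integrable_continuous_interval[OF k'c] by blast
  then have k: "(k has_real_derivative k' t) (at t)" for t
    using primitive_deriv[OF _ k'c] by (simp add: has_real_derivative_iff_has_vector_derivative)
  define u where "u t = complex_of_real (Im (v t))" for t
  have u_lip: "loc_lip u"
    unfolding u_def by (rule loc_lip_bounded_linear[OF bounded_linear_compose[OF bounded_linear_of_real bounded_linear_Im] v_lip])
  have u_deriv: "AE t in lebesgue. (u has_vector_derivative complex_of_real (Im (v' t))) (at t)"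
    using v_deriv
  proof eventually_elim
    fix t assume "(v has_vector_derivative v' t) (at t)"
    then show "(u has_vector_derivative complex_of_real (Im (v' t))) (at t)"
      unfolding u_def
      by (rule bounded_linear.has_vector_derivative[OF bounded_linear_compose[OF bounded_linear_of_real bounded_linear_Im]])
  qed
  show ?thesis
  proof (rule that[of k])
    show "(k has_real_derivative Cd * japanese t powr \<nu>) (at t)" for t using k[of t] by (simp add: k'_def)
    fix s t assume st: "X \<le> s" "s \<le> t"
    have le1: "AE x in lebesgue. x \<in> {s..t} \<longrightarrow> norm (complex_of_real (Im (v' x))) \<le> k' x * norm (u x)"
      using Cd(2) by eventually_elim (use st in \<open>auto simp: k'_def u_def mult_ac\<close>)
    have le2: "AE x in lebesgue. x \<in> {s..t} \<longrightarrow> norm (v' x) \<le> k' x * norm (v x)"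
      using Cd(3) by eventually_elim (use st in \<open>auto simp: k'_def mult_ac\<close>)
    show "a t \<le> a s * exp (k t - k s)" "a s \<le> a t * exp (k t - k s)"
      using Gronwall_AE[OF u_lip u_deriv k k'c le1 st(2)] by (auto simp: u_def)
    show "norm (v t) \<le> norm (v s) * exp (k t - k s)"
      using Gronwall_AE(1)[OF v_lip v_deriv k k'c le2 st(2)] .
  qed
qed

text \<open>The exponent \<open>b\<close> may exceed \<open>\<nu>\<close>, which avoids the logarithm that would appear for \<open>\<nu> = -1\<close>.\<close>

lemma k_growth:
  assumes k: "\<And>t. (k has_real_derivative Cd * japanese t powr \<nu>) (at t)"
    and b: "\<nu> \<le> b" "b \<noteq> -1" and st: "1 \<le> s" "s \<le> t"
  shows "k t - k s \<le> Cd * 2 powr \<bar>\<nu>\<bar> / (b + 1) * (t powr (b + 1) - s powr (b + 1))"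
proof -
  let ?K = "Cd * 2 powr \<bar>\<nu>\<bar>"
  define G where "G x = ?K / (b + 1) * x powr (b + 1) - k x" for x
  have "0 * (t - s) \<le> G t - G s"
  proof (rule deriv_ge_imp_growth[where p'="\<lambda>x. ?K * x powr b - Cd * japanese x powr \<nu>"])
    fix x assume x: "x \<in> {s..t}"
    have "((\<lambda>x. x powr (b + 1)) has_real_derivative (b + 1) * x powr (b + 1 - 1)) (at x)"
      using x st by (intro has_real_derivative_powr) auto
    from DERIV_diff[OF DERIV_cmult[OF this, of "?K / (b + 1)"] k[of x]]
    have "(G has_real_derivative ?K / (b + 1) * ((b + 1) * x powr (b + 1 - 1)) - Cd * japanese x powr \<nu>) (at x)"
      unfolding G_def .
    moreover have "?K / (b + 1) * ((b + 1) * x powr (b + 1 - 1)) = ?K * x powr b"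
      using b(2) by (simp add: add_eq_0_iff)
    ultimately show "(G has_real_derivative ?K * x powr b - Cd * japanese x powr \<nu>) (at x)" by simp
    have "japanese x powr \<nu> \<le> 2 powr \<bar>\<nu>\<bar> * x powr \<nu>" using x st by (intro japanese_powr_bounds(1)) auto
    also have "\<dots> \<le> 2 powr \<bar>\<nu>\<bar> * x powr b" using x st b(1) by (intro mult_left_mono powr_mono) auto
    finally have "Cd * japanese x powr \<nu> \<le> Cd * (2 powr \<bar>\<nu>\<bar> * x powr b)" using Cd(1) by (rule mult_left_mono)
    then show "0 \<le> ?K * x powr b - Cd * japanese x powr \<nu>" by (simp add: mult_ac)
  qed (use st in auto)
  then show ?thesis by (simp add: G_def right_diff_distrib)
qed

text \<open>If \<open>\<nu> < -1\<close>, the growth rate is integrable and Gronwall's inequality bounds \<open>V\<close>.\<close>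

lemma nu_ge: "-1 \<le> \<nu>"
proof (rule ccontr)
  assume "\<not> -1 \<le> \<nu>"
  then have n: "\<nu> + 1 < 0" by simp
  obtain k where k: "\<And>t. (k has_real_derivative Cd * japanese t powr \<nu>) (at t)"
    "\<And>s t. X \<le> s \<Longrightarrow> s \<le> t \<Longrightarrow> norm (v t) \<le> norm (v s) * exp (k t - k s)"
    using gronwall_end by metis
  let ?K = "Cd * 2 powr \<bar>\<nu>\<bar> / (\<nu> + 1)"
  have "norm (v t) \<le> norm (v X) * exp (- ?K * X powr (\<nu> + 1))" if "X \<le> t" for t
  proof -
    have "k t - k X \<le> ?K * (t powr (\<nu> + 1) - X powr (\<nu> + 1))"
      using k_growth[OF k(1), of \<nu> X t] n X that by auto
    also have "\<dots> \<le> - ?K * X powr (\<nu> + 1)"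
    proof -
      have "?K \<le> 0" using n Cd(1) by (simp add: divide_nonneg_neg)
      then have "?K * t powr (\<nu> + 1) \<le> 0" by (rule mult_nonpos_nonneg) simp
      then show ?thesis by (simp add: right_diff_distrib)
    qed
    finally have "exp (k t - k X) \<le> exp (- ?K * X powr (\<nu> + 1))" by simp
    then show ?thesis using k(2)[of X t] that by (meson mult_left_mono norm_ge_zero order_refl order_trans)
  qed
  then show False by (rule bounded_if_tail)
qed

lemma exponent_pos: "0 < \<nu> + 1 + \<epsilon>"
  using nu_ge \<epsilon> by linarith

text \<open>Otherwise the assumption relating \<open>Re V\<close> to \<open>Im V\<close> bounds \<open>\<langle>t\<rangle>\<^sup>2\<^sup>\<epsilon> (\<langle>t\<rangle>\<^sup>4\<^sup>\<nu>\<^sup>+\<^sup>2 + \<bar>Re V\<bar>)\<close>. So \<open>Re V\<close> is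
bounded, the exponent \<open>4 \<nu> + 2 \<epsilon> + 2\<close> is not positive, and then \<open>Im V\<close> is bounded as well.\<close>

lemma Q_unbounded: "\<exists>d\<ge>0. B < Q d"
proof (rule ccontr)
  assume "\<not> (\<exists>d\<ge>0. B < Q d)"
  then have B: "Q d \<le> B" if "0 \<le> d" for d using that by force
  have "0 \<le> Q 0" by (simp add: Q_def)
  then have B0: "0 \<le> B" using B[of 0] by linarith
  let ?m = "4 * \<nu> + 2 * \<epsilon> + 2"
  have tail: "japanese t powr (2 * \<epsilon>) * (japanese t powr (4 * \<nu> + 2) + \<bar>Re (v t)\<bar>) \<le> C0 * B" if "X \<le> t" for t
  proof -
    have "(a t)\<^sup>2 = Q t * japanese t powr ?m"
      unfolding Q_def mult.assoc powr_add[symmetric] using japanese_pos[of t] by simp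
    also have "\<dots> \<le> B * japanese t powr ?m" using B[of t] that X by (intro mult_right_mono) auto
    finally have "C0 * (a t)\<^sup>2 \<le> C0 * (B * japanese t powr ?m)" using C0(1) by simp
    then have "japanese t powr (4 * (\<nu> + \<epsilon>) + 2) * (japanese t powr (4 * \<nu> + 2) + \<bar>Re (v t)\<bar>) \<le> C0 * (B * japanese t powr ?m)"
      using C0(2)[OF that] by linarith
    moreover have "japanese t powr (4 * (\<nu> + \<epsilon>) + 2) = japanese t powr ?m * japanese t powr (2 * \<epsilon>)"
      by (simp add: algebra_simps flip: powr_add)
    ultimately have "japanese t powr ?m * (japanese t powr (2 * \<epsilon>) * (japanese t powr (4 * \<nu> + 2) + \<bar>Re (v t)\<bar>))
        \<le> japanese t powr ?m * (C0 * B)" by (simp add: mult_ac)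
    then show ?thesis using japanese_pos[of t] by simp
  qed
  have j1: "1 \<le> japanese t powr (2 * \<epsilon>)" for t
    using japanese_ge_1[of t] \<epsilon> by (intro ge_one_powr_ge_zero) auto
  have re: "\<bar>Re (v t)\<bar> \<le> C0 * B" if "X \<le> t" for t
  proof -
    have "1 * \<bar>Re (v t)\<bar> \<le> japanese t powr (2 * \<epsilon>) * (japanese t powr (4 * \<nu> + 2) + \<bar>Re (v t)\<bar>)"
      using j1[of t] by (intro mult_mono) auto
    then show ?thesis using tail[OF that] by simp
  qed
  have m_le: "?m \<le> 0"
  proof (rule ccontr)
    assume "\<not> ?m \<le> 0"
    then have m: "0 < ?m" by simp
    have "\<forall>\<^sub>F t in at_top. C0 * B + 1 \<le> t powr ?m"
      using filterlim_powr_at_top[OF m] by (simp add: filterlim_at_top)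
    from eventually_conj[OF this eventually_ge_at_top[of X]]
    obtain t where t: "C0 * B + 1 \<le> t powr ?m" "X \<le> t"
      unfolding eventually_at_top_linorder by blast
      have "t powr ?m \<le> japanese t powr ?m"
        using t X m japanese_ge_abs[of t] by (intro powr_mono2) auto
      also have "\<dots> = japanese t powr (2 * \<epsilon>) * japanese t powr (4 * \<nu> + 2)"
        by (simp add: add_ac flip: powr_add)
      also have "\<dots> \<le> japanese t powr (2 * \<epsilon>) * (japanese t powr (4 * \<nu> + 2) + \<bar>Re (v t)\<bar>)"
        by (intro mult_left_mono) auto
      also have "\<dots> \<le> C0 * B" by (rule tail[OF t(2)])
      finally show False using t(1) by simp
  qed
  have im: "a t \<le> sqrt B" if "X \<le> t" for t
  proof -
    have "(a t)\<^sup>2 = Q t * japanese t powr ?m"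
      unfolding Q_def mult.assoc powr_add[symmetric] using japanese_pos[of t] by simp
    also have "\<dots> \<le> B * 1"
    proof (rule mult_mono)
      have "japanese t powr ?m \<le> japanese t powr 0" using m_le japanese_ge_1[of t] by (intro powr_mono) auto
      then show "japanese t powr ?m \<le> 1" using japanese_pos[of t] by simp
    qed (use B[of t] that X B0 in auto)
    finally show ?thesis using B0 by (intro real_le_rsqrt) simp
  qed
  have "norm (v t) \<le> C0 * B + sqrt B" if "X \<le> t" for t
    using cmod_le[of "v t"] re[OF that] im[OF that] by linarith
  then show False by (rule bounded_if_tail)
qed

text \<open>Above the initial value of \<open>Q\<close>, the level set is nonempty by the intermediate value theorem and closed,
so its infimum is attained; by the same theorem \<open>Q\<close> stays below \<open>l\<close> before.\<close>

lemma delta_props: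
  assumes l: "Q 0 < l"
  shows "0 < \<delta> l" "Q (\<delta> l) = l" "\<And>t. 0 \<le> t \<Longrightarrow> t < \<delta> l \<Longrightarrow> Q t < l"
proof -
  let ?S = "{d. 0 \<le> d \<and> Q d = l}"
  obtain d where d: "0 \<le> d" "l < Q d" using Q_unbounded by blast
  have "\<exists>x\<ge>0. x \<le> d \<and> Q x = l"
    using IVT'[of Q 0 l d] l d continuous_Q by auto
  then have ne: "?S \<noteq> {}" by blast
  have bb: "bdd_below ?S" by (rule bdd_belowI[of _ 0]) auto
  have "?S = {0..} \<inter> Q -` {l}" by auto
  also have "closed \<dots>" by (rule continuous_closed_preimage[OF continuous_Q]) auto
  finally have cl: "closed ?S" .
  have "\<delta> l \<in> ?S" unfolding \<delta>_def by (rule closed_contains_Inf[OF ne bb cl])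
  then show Ql: "Q (\<delta> l) = l" and "0 < \<delta> l" using l by (auto simp: less_le)
  fix t assume t: "0 \<le> t" "t < \<delta> l"
  show "Q t < l"
  proof (rule ccontr)
    assume "\<not> Q t < l"
    then obtain x where "0 \<le> x" "x \<le> t" "Q x = l"
      using IVT'[of Q 0 l t] l t continuous_Q by auto
    then have "\<delta> l \<le> x" unfolding \<delta>_def using bb by (intro cInf_lower) auto
    then show False using t \<open>x \<le> t\<close> by simp
  qed
qed

lemma delta_at_top: "filterlim \<delta> at_top at_top"
  unfolding filterlim_at_top
proof
  fix M :: real
  obtain C where C: "\<And>t. t \<in> {0..max 0 M} \<Longrightarrow> norm (Q t) \<le> C"
    using continuous_bounded_interval[OF continuous_Q] by metis
  show "\<forall>\<^sub>F l in at_top. M \<le> \<delta> l"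
    using eventually_gt_at_top[of C] eventually_gt_at_top[of "Q 0"]
  proof eventually_elim
    fix l assume l: "C < l" "Q 0 < l"
    show "M \<le> \<delta> l"
    proof (rule ccontr)
      assume "\<not> M \<le> \<delta> l"
      then have "\<delta> l \<in> {0..max 0 M}" using delta_props(1)[OF l(2)] by simp
      from C[OF this] show False using delta_props(2)[OF l(2)] l(1) by simp
    qed
  qed
qed

text \<open>The power \<open>q + 1\<close> instead of \<open>q\<close> allows to divide by it when \<open>q = 0\<close>.\<close>

lemma powr_le_exp:
  fixes q e \<eta> :: real
  assumes "0 \<le> q" "0 < e" "0 < \<eta>"
  shows "\<forall>\<^sub>F d in at_top. d powr q \<le> exp (\<eta> * d powr e)"
proof -
  have "\<forall>\<^sub>F d in at_top. d \<le> exp (\<eta> / (q + 1) * d powr e)"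
    using assms by (intro linear_le_exp_powr) auto
  then show ?thesis
    using eventually_ge_at_top[of 1]
  proof eventually_elim
    fix d :: real assume d: "d \<le> exp (\<eta> / (q + 1) * d powr e)" "1 \<le> d"
    have "d powr q \<le> d powr (q + 1)" using d by (intro powr_mono) auto
    also have "\<dots> \<le> exp (\<eta> / (q + 1) * d powr e) powr (q + 1)" using d assms by (intro powr_mono2) auto
    also have "\<dots> = exp (\<eta> * d powr e)" using assms by (simp add: powr_def)
    finally show "d powr q \<le> exp (\<eta> * d powr e)" .
  qed
qed

text \<open>With this exponent \<open>(Im V)\<^sup>2 = Q \<langle>t\<rangle>\<^sup>m\<close>, and the assumption relating \<open>Re V\<close> to \<open>Im V\<close> has the weight
\<open>\<langle>t\<rangle>\<^sup>m\<^sup>+\<^sup>2\<^sup>\<epsilon>\<close>.\<close>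

abbreviation m :: real where "m \<equiv> 4 * \<nu> + 2 * \<epsilon> + 2"

lemma a_square: "(a t)\<^sup>2 = Q t * japanese t powr m"
  unfolding Q_def mult.assoc powr_add[symmetric] using japanese_pos[of t] by simp

lemma a_pos: "X \<le> t \<Longrightarrow> 0 < a t"
  using c0(1) c0(2)[of t] by linarith

lemma japanese_m_le: assumes "X \<le> t" shows "japanese t powr m \<le> sqrt C0 * a t"
proof (rule power2_le_imp_le)
  have "(japanese t powr m)\<^sup>2 = japanese t powr (4 * (\<nu> + \<epsilon>) + 2) * japanese t powr (4 * \<nu> + 2)"
    by (simp add: power2_eq_square algebra_simps flip: powr_add)
  also have "\<dots> \<le> japanese t powr (4 * (\<nu> + \<epsilon>) + 2) * (japanese t powr (4 * \<nu> + 2) + \<bar>Re (v t)\<bar>)"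
    by (intro mult_left_mono) auto
  also have "\<dots> \<le> C0 * (a t)\<^sup>2" by (rule C0(2)[OF assms])
  also have "\<dots> = (sqrt C0 * a t)\<^sup>2" using C0(1) by (simp add: power_mult_distrib)
  finally show "(japanese t powr m)\<^sup>2 \<le> (sqrt C0 * a t)\<^sup>2" .
qed (use C0(1) in simp)

lemma Re_le: assumes "X \<le> t" shows "\<bar>Re (v t)\<bar> * japanese t powr (m + 2 * \<epsilon>) \<le> C0 * (a t)\<^sup>2"
proof -
  have e: "m + 2 * \<epsilon> = 4 * (\<nu> + \<epsilon>) + 2" by simp
  have "\<bar>Re (v t)\<bar> * japanese t powr (m + 2 * \<epsilon>) = japanese t powr (4 * (\<nu> + \<epsilon>) + 2) * \<bar>Re (v t)\<bar>"
    unfolding e by (rule mult.commute)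
  also have "\<dots> \<le> japanese t powr (4 * (\<nu> + \<epsilon>) + 2) * (japanese t powr (4 * \<nu> + 2) + \<bar>Re (v t)\<bar>)"
    by (intro mult_left_mono) auto
  finally have "\<bar>Re (v t)\<bar> * japanese t powr (m + 2 * \<epsilon>) \<le> japanese t powr (4 * (\<nu> + \<epsilon>) + 2) * (japanese t powr (4 * \<nu> + 2) + \<bar>Re (v t)\<bar>)" .
  then show ?thesis using C0(2)[OF assms] by linarith
qed

lemma a_below:
  assumes "Q 0 < l" "0 \<le> t" "t < \<delta> l"
  shows "(a t)\<^sup>2 \<le> l * japanese t powr m" "a t \<le> sqrt l * japanese t powr (m / 2)"
proof -
  have Ql: "Q t < l" using delta_props(3)[OF assms(1)] assms by blast
  have l: "0 < l" using assms(1) zero_le_power2[of "a 0"] by (smt (verit) Q_def mult_nonneg_nonneg powr_ge_zero)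
  show 1: "(a t)\<^sup>2 \<le> l * japanese t powr m" unfolding a_square using Ql by (intro mult_right_mono) auto
  also have "\<dots> = (sqrt l * japanese t powr (m / 2))\<^sup>2"
  proof -
    have "(japanese t powr (m / 2))\<^sup>2 = japanese t powr m"
      unfolding power2_eq_square powr_add[symmetric] by simp
    then show ?thesis using l by (simp only: power_mult_distrib real_sqrt_pow2[OF less_imp_le[OF l]])
  qed
  finally show "a t \<le> sqrt l * japanese t powr (m / 2)" by (rule power2_le_imp_le) (use l in simp)
qed

lemma Q_nonneg: "0 \<le> Q t"
  by (simp add: Q_def)

lemma a_delta:
  assumes "Q 0 < l" shows "a (\<delta> l) = sqrt l * japanese (\<delta> l) powr (m / 2)"
proof -
  have l: "0 < l" using assms Q_nonneg[of 0] by linarith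
  have "(japanese (\<delta> l) powr (m / 2))\<^sup>2 = japanese (\<delta> l) powr m"
    unfolding power2_eq_square powr_add[symmetric] by simp
  then have "(a (\<delta> l))\<^sup>2 = (sqrt l * japanese (\<delta> l) powr (m / 2))\<^sup>2"
    unfolding a_square delta_props(2)[OF assms] by (simp only: power_mult_distrib real_sqrt_pow2[OF less_imp_le[OF l]])
  then show ?thesis by (rule power2_eq_imp_eq) (use l in auto)
qed

lemma sqrt_lower:
  assumes "Q 0 < l" "X \<le> \<delta> l" shows "japanese (\<delta> l) powr (m / 2) \<le> sqrt C0 * sqrt l"
proof -
  have "japanese (\<delta> l) powr (m / 2) * japanese (\<delta> l) powr (m / 2) = japanese (\<delta> l) powr m"
    unfolding powr_add[symmetric] by simp
  also have "\<dots> \<le> sqrt C0 * (sqrt l * japanese (\<delta> l) powr (m / 2))"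
    using japanese_m_le[OF assms(2)] a_delta[OF assms(1)] by simp
  also have "\<dots> = (sqrt C0 * sqrt l) * japanese (\<delta> l) powr (m / 2)" by simp
  finally show ?thesis by (rule mult_right_le_imp_le) (use japanese_pos[of "\<delta> l"] in simp)
qed

lemma delta_ev: "\<forall>\<^sub>F l in at_top. Y \<le> \<delta> l"
  using delta_at_top by (simp add: filterlim_at_top)

text \<open>For \<open>\<nu> > 0\<close> the square root of \<open>l\<close> is at least of the order of \<open>\<delta>\<^sup>m\<^sup>/\<^sup>2\<close>, and \<open>m / 2\<close> exceeds
\<open>\<nu>\<close> by \<open>\<nu> + 1 + \<epsilon>\<close>.\<close>

lemma weight_small: "\<forall>\<^sub>F l in at_top. M * \<delta> l powr (max \<nu> 0) \<le> sqrt l"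
proof (cases "0 < \<nu>")
  case True
  have "\<forall>\<^sub>F d in at_top. M * d powr \<nu> \<le> (1 / sqrt C0) * d powr (\<nu> + (\<nu> + 1 + \<epsilon>))"
    using exponent_pos C0(1) by (intro powr_dominates) auto
  from eventually_compose_filterlim[OF this delta_at_top]
  show ?thesis
    using delta_ev[of X] eventually_gt_at_top[of "Q 0"]
  proof eventually_elim
    fix l assume 1: "M * \<delta> l powr \<nu> \<le> (1 / sqrt C0) * \<delta> l powr (\<nu> + (\<nu> + 1 + \<epsilon>))" and d: "X \<le> \<delta> l" and l: "Q 0 < l"
    have "\<nu> + (\<nu> + 1 + \<epsilon>) = m / 2" by simp
    then have "\<delta> l powr (\<nu> + (\<nu> + 1 + \<epsilon>)) = \<delta> l powr (m / 2)" by (simp only:)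
    also have "\<dots> \<le> japanese (\<delta> l) powr (m / 2)"
      using True \<epsilon> d X japanese_ge_abs[of "\<delta> l"] by (intro powr_mono2) auto
    also have "\<dots> \<le> sqrt C0 * sqrt l" by (rule sqrt_lower[OF l d])
    finally have "(1 / sqrt C0) * \<delta> l powr (\<nu> + (\<nu> + 1 + \<epsilon>)) \<le> sqrt l" using C0(1) by (simp add: field_simps)
    then show "M * \<delta> l powr (max \<nu> 0) \<le> sqrt l" using 1 True by simp
  qed
next
  case False
  show ?thesis
    using delta_ev[of 1] eventually_ge_at_top[of "(max M 0)\<^sup>2"]
  proof eventually_elim
    fix l assume "1 \<le> \<delta> l" "(max M 0)\<^sup>2 \<le> l"
    moreover from this have "max M 0 \<le> sqrt l" by (intro real_le_rsqrt)
    ultimately show "M * \<delta> l powr (max \<nu> 0) \<le> sqrt l" using False by simp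
  qed
qed

lemma weight_le:
  assumes "1 \<le> \<delta> l" "0 \<le> t" "t < \<delta> l"
  shows "japanese t powr \<nu> \<le> 2 powr \<bar>\<nu>\<bar> * \<delta> l powr (max \<nu> 0)"
  using assms by (intro japanese_powr_le_max) auto

lemma powr_neg_small: assumes "0 < r" "0 < \<eta>" obtains Y where "\<And>t. Y \<le> t \<Longrightarrow> M * japanese t powr (- r) \<le> \<eta>"
proof -
  have "\<forall>\<^sub>F t in at_top. max M 0 / \<eta> \<le> t powr r"
    using filterlim_powr_at_top[OF assms(1)] by (simp add: filterlim_at_top)
  then obtain Y where Y: "\<And>t. Y \<le> t \<Longrightarrow> max M 0 / \<eta> \<le> t powr r" unfolding eventually_at_top_linorder by blast
  show ?thesis
  proof (rule that[of "max Y 0"])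
    fix t assume t: "max Y 0 \<le> t"
    have "t powr r \<le> japanese t powr r"
      using t assms japanese_ge_abs[of t] by (intro powr_mono2) auto
    then have "max M 0 / \<eta> \<le> japanese t powr r" using Y[of t] t by simp
    then have "max M 0 \<le> \<eta> * japanese t powr r" using assms(2) by (simp add: field_simps)
    then have "max M 0 * japanese t powr (- r) \<le> \<eta>"
      using japanese_pos[of t] by (simp add: powr_minus_divide field_simps)
    moreover have "M * japanese t powr (- r) \<le> max M 0 * japanese t powr (- r)" by (intro mult_right_mono) auto
    ultimately show "M * japanese t powr (- r) \<le> \<eta>" by linarith
  qed
qed

text \<open>Before \<open>\<delta>\<close> one has \<open>(Im V)\<^sup>2 \<le> l \<langle>t\<rangle>\<^sup>m\<close>; the assumption relating \<open>Re V\<close> to \<open>Im V\<close> then makes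
\<open>Im V\<close> at most of order \<open>l\<close> and \<open>Re V\<close> at most of order \<open>l \<langle>t\<rangle>\<^sup>-\<^sup>2\<^sup>\<epsilon>\<close>. The negative power yields the constant
\<open>1/2\<close> far out; the remaining compact part is dominated by taking \<open>l\<close> large.\<close>

lemma geometry_size:
  "\<exists>C\<ge>0. \<forall>\<^sub>F l in at_top. \<forall>t. 0 \<le> t \<and> t < \<delta> l \<longrightarrow>
        norm (v t) + 1 \<le> C * l \<and> Re (v t) \<le> l / 2 \<and> japanese t powr \<nu> \<le> C * sqrt l"
proof -
  obtain Y where Y: "\<And>t. Y \<le> t \<Longrightarrow> C0 * japanese t powr (- (2 * \<epsilon>)) \<le> 1 / 2"
    using powr_neg_small[of "2 * \<epsilon>" "1 / 2"] \<epsilon> by auto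
  define X2 where "X2 = max X Y"
  obtain K where K: "K \<ge> 0" "\<And>t. t \<in> {0..X2} \<Longrightarrow> norm (v t) \<le> K"
    using continuous_bounded_interval[OF continuous_v] by metis
  let ?C = "sqrt C0 + K + 2"
  have C: "0 \<le> ?C" "1 \<le> ?C" "K + 1 \<le> ?C" using K C0(1) by auto
  have "\<forall>\<^sub>F l in at_top. \<forall>t. 0 \<le> t \<and> t < \<delta> l \<longrightarrow>
        norm (v t) + 1 \<le> ?C * l \<and> Re (v t) \<le> l / 2 \<and> japanese t powr \<nu> \<le> ?C * sqrt l"
    using weight_small[of "2 powr \<bar>\<nu>\<bar>"] delta_ev[of 1] eventually_gt_at_top[of "Q 0"] eventually_ge_at_top[of 1]
      eventually_ge_at_top[of "2 * K"]
  proof eventually_elim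
    fix l assume ws: "2 powr \<bar>\<nu>\<bar> * \<delta> l powr (max \<nu> 0) \<le> sqrt l" and d: "1 \<le> \<delta> l" and l: "Q 0 < l" "1 \<le> l" "2 * K \<le> l"
    show "\<forall>t. 0 \<le> t \<and> t < \<delta> l \<longrightarrow>
        norm (v t) + 1 \<le> ?C * l \<and> Re (v t) \<le> l / 2 \<and> japanese t powr \<nu> \<le> ?C * sqrt l"
    proof (intro allI impI)
      fix t assume t: "0 \<le> t \<and> t < \<delta> l"
      have "japanese t powr \<nu> \<le> 1 * sqrt l" using weight_le[OF d] t ws by force
      also have "\<dots> \<le> ?C * sqrt l" using C l by (intro mult_right_mono) auto
      finally have 1: "japanese t powr \<nu> \<le> ?C * sqrt l" .
      have 2: "norm (v t) + 1 \<le> ?C * l \<and> Re (v t) \<le> l / 2"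
      proof (cases "t \<le> X2")
        case True
        then have k: "norm (v t) \<le> K" using t K(2) by simp
        have "norm (v t) + 1 \<le> ?C * 1" using k C by simp
        also have "\<dots> \<le> ?C * l" using l C by (intro mult_left_mono) auto
        finally show ?thesis using k l(3) complex_Re_le_cmod[of "v t"] by linarith
      next
        case False
        then have tX: "X \<le> t" "Y \<le> t" by (auto simp: X2_def)
        have sq: "(a t)\<^sup>2 \<le> l * japanese t powr m" using a_below(1)[OF l(1)] t by blast
        have "a t * a t = (a t)\<^sup>2" by (simp only: power2_eq_square)
        then have "a t * a t \<le> l * (sqrt C0 * a t)"
          using sq mult_left_mono[OF japanese_m_le[OF tX(1)], of l] l by linarith
        then have "a t * a t \<le> (sqrt C0 * l) * a t" by (simp add: mult_ac)
        then have im: "a t \<le> sqrt C0 * l" by (rule mult_right_le_imp_le) (rule a_pos[OF tX(1)])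
        have "\<bar>Re (v t)\<bar> * japanese t powr (m + 2 * \<epsilon>) \<le> C0 * (l * japanese t powr m)"
          using Re_le[OF tX(1)] mult_left_mono[OF sq, of C0] C0(1) by linarith
        also have "\<dots> = (l * (C0 * japanese t powr (- (2 * \<epsilon>)))) * japanese t powr (m + 2 * \<epsilon>)"
        proof -
          have "- (2 * \<epsilon>) + (m + 2 * \<epsilon>) = m" by simp
          then have "japanese t powr m = japanese t powr (- (2 * \<epsilon>)) * japanese t powr (m + 2 * \<epsilon>)"
            by (simp only: powr_add[symmetric])
          then show ?thesis by (simp only: mult_ac)
        qed
        finally have "\<bar>Re (v t)\<bar> \<le> l * (C0 * japanese t powr (- (2 * \<epsilon>)))"
          by (rule mult_right_le_imp_le) (use japanese_pos[of t] in simp)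
        also have "\<dots> \<le> l * (1 / 2)" using Y[OF tX(2)] l by (intro mult_left_mono) auto
        finally have re: "\<bar>Re (v t)\<bar> \<le> l / 2" by simp
        have "norm (v t) + 1 \<le> l / 2 + sqrt C0 * l + 1" using cmod_le[of "v t"] re im by linarith
        also have "\<dots> \<le> sqrt C0 * l + K * l + 2 * l" using l mult_nonneg_nonneg[of K l] K(1) by linarith
        also have "\<dots> = ?C * l" by (simp add: distrib_right)
        finally show ?thesis using re by linarith
      qed
      show "norm (v t) + 1 \<le> ?C * l \<and> Re (v t) \<le> l / 2 \<and> japanese t powr \<nu> \<le> ?C * sqrt l" using 1 2 by blast
    qed
  qed
  then show ?thesis using C(1) by blast
qed

text \<open>The parts coming from \<open>Im V\<close> and from the constant are handled by the smallness of the weight. For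
\<open>Re V\<close>, inserting \<open>\<bar>Im V\<bar> \<le> l\<^sup>1\<^sup>/\<^sup>2 \<langle>t\<rangle>\<^sup>m\<^sup>/\<^sup>2\<close> for one of the two factors \<open>Im V\<close> leaves the power
\<open>\<nu> - m / 2 - 2 \<epsilon>\<close> of the bracket, which is at most \<open>- 3 \<epsilon>\<close> because \<open>\<nu> \<ge> -1\<close>.\<close>

lemma geometry_small:
  assumes \<eta>: "0 < \<eta>"
  shows "\<exists>Y. \<forall>\<^sub>F l in at_top. \<forall>t. Y \<le> t \<and> t < \<delta> l \<longrightarrow>
        (norm (v t) + 1) * japanese t powr \<nu> \<le> \<eta> * (sqrt l * a t)"
proof -
  obtain Y where Y: "\<And>t. Y \<le> t \<Longrightarrow> C0 * japanese t powr (- (3 * \<epsilon>)) \<le> \<eta> / 2"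
    using powr_neg_small[of "3 * \<epsilon>" "\<eta> / 2"] \<epsilon> \<eta> by auto
  let ?M = "(1 + 1 / c0) * 2 powr \<bar>\<nu>\<bar> / (\<eta> / 2)"
  have "\<forall>\<^sub>F l in at_top. \<forall>t. max X Y \<le> t \<and> t < \<delta> l \<longrightarrow>
        (norm (v t) + 1) * japanese t powr \<nu> \<le> \<eta> * (sqrt l * a t)"
    using weight_small[of ?M] delta_ev[of 1] eventually_gt_at_top[of "Q 0"] eventually_ge_at_top[of 1]
  proof eventually_elim
    fix l assume ws: "?M * \<delta> l powr (max \<nu> 0) \<le> sqrt l" and d: "1 \<le> \<delta> l" and l: "Q 0 < l" "1 \<le> l"
    show "\<forall>t. max X Y \<le> t \<and> t < \<delta> l \<longrightarrow> (norm (v t) + 1) * japanese t powr \<nu> \<le> \<eta> * (sqrt l * a t)"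
    proof (intro allI impI)
      fix t assume t: "max X Y \<le> t \<and> t < \<delta> l"
      then have tX: "X \<le> t" "Y \<le> t" "0 \<le> t" "t < \<delta> l" using X by auto
      let ?j = "japanese t"
      have jp: "0 < ?j powr \<mu>" for \<mu> using japanese_pos[of t] by simp
      have "1 \<le> 1 / c0 * a t" using c0(1) c0(2)[OF tX(1)] by (simp add: field_simps)
      then have n: "norm (v t) + 1 \<le> \<bar>Re (v t)\<bar> + (1 + 1 / c0) * a t"
        using cmod_le[of "v t"] by (simp add: distrib_right)
      have "(1 + 1 / c0) * ?j powr \<nu> \<le> (1 + 1 / c0) * (2 powr \<bar>\<nu>\<bar> * \<delta> l powr (max \<nu> 0))"
        using weight_le[OF d tX(3,4)] c0(1) by (intro mult_left_mono) auto
      also have "\<dots> = \<eta> / 2 * (?M * \<delta> l powr (max \<nu> 0))" using \<eta> by simp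
      also have "\<dots> \<le> \<eta> / 2 * sqrt l" using ws \<eta> by (intro mult_left_mono) auto
      finally have A: "(1 + 1 / c0) * ?j powr \<nu> * a t \<le> \<eta> / 2 * sqrt l * a t" by (rule mult_right_mono) simp
      have at: "a t \<le> sqrt l * ?j powr (m / 2)" by (rule a_below(2)[OF l(1) tX(3,4)])
      have "\<bar>Re (v t)\<bar> * ?j powr (m + 2 * \<epsilon>) \<le> C0 * (a t * a t)"
        using Re_le[OF tX(1)] by (simp only: power2_eq_square)
      also have "\<dots> \<le> C0 * ((sqrt l * ?j powr (m / 2)) * a t)"
        using at C0(1) by (intro mult_left_mono mult_right_mono) auto
      also have "\<dots> = (C0 * sqrt l * a t * ?j powr (- (m / 2) - 2 * \<epsilon>)) * ?j powr (m + 2 * \<epsilon>)"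
      proof -
        have "- (m / 2) - 2 * \<epsilon> + (m + 2 * \<epsilon>) = m / 2" by (simp add: field_simps)
        then have "?j powr (m / 2) = ?j powr (- (m / 2) - 2 * \<epsilon>) * ?j powr (m + 2 * \<epsilon>)"
          by (simp only: powr_add[symmetric])
        then show ?thesis by (simp only: mult_ac)
      qed
      finally have re: "\<bar>Re (v t)\<bar> \<le> C0 * sqrt l * a t * ?j powr (- (m / 2) - 2 * \<epsilon>)"
        by (rule mult_right_le_imp_le) (rule jp)
      have "\<bar>Re (v t)\<bar> * ?j powr \<nu> \<le> (C0 * sqrt l * a t * ?j powr (- (m / 2) - 2 * \<epsilon>)) * ?j powr \<nu>"
        by (rule mult_right_mono[OF re]) simp
      also have "\<dots> = C0 * sqrt l * a t * (?j powr (- (m / 2) - 2 * \<epsilon>) * ?j powr \<nu>)" by simp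
      also have "?j powr (- (m / 2) - 2 * \<epsilon>) * ?j powr \<nu> = ?j powr (- (m / 2) - 2 * \<epsilon> + \<nu>)" by (simp only: powr_add)
      also have "C0 * sqrt l * a t * ?j powr (- (m / 2) - 2 * \<epsilon> + \<nu>) \<le> C0 * sqrt l * a t * ?j powr (- (3 * \<epsilon>))"
      proof (intro mult_left_mono powr_mono)
        have "m / 2 = 2 * \<nu> + \<epsilon> + 1" by simp
        then show "- (m / 2) - 2 * \<epsilon> + \<nu> \<le> - (3 * \<epsilon>)" using nu_ge by linarith
      qed (use japanese_ge_1[of t] C0(1) l in auto)
      also have "\<dots> = (C0 * ?j powr (- (3 * \<epsilon>))) * (sqrt l * a t)" by simp
      also have "\<dots> \<le> \<eta> / 2 * (sqrt l * a t)" using Y[OF tX(2)] l by (intro mult_right_mono) auto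
      finally have B: "\<bar>Re (v t)\<bar> * ?j powr \<nu> \<le> \<eta> / 2 * (sqrt l * a t)" .
      have "(norm (v t) + 1) * ?j powr \<nu> \<le> (\<bar>Re (v t)\<bar> + (1 + 1 / c0) * a t) * ?j powr \<nu>"
        by (rule mult_right_mono[OF n]) simp
      also have "\<dots> = \<bar>Re (v t)\<bar> * ?j powr \<nu> + (1 + 1 / c0) * ?j powr \<nu> * a t"
        by (simp only: distrib_right mult.assoc mult.commute[of "a t"])
      also have "\<dots> \<le> \<eta> / 2 * (sqrt l * a t) + \<eta> / 2 * sqrt l * a t" by (rule add_mono[OF B A])
      also have "\<dots> = \<eta> * (sqrt l * a t)" by simp
      finally show "(norm (v t) + 1) * ?j powr \<nu> \<le> \<eta> * (sqrt l * a t)" .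
    qed
  qed
  then show ?thesis by blast
qed

lemma Delta_le: assumes "1 \<le> \<delta> l" shows "0 < \<Delta> l" "\<Delta> l \<le> \<delta> l / 4"
proof -
  show "0 < \<Delta> l" using assms by (simp add: \<Delta>_def)
  have "\<delta> l powr (- \<nu>) \<le> \<delta> l powr 1" using assms nu_ge by (intro powr_mono) auto
  then show "\<Delta> l \<le> \<delta> l / 4" using assms by (simp add: \<Delta>_def)
qed

text \<open>The window has length \<open>\<Delta>\<close> and lies within \<open>2 \<Delta>\<close> of \<open>\<delta>\<close>, where the logarithmic growth rate is of
order \<open>\<delta>\<^sup>\<nu>\<close>, that is, of order \<open>1 / \<Delta>\<close>. So \<open>\<bar>Im V\<bar>\<close> is there at least a fixed fraction of its
value at \<open>\<delta>\<close>, which is known exactly, and \<open>4 \<Delta> \<delta>\<^sup>m\<^sup>/\<^sup>2 = E\<close>.\<close>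

lemma geometry_decay:
  "\<exists>c>0. \<forall>\<^sub>F l in at_top. \<forall>t\<in>{\<delta> l - 2 * \<Delta> l..\<delta> l - \<Delta> l}. c * (sqrt l * E l) \<le> \<Delta> l * a t"
proof -
  obtain k where k: "\<And>t. (k has_real_derivative Cd * japanese t powr \<nu>) (at t)"
    "\<And>s t. X \<le> s \<Longrightarrow> s \<le> t \<Longrightarrow> a t \<le> a s * exp (k t - k s)"
    using gronwall_end by metis
  define \<kappa> where "\<kappa> = Cd * 2 powr \<bar>\<nu>\<bar> / 2"
  define c where "c = exp (- \<kappa>) / 4 / 2 powr \<bar>m / 2\<bar>"
  have c: "0 < c" by (simp add: c_def)
  have "\<forall>\<^sub>F l in at_top. \<forall>t\<in>{\<delta> l - 2 * \<Delta> l..\<delta> l - \<Delta> l}. c * (sqrt l * E l) \<le> \<Delta> l * a t"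
    using delta_ev[of "2 * X"] eventually_gt_at_top[of "Q 0"]
  proof eventually_elim
    fix l assume d: "2 * X \<le> \<delta> l" and l: "Q 0 < l"
    have d1: "1 \<le> \<delta> l" using d X by simp
    have l0: "0 < l" using l Q_nonneg[of 0] by linarith
    show "\<forall>t\<in>{\<delta> l - 2 * \<Delta> l..\<delta> l - \<Delta> l}. c * (sqrt l * E l) \<le> \<Delta> l * a t"
    proof
      fix t assume t: "t \<in> {\<delta> l - 2 * \<Delta> l..\<delta> l - \<Delta> l}"
      have half: "\<delta> l / 2 \<le> t" and tX: "X \<le> t" and td: "t \<le> \<delta> l" and gap: "\<delta> l - t \<le> 2 * \<Delta> l"
        using t Delta_le[OF d1] d by auto
      let ?L = "Cd * (2 powr \<bar>\<nu>\<bar> * \<delta> l powr \<nu>)"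
      have "- ?L * (\<delta> l - t) \<le> - k (\<delta> l) - - k t"
      proof (rule deriv_ge_imp_growth[OF DERIV_minus[OF k(1)] _ td])
        fix \<tau> assume \<tau>: "\<tau> \<in> {t..\<delta> l}"
        have "japanese \<tau> powr \<nu> \<le> 2 powr \<bar>\<nu>\<bar> * \<delta> l powr \<nu>"
          using \<tau> half tX X d1 japanese_ge_abs[of \<tau>] japanese_le_2[of \<tau>] by (intro powr_ratio_bound(1)) auto
        then have "Cd * japanese \<tau> powr \<nu> \<le> ?L" using Cd(1) by (rule mult_left_mono)
        then show "- ?L \<le> - (Cd * japanese \<tau> powr \<nu>)" by simp
      qed
      then have "k (\<delta> l) - k t \<le> ?L * (\<delta> l - t)" by simp
      also have "\<dots> \<le> ?L * (2 * \<Delta> l)" using gap Cd(1) by (intro mult_left_mono) auto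
      also have "\<dots> = \<kappa> * (\<delta> l powr \<nu> * \<delta> l powr (- \<nu>))" by (simp add: \<Delta>_def \<kappa>_def)
      also have "\<delta> l powr \<nu> * \<delta> l powr (- \<nu>) = 1" using d1 by (simp flip: powr_add)
      finally have "exp (k (\<delta> l) - k t) \<le> exp \<kappa>" by simp
      then have "a (\<delta> l) \<le> a t * exp \<kappa>"
        using k(2)[OF tX td] by (meson abs_ge_zero mult_left_mono order_trans)
      then have low: "exp (- \<kappa>) * a (\<delta> l) \<le> a t" by (simp add: exp_minus field_simps)
      have "\<delta> l powr (m / 2) \<le> 2 powr \<bar>m / 2\<bar> * japanese (\<delta> l) powr (m / 2)"
        by (rule japanese_powr_bounds(2)[OF d1])
      then have j: "\<delta> l powr (m / 2) / 2 powr \<bar>m / 2\<bar> \<le> japanese (\<delta> l) powr (m / 2)"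
        by (simp add: field_simps)
      have "\<nu> + 1 + \<epsilon> = - \<nu> + m / 2" by simp
      then have "E l = \<delta> l powr (- \<nu>) * \<delta> l powr (m / 2)" by (simp only: E_def powr_add[symmetric])
      then have "c * (sqrt l * E l) = (\<delta> l powr (- \<nu>) / 4) * (exp (- \<kappa>) * (sqrt l * (\<delta> l powr (m / 2) / 2 powr \<bar>m / 2\<bar>)))"
        by (simp add: c_def)
      also have "\<dots> \<le> (\<delta> l powr (- \<nu>) / 4) * (exp (- \<kappa>) * (sqrt l * japanese (\<delta> l) powr (m / 2)))"
        using j l0 by (intro mult_left_mono) auto
      also have "\<dots> = \<Delta> l * (exp (- \<kappa>) * a (\<delta> l))" unfolding \<Delta>_def a_delta[OF l] ..
      also have "\<dots> \<le> \<Delta> l * a t" using low Delta_le(1)[OF d1] by (intro mult_left_mono) auto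
      finally show "c * (sqrt l * E l) \<le> \<Delta> l * a t" .
    qed
  qed
  then show ?thesis using c by blast
qed

text \<open>Gronwall's inequality from \<open>X\<close> to \<open>\<delta>\<close> bounds \<open>\<bar>Im V(\<delta>)\<bar>\<close> by the exponential of a multiple of
\<open>\<delta>\<^sup>\<nu>\<^sup>+\<^sup>1\<^sup>+\<^sup>\<epsilon>\<^sup>/\<^sup>2\<close>, a lower power than \<open>E\<close>; and \<open>l = Q(\<delta>)\<close> is this squared, up to a power of \<open>\<delta>\<close>.\<close>

lemma geometry_exp:
  assumes \<eta>: "0 < \<eta>"
  shows "\<forall>\<^sub>F l in at_top. l \<le> exp (\<eta> * E l) \<and> 1 / \<Delta> l \<le> exp (\<eta> * E l) \<and> \<delta> l \<le> exp (\<eta> * E l)"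
proof -
  let ?e = "\<nu> + 1 + \<epsilon>" and ?b = "\<nu> + \<epsilon> / 2"
  obtain k where k: "\<And>t. (k has_real_derivative Cd * japanese t powr \<nu>) (at t)"
    "\<And>s t. X \<le> s \<Longrightarrow> s \<le> t \<Longrightarrow> a t \<le> a s * exp (k t - k s)"
    using gronwall_end by metis
  define K where "K = Cd * 2 powr \<bar>\<nu>\<bar> / (?b + 1)"
  have b: "0 < ?b + 1" using nu_ge \<epsilon> by linarith
  have K: "0 \<le> K" using Cd(1) b by (simp add: K_def)
  have e1: "\<forall>\<^sub>F d in at_top. d powr \<bar>m\<bar> \<le> exp (\<eta> / 4 * d powr ?e)"
    using exponent_pos \<eta> by (intro powr_le_exp) auto
  have e2: "\<forall>\<^sub>F d in at_top. d powr 1 \<le> exp (\<eta> / 4 * d powr ?e)"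
    using exponent_pos \<eta> by (intro powr_le_exp) auto
  have e3: "\<forall>\<^sub>F d in at_top. (2 * K) * d powr (?b + 1) \<le> \<eta> / 4 * d powr (?b + 1 + \<epsilon> / 2)"
    using \<eta> \<epsilon> by (intro powr_dominates) auto
  have e4: "\<forall>\<^sub>F d in at_top. d powr (\<bar>\<nu>\<bar> + 1) \<le> exp (\<eta> * d powr ?e)"
    using exponent_pos \<eta> by (intro powr_le_exp) auto
  have "\<forall>\<^sub>F d in at_top. d powr \<bar>m\<bar> \<le> exp (\<eta> / 4 * d powr ?e) \<and> d powr 1 \<le> exp (\<eta> / 4 * d powr ?e) \<and>
      (2 * K) * d powr (?b + 1) \<le> \<eta> / 4 * d powr (?b + 1 + \<epsilon> / 2) \<and> d powr (\<bar>\<nu>\<bar> + 1) \<le> exp (\<eta> * d powr ?e)"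
    by (intro eventually_conj e1 e2 e3 e4)
  from eventually_compose_filterlim[OF this delta_at_top]
  show ?thesis
    using delta_ev[of X] delta_ev[of 4] delta_ev[of "(a X)\<^sup>2 * 2 powr \<bar>m\<bar>"] eventually_gt_at_top[of "Q 0"]
  proof eventually_elim
    fix l assume H: "\<delta> l powr \<bar>m\<bar> \<le> exp (\<eta> / 4 * \<delta> l powr ?e) \<and> \<delta> l powr 1 \<le> exp (\<eta> / 4 * \<delta> l powr ?e) \<and>
      (2 * K) * \<delta> l powr (?b + 1) \<le> \<eta> / 4 * \<delta> l powr (?b + 1 + \<epsilon> / 2) \<and> \<delta> l powr (\<bar>\<nu>\<bar> + 1) \<le> exp (\<eta> * \<delta> l powr ?e)"
      and d: "X \<le> \<delta> l" "4 \<le> \<delta> l" "(a X)\<^sup>2 * 2 powr \<bar>m\<bar> \<le> \<delta> l" and l: "Q 0 < l"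
    have d1: "1 \<le> \<delta> l" using d by simp
    have E: "E l = \<delta> l powr ?e" by (simp add: E_def)
    have bb: "?b + 1 + \<epsilon> / 2 = ?e" by simp
    have "k (\<delta> l) - k X \<le> K * (\<delta> l powr (?b + 1) - X powr (?b + 1))"
      unfolding K_def using X d b \<epsilon> by (intro k_growth[OF k(1)]) auto
    also have "\<dots> \<le> K * \<delta> l powr (?b + 1)" using K by (intro mult_left_mono) auto
    finally have "exp (k (\<delta> l) - k X) \<le> exp (K * \<delta> l powr (?b + 1))" by simp
    then have "a (\<delta> l) \<le> a X * exp (K * \<delta> l powr (?b + 1))"
      using k(2)[OF order_refl d(1)] by (meson abs_ge_zero mult_left_mono order_trans)
    then have "(a (\<delta> l))\<^sup>2 \<le> (a X * exp (K * \<delta> l powr (?b + 1)))\<^sup>2" by (intro power_mono) auto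
    also have "\<dots> = (a X)\<^sup>2 * exp ((2 * K) * \<delta> l powr (?b + 1))"
      by (simp add: power_mult_distrib mult.assoc flip: exp_of_nat_mult)
    also have "\<dots> \<le> (a X)\<^sup>2 * exp (\<eta> / 4 * E l)" using H unfolding bb E by (intro mult_left_mono) auto
    finally have A: "(a (\<delta> l))\<^sup>2 \<le> (a X)\<^sup>2 * exp (\<eta> / 4 * E l)" .
    have "l = (a (\<delta> l))\<^sup>2 * japanese (\<delta> l) powr (- m)"
      unfolding a_square delta_props(2)[OF l] mult.assoc powr_add[symmetric] using japanese_pos[of "\<delta> l"] by simp
    also have "\<dots> \<le> ((a X)\<^sup>2 * exp (\<eta> / 4 * E l)) * (2 powr \<bar>m\<bar> * \<delta> l powr \<bar>m\<bar>)"
    proof (intro mult_mono A)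
      have "japanese (\<delta> l) powr (- m) \<le> 2 powr \<bar>- m\<bar> * \<delta> l powr (- m)" by (rule japanese_powr_bounds(1)[OF d1])
      also have "\<dots> \<le> 2 powr \<bar>m\<bar> * \<delta> l powr \<bar>m\<bar>" using d1 by (intro mult_mono powr_mono) auto
      finally show "japanese (\<delta> l) powr (- m) \<le> 2 powr \<bar>m\<bar> * \<delta> l powr \<bar>m\<bar>" .
    qed auto
    also have "\<dots> = ((a X)\<^sup>2 * 2 powr \<bar>m\<bar>) * (exp (\<eta> / 4 * E l) * \<delta> l powr \<bar>m\<bar>)" by (simp only: mult_ac)
    also have "\<dots> \<le> exp (\<eta> / 4 * E l) * (exp (\<eta> / 4 * E l) * exp (\<eta> / 4 * E l))"
    proof (intro mult_mono)
      show "(a X)\<^sup>2 * 2 powr \<bar>m\<bar> \<le> exp (\<eta> / 4 * E l)" using d(3) H d1 unfolding E by simp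
      show "\<delta> l powr \<bar>m\<bar> \<le> exp (\<eta> / 4 * E l)" using H unfolding E by blast
    qed auto
    also have "\<dots> = exp (3 / 4 * (\<eta> * E l))" by (simp flip: exp_add)
    also have "\<dots> \<le> exp (\<eta> * E l)" using \<eta> by (simp add: E)
    finally have 1: "l \<le> exp (\<eta> * E l)" .
    have "1 / \<Delta> l = 4 * \<delta> l powr \<nu>" using d1 by (simp add: \<Delta>_def powr_minus_divide)
    also have "\<dots> \<le> \<delta> l powr 1 * \<delta> l powr \<bar>\<nu>\<bar>" using d d1 by (intro mult_mono powr_mono) auto
    also have "\<dots> = \<delta> l powr (\<bar>\<nu>\<bar> + 1)" by (simp add: powr_add)
    also have "\<dots> \<le> exp (\<eta> * E l)" using H unfolding E by blast
    finally have 2: "1 / \<Delta> l \<le> exp (\<eta> * E l)" .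
    have "\<delta> l \<le> exp (\<eta> / 4 * E l)" using H d1 unfolding E by simp
    also have "\<dots> \<le> exp (\<eta> * E l)" using \<eta> by (simp add: E)
    finally have 3: "\<delta> l \<le> exp (\<eta> * E l)" .
    show "l \<le> exp (\<eta> * E l) \<and> 1 / \<Delta> l \<le> exp (\<eta> * E l) \<and> \<delta> l \<le> exp (\<eta> * E l)" using 1 2 3 by blast
  qed
qed

lemma unbounded_end_geometry: "end_geometry v \<nu> \<delta> \<Delta> E"
  unfolding end_geometry_def
proof (intro conjI)
  show "\<forall>\<^sub>F l in at_top. 0 < \<Delta> l \<and> \<Delta> l \<le> \<delta> l / 4"
    using delta_ev[of 1] by eventually_elim (intro conjI Delta_le)
qed (use delta_at_top geometry_size geometry_small geometry_decay geometry_exp in blast)+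

end

section \<open>The estimate for the quotient of norms\<close>

lemma deriv_zero_if_locally_const:
  fixes \<eta> :: "real \<Rightarrow> real"
  assumes "open S" "x \<in> S" "\<And>y. y \<in> S \<Longrightarrow> \<eta> y = c"
  shows "deriv \<eta> x = 0" "deriv (deriv \<eta>) x = 0"
proof -
  have d: "deriv \<eta> y = 0" if "y \<in> S" for y
  proof (rule DERIV_imp_deriv)
    show "(\<eta> has_field_derivative 0) (at y)"
      by (rule has_field_derivative_transform_within_open[OF DERIV_const assms(1) that]) (use assms(3) in auto)
  qed
  show "deriv \<eta> x = 0" by (rule d[OF assms(2)])
  show "deriv (deriv \<eta>) x = 0"
  proof (rule DERIV_imp_deriv)
    show "(deriv \<eta> has_field_derivative 0) (at x)"
      by (rule has_field_derivative_transform_within_open[OF DERIV_const assms(1,2)]) (use d in auto)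
  qed
qed

lemma norm_L2_cong_AE:
  assumes "f \<in> borel_measurable lebesgue" "g \<in> borel_measurable lebesgue" "AE x in lebesgue. f x = g x"
  shows "norm_L2 f = norm_L2 g"
proof -
  have "(LINT x|lebesgue. (norm (f x))\<^sup>2) = (LINT x|lebesgue. (norm (g x))\<^sup>2)"
  proof (rule integral_cong_AE)
    show "AE x in lebesgue. (norm (f x))\<^sup>2 = (norm (g x))\<^sup>2" using assms(3) by eventually_elim simp
  qed (intro borel_measurable_power measurable_compose[OF assms(1) borel_measurable_norm],
       intro borel_measurable_power measurable_compose[OF assms(2) borel_measurable_norm])
  then show ?thesis by (simp add: norm_L2_def)
qed

text \<open>The value of the operator is unique up to null sets, so the norm does not depend on which one is
chosen.\<close>

lemma H_op_defect_norm:
  assumes "H_graph V f (\<lambda>x. complex_of_real l * f x + d x)"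
  shows "f \<in> H_dom V" "norm_L2 (\<lambda>x. H_op V f x - complex_of_real l * f x) = norm_L2 d"
proof -
  let ?h = "\<lambda>x. complex_of_real l * f x + d x"
  show "f \<in> H_dom V" using assms unfolding H_dom_def by blast
  have g: "H_graph V f (H_op V f)" unfolding H_op_def using assms by (rule someI[of "H_graph V f"])
  have ae: "AE x in lebesgue. H_op V f x = ?h x" by (rule H_graph_unique[OF g assms])
  have m: "f \<in> borel_measurable lebesgue" "?h \<in> borel_measurable lebesgue" "H_op V f \<in> borel_measurable lebesgue"
    using g assms by (auto simp: H_graph_def L2_fun_def)
  have lf: "(\<lambda>x. complex_of_real l * f x) \<in> borel_measurable lebesgue"
    by (intro borel_measurable_times borel_measurable_const m(1))
  have dm: "d \<in> borel_measurable lebesgue"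
    using borel_measurable_diff[OF m(2) lf] by simp
  show "norm_L2 (\<lambda>x. H_op V f x - complex_of_real l * f x) = norm_L2 d"
  proof (rule norm_L2_cong_AE[OF borel_measurable_diff[OF m(3) lf] dm])
    show "AE x in lebesgue. H_op V f x - complex_of_real l * f x = d x" using ae by eventually_elim simp
  qed
qed

lemma norm_L2_lower:
  assumes f: "L2_fun f" and b: "0 \<le> b" "\<And>x. x \<in> {0..1} \<Longrightarrow> b \<le> norm (f x)"
  shows "b \<le> norm_L2 f"
proof (rule power2_le_imp_le[OF _ norm_L2_nonneg])
  have i: "integrable lebesgue (\<lambda>x::real. b\<^sup>2 * indicat_real {0..1} x)"
  proof (rule integrable_mult_right)
    have "integrable lebesgue (indicat_real {a..b})" for a b :: real
      using absolutely_integrable_on_const[of "{a..b}" "1::real"] by (simp add: set_integrable_def)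
    then show "integrable lebesgue (indicat_real {0..1::real})" .
  qed
  have "b\<^sup>2 = (LINT x::real|lebesgue. b\<^sup>2 * indicat_real {0..1} x)" by simp
  also have "\<dots> \<le> (LINT x|lebesgue. (norm (f x))\<^sup>2)"
  proof (rule integral_mono[OF i])
    show "integrable lebesgue (\<lambda>x. (norm (f x))\<^sup>2)" using f by (simp add: L2_fun_def)
    show "b\<^sup>2 * indicat_real {0..1} x \<le> (norm (f x))\<^sup>2" for x
      using b(2)[of x] b(1) by (cases "x \<in> {0..1}") (auto intro: power_mono)
  qed
  finally show "b\<^sup>2 \<le> (norm_L2 f)\<^sup>2" by (simp add: norm_L2_square)
qed

context wkb begin

text \<open>The factors \<open>1 / D\<close> and \<open>l\<^sup>1\<^sup>/\<^sup>2\<close>, both at most \<open>exp (h e)\<close>, occur at most twice in total.\<close>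

lemma cut_error_bound:
  fixes C\<xi> :: real
  assumes lx: "l \<ge> l0" "x \<in> J l" and CP: "0 \<le> CP" "norm (Pd l x) \<le> CP * sqrt l"
    and g: "norm (g_mode V n l x) \<le> C2 * exp (- (c2 * e))"
    and d1: "\<bar>deriv \<eta> x\<bar> \<le> C\<xi> * (1 / D)" and d2: "\<bar>deriv (deriv \<eta>) x\<bar> \<le> C\<xi> * (1 / D)\<^sup>2"
    and D: "0 < D" "1 / D \<le> exp (h * e)" and l: "l \<le> exp (h * e)" and C\<xi>: "0 \<le> C\<xi>"
  shows "norm (cut_error \<eta> l x) \<le> C\<xi> * (2 * CP + 1) * C2 * exp ((2 * h - c2) * e)"
proof -
  have l1: "1 \<le> l" using lx(1) l0 by simp
  have "sqrt l \<le> l"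
  proof -
    have "sqrt l * 1 \<le> sqrt l * sqrt l" using l1 by (intro mult_left_mono) auto
    then show ?thesis using l1 by simp
  qed
  then have sl: "sqrt l \<le> exp (h * e)" using l by linarith
  have e2: "exp (h * e) * exp (h * e) = exp (2 * h * e)" by (simp flip: exp_add)
  have "norm (2 * complex_of_real (deriv \<eta> x) * Pd l x - complex_of_real (deriv (deriv \<eta>) x)) \<le>
      2 * \<bar>deriv \<eta> x\<bar> * norm (Pd l x) + \<bar>deriv (deriv \<eta>) x\<bar>"
    by (rule order_trans[OF norm_triangle_ineq4]) (simp add: norm_mult)
  also have "\<dots> \<le> 2 * (C\<xi> * exp (h * e)) * (CP * exp (h * e)) + C\<xi> * (exp (h * e))\<^sup>2"
  proof (intro add_mono mult_mono)
    have "C\<xi> * (1 / D) \<le> C\<xi> * exp (h * e)" using D(2) C\<xi> by (intro mult_left_mono) auto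
    then show "\<bar>deriv \<eta> x\<bar> \<le> C\<xi> * exp (h * e)" using d1 by linarith
    have "CP * sqrt l \<le> CP * exp (h * e)" using sl CP(1) by (intro mult_left_mono) auto
    then show "norm (Pd l x) \<le> CP * exp (h * e)" using CP(2) by linarith
    have "(1 / D)\<^sup>2 \<le> (exp (h * e))\<^sup>2" using D by (intro power_mono) auto
    then have "C\<xi> * (1 / D)\<^sup>2 \<le> C\<xi> * (exp (h * e))\<^sup>2" using C\<xi> by (intro mult_left_mono) auto
    then show "\<bar>deriv (deriv \<eta>) x\<bar> \<le> C\<xi> * (exp (h * e))\<^sup>2" using d2 by linarith
  qed (use C\<xi> in auto)
  also have "\<dots> = C\<xi> * (2 * CP + 1) * exp (2 * h * e)"
    unfolding e2[symmetric] by (simp add: power2_eq_square algebra_simps)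
  finally have A: "norm (2 * complex_of_real (deriv \<eta> x) * Pd l x - complex_of_real (deriv (deriv \<eta>) x)) \<le> C\<xi> * (2 * CP + 1) * exp (2 * h * e)" .
  have "norm (cut_error \<eta> l x) \<le> (C\<xi> * (2 * CP + 1) * exp (2 * h * e)) * (C2 * exp (- (c2 * e)))"
    unfolding cut_error_def norm_mult[of _ "g_mode V n l x"]
    by (rule mult_mono'[OF A g]) auto
  also have "\<dots> = C\<xi> * (2 * CP + 1) * C2 * (exp (2 * h * e) * exp (- (c2 * e)))" by simp
  also have "exp (2 * h * e) * exp (- (c2 * e)) = exp ((2 * h - c2) * e)"
    by (simp add: left_diff_distrib flip: exp_add)
  finally show ?thesis .
qed

text \<open>The functions \<open>\<sigma>b\<close> are any upper bounds for the size of the remainder on the two sides. The cut-off error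
vanishes where the cut-off is locally constant; on the rest of \<open>J\<close> it is bounded by the decay of \<open>g\<close>.\<close>

lemma pseudomode_estimate:
  fixes \<delta> \<Delta> E \<sigma>b :: "side \<Rightarrow> real \<Rightarrow> real" and \<xi> :: "real \<Rightarrow> real \<Rightarrow> real"
  assumes geom: "\<And>s. end_geometry (\<lambda>t. V (sg s * t)) (\<nu> s) (\<delta> s) (\<Delta> s) (E s)"
    and U: "\<And>x. U x = norm (V x) + 1"
    and w: "\<And>s t. 0 \<le> t \<Longrightarrow> w (sg s * t) = japanese t powr \<nu> s"
    and J: "\<And>l. J l = {- \<delta> Minus l <..< \<delta> Plus l}"
    and J0: "\<And>s l. l \<ge> l0 \<Longrightarrow> 0 < \<delta> s l"
    and sign: "\<And>s. \<exists>X. \<forall>t\<ge>X. 0 < sg s * Im (V (sg s * t))"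
    and Uw: "\<And>r. \<exists>K. \<forall>x. \<bar>x\<bar> \<le> r \<longrightarrow> U x * w x \<le> K"
    and C\<xi>: "0 < C\<xi>"
    and cutoff: "\<forall>\<^sub>F l in at_top. test_fun (\<xi> l) \<and>
           (\<forall>x\<in>{- \<delta> Minus l + \<Delta> Minus l <..< \<delta> Plus l - \<Delta> Plus l}. \<xi> l x = 1) \<and>
           (\<forall>x. x \<notin> {- \<delta> Minus l <..< \<delta> Plus l} \<longrightarrow> \<xi> l x = 0) \<and>
           (\<forall>s. \<forall>j\<in>{1,2}. AE x in lebesgue. x \<in> half_line s \<longrightarrow>
              \<bar>(deriv ^^ j) (\<xi> l) x\<bar> \<le> C\<xi> * \<Delta> s l powr (- real j))"
    and \<sigma>b: "\<And>s l. 0 \<le> \<sigma>b s l"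
    and CS: "\<And>s. \<exists>C\<ge>0. \<forall>\<^sub>F l in at_top. \<forall>t. 0 \<le> t \<and> t < \<delta> s l \<longrightarrow>
        l powr (- (real n + 1) / 2) * (U (sg s * t) * w (sg s * t) ^ N) \<le> C * \<sigma>b s l"
  obtains c C where "\<And>s. 0 < c s" "0 \<le> C"
    "\<forall>\<^sub>F l in at_top. (let f = pseudomode V n \<xi> l in f \<in> H_dom V \<and> 0 < norm_L2 f \<and>
       norm_L2 (\<lambda>x. H_op V f x - complex_of_real l * f x) / norm_L2 f
         \<le> C * ((exp (- (c Minus * E Minus l)) + exp (- (c Plus * E Plus l))) + (\<sigma>b Minus l + \<sigma>b Plus l)))"
proof -
  have Jside: "sg s * t \<in> J l" if "l \<ge> l0" "0 \<le> t" "t < \<delta> s l" for s l t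
    using that J0[OF that(1), of Minus] J0[OF that(1), of Plus] unfolding J by (cases s) auto
  have g_ex: "\<exists>c2 C2. 0 < c2 \<and> 0 < C2 \<and>
    (\<forall>\<^sub>F l in at_top. \<forall>t. \<delta> s l - \<Delta> s l \<le> t \<and> t < \<delta> s l \<longrightarrow> norm (g_mode V n l (sg s * t)) \<le> C2 * exp (- (c2 * E s l))) \<and>
    (\<forall>\<^sub>F l in at_top. \<forall>t. 0 \<le> t \<and> t \<le> 1 \<longrightarrow> C2 \<ge> 1 \<and> norm (g_mode V n l (sg s * t)) \<ge> 1 / C2)" for s
  proof -
    obtain X where X: "\<And>t. X \<le> t \<Longrightarrow> 0 < sg s * Im (V (sg s * t))" using sign by blast
    have small: "\<exists>X'. \<forall>\<^sub>F l in at_top. \<forall>t. X' \<le> t \<and> t < \<delta> s l \<longrightarrow>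
        U (sg s * t) * w (sg s * t) \<le> \<eta> * (sqrt l * \<bar>Im (V (sg s * t))\<bar>)" if \<eta>: "0 < \<eta>" for \<eta>
    proof -
      obtain Y where Y: "\<forall>\<^sub>F l in at_top. \<forall>t. Y \<le> t \<and> t < \<delta> s l \<longrightarrow>
        (norm (V (sg s * t)) + 1) * japanese t powr \<nu> s \<le> \<eta> * (sqrt l * \<bar>Im (V (sg s * t))\<bar>)"
        using geom[of s] \<eta> unfolding end_geometry_def by blast
      have "\<forall>\<^sub>F l in at_top. \<forall>t. max Y 0 \<le> t \<and> t < \<delta> s l \<longrightarrow>
        U (sg s * t) * w (sg s * t) \<le> \<eta> * (sqrt l * \<bar>Im (V (sg s * t))\<bar>)"
        using Y
      proof eventually_elim
        fix l assume H: "\<forall>t. Y \<le> t \<and> t < \<delta> s l \<longrightarrow>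
          (norm (V (sg s * t)) + 1) * japanese t powr \<nu> s \<le> \<eta> * (sqrt l * \<bar>Im (V (sg s * t))\<bar>)"
        show "\<forall>t. max Y 0 \<le> t \<and> t < \<delta> s l \<longrightarrow> U (sg s * t) * w (sg s * t) \<le> \<eta> * (sqrt l * \<bar>Im (V (sg s * t))\<bar>)"
        proof (intro allI impI)
          fix t assume t: "max Y 0 \<le> t \<and> t < \<delta> s l"
          then show "U (sg s * t) * w (sg s * t) \<le> \<eta> * (sqrt l * \<bar>Im (V (sg s * t))\<bar>)"
            using H w[of t s] unfolding U by simp
        qed
      qed
      then show ?thesis by blast
    qed
    have \<delta>: "filterlim (\<delta> s) at_top at_top" and \<Delta>: "\<forall>\<^sub>F l in at_top. 0 < \<Delta> s l \<and> \<Delta> s l \<le> \<delta> s l / 4"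
      using geom[of s] unfolding end_geometry_def by blast+
    obtain c where c: "0 < c" "\<forall>\<^sub>F l in at_top. \<forall>t\<in>{\<delta> s l - 2 * \<Delta> s l..\<delta> s l - \<Delta> s l}.
        c * (sqrt l * E s l) \<le> \<Delta> s l * \<bar>Im (V (sg s * t))\<bar>"
      using geom[of s] unfolding end_geometry_def by blast
    show ?thesis
      by (rule g_decay[OF Jside X Uw small \<delta> \<Delta> c]) blast+
  qed
  define good_g where "good_g s c2 C2 \<longleftrightarrow> 0 < c2 \<and> 0 < C2 \<and>
    (\<forall>\<^sub>F l in at_top. \<forall>t. \<delta> s l - \<Delta> s l \<le> t \<and> t < \<delta> s l \<longrightarrow> norm (g_mode V n l (sg s * t)) \<le> C2 * exp (- (c2 * E s l))) \<and>
    (\<forall>\<^sub>F l in at_top. \<forall>t. 0 \<le> t \<and> t \<le> 1 \<longrightarrow> C2 \<ge> 1 \<and> norm (g_mode V n l (sg s * t)) \<ge> 1 / C2)"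
    for s c2 C2
  have "\<exists>c2 C2. good_g s c2 C2" for s using g_ex[of s] unfolding good_g_def .
  then obtain c2 C2 where gg: "\<And>s. good_g s (c2 s) (C2 s)" by metis
  have c2: "0 < c2 s" and C2: "0 < C2 s"
    and gup: "\<forall>\<^sub>F l in at_top. \<forall>t. \<delta> s l - \<Delta> s l \<le> t \<and> t < \<delta> s l \<longrightarrow>
        norm (g_mode V n l (sg s * t)) \<le> C2 s * exp (- (c2 s * E s l))"
    and glow: "\<forall>\<^sub>F l in at_top. \<forall>t. 0 \<le> t \<and> t \<le> 1 \<longrightarrow> C2 s \<ge> 1 \<and> norm (g_mode V n l (sg s * t)) \<ge> 1 / C2 s" for s
    using gg[of s] unfolding good_g_def by blast+
  obtain CP where CP: "CP \<ge> 0" "\<And>l x. l \<ge> l0 \<Longrightarrow> x \<in> J l \<Longrightarrow> norm (Pd l x) \<le> CP * sqrt l"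
    using Pd_bound by blast
  obtain CR where CR: "CR \<ge> 0" "\<And>l x. l \<ge> l0 \<Longrightarrow> x \<in> J l \<Longrightarrow> x \<notin> Z \<Longrightarrow>
      norm (rem l x) \<le> CR * (l powr (- (real n + 1) / 2) * (U x * w x ^ N))"
    using rem_bound by blast
  define good_S where "good_S s C \<longleftrightarrow> 0 \<le> C \<and> (\<forall>\<^sub>F l in at_top. \<forall>t. 0 \<le> t \<and> t < \<delta> s l \<longrightarrow>
        l powr (- (real n + 1) / 2) * (U (sg s * t) * w (sg s * t) ^ N) \<le> C * \<sigma>b s l)" for s C
  have "\<exists>C. good_S s C" for s using CS[of s] unfolding good_S_def .
  then obtain cs where gs: "\<And>s. good_S s (cs s)" by metis
  have cs: "0 \<le> cs s" "\<forall>\<^sub>F l in at_top. \<forall>t. 0 \<le> t \<and> t < \<delta> s l \<longrightarrow>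
        l powr (- (real n + 1) / 2) * (U (sg s * t) * w (sg s * t) ^ N) \<le> cs s * \<sigma>b s l" for s
    using gs[of s] unfolding good_S_def by blast+
  (* Three factors exp (h E) are spent: two on the cut-off error and one on the square root of the
     length. This uses up half of the exponent c2. *)
  define h where "h s = c2 s / 6" for s
  have hpos: "0 < h s" for s using c2[of s] by (simp add: h_def)
  define A where "A s = C\<xi> * (2 * CP + 1) * C2 s" for s
  have A: "0 \<le> A s" for s unfolding A_def using C\<xi> CP(1) C2[of s] by simp
  define S where "S l = CR * (cs Minus * \<sigma>b Minus l + cs Plus * \<sigma>b Plus l)" for l
  have S: "0 \<le> S l" for l unfolding S_def using CR(1) cs(1) \<sigma>b by (intro mult_nonneg_nonneg add_nonneg_nonneg) auto
  let ?C = "2 * C2 Plus * (A Minus + A Plus) + 2 * CR * (cs Minus + cs Plus)"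
  define regime where "regime s l \<longleftrightarrow> (0 < \<Delta> s l \<and> \<Delta> s l \<le> \<delta> s l / 4) \<and> 4 \<le> \<delta> s l \<and>
      (l \<le> exp (h s * E s l) \<and> 1 / \<Delta> s l \<le> exp (h s * E s l) \<and> \<delta> s l \<le> exp (h s * E s l)) \<and>
      (\<forall>t. \<delta> s l - \<Delta> s l \<le> t \<and> t < \<delta> s l \<longrightarrow> norm (g_mode V n l (sg s * t)) \<le> C2 s * exp (- (c2 s * E s l))) \<and>
      (\<forall>t. 0 \<le> t \<and> t < \<delta> s l \<longrightarrow>
        l powr (- (real n + 1) / 2) * (U (sg s * t) * w (sg s * t) ^ N) \<le> cs s * \<sigma>b s l)" for s l
  have ev_side: "\<forall>\<^sub>F l in at_top. regime s l" for s
  proof -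
    have e1: "\<forall>\<^sub>F l in at_top. 0 < \<Delta> s l \<and> \<Delta> s l \<le> \<delta> s l / 4" using geom[of s] unfolding end_geometry_def by blast
    have "filterlim (\<delta> s) at_top at_top" using geom[of s] unfolding end_geometry_def by blast
    then have e2: "\<forall>\<^sub>F l in at_top. 4 \<le> \<delta> s l" unfolding filterlim_at_top by blast
    have e3: "\<forall>\<^sub>F l in at_top. l \<le> exp (h s * E s l) \<and> 1 / \<Delta> s l \<le> exp (h s * E s l) \<and> \<delta> s l \<le> exp (h s * E s l)"
      using geom[of s] hpos unfolding end_geometry_def by blast
    show ?thesis unfolding regime_def
      by (rule eventually_conj[OF e1 eventually_conj[OF e2 eventually_conj[OF e3 eventually_conj[OF gup cs(2)]]]])
  qed
  have ev_all: "\<forall>\<^sub>F l in at_top. \<forall>s. regime s l"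
    using ev_side[of Minus] ev_side[of Plus]
  proof eventually_elim
    case (elim l)
    show ?case
    proof
      fix s show "regime s l" using elim by (cases s) blast+
    qed
  qed
  show ?thesis
  proof (rule that[of "\<lambda>s. c2 s / 2" ?C])
    show "0 < c2 s / 2" for s using c2[of s] by simp
    show "0 \<le> ?C" using C2[of Plus] A CR(1) cs(1) by (intro add_nonneg_nonneg mult_nonneg_nonneg) auto
    show "\<forall>\<^sub>F l in at_top. (let f = pseudomode V n \<xi> l in f \<in> H_dom V \<and> 0 < norm_L2 f \<and>
       norm_L2 (\<lambda>x. H_op V f x - complex_of_real l * f x) / norm_L2 f
         \<le> ?C * ((exp (- (c2 Minus / 2 * E Minus l)) + exp (- (c2 Plus / 2 * E Plus l))) + (\<sigma>b Minus l + \<sigma>b Plus l)))"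
      using ev_all cutoff glow[of Plus] eventually_ge_at_top[of l0]
    proof eventually_elim
      fix l
      assume H: "\<forall>s. regime s l"
        and cut: "test_fun (\<xi> l) \<and>
           (\<forall>x\<in>{- \<delta> Minus l + \<Delta> Minus l <..< \<delta> Plus l - \<Delta> Plus l}. \<xi> l x = 1) \<and>
           (\<forall>x. x \<notin> {- \<delta> Minus l <..< \<delta> Plus l} \<longrightarrow> \<xi> l x = 0) \<and>
           (\<forall>s. \<forall>j\<in>{1,2}. AE x in lebesgue. x \<in> half_line s \<longrightarrow>
              \<bar>(deriv ^^ j) (\<xi> l) x\<bar> \<le> C\<xi> * \<Delta> s l powr (- real j))"
        and low: "\<forall>t. 0 \<le> t \<and> t \<le> 1 \<longrightarrow> C2 Plus \<ge> 1 \<and> norm (g_mode V n l (sg Plus * t)) \<ge> 1 / C2 Plus"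
        and l: "l \<ge> l0"
      have tf: "test_fun (\<xi> l)" and one: "\<And>x. x \<in> {- \<delta> Minus l + \<Delta> Minus l <..< \<delta> Plus l - \<Delta> Plus l} \<Longrightarrow> \<xi> l x = 1"
        and zero: "\<And>x. x \<notin> {- \<delta> Minus l <..< \<delta> Plus l} \<Longrightarrow> \<xi> l x = 0"
        and AEd: "\<And>s j. j \<in> {1,2} \<Longrightarrow> AE x in lebesgue. x \<in> half_line s \<longrightarrow>
              \<bar>(deriv ^^ j) (\<xi> l) x\<bar> \<le> C\<xi> * \<Delta> s l powr (- real j)"
        using cut by blast+
      have \<Delta>: "0 < \<Delta> s l" "\<Delta> s l \<le> \<delta> s l / 4" and \<delta>4: "4 \<le> \<delta> s l" and le: "l \<le> exp (h s * E s l)"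
        and \<Delta>e: "1 / \<Delta> s l \<le> exp (h s * E s l)" and \<delta>e: "\<delta> s l \<le> exp (h s * E s l)" for s
        using H unfolding regime_def by blast+
      have gu: "norm (g_mode V n l (sg s * t)) \<le> C2 s * exp (- (c2 s * E s l))" if "\<delta> s l - \<Delta> s l \<le> t" "t < \<delta> s l" for s t
        using H that unfolding regime_def by blast
      have \<sigma>u: "l powr (- (real n + 1) / 2) * (U (sg s * t) * w (sg s * t) ^ N) \<le> cs s * \<sigma>b s l" if "0 \<le> t" "t < \<delta> s l" for s t
        using H that unfolding regime_def by blast
      define f where "f = (\<lambda>x. complex_of_real (\<xi> l x) * g_mode V n l x)"
      have fp: "pseudomode V n \<xi> l = f" by (simp add: f_def pseudomode_def[abs_def])
      have graph: "H_graph V f (\<lambda>x. complex_of_real l * f x + defect (\<xi> l) l x)"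
        unfolding f_def by (rule pseudomode_H_graph[OF l tf])
      have nf: "1 / C2 Plus \<le> norm_L2 f"
      proof (rule norm_L2_lower)
        show "L2_fun f" using graph by (simp add: H_graph_def)
        show "0 \<le> 1 / C2 Plus" using C2[of Plus] by simp
        fix x :: real assume x: "x \<in> {0..1}"
        have "\<xi> l x = 1"
          using x \<Delta>(2)[of Plus] \<Delta>(2)[of Minus] \<delta>4[of Plus] \<delta>4[of Minus] by (intro one) auto
        then show "1 / C2 Plus \<le> norm (f x)" using low x by (simp add: f_def)
      qed
      have nf0: "0 < norm_L2 f" using nf C2[of Plus] by (meson divide_pos_pos less_le_trans zero_less_one)
      define K where "K s = A s * exp ((2 * h s - c2 s) * E s l)" for s
      have K: "0 \<le> K s" for s using A[of s] by (simp add: K_def)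
      have def_le: "norm_L2 (defect (\<xi> l) l) \<le> 2 * (K Minus * sqrt (\<delta> Minus l) + K Plus * sqrt (\<delta> Plus l)) + 2 * S l * norm_L2 f"
        unfolding f_def
      proof (rule norm_defect_bound[OF l tf _ K S])
        show "0 \<le> \<delta> s l" for s using \<delta>4[of s] by simp
        show "AE x in lebesgue. 0 < sg s * x \<longrightarrow> norm (cut_error (\<xi> l) l x) \<le> (if sg s * x \<le> \<delta> s l then K s else 0)" for s
        proof -
          have n\<delta>: "AE x in lebesgue. x \<noteq> sg s * \<delta> s l"
            unfolding AE_lebesgue_negligible by (rule exI[of _ "{sg s * \<delta> s l}"]) auto
          have A1: "AE x in lebesgue. x \<in> half_line s \<longrightarrow> \<bar>deriv (\<xi> l) x\<bar> \<le> C\<xi> * \<Delta> s l powr - 1"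
            using AEd[of 1 s] by simp
          have A2: "AE x in lebesgue. x \<in> half_line s \<longrightarrow> \<bar>(deriv ^^ 2) (\<xi> l) x\<bar> \<le> C\<xi> * \<Delta> s l powr - 2"
            using AEd[of 2 s] by simp
          show ?thesis
            using A1 A2 n\<delta>
          proof eventually_elim
            fix x assume D1: "x \<in> half_line s \<longrightarrow> \<bar>deriv (\<xi> l) x\<bar> \<le> C\<xi> * \<Delta> s l powr - 1"
              and D2: "x \<in> half_line s \<longrightarrow> \<bar>(deriv ^^ 2) (\<xi> l) x\<bar> \<le> C\<xi> * \<Delta> s l powr - 2" and x\<delta>: "x \<noteq> sg s * \<delta> s l"
            show "0 < sg s * x \<longrightarrow> norm (cut_error (\<xi> l) l x) \<le> (if sg s * x \<le> \<delta> s l then K s else 0)"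
            proof
              assume x0: "0 < sg s * x"
              define t where "t = sg s * x"
              have xt: "x = sg s * t" by (simp add: t_def)
              have t0: "0 < t" using x0 by (simp add: t_def)
              have t\<delta>: "t \<noteq> \<delta> s l" using x\<delta> xt by auto
              have zero_err: "cut_error (\<xi> l) l x = 0" if "deriv (\<xi> l) x = 0" "deriv (deriv (\<xi> l)) x = 0"
                using that by (simp add: cut_error_def)
              consider "t < \<delta> s l - \<Delta> s l" | "\<delta> s l - \<Delta> s l \<le> t \<and> t < \<delta> s l" | "\<delta> s l < t"
                using t\<delta> by linarith
              then show "norm (cut_error (\<xi> l) l x) \<le> (if sg s * x \<le> \<delta> s l then K s else 0)"
              proof cases
                case 1
                let ?I = "{- \<delta> Minus l + \<Delta> Minus l <..< \<delta> Plus l - \<Delta> Plus l}"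
                have "x \<in> ?I" unfolding xt
                  using 1 t0 \<Delta>(2)[of Plus] \<Delta>(2)[of Minus] \<delta>4[of Plus] \<delta>4[of Minus] by (cases s) auto
                then have "cut_error (\<xi> l) l x = 0"
                  using deriv_zero_if_locally_const[of ?I x "\<xi> l" 1] one by (intro zero_err) auto
                then show ?thesis using K[of s] by simp
              next
                case 3
                have "\<exists>S. open S \<and> x \<in> S \<and> (\<forall>y\<in>S. \<xi> l y = 0)"
                proof (cases s)
                  case Minus
                  then have "x \<in> {..< - \<delta> Minus l}" using 3 xt by auto
                  moreover have "\<forall>y\<in>{..< - \<delta> Minus l}. \<xi> l y = 0" using zero by auto
                  ultimately show ?thesis by (intro exI[of _ "{..< - \<delta> Minus l}"]) auto
                next
                  case Plus
                  then have "x \<in> {\<delta> Plus l <..}" using 3 xt by auto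
                  moreover have "\<forall>y\<in>{\<delta> Plus l <..}. \<xi> l y = 0" using zero by auto
                  ultimately show ?thesis by (intro exI[of _ "{\<delta> Plus l <..}"]) auto
                qed
                then obtain S where "open S" "x \<in> S" "\<And>y. y \<in> S \<Longrightarrow> \<xi> l y = 0" by blast
                then have "cut_error (\<xi> l) l x = 0"
                  using deriv_zero_if_locally_const[of S x "\<xi> l" 0] by (intro zero_err) auto
                then show ?thesis using K[of s] by simp
              next
                case 2
                have xJ: "x \<in> J l" unfolding xt using 2 t0 by (intro Jside l) auto
                have hl: "x \<in> half_line s" using x0 by (simp add: half_line_def)
                have p1: "\<Delta> s l powr - 1 = 1 / \<Delta> s l" using \<Delta>(1)[of s] by (simp add: powr_minus_divide)
                have p2: "\<Delta> s l powr - 2 = (1 / \<Delta> s l)\<^sup>2"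
                  using \<Delta>(1)[of s] by (simp add: powr_minus_divide power_divide)
                have "norm (cut_error (\<xi> l) l x) \<le> K s"
                  unfolding K_def A_def
                proof (rule cut_error_bound[OF l xJ CP(1) CP(2)[OF l xJ] _ _ _ \<Delta>(1) \<Delta>e le])
                  show "norm (g_mode V n l x) \<le> C2 s * exp (- (c2 s * E s l))" unfolding xt using 2 by (intro gu) auto
                  show "\<bar>deriv (\<xi> l) x\<bar> \<le> C\<xi> * (1 / \<Delta> s l)" using D1 hl unfolding p1 by blast
                  have "\<bar>(deriv ^^ 2) (\<xi> l) x\<bar> \<le> C\<xi> * (1 / \<Delta> s l)\<^sup>2" using D2 hl unfolding p2 by blast
                  then show "\<bar>deriv (deriv (\<xi> l)) x\<bar> \<le> C\<xi> * (1 / \<Delta> s l)\<^sup>2" by (simp add: numeral_2_eq_2)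
                qed (use C\<xi> in simp)
                then show ?thesis using 2 by (simp add: t_def)
              qed
            qed
          qed
        qed
        show "AE x in lebesgue. \<xi> l x \<noteq> 0 \<longrightarrow> norm (rem l x) \<le> S l"
          unfolding AE_lebesgue_negligible
        proof (intro exI[of _ Z] conjI allI impI neg_Z)
          fix x assume xZ: "x \<notin> Z" and x: "\<xi> l x \<noteq> 0"
          then have xJ: "x \<in> J l" unfolding J using zero by blast
          have "\<exists>s t. x = sg s * t \<and> 0 \<le> t \<and> t < \<delta> s l"
          proof (cases "0 \<le> x")
            case True
            then show ?thesis using xJ unfolding J by (intro exI[of _ Plus] exI[of _ x]) auto
          next
            case False
            then show ?thesis using xJ unfolding J by (intro exI[of _ Minus] exI[of _ "- x"]) auto
          qed
          then obtain s t where t: "x = sg s * t" "0 \<le> t" "t < \<delta> s l" by blast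
          have "norm (rem l x) \<le> CR * (l powr (- (real n + 1) / 2) * (U x * w x ^ N))" by (rule CR(2)[OF l xJ xZ])
          also have "\<dots> \<le> CR * (cs s * \<sigma>b s l)" unfolding t(1) using \<sigma>u[OF t(2,3)] CR(1) by (rule mult_left_mono)
          also have "\<dots> \<le> S l" unfolding S_def
          proof (rule mult_left_mono[OF _ CR(1)])
            have "0 \<le> cs s * \<sigma>b s l" for s using cs(1) \<sigma>b by simp
            then show "cs s * \<sigma>b s l \<le> cs Minus * \<sigma>b Minus l + cs Plus * \<sigma>b Plus l" by (cases s) auto
          qed
          finally show "norm (rem l x) \<le> S l" .
        qed
      qed
      have Ks: "K s * sqrt (\<delta> s l) \<le> A s * exp (- (c2 s / 2 * E s l))" for s
      proof -
        have d1: "1 \<le> \<delta> s l" using \<delta>4[of s] by simp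
        have "sqrt (\<delta> s l) * 1 \<le> sqrt (\<delta> s l) * sqrt (\<delta> s l)" using d1 by (intro mult_left_mono) auto
        then have "sqrt (\<delta> s l) \<le> exp (h s * E s l)" using \<delta>e[of s] d1 by simp
        then have "K s * sqrt (\<delta> s l) \<le> K s * exp (h s * E s l)" using K[of s] by (rule mult_left_mono)
        also have "\<dots> = A s * exp ((2 * h s - c2 s) * E s l + h s * E s l)" by (simp add: K_def exp_add)
        also have "(2 * h s - c2 s) * E s l + h s * E s l = - (c2 s / 2 * E s l)" by (simp add: h_def algebra_simps)
        finally show ?thesis .
      qed
      let ?eM = "exp (- (c2 Minus / 2 * E Minus l))" and ?eP = "exp (- (c2 Plus / 2 * E Plus l))"
      have "norm_L2 (defect (\<xi> l) l) / norm_L2 f \<le>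
          (2 * (A Minus * ?eM + A Plus * ?eP) + 2 * S l * norm_L2 f) / norm_L2 f"
        using def_le Ks[of Minus] Ks[of Plus] nf0 by (intro divide_right_mono) auto
      also have "\<dots> = 2 * (A Minus * ?eM + A Plus * ?eP) * (1 / norm_L2 f) + 2 * S l"
        using nf0 by (simp add: add_divide_distrib)
      also have "\<dots> \<le> 2 * (A Minus * ?eM + A Plus * ?eP) * C2 Plus + 2 * S l"
      proof (intro add_right_mono mult_left_mono)
        show "1 / norm_L2 f \<le> C2 Plus" using nf nf0 C2[of Plus] by (simp add: field_simps)
        show "0 \<le> 2 * (A Minus * ?eM + A Plus * ?eP)" using A by simp
      qed
      also have "\<dots> \<le> ?C * ((?eM + ?eP) + (\<sigma>b Minus l + \<sigma>b Plus l))"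
      proof -
        have gen: "2 * (aM * eM + aP * eP) * k + 2 * (r * (cM * sM + cP * sP))
            \<le> (2 * k * (aM + aP) + 2 * r * (cM + cP)) * ((eM + eP) + (sM + sP))"
          if "0 \<le> aM" "0 \<le> aP" "0 \<le> eM" "0 \<le> eP" "0 \<le> k" "0 \<le> r" "0 \<le> cM" "0 \<le> cP" "0 \<le> sM" "0 \<le> sP"
          for aM aP eM eP k r cM cP sM sP :: real
        proof -
          have "(2 * k * (aM + aP) + 2 * r * (cM + cP)) * ((eM + eP) + (sM + sP))
            - (2 * (aM * eM + aP * eP) * k + 2 * (r * (cM * sM + cP * sP)))
            = 2 * (k * aM * eP) + 2 * (k * aP * eM) + 2 * (k * (aM + aP) * (sM + sP))
              + 2 * (r * (cM + cP) * (eM + eP)) + 2 * (r * cM * sP) + 2 * (r * cP * sM)"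
            by (simp add: algebra_simps)
          moreover have "0 \<le> \<dots>" using that by (intro add_nonneg_nonneg mult_nonneg_nonneg) auto
          ultimately show ?thesis by linarith
        qed
        show ?thesis unfolding S_def using A C2[of Plus] CR(1) cs(1) \<sigma>b by (intro gen) (auto intro: less_imp_le)
      qed
      finally have "norm_L2 (defect (\<xi> l) l) / norm_L2 f \<le> ?C * ((?eM + ?eP) + (\<sigma>b Minus l + \<sigma>b Plus l))" .
      then show "let f = pseudomode V n \<xi> l in f \<in> H_dom V \<and> 0 < norm_L2 f \<and>
       norm_L2 (\<lambda>x. H_op V f x - complex_of_real l * f x) / norm_L2 f
         \<le> ?C * ((?eM + ?eP) + (\<sigma>b Minus l + \<sigma>b Plus l))"
        using H_op_defect_norm[OF graph] nf0 unfolding fp Let_def by simp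
    qed
  qed
qed

end

section \<open>The potential at its two ends\<close>

lemma AE_le_continuous:
  fixes F G :: "real \<Rightarrow> real"
  assumes "continuous_on UNIV F" "continuous_on UNIV G" "AE x in lebesgue. F x \<le> G x"
  shows "F x \<le> G x"
proof (rule ccontr)
  assume "\<not> F x \<le> G x"
  have "open {x. G x < F x}" using assms(1,2) by (intro open_Collect_less)
  moreover have "x \<in> {x. G x < F x}" using \<open>\<not> F x \<le> G x\<close> by simp
  ultimately obtain e where e: "e > 0" "ball x e \<subseteq> {x. G x < F x}" using open_contains_ball by blast
  obtain Z where Z: "negligible Z" "\<And>x. x \<notin> Z \<Longrightarrow> F x \<le> G x" using assms(3) unfolding AE_lebesgue_negligible by blast
  have "ball x e \<subseteq> Z" using e(2) Z(2) by (metis (no_types, lifting) mem_Collect_eq not_le subset_iff)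
  then have "negligible (ball x e)" using Z(1) negligible_subset by blast
  then show False using e(1) open_not_negligible[of "ball x e"] by simp
qed

lemma AE_sg:
  assumes "AE x in lebesgue. P x" shows "AE t in lebesgue. P (sg s * t)"
proof -
  obtain Z where Z: "negligible Z" "\<And>x. x \<notin> Z \<Longrightarrow> P x" using assms unfolding AE_lebesgue_negligible by blast
  have "negligible ((\<lambda>x. sg s * x) ` Z)"
    using Z(1) by (intro negligible_differentiable_image_negligible) (auto intro!: derivative_intros)
  moreover have "P (sg s * t)" if "t \<notin> (\<lambda>x. sg s * x) ` Z" for t
  proof (rule Z(2))
    show "sg s * t \<notin> Z" using that sg_square[of s t] by (metis image_eqI)
  qed
  ultimately show ?thesis unfolding AE_lebesgue_negligible by blast
qed

lemma eventually_at_endD: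
  assumes "eventually P (at_end s)" shows "\<exists>X. \<forall>t\<ge>X. P (sg s * t)"
proof (cases s)
  case Minus
  then obtain Y where Y: "\<And>x. x \<le> Y \<Longrightarrow> P x" using assms by (auto simp: eventually_at_bot_linorder)
  have "P (sg s * t)" if "- Y \<le> t" for t using Y[of "- t"] that Minus by simp
  then show ?thesis by blast
next
  case Plus
  then show ?thesis using assms by (auto simp: eventually_at_top_linorder)
qed

lemma powr_to_power: "0 < x \<Longrightarrow> (x powr a) ^ k = x powr (real k * a)" for x a :: real
  by (simp add: powr_powr mult.commute flip: powr_realpow)

locale potential =
  fixes V :: "real \<Rightarrow> complex" and N n :: nat and \<nu> \<epsilon>1 \<epsilon>2 :: "side \<Rightarrow> real"
  assumes N: "1 \<le> N" and n: "n = N - 1"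
    and V: "standing_assumption N V \<nu> \<epsilon>1"
    and \<epsilon>2: "\<And>s. bounded_at s V \<Longrightarrow> 0 < \<epsilon>2 s \<and> \<epsilon>2 s < 1 - \<nu> s"
begin

abbreviation \<delta> where "\<delta> s l \<equiv> cut_delta V \<nu> \<epsilon>1 \<epsilon>2 s l"
abbreviation \<Delta> where "\<Delta> s l \<equiv> cut_Delta V \<nu> \<epsilon>1 \<epsilon>2 s l"

text \<open>The exponent in the claimed bound for \<open>\<kappa>\<close>.\<close>

definition decay :: "side \<Rightarrow> real \<Rightarrow> real" where
  "decay s l = (if bounded_at s V then l powr (\<epsilon>2 s / 2) else \<delta> s l powr (\<nu> s + 1 + \<epsilon>1 s))"

text \<open>Each end has its own power; with minimum and maximum the two match continuously at the origin, where both
brackets are \<open>1\<close>.\<close>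

definition w :: "real \<Rightarrow> real" where
  "w x = japanese (min x 0) powr \<nu> Minus * japanese (max x 0) powr \<nu> Plus"

text \<open>The summand \<open>1\<close> keeps this away from zero where \<open>V\<close> vanishes, as the derivatives of \<open>V\<close> need not
vanish there.\<close>

definition U :: "real \<Rightarrow> real" where
  "U x = norm (V x) + 1"

lemma V_cont: "continuous_on A V"
  using V continuous_on_subset unfolding standing_assumption_def by blast

lemma w_side: "0 \<le> t \<Longrightarrow> w (sg s * t) = japanese t powr \<nu> s"
  by (cases s) (auto simp: w_def japanese_def)

lemma w_pos: "0 < w x"
  unfolding w_def using japanese_pos[of "min x 0"] japanese_pos[of "max x 0"] by (intro mult_pos_pos) auto

lemma w_cont: "continuous_on A w"
  unfolding w_def[abs_def]
  by (intro continuous_on_mult continuous_on_compose2[OF continuous_japanese_powr[of UNIV]] continuous_intros) auto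

lemma U_cont: "continuous_on A U"
  unfolding U_def[abs_def] by (intro continuous_intros V_cont)

lemma U_ge: "1 \<le> U x" "norm (V x) \<le> U x"
  by (auto simp: U_def)

lemma side_cases: obtains s t where "x = sg s * t" "0 \<le> t"
proof (cases "0 \<le> x")
  case True then show ?thesis using that[of Plus x] by simp
next
  case False then show ?thesis using that[of Minus "- x"] by simp
qed

lemma sign_at_end: "\<exists>c0>0. \<exists>X\<ge>1. \<forall>t\<ge>X. c0 \<le> sg s * Im (V (sg s * t))"
proof -
  have "\<exists>c0>0. eventually (\<lambda>x. c0 \<le> sg s * Im (V x)) (at_end s)"
  proof (cases s)
    case Minus
    have L: "Limsup at_bot (\<lambda>x. ereal (Im (V x))) < 0" using V unfolding standing_assumption_def by blast
    then obtain r where r: "Limsup at_bot (\<lambda>x. ereal (Im (V x))) < ereal r" "ereal r < 0"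
      using ereal_dense2 by blast
    have "eventually (\<lambda>x. ereal (Im (V x)) < ereal r) at_bot" by (rule Limsup_lessD[OF r(1)])
    then have "eventually (\<lambda>x. - r \<le> sg s * Im (V x)) (at_end s)"
      unfolding Minus at_end.simps by eventually_elim simp
    then show ?thesis using r(2) by (intro exI[of _ "- r"]) simp
  next
    case Plus
    have L: "0 < Liminf at_top (\<lambda>x. ereal (Im (V x)))" using V unfolding standing_assumption_def by blast
    then obtain r where r: "0 < ereal r" "ereal r < Liminf at_top (\<lambda>x. ereal (Im (V x)))"
      using ereal_dense2 by blast
    have "eventually (\<lambda>x. ereal r < ereal (Im (V x))) at_top" by (rule less_LiminfD[OF r(2)])
    then have "eventually (\<lambda>x. r \<le> sg s * Im (V x)) (at_end s)"
      unfolding Plus at_end.simps by eventually_elim simp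
    then show ?thesis using r(1) by (intro exI[of _ r]) simp
  qed
  then obtain c0 where c0: "0 < c0" "eventually (\<lambda>x. c0 \<le> sg s * Im (V x)) (at_end s)" by blast
  obtain X where X: "\<forall>t\<ge>X. c0 \<le> sg s * Im (V (sg s * t))" using eventually_at_endD[OF c0(2)] by blast
  have "\<forall>t\<ge>max 1 X. c0 \<le> sg s * Im (V (sg s * t))" using X by auto
  then show ?thesis using c0(1) by (intro exI[of _ c0] conjI exI[of _ "max 1 X"]) auto
qed

lemma abs_Im_at_end: obtains c0 X where "0 < c0" "1 \<le> X" "\<And>t. X \<le> t \<Longrightarrow> c0 \<le> \<bar>Im (V (sg s * t))\<bar>"
proof -
  obtain c0 X where c: "0 < c0" "1 \<le> X" "\<forall>t\<ge>X. c0 \<le> sg s * Im (V (sg s * t))" using sign_at_end[of s] by blast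
  have "c0 \<le> \<bar>Im (V (sg s * t))\<bar>" if "X \<le> t" for t
  proof -
    have "sg s * Im (V (sg s * t)) \<le> \<bar>sg s * Im (V (sg s * t))\<bar>" by (rule abs_ge_self)
    then show ?thesis using c(3) that unfolding abs_sg by force
  qed
  then show ?thesis using that c by blast
qed

lemma continuous_side: "continuous_on A (\<lambda>t. V (sg s * t))"
  by (intro continuous_on_compose2[OF V_cont[of UNIV]] continuous_intros) auto

lemma half_line_image: "V ` half_line s = (\<lambda>t. V (sg s * t)) ` {0<..}"
proof -
  have "half_line s = (\<lambda>t. sg s * t) ` {0<..}"
  proof
    show "half_line s \<subseteq> (\<lambda>t. sg s * t) ` {0<..}"
    proof
      fix x assume "x \<in> half_line s"
      then show "x \<in> (\<lambda>t. sg s * t) ` {0<..}"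
        by (intro image_eqI[of _ _ "sg s * x"]) (auto simp: half_line_def)
    qed
    show "(\<lambda>t. sg s * t) ` {0<..} \<subseteq> half_line s" by (auto simp: half_line_def)
  qed
  then show ?thesis by (simp add: image_image)
qed

lemma bounded_side: assumes "bounded_at s V" obtains M where "\<And>t. 0 \<le> t \<Longrightarrow> norm (V (sg s * t)) \<le> M"
proof -
  obtain M where M: "\<And>t. 0 < t \<Longrightarrow> norm (V (sg s * t)) \<le> M"
    using assms unfolding bounded_at_def half_line_image bounded_iff by auto
  have "norm (V (sg s * t)) \<le> max M (norm (V 0))" if "0 \<le> t" for t
    using M[of t] that by (cases "t = 0") auto
  then show ?thesis using that by blast
qed

text \<open>Far out this is the standing assumption; on the compact part that remains, the derivative is
essentially bounded and \<open>U w\<^sup>m\<close> is bounded below.\<close>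

lemma derivative_bound_AE:
  assumes m: "m \<in> {1..N}" and Vm: "Linf_loc Vm" "AE x in lebesgue. Vm x = wderiv m V x"
  shows "\<exists>C\<ge>0. AE x in lebesgue. norm (Vm x) \<le> C * (U x * w x ^ m)"
proof -
  have side: "\<exists>C\<ge>0. AE x in lebesgue. 0 \<le> sg s * x \<longrightarrow> norm (Vm x) \<le> C * (U x * w x ^ m)" for s
  proof -
    obtain C X where CX: "AE x in lebesgue. X \<le> sg s * x \<longrightarrow>
           norm (wderiv m V x) \<le> C * (norm (V x) * japanese x powr (m * \<nu> s))"
      using V m unfolding standing_assumption_def by blast
    obtain K where K: "K \<ge> 0" "AE x in lebesgue. x \<in> {-\<bar>X\<bar>..\<bar>X\<bar>} \<longrightarrow> norm (Vm x) \<le> K"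
      using Linf_loc_interval[OF Vm(1)] by blast
    have "continuous_on {-\<bar>X\<bar>..\<bar>X\<bar>} (\<lambda>x. inverse (w x ^ m))"
      using w_pos by (intro continuous_intros w_cont) (simp add: less_imp_neq[symmetric])
    then obtain B where B: "B \<ge> 0" "\<And>x. x \<in> {-\<bar>X\<bar>..\<bar>X\<bar>} \<Longrightarrow> norm (inverse (w x ^ m)) \<le> B"
      using continuous_bounded_interval by metis
    have "AE x in lebesgue. 0 \<le> sg s * x \<longrightarrow> norm (Vm x) \<le> (\<bar>C\<bar> + K * B) * (U x * w x ^ m)"
      using CX K(2) Vm(2)
    proof eventually_elim
      fix x assume a: "X \<le> sg s * x \<longrightarrow> norm (wderiv m V x) \<le> C * (norm (V x) * japanese x powr (m * \<nu> s))"
        and b: "x \<in> {-\<bar>X\<bar>..\<bar>X\<bar>} \<longrightarrow> norm (Vm x) \<le> K" and c: "Vm x = wderiv m V x"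
      have wp: "0 < w x ^ m" using w_pos by simp
      have UW: "0 \<le> U x * w x ^ m" using wp U_ge(1)[of x] by simp
      show "0 \<le> sg s * x \<longrightarrow> norm (Vm x) \<le> (\<bar>C\<bar> + K * B) * (U x * w x ^ m)"
      proof
        assume s0: "0 \<le> sg s * x"
        have wx: "w x ^ m = japanese x powr (m * \<nu> s)"
          using w_side[OF s0, of s] japanese_pos[of x] by (simp add: powr_to_power)
        show "norm (Vm x) \<le> (\<bar>C\<bar> + K * B) * (U x * w x ^ m)"
        proof (cases "X \<le> sg s * x")
          case True
          then have "norm (Vm x) \<le> C * (norm (V x) * w x ^ m)" using a c wx by simp
          also have "\<dots> \<le> \<bar>C\<bar> * (U x * w x ^ m)"
            using U_ge(2)[of x] wp by (intro mult_mono mult_right_mono) auto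
          also have "\<dots> \<le> (\<bar>C\<bar> + K * B) * (U x * w x ^ m)"
            using UW K(1) B(1) by (intro mult_right_mono) auto
          finally show ?thesis .
        next
          case False
          have "\<bar>x\<bar> \<le> \<bar>X\<bar>" using False s0 abs_sg[of s x] by linarith
          then have xi: "x \<in> {-\<bar>X\<bar>..\<bar>X\<bar>}" unfolding atLeastAtMost_iff by linarith
          have "1 \<le> B * w x ^ m" using B(2)[OF xi] wp by (simp add: field_simps)
          also have "\<dots> \<le> B * (U x * w x ^ m)"
            using U_ge(1)[of x] wp B(1) by (intro mult_left_mono) auto
          finally have "K * 1 \<le> K * (B * (U x * w x ^ m))" using K(1) by (rule mult_left_mono)
          then have "norm (Vm x) \<le> (K * B) * (U x * w x ^ m)" using b xi by (simp add: mult.assoc)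
          also have "\<dots> \<le> (\<bar>C\<bar> + K * B) * (U x * w x ^ m)" using UW by (intro mult_right_mono) auto
          finally show ?thesis .
        qed
      qed
    qed
    moreover have "0 \<le> \<bar>C\<bar> + K * B" using K(1) B(1) by simp
    ultimately show ?thesis by blast
  qed
  obtain CM where CM: "CM \<ge> 0" "AE x in lebesgue. 0 \<le> sg Minus * x \<longrightarrow> norm (Vm x) \<le> CM * (U x * w x ^ m)"
    using side by blast
  obtain CP where CP: "CP \<ge> 0" "AE x in lebesgue. 0 \<le> sg Plus * x \<longrightarrow> norm (Vm x) \<le> CP * (U x * w x ^ m)"
    using side by blast
  have "AE x in lebesgue. norm (Vm x) \<le> (CM + CP) * (U x * w x ^ m)"
    using CM(2) CP(2)
  proof eventually_elim
    fix x assume a: "0 \<le> sg Minus * x \<longrightarrow> norm (Vm x) \<le> CM * (U x * w x ^ m)"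
      and b: "0 \<le> sg Plus * x \<longrightarrow> norm (Vm x) \<le> CP * (U x * w x ^ m)"
    have UW: "0 \<le> U x * w x ^ m" using w_pos[of x] U_ge(1)[of x] by simp
    show "norm (Vm x) \<le> (CM + CP) * (U x * w x ^ m)"
    proof (cases "0 \<le> x")
      case True
      then have "norm (Vm x) \<le> CP * (U x * w x ^ m)" using b by simp
      also have "\<dots> \<le> (CM + CP) * (U x * w x ^ m)" using CM(1) UW by (intro mult_right_mono) auto
      finally show ?thesis .
    next
      case False
      then have "norm (Vm x) \<le> CM * (U x * w x ^ m)" using a by simp
      also have "\<dots> \<le> (CM + CP) * (U x * w x ^ m)" using CP(1) UW by (intro mult_right_mono) auto
      finally show ?thesis .
    qed
  qed
  then show ?thesis using CM(1) CP(1) by (intro exI[of _ "CM + CP"]) auto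
qed

text \<open>Below the highest order both sides of the bound are continuous, so it holds everywhere; for the
highest order the exceptional points are put into \<open>Z\<close>.\<close>

lemma derivative_tower:
  obtains Vd Z CV where "Vd 0 = V" "negligible Z" "0 \<le> CV"
    "\<And>m. m < N \<Longrightarrow> loc_lip (Vd m)"
    "\<And>m x. m < N \<Longrightarrow> (Suc m = N \<longrightarrow> x \<notin> Z) \<Longrightarrow> (Vd m has_vector_derivative Vd (Suc m) x) (at x)"
    "\<And>m x. 1 \<le> m \<Longrightarrow> m \<le> N \<Longrightarrow> (m = N \<longrightarrow> x \<notin> Z) \<Longrightarrow> norm (Vd m x) \<le> CV * (U x * w x ^ m)"
    "AE x in lebesgue. (V has_vector_derivative Vd 1 x) (at x)" "AE x in lebesgue. Vd 1 x = wderiv 1 V x"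
proof -
  have W: "W_Ninf_loc N V" using V unfolding standing_assumption_def by blast
  obtain Vd where Vd: "Vd 0 = V" "\<And>m. m < N \<Longrightarrow> primitive (Vd m) (Vd (Suc m))"
    "\<And>m. m < N \<Longrightarrow> loc_lip (Vd m)" "Linf_loc (Vd N)"
    "\<And>m. m \<in> {1..N} \<Longrightarrow> AE x in lebesgue. Vd m x = wderiv m V x"
    by (rule W_Ninf_loc_tower[OF W V_cont N]) blast
  have L: "Linf_loc (Vd m)" if "m \<le> N" for m
    using that Vd(3)[of m] Vd(4) by (cases "m = N") (auto intro!: continuous_Linf_loc loc_lip_continuous)
  define good where "good m C \<longleftrightarrow> 0 \<le> C \<and> (AE x in lebesgue. norm (Vd m x) \<le> C * (U x * w x ^ m))" for m C
  have "\<exists>C. m \<in> {1..N} \<longrightarrow> good m C" for m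
    using derivative_bound_AE[of m "Vd m"] L[of m] Vd(5)[of m] unfolding good_def by auto
  then obtain c where c: "\<And>m. m \<in> {1..N} \<Longrightarrow> good m (c m)" by metis
  define CV where "CV = (\<Sum>m\<in>{1..N}. c m)"
  have c0: "0 \<le> c m" if "m \<in> {1..N}" for m using c[OF that] by (simp add: good_def)
  have CV: "0 \<le> CV" unfolding CV_def by (intro sum_nonneg c0)
  have b: "AE x in lebesgue. norm (Vd m x) \<le> CV * (U x * w x ^ m)" if m: "m \<in> {1..N}" for m
  proof -
    have cm: "c m \<le> CV" unfolding CV_def using c0 m by (intro member_le_sum) auto
    have "AE x in lebesgue. norm (Vd m x) \<le> c m * (U x * w x ^ m)" using c[OF m] by (simp add: good_def)
    then show ?thesis
    proof eventually_elim
      fix x assume "norm (Vd m x) \<le> c m * (U x * w x ^ m)"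
      also have "\<dots> \<le> CV * (U x * w x ^ m)"
        using cm w_pos[of x] U_ge(1)[of x] by (intro mult_right_mono) auto
      finally show "norm (Vd m x) \<le> CV * (U x * w x ^ m)" .
    qed
  qed
  have nN: "n < N" "Suc n = N" using N n by auto
  have dn: "AE x in lebesgue. (Vd n has_vector_derivative Vd (Suc n) x) (at x)"
    by (rule primitive_AE_deriv[OF Vd(2)[OF nN(1)]])
  have "AE x in lebesgue. norm (Vd N x) \<le> CV * (U x * w x ^ N)" using b[of N] N by simp
  then have "AE x in lebesgue. (Vd n has_vector_derivative Vd (Suc n) x) (at x) \<and> norm (Vd N x) \<le> CV * (U x * w x ^ N)"
    using dn by eventually_elim blast
  then obtain Z where Z: "negligible Z" "\<And>x. x \<notin> Z \<Longrightarrow> (Vd n has_vector_derivative Vd (Suc n) x) (at x)"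
    "\<And>x. x \<notin> Z \<Longrightarrow> norm (Vd N x) \<le> CV * (U x * w x ^ N)"
    unfolding AE_lebesgue_negligible by blast
  show ?thesis
  proof (rule that[of Vd Z CV])
    show "(Vd m has_vector_derivative Vd (Suc m) x) (at x)" if "m < N" "Suc m = N \<longrightarrow> x \<notin> Z" for m x
    proof (cases "Suc m = N")
      case True
      then have "m = n" using nN by simp
      then show ?thesis using Z(2) that True by simp
    next
      case False
      then have "loc_lip (Vd (Suc m))" using that by (intro Vd(3)) simp
      then show ?thesis using primitive_deriv[OF Vd(2)[OF that(1)] loc_lip_continuous] by blast
    qed
    show "norm (Vd m x) \<le> CV * (U x * w x ^ m)" if "1 \<le> m" "m \<le> N" "m = N \<longrightarrow> x \<notin> Z" for m x
    proof (cases "m = N")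
      case True then show ?thesis using Z(3) that by simp
    next
      case False
      then have "m < N" using that by simp
      then have "continuous_on UNIV (\<lambda>x. norm (Vd m x))" by (intro continuous_on_norm loc_lip_continuous Vd(3))
      moreover have "continuous_on UNIV (\<lambda>x. CV * (U x * w x ^ m))" by (intro continuous_intros U_cont w_cont)
      ultimately show ?thesis using b[of m] that by (intro AE_le_continuous[of "\<lambda>x. norm (Vd m x)" "\<lambda>x. CV * (U x * w x ^ m)"]) auto
    qed
    show "AE x in lebesgue. (V has_vector_derivative Vd 1 x) (at x)"
      using primitive_AE_deriv[OF Vd(2)[of 0]] Vd(1) N by simp
    show "AE x in lebesgue. Vd 1 x = wderiv 1 V x" using Vd(5)[of 1] N by simp
  qed (use Vd Z CV in auto)
qed

lemma end_geometry_side: "end_geometry (\<lambda>t. V (sg s * t)) (\<nu> s) (\<delta> s) (\<Delta> s) (decay s)"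
proof -
  obtain c0 X0 where c0: "0 < c0" "1 \<le> X0" "\<And>t. X0 \<le> t \<Longrightarrow> c0 \<le> \<bar>Im (V (sg s * t))\<bar>"
    by (rule abs_Im_at_end[of s]) blast
  show ?thesis
  proof (cases "bounded_at s V")
    case True
    obtain M where M: "\<And>t. 0 \<le> t \<Longrightarrow> norm (V (sg s * t)) \<le> M" using bounded_side[OF True] by blast
    have \<epsilon>: "0 < \<epsilon>2 s" "\<epsilon>2 s < 1 - \<nu> s" using \<epsilon>2[OF True] by auto
    have "end_geometry (\<lambda>t. V (sg s * t)) (\<nu> s) (\<lambda>l. l powr ((1 + \<epsilon>2 s) / 2)) (\<lambda>l. l powr ((1 + \<epsilon>2 s) / 2) / 4)
        (\<lambda>l. l powr (\<epsilon>2 s / 2))"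
      by (rule bounded_end_geometry[of "\<lambda>t. V (sg s * t)", OF M c0(1,3) \<epsilon>])
    moreover have "\<delta> s = (\<lambda>l. l powr ((1 + \<epsilon>2 s) / 2))" using True by (auto simp: cut_delta_def)
    moreover have "\<Delta> s = (\<lambda>l. l powr ((1 + \<epsilon>2 s) / 2) / 4)" using True by (auto simp: cut_Delta_def cut_delta_def)
    moreover have "decay s = (\<lambda>l. l powr (\<epsilon>2 s / 2))" using True by (auto simp: decay_def)
    ultimately show ?thesis by simp
  next
    case False
    have \<epsilon>: "0 < \<epsilon>1 s" and bigo: "(\<lambda>x. japanese x powr (4 * (\<nu> s + \<epsilon>1 s) + 2) *
              (japanese x powr (4 * \<nu> s + 2) + \<bar>Re (V x)\<bar>))
          \<in> O[at_end s](\<lambda>x. \<bar>Im (V x)\<bar>\<^sup>2)"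
      using V False unfolding standing_assumption_def by blast+
    obtain C0 where C0: "0 < C0" "eventually (\<lambda>x. norm (japanese x powr (4 * (\<nu> s + \<epsilon>1 s) + 2) *
              (japanese x powr (4 * \<nu> s + 2) + \<bar>Re (V x)\<bar>)) \<le> C0 * norm (\<bar>Im (V x)\<bar>\<^sup>2)) (at_end s)"
      using landau_o.bigE[OF bigo] by blast
    obtain X1 where X1: "\<And>t. X1 \<le> t \<Longrightarrow> norm (japanese (sg s * t) powr (4 * (\<nu> s + \<epsilon>1 s) + 2) *
              (japanese (sg s * t) powr (4 * \<nu> s + 2) + \<bar>Re (V (sg s * t))\<bar>)) \<le> C0 * norm (\<bar>Im (V (sg s * t))\<bar>\<^sup>2)"
      using eventually_at_endD[OF C0(2)] by blast
    have m1: "1 \<in> {1..N}" using N by simp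
    obtain CI XI where CI: "AE x in lebesgue. XI \<le> sg s * x \<longrightarrow>
           \<bar>Im (wderiv 1 V x)\<bar> \<le> CI * (\<bar>Im (V x)\<bar> * japanese x powr (real 1 * \<nu> s))"
      using V m1 unfolding standing_assumption_def by blast
    obtain CA XA where CA: "AE x in lebesgue. XA \<le> sg s * x \<longrightarrow>
           norm (wderiv 1 V x) \<le> CA * (norm (V x) * japanese x powr (real 1 * \<nu> s))"
      using V m1 unfolding standing_assumption_def by blast
    obtain Vd :: "nat \<Rightarrow> real \<Rightarrow> complex" where Vd: "Vd 0 = V" "\<And>m. m < N \<Longrightarrow> loc_lip (Vd m)"
      "AE x in lebesgue. (V has_vector_derivative Vd 1 x) (at x)" "AE x in lebesgue. Vd 1 x = wderiv 1 V x"
      by (rule derivative_tower) blast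
    define X where "X = max X0 (max X1 (max XI XA))"
    define Cd where "Cd = \<bar>CI\<bar> + \<bar>CA\<bar>"
    define v where "v t = V (sg s * t)" for t
    define v' where "v' t = sg s *\<^sub>R Vd 1 (sg s * t)" for t
    have V_lip: "loc_lip V" using Vd(2)[of 0] Vd(1) N by simp
    interpret ue: unbounded_end v v' "\<nu> s" "\<epsilon>1 s" C0 Cd c0 X
    proof
      show "loc_lip v"
        unfolding loc_lip_def
      proof (intro allI)
        fix a b
        obtain L where L: "L-lipschitz_on {- (\<bar>a\<bar> + \<bar>b\<bar>)..\<bar>a\<bar> + \<bar>b\<bar>} V" using V_lip unfolding loc_lip_def by blast
        have "L-lipschitz_on {a..b} v"
        proof (rule lipschitz_onI)
          fix x y assume xy: "x \<in> {a..b}" "y \<in> {a..b}"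
          have "sg s * x \<in> {- (\<bar>a\<bar> + \<bar>b\<bar>)..\<bar>a\<bar> + \<bar>b\<bar>}" "sg s * y \<in> {- (\<bar>a\<bar> + \<bar>b\<bar>)..\<bar>a\<bar> + \<bar>b\<bar>}"
            using xy by (cases s; auto)+
          from lipschitz_onD[OF L this] show "dist (v x) (v y) \<le> L * dist x y"
            by (cases s) (auto simp: v_def dist_real_def abs_minus_commute)
        qed (rule lipschitz_on_nonneg[OF L])
        then show "\<exists>L. L-lipschitz_on {a..b} v" by blast
      qed
      show "AE t in lebesgue. (v has_vector_derivative v' t) (at t)"
        using AE_sg[OF Vd(3), of s]
      proof eventually_elim
        fix t assume d: "(V has_vector_derivative Vd 1 (sg s * t)) (at (sg s * t))"
        have "((\<lambda>t. sg s * t) has_vector_derivative sg s) (at t)" by (auto intro!: derivative_eq_intros)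
        from vector_diff_chain_at[OF this d] show "(v has_vector_derivative v' t) (at t)"
          unfolding v_def[abs_def] v'_def by (simp add: o_def)
      qed
      show "1 \<le> X" using c0(2) by (simp add: X_def)
      show "0 < c0" by (rule c0(1))
      show "c0 \<le> \<bar>Im (v t)\<bar>" if "X \<le> t" for t unfolding v_def using that by (intro c0(3)) (simp add: X_def)
      show "0 \<le> Cd" by (simp add: Cd_def)
      have absg: "\<bar>sg s\<bar> = 1" by (cases s) auto
      show "AE t in lebesgue. X \<le> t \<longrightarrow> \<bar>Im (v' t)\<bar> \<le> Cd * (\<bar>Im (v t)\<bar> * japanese t powr \<nu> s)"
        using AE_sg[OF CI, of s] AE_sg[OF Vd(4), of s]
      proof eventually_elim
        fix t assume a: "XI \<le> sg s * (sg s * t) \<longrightarrow>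
           \<bar>Im (wderiv 1 V (sg s * t))\<bar> \<le> CI * (\<bar>Im (V (sg s * t))\<bar> * japanese (sg s * t) powr (real 1 * \<nu> s))"
          and b: "Vd 1 (sg s * t) = wderiv 1 V (sg s * t)"
        show "X \<le> t \<longrightarrow> \<bar>Im (v' t)\<bar> \<le> Cd * (\<bar>Im (v t)\<bar> * japanese t powr \<nu> s)"
        proof
          assume "X \<le> t"
          then have "\<bar>Im (Vd 1 (sg s * t))\<bar> \<le> CI * (\<bar>Im (v t)\<bar> * japanese t powr \<nu> s)"
            using a b by (simp add: X_def v_def)
          also have "\<dots> \<le> Cd * (\<bar>Im (v t)\<bar> * japanese t powr \<nu> s)" by (intro mult_right_mono) (auto simp: Cd_def)
          finally show "\<bar>Im (v' t)\<bar> \<le> Cd * (\<bar>Im (v t)\<bar> * japanese t powr \<nu> s)" by (simp add: v'_def)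
        qed
      qed
      show "AE t in lebesgue. X \<le> t \<longrightarrow> norm (v' t) \<le> Cd * (norm (v t) * japanese t powr \<nu> s)"
        using AE_sg[OF CA, of s] AE_sg[OF Vd(4), of s]
      proof eventually_elim
        fix t assume a: "XA \<le> sg s * (sg s * t) \<longrightarrow>
           norm (wderiv 1 V (sg s * t)) \<le> CA * (norm (V (sg s * t)) * japanese (sg s * t) powr (real 1 * \<nu> s))"
          and b: "Vd 1 (sg s * t) = wderiv 1 V (sg s * t)"
        show "X \<le> t \<longrightarrow> norm (v' t) \<le> Cd * (norm (v t) * japanese t powr \<nu> s)"
        proof
          assume "X \<le> t"
          then have "norm (Vd 1 (sg s * t)) \<le> CA * (norm (v t) * japanese t powr \<nu> s)"
            using a b by (simp add: X_def v_def)
          also have "\<dots> \<le> Cd * (norm (v t) * japanese t powr \<nu> s)" by (intro mult_right_mono) (auto simp: Cd_def)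
          finally show "norm (v' t) \<le> Cd * (norm (v t) * japanese t powr \<nu> s)" by (simp add: v'_def absg)
        qed
      qed
      show "0 < C0" by (rule C0(1))
      show "japanese t powr (4 * (\<nu> s + \<epsilon>1 s) + 2) * (japanese t powr (4 * \<nu> s + 2) + \<bar>Re (v t)\<bar>) \<le> C0 * \<bar>Im (v t)\<bar>\<^sup>2"
        if "X \<le> t" for t
      proof -
        let ?a = "japanese t powr (4 * (\<nu> s + \<epsilon>1 s) + 2) * (japanese t powr (4 * \<nu> s + 2) + \<bar>Re (v t)\<bar>)"
        have "?a \<le> norm ?a" by simp
        also have "\<dots> \<le> C0 * norm (\<bar>Im (v t)\<bar>\<^sup>2)" using X1[of t] that unfolding v_def japanese_sg by (simp add: X_def)
        also have "norm (\<bar>Im (v t)\<bar>\<^sup>2) = \<bar>Im (v t)\<bar>\<^sup>2" by simp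
        finally show ?thesis .
      qed
      show "0 < \<epsilon>1 s" by (rule \<epsilon>)
      show "\<not> bounded (v ` {0<..})"
        using False unfolding bounded_at_def half_line_image v_def[abs_def] .
    qed
    have d: "cut_delta V \<nu> \<epsilon>1 \<epsilon>2 s = ue.\<delta>"
      using False by (auto simp: cut_delta_def ue.\<delta>_def ue.Q_def v_def fun_eq_iff)
    have D: "cut_Delta V \<nu> \<epsilon>1 \<epsilon>2 s = ue.\<Delta>"
      using False by (auto simp: cut_Delta_def ue.\<Delta>_def d fun_eq_iff)
    have e: "decay s = ue.E"
      using False by (auto simp: decay_def ue.E_def d fun_eq_iff)
    show ?thesis using ue.unbounded_end_geometry unfolding d D e v_def[abs_def] .
  qed
qed

text \<open>The claimed bound for \<open>\<sigma>\<close>. The absolute value makes it nonnegative for all \<open>l\<close>, including those for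
which the set below the supremum is empty.\<close>

definition remainder_rate :: "side \<Rightarrow> real \<Rightarrow> real" where
  "remainder_rate s l =
     (if bounded_at s V then
        (if \<nu> s < 0 then l powr (- (real n + 1) / 2)
         else l powr (- ((real n + 1) / 2) * (1 - (1 + \<epsilon>2 s) * \<nu> s)))
      else
        (if \<nu> s < 0 then l powr (- (real n + 1) / 2) *
            \<bar>SUP x\<in>J_side V \<nu> \<epsilon>1 \<epsilon>2 s l. norm (V x) * japanese x powr ((real n + 1) * \<nu> s)\<bar>
         else \<delta> s l powr ((real n + 1) * \<nu> s) * l powr ((1 - real n) / 2)))"

lemma remainder_rate_nonneg: "0 \<le> remainder_rate s l"
  by (simp add: remainder_rate_def)

lemma Suc_n: "N = Suc n"
  using N n by simp

lemma w_power: "0 \<le> t \<Longrightarrow> w (sg s * t) ^ N = japanese t powr ((real n + 1) * \<nu> s)"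
proof -
  assume t: "0 \<le> t"
  have "real N = real n + 1" by (simp add: Suc_n)
  moreover have "w (sg s * t) ^ N = japanese t powr (real N * \<nu> s)"
    unfolding w_side[OF t] by (rule powr_to_power[OF japanese_pos])
  ultimately show ?thesis by simp
qed

lemma delta_ev: "\<forall>\<^sub>F l in at_top. Y \<le> \<delta> s l"
  using end_geometry_side[of s] unfolding end_geometry_def filterlim_at_top by blast

lemma sup_bound:
  assumes "x \<in> J_side V \<nu> \<epsilon>1 \<epsilon>2 s l"
  shows "norm (V x) * japanese x powr p \<le> (SUP x\<in>J_side V \<nu> \<epsilon>1 \<epsilon>2 s l. norm (V x) * japanese x powr p)"
proof (rule cSUP_upper[OF assms])
  have c: "continuous_on {- \<delta> s l..\<delta> s l} (\<lambda>x. norm (V x) * japanese x powr p)"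
    by (intro continuous_on_mult continuous_on_norm V_cont continuous_japanese_powr)
  obtain C where C: "\<And>x. x \<in> {- \<delta> s l..\<delta> s l} \<Longrightarrow> norm (norm (V x) * japanese x powr p) \<le> C"
    using continuous_bounded_interval[OF c] by blast
  show "bdd_above ((\<lambda>x. norm (V x) * japanese x powr p) ` J_side V \<nu> \<epsilon>1 \<epsilon>2 s l)"
  proof (rule bdd_aboveI2)
    fix x assume "x \<in> J_side V \<nu> \<epsilon>1 \<epsilon>2 s l"
    then have "x \<in> {- \<delta> s l..\<delta> s l}" by (auto simp: J_side_def)
    from C[OF this] show "norm (V x) * japanese x powr p \<le> C" by simp
  qed
qed

text \<open>At an unbounded end with \<open>\<nu> < 0\<close> the supremum involves \<open>\<bar>V\<bar>\<close> instead of \<open>\<bar>V\<bar> + 1\<close>. This costs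
only a constant: far out \<open>\<bar>V\<bar>\<close> is bounded below through its imaginary part, and the supremum is at least its value \<open>v0\<close>
at one fixed point, which absorbs the compact part. In the other cases the weight is estimated by its value at
\<open>\<delta>\<close>, or by \<open>1\<close>.\<close>

lemma remainder_rate_bound:
  "\<exists>C\<ge>0. \<forall>\<^sub>F l in at_top. \<forall>t. 0 \<le> t \<and> t < \<delta> s l \<longrightarrow>
     l powr (- (real n + 1) / 2) * (U (sg s * t) * w (sg s * t) ^ N) \<le> C * remainder_rate s l"
proof -
  let ?p = "(real n + 1) * \<nu> s"
  have jneg: "japanese t powr ?p \<le> 1" if "\<nu> s < 0" for t
  proof -
    have "japanese t powr ?p \<le> japanese t powr 0"
      using that japanese_ge_1[of t] by (intro powr_mono) (auto simp: mult_nonneg_nonpos)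
    then show ?thesis using japanese_pos[of t] by simp
  qed
  have jpos: "japanese t powr ?p \<le> 2 powr ?p * \<delta> s l powr ?p" if "0 \<le> \<nu> s" "0 \<le> t" "t < \<delta> s l" "1 \<le> \<delta> s l" for t l
    using japanese_powr_le_max[of t "\<delta> s l" ?p] that by simp
  have exponent: "- a / 2 + (1 + e) / 2 * (a * v) = - (a / 2) * (1 - (1 + e) * v)" for a e v :: real
    by (simp add: field_simps)
  show ?thesis
  proof (cases "bounded_at s V")
    case True
    obtain M where M: "\<And>t. 0 \<le> t \<Longrightarrow> norm (V (sg s * t)) \<le> M" using bounded_side[OF True] by blast
    have M0: "0 \<le> M" using M[of 0] norm_ge_zero order_trans by blast
    have UM: "U (sg s * t) \<le> M + 1" if "0 \<le> t" for t using M[OF that] by (simp add: U_def)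
    show ?thesis
    proof (cases "\<nu> s < 0")
      case neg: True
      have "\<forall>t. 0 \<le> t \<and> t < \<delta> s l \<longrightarrow>
         l powr (- (real n + 1) / 2) * (U (sg s * t) * w (sg s * t) ^ N) \<le> (M + 1) * remainder_rate s l" for l
      proof (intro allI impI)
        fix t assume t: "0 \<le> t \<and> t < \<delta> s l"
        have "U (sg s * t) * w (sg s * t) ^ N \<le> (M + 1) * 1"
          using t UM[of t] jneg[OF neg, of t] U_ge(1)[of "sg s * t"] M0 by (intro mult_mono) (auto simp: w_power)
        then have "l powr (- (real n + 1) / 2) * (U (sg s * t) * w (sg s * t) ^ N) \<le> l powr (- (real n + 1) / 2) * (M + 1)"
          by (intro mult_left_mono) auto
        then show "l powr (- (real n + 1) / 2) * (U (sg s * t) * w (sg s * t) ^ N) \<le> (M + 1) * remainder_rate s l"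
          using True neg by (simp add: remainder_rate_def mult.commute)
      qed
      then show ?thesis using M0 by (intro exI[of _ "M + 1"]) auto
    next
      case pos: False
      have "\<forall>\<^sub>F l in at_top. \<forall>t. 0 \<le> t \<and> t < \<delta> s l \<longrightarrow>
         l powr (- (real n + 1) / 2) * (U (sg s * t) * w (sg s * t) ^ N) \<le> ((M + 1) * 2 powr ?p) * remainder_rate s l"
        using delta_ev[of 1 s]
      proof eventually_elim
        fix l assume d: "1 \<le> \<delta> s l"
        show "\<forall>t. 0 \<le> t \<and> t < \<delta> s l \<longrightarrow>
         l powr (- (real n + 1) / 2) * (U (sg s * t) * w (sg s * t) ^ N) \<le> ((M + 1) * 2 powr ?p) * remainder_rate s l"
        proof (intro allI impI)
          fix t assume t: "0 \<le> t \<and> t < \<delta> s l"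
          have "U (sg s * t) * w (sg s * t) ^ N \<le> (M + 1) * (2 powr ?p * \<delta> s l powr ?p)"
            using t UM[of t] jpos[of t l] pos d U_ge(1)[of "sg s * t"] M0 by (intro mult_mono) (auto simp: w_power)
          then have "l powr (- (real n + 1) / 2) * (U (sg s * t) * w (sg s * t) ^ N)
              \<le> l powr (- (real n + 1) / 2) * ((M + 1) * (2 powr ?p * \<delta> s l powr ?p))"
            by (intro mult_left_mono) auto
          also have "\<dots> = ((M + 1) * 2 powr ?p) * (l powr (- (real n + 1) / 2) * \<delta> s l powr ?p)" by simp
          also have "\<delta> s l powr ?p = l powr ((1 + \<epsilon>2 s) / 2 * ?p)"
            using True by (simp add: cut_delta_def powr_powr)
          also have "l powr (- (real n + 1) / 2) * l powr ((1 + \<epsilon>2 s) / 2 * ?p) = l powr (- (real n + 1) / 2 + (1 + \<epsilon>2 s) / 2 * ?p)"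
            by (simp only: powr_add)
          also have "- (real n + 1) / 2 + (1 + \<epsilon>2 s) / 2 * ?p = - ((real n + 1) / 2) * (1 - (1 + \<epsilon>2 s) * \<nu> s)"
            by (rule exponent)
          finally show "l powr (- (real n + 1) / 2) * (U (sg s * t) * w (sg s * t) ^ N) \<le> ((M + 1) * 2 powr ?p) * remainder_rate s l"
            using True pos by (simp only: remainder_rate_def if_True if_False)
        qed
      qed
      then show ?thesis using M0 by (intro exI[of _ "(M + 1) * 2 powr ?p"]) auto
    qed
  next
    case unb: False
    show ?thesis
    proof (cases "\<nu> s < 0")
      case neg: True
      obtain c0 X where c0: "0 < c0" "1 \<le> X" "\<And>t. X \<le> t \<Longrightarrow> c0 \<le> \<bar>Im (V (sg s * t))\<bar>" by (rule abs_Im_at_end[of s]) blast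
      have VX: "c0 \<le> norm (V (sg s * t))" if "X \<le> t" for t
        using c0(3)[OF that] abs_Im_le_cmod[of "V (sg s * t)"] by linarith
      obtain K where K: "K \<ge> 0" "\<And>t. t \<in> {0..X} \<Longrightarrow> norm (V (sg s * t)) \<le> K"
        using continuous_bounded_interval[OF continuous_side] by metis
      define v0 where "v0 = norm (V (sg s * X)) * japanese X powr ?p"
      have v0: "0 < v0" unfolding v0_def using less_le_trans[OF c0(1) VX[OF order_refl]] japanese_pos[of X]
        by (intro mult_pos_pos) (auto simp: powr_gt_zero)
      let ?C = "(K + 1) / v0 + (1 + 1 / c0)"
      have C: "0 \<le> ?C" using K(1) v0 c0(1) by simp
      have "\<forall>\<^sub>F l in at_top. \<forall>t. 0 \<le> t \<and> t < \<delta> s l \<longrightarrow>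
         l powr (- (real n + 1) / 2) * (U (sg s * t) * w (sg s * t) ^ N) \<le> ?C * remainder_rate s l"
        using delta_ev[of "X + 1" s]
      proof eventually_elim
        fix l assume d: "X + 1 \<le> \<delta> s l"
        let ?S = "SUP x\<in>J_side V \<nu> \<epsilon>1 \<epsilon>2 s l. norm (V x) * japanese x powr ?p"
        have inJ: "sg s * t \<in> J_side V \<nu> \<epsilon>1 \<epsilon>2 s l" if "0 < t" "t < \<delta> s l" for t
          using that by (simp add: J_side_def half_line_def)
        have S1: "v0 \<le> ?S"
          using sup_bound[OF inJ[of X], of ?p] c0(2) d unfolding v0_def by simp
        then have S0: "0 \<le> ?S" using v0 by linarith
        show "\<forall>t. 0 \<le> t \<and> t < \<delta> s l \<longrightarrow>
         l powr (- (real n + 1) / 2) * (U (sg s * t) * w (sg s * t) ^ N) \<le> ?C * remainder_rate s l"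
        proof (intro allI impI)
          fix t assume t: "0 \<le> t \<and> t < \<delta> s l"
          have "U (sg s * t) * w (sg s * t) ^ N \<le> ?C * ?S"
          proof (cases "t \<le> X")
            case True
            have "U (sg s * t) * w (sg s * t) ^ N \<le> (K + 1) * 1"
              using t True K jneg[OF neg, of t] U_ge(1)[of "sg s * t"] by (intro mult_mono) (auto simp: w_power U_def)
            also have "\<dots> = (K + 1) / v0 * v0" using v0 by simp
            also have "\<dots> \<le> (K + 1) / v0 * ?S" using S1 K(1) v0 by (intro mult_left_mono) auto
            also have "\<dots> \<le> ?C * ?S" using S0 c0(1) by (intro mult_right_mono) auto
            finally show ?thesis .
          next
            case False
            then have tX: "X \<le> t" "0 < t" using c0(2) by auto
            have "1 \<le> 1 / c0 * norm (V (sg s * t))" using VX[OF tX(1)] c0(1) by (simp add: field_simps)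
            then have "U (sg s * t) \<le> (1 + 1 / c0) * norm (V (sg s * t))" by (simp add: U_def distrib_right)
            then have "U (sg s * t) * w (sg s * t) ^ N \<le> ((1 + 1 / c0) * norm (V (sg s * t))) * japanese t powr ?p"
              using t by (simp add: w_power mult_right_mono)
            also have "\<dots> = (1 + 1 / c0) * (norm (V (sg s * t)) * japanese (sg s * t) powr ?p)" by simp
            also have "\<dots> \<le> (1 + 1 / c0) * ?S"
              using sup_bound[OF inJ[of t], of ?p] tX t c0(1) by (intro mult_left_mono) auto
            also have "\<dots> \<le> ?C * ?S" using S0 K(1) v0 by (intro mult_right_mono) auto
            finally show ?thesis .
          qed
          then have "l powr (- (real n + 1) / 2) * (U (sg s * t) * w (sg s * t) ^ N) \<le> l powr (- (real n + 1) / 2) * (?C * ?S)"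
            by (intro mult_left_mono) auto
          also have "\<dots> = ?C * (l powr (- (real n + 1) / 2) * \<bar>?S\<bar>)" using S0 by (simp only: abs_of_nonneg mult_ac)
          finally show "l powr (- (real n + 1) / 2) * (U (sg s * t) * w (sg s * t) ^ N) \<le> ?C * remainder_rate s l"
            using unb neg by (simp only: remainder_rate_def if_True if_False)
        qed
      qed
      then show ?thesis using C by blast
    next
      case pos: False
      obtain C where C: "0 \<le> C" "\<forall>\<^sub>F l in at_top. \<forall>t. 0 \<le> t \<and> t < \<delta> s l \<longrightarrow>
        norm (V (sg s * t)) + 1 \<le> C * l \<and> Re (V (sg s * t)) \<le> l / 2 \<and> japanese t powr \<nu> s \<le> C * sqrt l"
        using end_geometry_side[of s] unfolding end_geometry_def by blast
      have "\<forall>\<^sub>F l in at_top. \<forall>t. 0 \<le> t \<and> t < \<delta> s l \<longrightarrow>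
         l powr (- (real n + 1) / 2) * (U (sg s * t) * w (sg s * t) ^ N) \<le> (C * 2 powr ?p) * remainder_rate s l"
        using C(2) delta_ev[of 1 s] eventually_gt_at_top[of 0]
      proof eventually_elim
        fix l :: real assume H: "\<forall>t. 0 \<le> t \<and> t < \<delta> s l \<longrightarrow>
        norm (V (sg s * t)) + 1 \<le> C * l \<and> Re (V (sg s * t)) \<le> l / 2 \<and> japanese t powr \<nu> s \<le> C * sqrt l"
          and d: "1 \<le> \<delta> s l" and l: "0 < l"
        show "\<forall>t. 0 \<le> t \<and> t < \<delta> s l \<longrightarrow>
         l powr (- (real n + 1) / 2) * (U (sg s * t) * w (sg s * t) ^ N) \<le> (C * 2 powr ?p) * remainder_rate s l"
        proof (intro allI impI)
          fix t assume t: "0 \<le> t \<and> t < \<delta> s l"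
          have "U (sg s * t) \<le> C * l" using H t by (simp add: U_def)
          then have "U (sg s * t) * w (sg s * t) ^ N \<le> (C * l) * (2 powr ?p * \<delta> s l powr ?p)"
            using t jpos[of t l] pos d U_ge(1)[of "sg s * t"] C(1) l by (intro mult_mono) (auto simp: w_power)
          then have "l powr (- (real n + 1) / 2) * (U (sg s * t) * w (sg s * t) ^ N)
              \<le> l powr (- (real n + 1) / 2) * ((C * l) * (2 powr ?p * \<delta> s l powr ?p))"
            by (intro mult_left_mono) auto
          also have "\<dots> = (C * 2 powr ?p) * (\<delta> s l powr ?p * (l powr (- (real n + 1) / 2) * l powr 1))"
            using l by simp
          also have "l powr (- (real n + 1) / 2) * l powr 1 = l powr (- (real n + 1) / 2 + 1)" by (simp only: powr_add)
          also have "- (real n + 1) / 2 + 1 = (1 - real n) / 2" by (simp add: field_simps)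
          finally show "l powr (- (real n + 1) / 2) * (U (sg s * t) * w (sg s * t) ^ N) \<le> (C * 2 powr ?p) * remainder_rate s l"
            using unb pos by (simp only: remainder_rate_def if_False)
        qed
      qed
      then show ?thesis using C(1) by (intro exI[of _ "C * 2 powr ?p"]) auto
    qed
  qed
qed

text \<open>The value \<open>l - V x\<close> can only be real where \<open>Im V\<close> vanishes, which happens in a compact set; there its
real part is positive for large \<open>l\<close>.\<close>

lemma slit_ev: "\<forall>\<^sub>F l in at_top. \<forall>x. complex_of_real l - V x \<notin> \<real>\<^sub>\<le>\<^sub>0"
proof -
  obtain cM XM where M: "0 < cM" "1 \<le> XM" "\<And>t. XM \<le> t \<Longrightarrow> cM \<le> \<bar>Im (V (sg Minus * t))\<bar>" by (rule abs_Im_at_end[of Minus]) blast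
  obtain cP XP where P: "0 < cP" "1 \<le> XP" "\<And>t. XP \<le> t \<Longrightarrow> cP \<le> \<bar>Im (V (sg Plus * t))\<bar>" by (rule abs_Im_at_end[of Plus]) blast
  define X where "X = max XM XP"
  obtain K where K: "\<And>x. x \<in> {-X..X} \<Longrightarrow> norm (V x) \<le> K" using continuous_bounded_interval[OF V_cont] by metis
  show ?thesis
    using eventually_gt_at_top[of K]
  proof eventually_elim
    fix l assume l: "K < l"
    show "\<forall>x. complex_of_real l - V x \<notin> \<real>\<^sub>\<le>\<^sub>0"
    proof (intro allI notI)
      fix x assume "complex_of_real l - V x \<in> \<real>\<^sub>\<le>\<^sub>0"
      then have a: "Im (V x) = 0" "l \<le> Re (V x)" by (auto simp: complex_nonpos_Reals_iff)
      consider "x < - X" | "X < x" | "x \<in> {-X..X}" by fastforce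
      then show False
      proof cases
        case 1
        then have "XM \<le> - x" unfolding X_def by linarith
        from M(3)[OF this] show False using M(1) a(1) by simp
      next
        case 2
        then have "XP \<le> x" unfolding X_def by linarith
        from P(3)[OF this] show False using P(1) a(1) by simp
      next
        case 3 then show False using K[OF 3] a(2) l complex_Re_le_cmod[of "V x"] by linarith
      qed
    qed
  qed
qed

lemma Uw_bounded: "\<exists>K. \<forall>x. \<bar>x\<bar> \<le> r \<longrightarrow> U x * w x \<le> K"
proof -
  have "continuous_on {-r..r} (\<lambda>x. U x * w x)" by (intro continuous_intros U_cont w_cont)
  from continuous_bounded_interval[OF this]
  obtain K where K: "\<And>x. x \<in> {-r..r} \<Longrightarrow> norm (U x * w x) \<le> K" by blast
  have "U x * w x \<le> K" if "\<bar>x\<bar> \<le> r" for x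
  proof -
    have "x \<in> {-r..r}" using that by (simp add: abs_le_iff)
    from K[OF this] show ?thesis by simp
  qed
  then show ?thesis by blast
qed

lemma quotient_bound:
  assumes \<xi>: "cutoff_family V \<nu> \<epsilon>1 \<epsilon>2 \<xi>"
  obtains c C where "\<And>s. 0 < c s" "0 \<le> C"
    "\<forall>\<^sub>F l in at_top. (let f = pseudomode V n \<xi> l in f \<in> H_dom V \<and> 0 < norm_L2 f \<and>
       norm_L2 (\<lambda>x. H_op V f x - complex_of_real l * f x) / norm_L2 f
         \<le> C * ((exp (- (c Minus * decay Minus l)) + exp (- (c Plus * decay Plus l)))
             + (remainder_rate Minus l + remainder_rate Plus l)))"
proof -
  obtain Vd Z CV where Vd: "Vd 0 = V" "negligible Z" "0 \<le> CV"
    "\<And>m. m < N \<Longrightarrow> loc_lip (Vd m)"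
    "\<And>m x. m < N \<Longrightarrow> (Suc m = N \<longrightarrow> x \<notin> Z) \<Longrightarrow> (Vd m has_vector_derivative Vd (Suc m) x) (at x)"
    "\<And>m x. 1 \<le> m \<Longrightarrow> m \<le> N \<Longrightarrow> (m = N \<longrightarrow> x \<notin> Z) \<Longrightarrow> norm (Vd m x) \<le> CV * (U x * w x ^ m)"
    by (rule derivative_tower) blast
  define size_ok where "size_ok s C l \<longleftrightarrow> (\<forall>t. 0 \<le> t \<and> t < \<delta> s l \<longrightarrow>
        norm (V (sg s * t)) + 1 \<le> C * l \<and> Re (V (sg s * t)) \<le> l / 2 \<and> japanese t powr \<nu> s \<le> C * sqrt l)" for s C l
  have ex: "\<exists>C\<ge>0. \<forall>\<^sub>F l in at_top. size_ok s C l" for s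
    using end_geometry_side[of s] unfolding end_geometry_def size_ok_def by blast
  obtain CM where CM: "0 \<le> CM" "\<forall>\<^sub>F l in at_top. size_ok Minus CM l" using ex by blast
  obtain CP where CP: "0 \<le> CP" "\<forall>\<^sub>F l in at_top. size_ok Plus CP l" using ex by blast
  have "\<forall>\<^sub>F l in at_top. size_ok Minus CM l \<and> size_ok Plus CP l \<and> (\<forall>x. complex_of_real l - V x \<notin> \<real>\<^sub>\<le>\<^sub>0)
      \<and> 1 \<le> \<delta> Minus l \<and> 1 \<le> \<delta> Plus l \<and> 1 \<le> l"
    by (intro eventually_conj CM(2) CP(2) slit_ev delta_ev eventually_ge_at_top)
  then obtain l0 where l0: "\<And>l. l0 \<le> l \<Longrightarrow> size_ok Minus CM l \<and> size_ok Plus CP l \<and> (\<forall>x. complex_of_real l - V x \<notin> \<real>\<^sub>\<le>\<^sub>0)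
      \<and> 1 \<le> \<delta> Minus l \<and> 1 \<le> \<delta> Plus l \<and> 1 \<le> l"
    unfolding eventually_at_top_linorder by blast
  define J where "J l = {- \<delta> Minus l <..< \<delta> Plus l}" for l
  define CU where "CU = CM + CP"
  have CU: "0 \<le> CU" using CM CP by (simp add: CU_def)
  have size: "U x \<le> CU * l \<and> Re (V x) \<le> l / 2 \<and> w x \<le> CU * sqrt l" if l: "l0 \<le> l" and x: "x \<in> J l" for l x
  proof -
    have l1: "1 \<le> l" using l0[OF l] by blast
    obtain s t where st: "x = sg s * t" "0 \<le> t" by (rule side_cases)
    have t: "t < \<delta> s l" using x st l0[OF l] unfolding J_def by (cases s) auto
    have "size_ok s (case s of Minus \<Rightarrow> CM | Plus \<Rightarrow> CP) l" using l0[OF l] by (cases s) auto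
    then have *: "norm (V x) + 1 \<le> (case s of Minus \<Rightarrow> CM | Plus \<Rightarrow> CP) * l" "Re (V x) \<le> l / 2"
        "japanese t powr \<nu> s \<le> (case s of Minus \<Rightarrow> CM | Plus \<Rightarrow> CP) * sqrt l"
      using st(2) t unfolding size_ok_def st(1) by blast+
    have c: "(case s of Minus \<Rightarrow> CM | Plus \<Rightarrow> CP) \<le> CU" using CM(1) CP(1) by (cases s) (auto simp: CU_def)
    have "(case s of Minus \<Rightarrow> CM | Plus \<Rightarrow> CP) * l \<le> CU * l" using c l1 by (intro mult_right_mono) auto
    moreover have "(case s of Minus \<Rightarrow> CM | Plus \<Rightarrow> CP) * sqrt l \<le> CU * sqrt l" using c l1 by (intro mult_right_mono) auto
    moreover have "w x = japanese t powr \<nu> s" unfolding st(1) by (rule w_side[OF st(2)])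
    ultimately show ?thesis using * unfolding U_def by linarith
  qed
  interpret W: wkb Z J w l0 V Vd U N n CV CU CU
  proof
    show "0 \<le> w x" for x using w_pos[of x] by simp
    show "N = Suc n" by (rule Suc_n)
    show "norm (V x) \<le> U x" for x by (rule U_ge)
    show "1 \<le> l0" using l0[OF order_refl] by blast
    show "complex_of_real l - V x \<notin> \<real>\<^sub>\<le>\<^sub>0" if "l0 \<le> l" for l x using l0[OF that] by blast
  qed (use Vd CU size in blast)+
  obtain C\<xi> where C\<xi>: "0 < C\<xi>" and cut: "\<forall>\<^sub>F l in at_top.
        (let d = (\<lambda>s. \<delta> s l); D = (\<lambda>s. \<Delta> s l) in
           test_fun (\<xi> l) \<and>
           (\<forall>x. 0 \<le> \<xi> l x \<and> \<xi> l x \<le> 1) \<and>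
           (\<forall>x\<in>{- d Minus + D Minus <..< d Plus - D Plus}. \<xi> l x = 1) \<and>
           (\<forall>x. x \<notin> {- d Minus <..< d Plus} \<longrightarrow> \<xi> l x = 0) \<and>
           (\<forall>s. \<forall>j\<in>{1,2}. AE x in lebesgue. x \<in> half_line s \<longrightarrow>
              \<bar>(deriv ^^ j) (\<xi> l) x\<bar> \<le> C\<xi> * D s powr (- real j)))"
    using \<xi> unfolding cutoff_family_def by blast
  have cut': "\<forall>\<^sub>F l in at_top. test_fun (\<xi> l) \<and>
           (\<forall>x\<in>{- \<delta> Minus l + \<Delta> Minus l <..< \<delta> Plus l - \<Delta> Plus l}. \<xi> l x = 1) \<and>
           (\<forall>x. x \<notin> {- \<delta> Minus l <..< \<delta> Plus l} \<longrightarrow> \<xi> l x = 0) \<and>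
           (\<forall>s. \<forall>j\<in>{1,2}. AE x in lebesgue. x \<in> half_line s \<longrightarrow>
              \<bar>(deriv ^^ j) (\<xi> l) x\<bar> \<le> C\<xi> * \<Delta> s l powr (- real j))"
    using cut unfolding Let_def by eventually_elim blast
  have sign: "\<exists>X. \<forall>t\<ge>X. 0 < sg s * Im (V (sg s * t))" for s
    using sign_at_end[of s] by (meson less_le_trans)
  have d0: "0 < \<delta> s l" if "l0 \<le> l" for s l using l0[OF that] by (cases s) auto
  have U_eq: "U x = norm (V x) + 1" for x by (simp add: U_def)
  show ?thesis
    by (rule W.pseudomode_estimate[OF end_geometry_side U_eq w_side J_def d0 sign Uw_bounded C\<xi> cut'
          remainder_rate_nonneg remainder_rate_bound]) (assumption, assumption, rule that, assumption+)
qed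

end

text \<open>Each of the four summands receives the share of \<open>Q\<close> that its rate has in the sum of the rates; this share is
at most \<open>C\<close> times the rate.\<close>

lemma split_quotient:
  fixes Q :: "real \<Rightarrow> real" and k r :: "side \<Rightarrow> real \<Rightarrow> real"
  assumes Q: "\<forall>\<^sub>F l in at_top. 0 \<le> Q l \<and> Q l \<le> C * ((k Minus l + k Plus l) + (r Minus l + r Plus l))"
    and C: "0 \<le> C" and k: "\<And>s l. 0 < k s l" and r: "\<And>s l. 0 \<le> r s l"
  obtains \<kappa> \<sigma> :: "side \<Rightarrow> real \<Rightarrow> real" where
    "\<And>l. Q l = (\<kappa> Minus l + \<kappa> Plus l) + (\<sigma> Minus l + \<sigma> Plus l)"
    "\<And>s. \<kappa> s \<in> O[at_top](k s)" "\<And>s. \<sigma> s \<in> O[at_top](r s)"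
proof -
  define T where "T l = (k Minus l + k Plus l) + (r Minus l + r Plus l)" for l
  have T: "0 < T l" for l using k[of Minus l] k[of Plus l] r[of Minus l] r[of Plus l] by (simp add: T_def)
  have QT: "\<forall>\<^sub>F l in at_top. norm (Q l / T l) \<le> C"
    using Q
  proof eventually_elim
    fix l assume "0 \<le> Q l \<and> Q l \<le> C * ((k Minus l + k Plus l) + (r Minus l + r Plus l))"
    then show "norm (Q l / T l) \<le> C" using T[of l] by (simp add: T_def[symmetric] divide_le_eq)
  qed
  show ?thesis
  proof (rule that[of "\<lambda>s l. Q l / T l * k s l" "\<lambda>s l. Q l / T l * r s l"])
    fix l
    have "Q l = Q l / T l * T l" using T[of l] by simp
    then show "Q l = (Q l / T l * k Minus l + Q l / T l * k Plus l) + (Q l / T l * r Minus l + Q l / T l * r Plus l)"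
      by (simp add: T_def distrib_left)
  next
    fix s
    show "(\<lambda>l. Q l / T l * k s l) \<in> O(k s)"
    proof (rule bigoI[where c=C])
      show "\<forall>\<^sub>F l in at_top. norm (Q l / T l * k s l) \<le> C * norm (k s l)"
        using QT by eventually_elim (simp only: norm_mult mult_right_mono norm_ge_zero)
    qed
    show "(\<lambda>l. Q l / T l * r s l) \<in> O(r s)"
    proof (rule bigoI[where c=C])
      show "\<forall>\<^sub>F l in at_top. norm (Q l / T l * r s l) \<le> C * norm (r s l)"
        using QT by eventually_elim (simp only: norm_mult mult_right_mono norm_ge_zero)
    qed
  qed
qed

theorem theorem3p7:
  fixes V :: "real \<Rightarrow> complex" and N n :: nat
    and \<nu> \<epsilon>1 \<epsilon>2 :: "side \<Rightarrow> real" and \<xi> :: "real \<Rightarrow> real \<Rightarrow> real"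
  assumes N: "1 \<le> N"
    and n: "n = N - 1"
    and V: "standing_assumption N V \<nu> \<epsilon>1"
    and \<epsilon>2: "\<And>s. bounded_at s V \<Longrightarrow> 0 < \<epsilon>2 s \<and> \<epsilon>2 s < 1 - \<nu> s"
    and \<xi>: "cutoff_family V \<nu> \<epsilon>1 \<epsilon>2 \<xi>"
  shows "\<exists>\<kappa> \<sigma> :: side \<Rightarrow> real \<Rightarrow> real.
    (\<forall>\<^sub>F l in at_top.
       let f = pseudomode V n \<xi> l in
         f \<in> H_dom V \<and> 0 < norm_L2 f \<and>
         norm_L2 (\<lambda>x. H_op V f x - complex_of_real l * f x) / norm_L2 f
           = (\<kappa> Minus l + \<kappa> Plus l) + (\<sigma> Minus l + \<sigma> Plus l)) \<and>
    (\<forall>s. \<not> bounded_at s V \<longrightarrow>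
       (\<exists>c>0. \<kappa> s \<in> O[at_top](\<lambda>l. exp (- c * cut_delta V \<nu> \<epsilon>1 \<epsilon>2 s l powr (\<nu> s + 1 + \<epsilon>1 s)))) \<and>
       (\<nu> s < 0 \<longrightarrow> \<sigma> s \<in> O[at_top](\<lambda>l. l powr (- (real n + 1) / 2) *
          (SUP x\<in>J_side V \<nu> \<epsilon>1 \<epsilon>2 s l. norm (V x) * japanese x powr ((real n + 1) * \<nu> s)))) \<and>
       (0 \<le> \<nu> s \<longrightarrow> \<sigma> s \<in> O[at_top](\<lambda>l.
          cut_delta V \<nu> \<epsilon>1 \<epsilon>2 s l powr ((real n + 1) * \<nu> s) * l powr ((1 - real n) / 2)))) \<and>
    (\<forall>s. bounded_at s V \<longrightarrow>
       (\<exists>c>0. \<kappa> s \<in> O[at_top](\<lambda>l. exp (- c * l powr (\<epsilon>2 s / 2)))) \<and>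
       (\<nu> s < 0 \<longrightarrow> \<sigma> s \<in> O[at_top](\<lambda>l. l powr (- (real n + 1) / 2))) \<and>
       (0 \<le> \<nu> s \<longrightarrow> \<sigma> s \<in> O[at_top](\<lambda>l.
          l powr (- ((real n + 1) / 2) * (1 - (1 + \<epsilon>2 s) * \<nu> s)))))"
proof -
  interpret potential V N n \<nu> \<epsilon>1 \<epsilon>2 using N n V \<epsilon>2 by unfold_locales
  obtain c C where c: "\<And>s. 0 < c s" and C: "0 \<le> C" and est:
    "\<forall>\<^sub>F l in at_top. (let f = pseudomode V n \<xi> l in f \<in> H_dom V \<and> 0 < norm_L2 f \<and>
       norm_L2 (\<lambda>x. H_op V f x - complex_of_real l * f x) / norm_L2 f
         \<le> C * ((exp (- (c Minus * decay Minus l)) + exp (- (c Plus * decay Plus l)))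
             + (remainder_rate Minus l + remainder_rate Plus l)))"
    by (rule quotient_bound[OF \<xi>]) blast
  define Q where "Q l = norm_L2 (\<lambda>x. H_op V (pseudomode V n \<xi> l) x - complex_of_real l * pseudomode V n \<xi> l x) /
      norm_L2 (pseudomode V n \<xi> l)" for l
  define k where "k s l = exp (- (c s * decay s l))" for s l
  have "\<forall>\<^sub>F l in at_top. 0 \<le> Q l \<and> Q l \<le> C * ((k Minus l + k Plus l) + (remainder_rate Minus l + remainder_rate Plus l))"
    using est
  proof eventually_elim
    case (elim l)
    have "0 \<le> Q l" unfolding Q_def using norm_L2_nonneg by (intro divide_nonneg_nonneg)
    then show ?case using elim unfolding Let_def Q_def k_def by blast
  qed
  note Q_le = this
  have k_pos: "0 < k s l" for s l by (simp add: k_def)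
  obtain \<kappa> \<sigma> where \<kappa>\<sigma>: "\<And>l. Q l = (\<kappa> Minus l + \<kappa> Plus l) + (\<sigma> Minus l + \<sigma> Plus l)"
    and \<kappa>: "\<And>s. \<kappa> s \<in> O[at_top](k s)" and \<sigma>: "\<And>s. \<sigma> s \<in> O[at_top](remainder_rate s)"
    by (rule split_quotient[OF Q_le C k_pos remainder_rate_nonneg]) (rule that, assumption+)
  have 1: "\<forall>\<^sub>F l in at_top.
       let f = pseudomode V n \<xi> l in
         f \<in> H_dom V \<and> 0 < norm_L2 f \<and>
         norm_L2 (\<lambda>x. H_op V f x - complex_of_real l * f x) / norm_L2 f
           = (\<kappa> Minus l + \<kappa> Plus l) + (\<sigma> Minus l + \<sigma> Plus l)"
    using est
  proof eventually_elim
    case (elim l)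
    then show ?case using \<kappa>\<sigma>[of l] unfolding Let_def Q_def by blast
  qed
  have 2: "(\<exists>c>0. \<kappa> s \<in> O[at_top](\<lambda>l. exp (- c * cut_delta V \<nu> \<epsilon>1 \<epsilon>2 s l powr (\<nu> s + 1 + \<epsilon>1 s)))) \<and>
       (\<nu> s < 0 \<longrightarrow> \<sigma> s \<in> O[at_top](\<lambda>l. l powr (- (real n + 1) / 2) *
          (SUP x\<in>J_side V \<nu> \<epsilon>1 \<epsilon>2 s l. norm (V x) * japanese x powr ((real n + 1) * \<nu> s)))) \<and>
       (0 \<le> \<nu> s \<longrightarrow> \<sigma> s \<in> O[at_top](\<lambda>l.
          cut_delta V \<nu> \<epsilon>1 \<epsilon>2 s l powr ((real n + 1) * \<nu> s) * l powr ((1 - real n) / 2)))"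
    if s: "\<not> bounded_at s V" for s
  proof (intro conjI impI)
    have "k s = (\<lambda>l. exp (- c s * cut_delta V \<nu> \<epsilon>1 \<epsilon>2 s l powr (\<nu> s + 1 + \<epsilon>1 s)))"
      using s by (auto simp: k_def decay_def fun_eq_iff)
    then show "\<exists>c>0. \<kappa> s \<in> O[at_top](\<lambda>l. exp (- c * cut_delta V \<nu> \<epsilon>1 \<epsilon>2 s l powr (\<nu> s + 1 + \<epsilon>1 s)))"
      using \<kappa>[of s] c[of s] by auto
    show "\<sigma> s \<in> O[at_top](\<lambda>l. l powr (- (real n + 1) / 2) *
          (SUP x\<in>J_side V \<nu> \<epsilon>1 \<epsilon>2 s l. norm (V x) * japanese x powr ((real n + 1) * \<nu> s)))" if "\<nu> s < 0"
    proof (rule landau_o.big_trans[OF \<sigma>], rule bigoI[where c=1])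
      show "\<forall>\<^sub>F l in at_top. norm (remainder_rate s l) \<le> 1 * norm (l powr (- (real n + 1) / 2) *
          (SUP x\<in>J_side V \<nu> \<epsilon>1 \<epsilon>2 s l. norm (V x) * japanese x powr ((real n + 1) * \<nu> s)))"
        using s that by (intro always_eventually allI) (simp add: remainder_rate_def abs_mult)
    qed
    show "\<sigma> s \<in> O[at_top](\<lambda>l. cut_delta V \<nu> \<epsilon>1 \<epsilon>2 s l powr ((real n + 1) * \<nu> s) * l powr ((1 - real n) / 2))" if "0 \<le> \<nu> s"
    proof -
      have "remainder_rate s = (\<lambda>l. cut_delta V \<nu> \<epsilon>1 \<epsilon>2 s l powr ((real n + 1) * \<nu> s) * l powr ((1 - real n) / 2))"
        using s that by (auto simp: remainder_rate_def fun_eq_iff)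
      then show ?thesis using \<sigma>[of s] by simp
    qed
  qed
  have 3: "(\<exists>c>0. \<kappa> s \<in> O[at_top](\<lambda>l. exp (- c * l powr (\<epsilon>2 s / 2)))) \<and>
       (\<nu> s < 0 \<longrightarrow> \<sigma> s \<in> O[at_top](\<lambda>l. l powr (- (real n + 1) / 2))) \<and>
       (0 \<le> \<nu> s \<longrightarrow> \<sigma> s \<in> O[at_top](\<lambda>l. l powr (- ((real n + 1) / 2) * (1 - (1 + \<epsilon>2 s) * \<nu> s))))"
    if s: "bounded_at s V" for s
  proof (intro conjI impI)
    have "k s = (\<lambda>l. exp (- c s * l powr (\<epsilon>2 s / 2)))"
      using s by (auto simp: k_def decay_def fun_eq_iff)
    then show "\<exists>c>0. \<kappa> s \<in> O[at_top](\<lambda>l. exp (- c * l powr (\<epsilon>2 s / 2)))"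
      using \<kappa>[of s] c[of s] by auto
    show "\<sigma> s \<in> O[at_top](\<lambda>l. l powr (- (real n + 1) / 2))" if "\<nu> s < 0"
    proof -
      have "remainder_rate s = (\<lambda>l. l powr (- (real n + 1) / 2))"
        using s that by (auto simp: remainder_rate_def fun_eq_iff)
      then show ?thesis using \<sigma>[of s] by simp
    qed
    show "\<sigma> s \<in> O[at_top](\<lambda>l. l powr (- ((real n + 1) / 2) * (1 - (1 + \<epsilon>2 s) * \<nu> s)))" if "0 \<le> \<nu> s"
    proof -
      have "remainder_rate s = (\<lambda>l. l powr (- ((real n + 1) / 2) * (1 - (1 + \<epsilon>2 s) * \<nu> s)))"
        using s that by (auto simp: remainder_rate_def fun_eq_iff)
      then show ?thesis using \<sigma>[of s] by simp
    qed
  qed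
  show ?thesis using 1 2 3 by blast
qed

end
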